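(* Let the jump function $\xi$ satisfy the standing assumptions in the context, let $\rho>0$, and let $(\alpha_j)_{j\ge1}$ be real numbers such that, for some $\alpha\in\mathbb{R}$, $\lim_{j\to\infty}\alpha_j=\alpha$ and either (i) $\alpha>0$ and $\sum_{j\ge1}|\alpha_j-\alpha|<\infty$, or (ii) $\alpha\le 0$ and $\sum_{j\ge1}\frac1j|\alpha_j-\alpha|<\infty$. Let $\rho_{\rm c}=\sum_{j\ge1}e^{-\alpha_j}\int_{\mathbb{R}^d}e^{-j\varepsilon(k)}\,dk$ be the critical density. Then: (a) the fraction of points in infinite cycles is $\nu=\max\bigl(0,\,1-\frac{\rho_{\rm c}}{\rho}\bigr)$; (b) when $\nu>0$, i.e. when $\rho>\rho_{\rm c}$, the cycle structure converges in distribution to Poisson-Dirichlet: in the thermodynamic limit $|\Lambda|,N\to\infty$ with $N/|\Lambda|=\rho$, $$\Bigl(\frac{\ell^{(1)}}{\nu N},\frac{\ell^{(2)}}{\nu N},\dots\Bigr)\Rightarrow \mathrm{PD}(e^{-\alpha}).$$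
   Context: **Jump function.** Let $d\ge1$ and $\xi:\mathbb{R}^d\to\mathbb{R}\cup\{+\infty\}$ be such that $e^{-\xi}$ is continuous, $\int_{\mathbb{R}^d}e^{-\xi(x)}dx=1$, and the Fourier transform of $e^{-\xi}$ is positive. Define $\varepsilon(k)$, $k\in\mathbb{R}^d$, by $e^{-\varepsilon(k)}=\int_{\mathbb{R}^d}e^{-2\pi i k\cdot x}e^{-\xi(x)}dx$. Assume $e^{-\varepsilon(k)}$ is uniformly continuous on $\mathbb{R}^d$, and that there are $a>0$ and $\eta<d$ with $\varepsilon(k)\ge a\|k\|^\eta$ for all sufficiently small $k$. For $L>0$ let $\Lambda\subset\mathbb{R}^d$ be a cubic box of side length $L$, $|\Lambda|=L^d$, $\Lambda^*=\frac1L\mathbb{Z}^d$, and define $\xi_\Lambda$ by $e^{-\xi_\Lambda(x)}=\sum_{z\in\mathbb{Z}^d}e^{-\xi(x-Lz)}$. Assume moreover that $e^{-\xi_\Lambda}$ is a continuous function for all $L$ large enough, and that $\lim_{L\to\infty}\frac1{|\Lambda|}\sum_{k\in\Lambda^*}e^{-\varepsilon(k)}=\int_{\mathbb{R}^d}e^{-\varepsilon(k)}dk$. **Spatial random permutations.** Let $\mathcal{S}_N$ be the symmetric group on $\{1,\dots,N\}$ and $r_\ell(\pi)$ the number of cycles of length $\ell$ of $\pi\in\mathcal{S}_N$. On $\Lambda^N\times\mathcal{S}_N$ set $H_\Lambda(\boldsymbol{x},\pi)=\sum_{i=1}^N\xi_\Lambda(x_i-x_{\pi(i)})+\sum_{\ell\ge1}\alpha_\ell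 r_\ell(\pi)$ and consider the probability measure $\mathrm{Prob}(d\boldsymbol{x},\pi)=\frac1{N!\,Y}e^{-H_\Lambda(\boldsymbol{x},\pi)}d\boldsymbol{x}$, with $d\boldsymbol{x}$ Lebesgue measure on $\Lambda^N$ and $Y=\frac1{N!}\sum_{\pi\in\mathcal{S}_N}\int_{\Lambda^N}e^{-H_\Lambda(\boldsymbol{x},\pi)}d\boldsymbol{x}$; $E$ denotes its expectation. Let $\ell^{(1)}(\pi)\ge\ell^{(2)}(\pi)\ge\cdots$ be the cycle lengths of $\pi$ in non-increasing order, repeated with multiplicities (set equal to $0$ beyond the number of cycles). **Thermodynamic limit.** $|\Lambda|,N\to\infty$ means that both go to infinity with $N/|\Lambda|=\rho$ fixed. **Fraction in infinite cycles.** $\nu_K=\liminf_{|\Lambda|,N\to\infty}E\bigl(\frac1N\sum_{i:\ell^{(i)}>K}\ell^{(i)}\bigr)$ and $\nu=\lim_{K\to\infty}\nu_K$ (the limit exists since $\nu_K$ is non-increasing in $K$ and bounded). **Poisson-Dirichlet.** For $\theta>0$, let $X_1,X_2,\dots$ be i.i.d. with $\mathrm{Prob}(X_i>s)=(1-s)^\theta$ for $0\le s\le1$. $\mathrm{GEM}(\theta)$ is the law of $(X_1,(1-X_1)X_2,(1-X_1)(1-X_2)X_3,\dots)$, and $\mathrm{PD}(\theta)$ is the law obtained by rearranging these numbers in non-increasing order. $(Y_n^{(1)},Y_n^{(2)},\dots)\Rightarrow\mathrm{PD}(\theta)$ means that for each fixed $m$ the joint law of $(Y_n^{(1)},\dots,Y_n^{(m)})$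 converges weakly to the joint law of the first $m$ components of $\mathrm{PD}(\theta)$. *)

theory Defs
  imports
    "HOL-Probability.Probability"
    "HOL-Combinatorics.Orbits"
begin

section \<open>Jump functions\<close>

text \<open>The Boltzmann factor \<open>e\<^sup>-\<^sup>u\<close> of an energy \<open>u\<close> in \<open>\<real> \<union> {+\<infinity>}\<close>. The value at \<open>-\<infinity>\<close> is irrelevant:
  jump functions never take it.\<close>

definition exp_neg :: "ereal \<Rightarrow> real" where
  "exp_neg u = (if u = \<infinity> then 0 else exp (- real_of_ereal u))"

definition fourier_weight :: "(real^'d \<Rightarrow> ereal) \<Rightarrow> real^'d \<Rightarrow> complex" where
  "fourier_weight \<xi> k =
     (LINT x|lborel. exp (- 2 * of_real pi * \<i> * of_real (k \<bullet> x)) * of_real (exp_neg (\<xi> x)))"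

text \<open>The function \<open>\<epsilon>\<close> with \<open>e\<^sup>-\<^sup>\<epsilon>\<^sup>(\<^sup>k\<^sup>)\<close> equal to the Fourier transform, which is assumed to be real and
  positive in \<open>jump_function\<close> below.\<close>

definition dispersion :: "(real^'d \<Rightarrow> ereal) \<Rightarrow> real^'d \<Rightarrow> real" where
  "dispersion \<xi> k = - ln (Re (fourier_weight \<xi> k))"

definition int_lattice :: "(real^'d) set" where
  "int_lattice = {z. \<forall>i. z $ i \<in> \<int>}"

definition dual_lattice :: "real \<Rightarrow> (real^'d) set" where
  "dual_lattice L = (\<lambda>z. (1 / L) *\<^sub>R z) ` int_lattice"

text \<open>\<open>periodized_weight \<xi> L\<close> is \<open>e\<^sup>-\<^sup>\<xi>\<^sup>\<Lambda>\<close> for a box \<open>\<Lambda>\<close> of side length \<open>L\<close>, and \<open>periodized_jump \<xi> L\<close> is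
  \<open>\<xi>\<^sub>\<Lambda>\<close> itself.\<close>

definition periodized_weight :: "(real^'d \<Rightarrow> ereal) \<Rightarrow> real \<Rightarrow> real^'d \<Rightarrow> real" where
  "periodized_weight \<xi> L x = (\<Sum>\<^sub>\<infinity>z\<in>int_lattice. exp_neg (\<xi> (x - L *\<^sub>R z)))"

definition periodized_jump :: "(real^'d \<Rightarrow> ereal) \<Rightarrow> real \<Rightarrow> real^'d \<Rightarrow> ereal" where
  "periodized_jump \<xi> L x =
     (if periodized_weight \<xi> L x = 0 then \<infinity> else ereal (- ln (periodized_weight \<xi> L x)))"

text \<open>The summability and integrability clauses say that the sums over \<open>int_lattice\<close> and
  \<open>dual_lattice L\<close> and the integral of \<open>e\<^sup>-\<^sup>\<epsilon>\<close> are finite; the operators \<open>\<Sum>\<^sub>\<infinity>\<close> and \<open>LINT\<close> are \<open>0\<close> otherwise.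
  In the bound on \<open>\<epsilon>\<close>, the point \<open>k = 0\<close> is harmless: \<open>\<epsilon> 0 = 0\<close> by normalization, and
  \<open>0 powr \<eta> = 0\<close>.\<close>

definition jump_function :: "(real^'d \<Rightarrow> ereal) \<Rightarrow> bool" where
  "jump_function \<xi> \<longleftrightarrow>
     (\<forall>x. \<xi> x \<noteq> -\<infinity>) \<and>
     continuous_on UNIV (\<lambda>x. exp_neg (\<xi> x)) \<and>
     has_bochner_integral lborel (\<lambda>x. exp_neg (\<xi> x)) 1 \<and>
     (\<forall>k. fourier_weight \<xi> k \<in> \<real> \<and> 0 < Re (fourier_weight \<xi> k)) \<and>
     uniformly_continuous_on UNIV (\<lambda>k. exp (- dispersion \<xi> k)) \<and>
     (\<exists>a \<eta>. 0 < a \<and> \<eta> < real CARD('d) \<and>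
        (\<forall>\<^sub>F k in nhds 0. a * norm k powr \<eta> \<le> dispersion \<xi> k)) \<and>
     (\<forall>\<^sub>F L in at_top.
        (\<forall>x. (\<lambda>z. exp_neg (\<xi> (x - L *\<^sub>R z))) summable_on int_lattice) \<and>
        continuous_on UNIV (periodized_weight \<xi> L)) \<and>
     integrable lborel (\<lambda>k. exp (- dispersion \<xi> k)) \<and>
     (\<forall>\<^sub>F L in at_top. (\<lambda>k. exp (- dispersion \<xi> k)) summable_on dual_lattice L) \<and>
     ((\<lambda>L. (1 / L ^ CARD('d)) * (\<Sum>\<^sub>\<infinity>k\<in>dual_lattice L. exp (- dispersion \<xi> k)))
        \<longlongrightarrow> (LINT k|lborel. exp (- dispersion \<xi> k))) at_top"

definition critical_density :: "(real^'d \<Rightarrow> ereal) \<Rightarrow> (nat \<Rightarrow> real) \<Rightarrow> real" where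
  "critical_density \<xi> \<alpha> =
     (\<Sum>n. exp (- \<alpha> (Suc n)) * (LINT k|lborel. exp (- real (Suc n) * dispersion \<xi> k)))"


section \<open>Cycle lengths\<close>

definition perms :: "nat \<Rightarrow> (nat \<Rightarrow> nat) set" where
  "perms N = {\<pi>. \<pi> permutes {1..N}}"

definition cycle_sets :: "nat \<Rightarrow> (nat \<Rightarrow> nat) \<Rightarrow> nat set set" where
  "cycle_sets N \<pi> = orbit \<pi> ` {1..N}"

definition cycle_count :: "nat \<Rightarrow> (nat \<Rightarrow> nat) \<Rightarrow> nat \<Rightarrow> nat" where
  "cycle_count N \<pi> l = card {C \<in> cycle_sets N \<pi>. card C = l}"

definition sorted_cycle_lengths :: "nat \<Rightarrow> (nat \<Rightarrow> nat) \<Rightarrow> nat list" where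
  "sorted_cycle_lengths N \<pi> =
     rev (sorted_list_of_multiset (image_mset card (mset_set (cycle_sets N \<pi>))))"

text \<open>Indices start at \<open>0\<close>: \<open>cycle_length N \<pi> i\<close> is \<open>\<ell>\<^sup>(\<^sup>i\<^sup>+\<^sup>1\<^sup>)(\<pi>)\<close>.\<close>

definition cycle_length :: "nat \<Rightarrow> (nat \<Rightarrow> nat) \<Rightarrow> nat \<Rightarrow> nat" where
  "cycle_length N \<pi> i =
     (if i < length (sorted_cycle_lengths N \<pi>) then sorted_cycle_lengths N \<pi> ! i else 0)"


section \<open>Spatial random permutations\<close>

text \<open>A cubic box of side length \<open>L\<close> is given by its corner \<open>c\<close> with smallest coordinates.\<close>

definition cubic_box :: "real^'d \<Rightarrow> real \<Rightarrow> (real^'d) set" where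
  "cubic_box c L = cbox c (c + vec L)"

definition hamiltonian ::
    "(real^'d \<Rightarrow> ereal) \<Rightarrow> (nat \<Rightarrow> real) \<Rightarrow> real \<Rightarrow> nat \<Rightarrow> (nat \<Rightarrow> real^'d) \<Rightarrow> (nat \<Rightarrow> nat) \<Rightarrow> ereal" where
  "hamiltonian \<xi> \<alpha> L N x \<pi> =
     (\<Sum>i=1..N. periodized_jump \<xi> L (x i - x (\<pi> i))) +
     ereal (\<Sum>l=1..N. \<alpha> l * real (cycle_count N \<pi> l))"

definition lebesgue_box_power :: "real^'d \<Rightarrow> real \<Rightarrow> nat \<Rightarrow> (nat \<Rightarrow> real^'d) measure" where
  "lebesgue_box_power c L N = PiM {1..N} (\<lambda>_. restrict_space lborel (cubic_box c L))"

definition partition_function ::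
    "(real^'d \<Rightarrow> ereal) \<Rightarrow> (nat \<Rightarrow> real) \<Rightarrow> real^'d \<Rightarrow> real \<Rightarrow> nat \<Rightarrow> real" where
  "partition_function \<xi> \<alpha> c L N =
     (1 / fact N) *
     (\<Sum>\<pi>\<in>perms N. LINT x|lebesgue_box_power c L N. exp_neg (hamiltonian \<xi> \<alpha> L N x \<pi>))"

definition spatial_perm_measure ::
    "(real^'d \<Rightarrow> ereal) \<Rightarrow> (nat \<Rightarrow> real) \<Rightarrow> real^'d \<Rightarrow> real \<Rightarrow> nat
       \<Rightarrow> ((nat \<Rightarrow> real^'d) \<times> (nat \<Rightarrow> nat)) measure" where
  "spatial_perm_measure \<xi> \<alpha> c L N =
     density (lebesgue_box_power c L N \<Otimes>\<^sub>M count_space (perms N))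
       (\<lambda>(x, \<pi>). ennreal (exp_neg (hamiltonian \<xi> \<alpha> L N x \<pi>)
                          / (fact N * partition_function \<xi> \<alpha> c L N)))"

text \<open>In the thermodynamic limit \<open>N / \<bar>\<Lambda>\<bar> = \<rho>\<close> is fixed, so that the side length is a function of \<open>N\<close>
  and the limit is \<open>N \<rightarrow> \<infinity>\<close>. The position \<open>c N\<close> of the \<open>N\<close>-th box is arbitrary.\<close>

definition thermo_measure ::
    "(real^'d \<Rightarrow> ereal) \<Rightarrow> (nat \<Rightarrow> real) \<Rightarrow> real \<Rightarrow> (nat \<Rightarrow> real^'d) \<Rightarrow> nat
       \<Rightarrow> ((nat \<Rightarrow> real^'d) \<times> (nat \<Rightarrow> nat)) measure" where
  "thermo_measure \<xi> \<alpha> \<rho> c N =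
     spatial_perm_measure \<xi> \<alpha> (c N) (root CARD('d) (real N / \<rho>)) N"

text \<open>The lower limit is taken in the complete lattice \<^typ>\<open>ereal\<close>; it lies in \<open>[0, 1]\<close>.\<close>

definition fraction_longer ::
    "(real^'d \<Rightarrow> ereal) \<Rightarrow> (nat \<Rightarrow> real) \<Rightarrow> real \<Rightarrow> (nat \<Rightarrow> real^'d) \<Rightarrow> nat \<Rightarrow> real" where
  "fraction_longer \<xi> \<alpha> \<rho> c K =
     real_of_ereal (liminf (\<lambda>N. ereal
       (LINT (x, \<pi>)|thermo_measure \<xi> \<alpha> \<rho> c N.
          (1 / real N) * (\<Sum>i | K < cycle_length N \<pi> i. real (cycle_length N \<pi> i)))))"

definition fraction_infinite ::
    "(real^'d \<Rightarrow> ereal) \<Rightarrow> (nat \<Rightarrow> real) \<Rightarrow> real \<Rightarrow> (nat \<Rightarrow> real^'d) \<Rightarrow> real" where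
  "fraction_infinite \<xi> \<alpha> \<rho> c = lim (\<lambda>K. fraction_longer \<xi> \<alpha> \<rho> c K)"


section \<open>The Poisson-Dirichlet law\<close>

text \<open>The law on \<open>[0, 1]\<close> with \<open>Prob(X > s) = (1 - s) powr \<theta>\<close>, given by its distribution function.\<close>

definition stick_law :: "real \<Rightarrow> real measure" where
  "stick_law \<theta> = interval_measure (\<lambda>s. 1 - (1 - max 0 (min 1 s)) powr \<theta>)"

lemma stick_law_tail:
  assumes "0 < \<theta>" and "0 \<le> s" and "s \<le> 1"
  shows "prob_space (stick_law \<theta>)" and "measure (stick_law \<theta>) {s<..} = (1 - s) powr \<theta>"
proof -
  let ?F = "\<lambda>s::real. 1 - (1 - max 0 (min 1 s)) powr \<theta>"
  have cont: "continuous_on UNIV ?F"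
    using assms(1) by (intro continuous_intros continuous_on_powr') auto
  have mono: "?F x \<le> ?F y" if "x \<le> y" for x y
    using that assms(1) by (auto intro!: powr_mono2)
  have right: "continuous (at_right a) ?F" for a
    using cont by (meson UNIV_I continuous_on_eq_continuous_within continuous_within_subset subset_UNIV)
  have bot: "(?F \<longlongrightarrow> 0) at_bot"
    by (rule tendsto_eventually, rule eventually_at_bot_linorderI[of 0]) auto
  have top: "(?F \<longlongrightarrow> 1) at_top"
    by (rule tendsto_eventually, rule eventually_at_top_linorderI[of 1]) auto
  interpret real_distribution "stick_law \<theta>"
    unfolding stick_law_def by (intro real_distribution_interval_measure mono right bot top)
  show "prob_space (stick_law \<theta>)" by unfold_locales
  have "cdf (stick_law \<theta>) s = ?F s"
    unfolding stick_law_def by (subst cdf_interval_measure[OF mono right bot]) auto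
  moreover have "{s<..} = space (stick_law \<theta>) - {..s}" by auto
  ultimately show "measure (stick_law \<theta>) {s<..} = (1 - s) powr \<theta>"
    using prob_compl[of "{..s}"] assms by (simp add: cdf_def)
qed

definition stick_breaking :: "(nat \<Rightarrow> real) \<Rightarrow> nat \<Rightarrow> real" where
  "stick_breaking X n = (\<Prod>i<n. 1 - X i) * X n"

definition GEM :: "real \<Rightarrow> (nat \<Rightarrow> real) measure" where
  "GEM \<theta> = distr (PiM UNIV (\<lambda>_. stick_law \<theta>)) (PiM UNIV (\<lambda>_. borel)) stick_breaking"

text \<open>The entry of index \<open>n\<close> is the \<open>(n+1)\<close>-th largest of the numbers \<open>w 0, w 1, \<dots>\<close>, counted with
  multiplicity; see \<open>decreasing_rearrangement_eq\<close>.\<close>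

definition decreasing_rearrangement :: "(nat \<Rightarrow> real) \<Rightarrow> nat \<Rightarrow> real" where
  "decreasing_rearrangement w n = (SUP I\<in>{I. finite I \<and> card I = Suc n}. Min (w ` I))"

lemma decreasing_rearrangement_eq:
  assumes "bij \<sigma>" and "decseq (w \<circ> \<sigma>)"
  shows "decreasing_rearrangement w = w \<circ> \<sigma>"
proof
  fix n
  let ?A = "{I::nat set. finite I \<and> card I = Suc n}"
  have "(w \<circ> \<sigma>) n \<in> (\<lambda>I. Min (w ` I)) ` ?A"
  proof
    show "\<sigma> ` {..n} \<in> ?A"
      using card_image[OF inj_on_subset[OF bij_is_inj[OF assms(1)] subset_UNIV], of "{..n}"] by simp
    have "Min ((w \<circ> \<sigma>) ` {..n}) = (w \<circ> \<sigma>) n"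
      using assms(2) by (intro Min_eqI) (auto simp: decseq_def)
    then show "(w \<circ> \<sigma>) n = Min (w ` \<sigma> ` {..n})"
      by (simp only: image_comp)
  qed
  moreover have "y \<le> (w \<circ> \<sigma>) n" if "y \<in> (\<lambda>I. Min (w ` I)) ` ?A" for y
  proof -
    from that obtain I where I: "finite I" "card I = Suc n" "y = Min (w ` I)" by auto
    let ?J = "\<sigma> -` I"
    have IJ: "\<sigma> ` ?J = I" using assms(1) by (simp add: bij_is_surj surj_image_vimage_eq)
    have "card ?J = Suc n"
      using I(2) IJ assms(1) by (metis bij_is_inj card_image inj_on_subset top_greatest)
    then have "\<not> ?J \<subseteq> {..<n}"
      by (metis card_lessThan card_mono finite_lessThan not_less_eq_eq order_refl)
    then obtain j where j: "\<sigma> j \<in> I" "n \<le> j"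
      by (metis lessThan_iff not_less subsetI vimageE)
    have "y \<le> w (\<sigma> j)" using I j by simp
    also have "\<dots> \<le> (w \<circ> \<sigma>) n" using assms(2) j by (auto simp: decseq_def)
    finally show ?thesis .
  qed
  ultimately show "decreasing_rearrangement w n = (w \<circ> \<sigma>) n"
    unfolding decreasing_rearrangement_def by (intro cSup_eq_maximum) auto
qed

definition PD :: "real \<Rightarrow> (nat \<Rightarrow> real) measure" where
  "PD \<theta> = distr (GEM \<theta>) (PiM UNIV (\<lambda>_. borel)) decreasing_rearrangement"


section \<open>Convergence of finite-dimensional laws\<close>

definition joint_law :: "nat \<Rightarrow> 'a measure \<Rightarrow> (nat \<Rightarrow> 'a \<Rightarrow> real) \<Rightarrow> (nat \<Rightarrow> real) measure" where
  "joint_law m M Y = distr M (PiM {..<m} (\<lambda>_. borel)) (\<lambda>\<omega>. \<lambda>i\<in>{..<m}. Y i \<omega>)"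

text \<open>Weak convergence of measures on \<open>\<real>\<^sup>m\<close>, realized as the space of extensional functions on
  \<open>{..<m}\<close> with the product topology.\<close>

definition weak_conv_pow ::
    "nat \<Rightarrow> (nat \<Rightarrow> (nat \<Rightarrow> real) measure) \<Rightarrow> (nat \<Rightarrow> real) measure \<Rightarrow> bool" where
  "weak_conv_pow m \<mu> \<mu>' \<longleftrightarrow>
     (\<forall>f. continuous_map (powertop_real {..<m}) euclideanreal f \<and>
          bounded (f ` topspace (powertop_real {..<m}))
        \<longrightarrow> (\<lambda>n. LINT y|\<mu> n. f y) \<longlonglongrightarrow> (LINT y|\<mu>'. f y))"

definition converges_to_PD ::
    "(nat \<Rightarrow> 'a measure) \<Rightarrow> (nat \<Rightarrow> nat \<Rightarrow> 'a \<Rightarrow> real) \<Rightarrow> real \<Rightarrow> bool" where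
  "converges_to_PD M Y \<theta> \<longleftrightarrow>
     (\<forall>m. weak_conv_pow m (\<lambda>n. joint_law m (M n) (Y n)) (joint_law m (PD \<theta>) (\<lambda>i p. p i)))"

end

theory Submission
  imports Defs "HOL-Real_Asymp.Real_Asymp"
begin

text \<open>Expanding the periodized weight in a Fourier series and integrating out the points leaves a
  random permutation in which a cycle of length \<open>j\<close> has weight \<open>w j = exp (- \<alpha> j) * (\<Sum>k. exp (- j * \<epsilon> k))\<close>,
  the sum being over the dual lattice. The normalization \<open>h\<close> satisfies \<open>n * h n = (\<Sum>j=1..n. w j * h (n - j))\<close>
  and factorizes over the modes. The modes \<open>k \<noteq> 0\<close> hold about \<open>\<rho>\<^sub>c / \<rho>\<close> of the points, in short cycles, by
  Chernoff bounds; the mode \<open>k = 0\<close> holds the remaining \<open>\<nu> N\<close> points and is a random permutation with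
  cycle weights \<open>exp (- \<alpha> j)\<close>, whose rooted cycle lengths converge to stick breaking. Weak convergence is
  tested on the products \<open>\<Prod>i. g (y i)\<close> with \<open>g = 1\<close> near \<open>0\<close>, which do not depend on the order of the \<open>y i\<close>.\<close>

section \<open>Cycle index coefficients\<close>

text \<open>The obstacle is that the law of the permutation is a ratio of coefficients, with no
  independence in it. The weights of the modes add up, however, so the generating function exp
  (\<Sum> w j x^j / j) is a product and the coefficients of the zero mode and of the other modes are
  convolved. Condensation comes from a mismatch of scales: a deviation of the nonzero modes from
  their mean costs exp (- c N^(1 - s)), whereas the zero mode takes up the surplus at polynomial
  cost, its coefficients being of order n^(\<theta> - 1) with \<theta> = exp (- \<alpha>). Here s =
  \<eta> / d: the smallest nonzero k has norm 1 / L, which leaves a gap L^(- \<eta>) of order N^(-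
  s), and \<eta> < d makes 1 - s positive. The alternatives in the hypothesis on \<alpha> are
  \<theta> < 1 and \<theta> \<ge> 1: for \<theta> < 1 the coefficients of (1 - x)^(- \<theta>)
  decrease, and the series that corrects them must have a finite first moment. For \<rho> \<le>
  \<rho>_c there is no surplus to compare with, and long cycles are excluded by a direct comparison
  of weights.\<close>

fun hcoef :: "(nat \<Rightarrow> real) \<Rightarrow> nat \<Rightarrow> real" where
  "hcoef u n = (if n = 0 then 1 else (\<Sum>j=1..n. u j * hcoef u (n - j)) / real n)"

declare hcoef.simps [simp del]

lemma hcoef_0 [simp]: "hcoef u 0 = 1" by (simp add: hcoef.simps)

lemma hcoef_rec: "real n * hcoef u n = (\<Sum>j=1..n. u j * hcoef u (n - j))" by (cases "n = 0") (simp_all add: hcoef.simps[of u n])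

text \<open>The recursion is x H' = U H read coefficientwise, so \<open>hcoef u\<close> lists the
  coefficients of H = exp (\<Sum> u j x^j / j), the exponential formula for permutations with cycle
  weights \<open>u\<close>. Uniqueness turns identities between such series into a check of the
  recursion.\<close>

lemma hcoef_unique:
  assumes "p 0 = 1" and "\<And>n. 0 < n \<Longrightarrow> real n * p n = (\<Sum>j=1..n. u j * p (n - j))"
  shows "p n = hcoef u n"
proof (induction n rule: less_induct)
  case (less n)
  show ?case
  proof (cases "n = 0")
    case False
    then have "real n * p n = (\<Sum>j=1..n. u j * hcoef u (n - j))" using less assms(2)[of n] by (auto intro!: sum.cong)
    then have "real n * p n = real n * hcoef u n" by (simp only: hcoef_rec)
    then show ?thesis using False by simp
  qed (simp add: assms)
qed

lemma hcoef_cong: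
  assumes "\<And>j. 1 \<le> j \<Longrightarrow> j \<le> n \<Longrightarrow> u j = v j"
  shows "hcoef u n = hcoef v n" using assms
proof (induction n rule: less_induct)
  case (less n)
  have "real n * hcoef u n = real n * hcoef v n" unfolding hcoef_rec using less by (intro sum.cong) auto
  then show ?case by (cases "n = 0") auto
qed

lemma hcoef_nonneg:
  assumes "\<And>j. 1 \<le> j \<Longrightarrow> 0 \<le> u j"
  shows "0 \<le> hcoef u n"
proof (induction n rule: less_induct)
  case (less n)
  have "0 \<le> real n * hcoef u n" unfolding hcoef_rec using less assms by (intro sum_nonneg mult_nonneg_nonneg) auto
  then show ?case by (cases "n = 0") (auto simp: zero_le_mult_iff)
qed

lemma hcoef_mono:
  assumes "\<And>j. 1 \<le> j \<Longrightarrow> 0 \<le> u j" "\<And>j. 1 \<le> j \<Longrightarrow> u j \<le> v j"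
  shows "hcoef u n \<le> hcoef v n"
proof (induction n rule: less_induct)
  case (less n)
  have "real n * hcoef u n \<le> real n * hcoef v n" unfolding hcoef_rec
  proof (intro sum_mono mult_mono)
    fix j assume "j \<in> {1..n}"
    then show "hcoef u (n - j) \<le> hcoef v (n - j)" "u j \<le> v j" "0 \<le> v j" "0 \<le> hcoef u (n - j)"
      using less assms order_trans hcoef_nonneg[of u] by (auto intro: order_trans)
  qed
  then show ?case by (cases "n = 0") auto
qed

lemma hcoef_abs_le: "\<bar>hcoef u n\<bar> \<le> hcoef (\<lambda>j. \<bar>u j\<bar>) n"
proof (induction n rule: less_induct)
  case (less n)
  have "real n * \<bar>hcoef u n\<bar> = \<bar>\<Sum>j=1..n. u j * hcoef u (n - j)\<bar>" unfolding hcoef_rec[symmetric] by (simp add: abs_mult)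
  also have "\<dots> \<le> (\<Sum>j=1..n. \<bar>u j * hcoef u (n - j)\<bar>)" by (rule sum_abs)
  also have "\<dots> \<le> real n * hcoef (\<lambda>j. \<bar>u j\<bar>) n" unfolding hcoef_rec abs_mult using less by (intro sum_mono mult_left_mono) auto
  finally show ?case by (cases "n = 0") auto
qed

text \<open>Rescaling of the variable in the generating function; this is the exponential tilting
  behind the Chernoff bound.\<close>

lemma hcoef_tilt: "hcoef (\<lambda>j. u j * x ^ j) n = x ^ n * hcoef u n"
proof -
  have "(\<lambda>n. x ^ n * hcoef u n) n = hcoef (\<lambda>j. u j * x ^ j) n"
  proof (rule hcoef_unique)
    fix n :: nat assume "0 < n"
    have "real n * (x ^ n * hcoef u n) = x ^ n * (\<Sum>j=1..n. u j * hcoef u (n - j))" by (simp only: hcoef_rec[symmetric] mult.left_commute)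
    also have "\<dots> = (\<Sum>j=1..n. u j * x ^ j * (x ^ (n - j) * hcoef u (n - j)))" unfolding sum_distrib_left
    proof (rule sum.cong)
      fix j assume "j \<in> {1..n}"
      then have "x ^ n = x ^ j * x ^ (n - j)" by (simp flip: power_add)
      then show "x ^ n * (u j * hcoef u (n - j)) = u j * x ^ j * (x ^ (n - j) * hcoef u (n - j))" by simp
    qed simp
    finally show "real n * (x ^ n * hcoef u n) = (\<Sum>j=1..n. u j * x ^ j * (x ^ (n - j) * hcoef u (n - j)))" .
  qed simp
  then show ?thesis by simp
qed

lemma hcoef_fps:
  "fps_X * fps_deriv (Abs_fps (hcoef u)) = Abs_fps (\<lambda>j. if j = 0 then 0 else u j) * Abs_fps (hcoef u)"
proof (rule fps_ext)
  fix n
  have "(\<Sum>j=0..n. (if j = 0 then 0 else u j) * hcoef u (n - j)) = (\<Sum>j=1..n. u j * hcoef u (n - j))"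
    by (rule sum.mono_neutral_cong_right) auto
  then show "fps_nth (fps_X * fps_deriv (Abs_fps (hcoef u))) n =
     fps_nth (Abs_fps (\<lambda>j. if j = 0 then 0 else u j) * Abs_fps (hcoef u)) n"
    using hcoef_rec[of n u] by (simp add: fps_mult_nth[of "Abs_fps _" "Abs_fps _"])
qed

text \<open>The exponential turns sums of weights into products of series. This is what separates
  the zero mode from the others, and short cycles from long ones.\<close>

lemma hcoef_add: "hcoef (\<lambda>j. u j + v j) n = (\<Sum>i\<le>n. hcoef u i * hcoef v (n - i))"
proof -
  let ?U = "Abs_fps (\<lambda>j. if j = 0 then 0 else u j)" and ?V = "Abs_fps (\<lambda>j. if j = 0 then 0 else v j)"
  let ?H = "Abs_fps (hcoef u)" and ?K = "Abs_fps (hcoef v)"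
  have "(\<lambda>n. fps_nth (?H * ?K) n) n = hcoef (\<lambda>j. u j + v j) n"
  proof (rule hcoef_unique)
    fix n :: nat assume n: "0 < n"
    have "fps_X * fps_deriv (?H * ?K) = (fps_X * fps_deriv ?H) * ?K + (fps_X * fps_deriv ?K) * ?H" by (simp add: algebra_simps)
    also have "\<dots> = Abs_fps (\<lambda>j. if j = 0 then 0 else u j + v j) * (?H * ?K)" unfolding hcoef_fps
    proof -
      have "Abs_fps (\<lambda>j. if j = 0 then 0 else u j + v j) = ?U + ?V" by (rule fps_ext) auto
      then show "?U * ?H * ?K + ?V * ?K * ?H = Abs_fps (\<lambda>j. if j = 0 then 0 else u j + v j) * (?H * ?K)" by (simp add: algebra_simps)
    qed
    finally have "fps_nth (fps_X * fps_deriv (?H * ?K)) n =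
        fps_nth (Abs_fps (\<lambda>j. if j = 0 then 0 else u j + v j) * (?H * ?K)) n" by simp
    also have "\<dots> = (\<Sum>j=0..n. (if j = 0 then 0 else u j + v j) * fps_nth (?H * ?K) (n - j))" by (subst fps_mult_nth) simp
    also have "\<dots> = (\<Sum>j=1..n. (u j + v j) * fps_nth (?H * ?K) (n - j))" by (rule sum.mono_neutral_cong_right) auto
    finally show "real n * fps_nth (?H * ?K) n = (\<Sum>j=1..n. (u j + v j) * fps_nth (?H * ?K) (n - j))" using n by (simp del: fps_deriv_mult)
  qed simp
  then show ?thesis by (simp add: fps_mult_nth atLeast0AtMost)
qed

text \<open>The series exp (x y^j / j) contains only powers of y^j: with a single admissible cycle
  length the coefficients are, up to normalization, Poisson weights on the multiples of
  \<open>j\<close>.\<close>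

lemma hcoef_single:
  assumes "1 \<le> j"
  shows "hcoef (\<lambda>i. if i = j then x else 0) n =
     (if j dvd n then (x / real j) ^ (n div j) / fact (n div j) else 0)" (is "_ = ?p n")
proof -
  have "?p n = hcoef (\<lambda>i. if i = j then x else 0) n"
  proof (rule hcoef_unique)
    fix n :: nat assume n: "0 < n"
    have "(\<Sum>i=1..n. (if i = j then x else 0) * ?p (n - i)) = (\<Sum>i=1..n. if i = j then x * ?p (n - j) else 0)" by (intro sum.cong) auto
    also have "\<dots> = (if j \<le> n then x * ?p (n - j) else 0)" using assms by auto
    also have "\<dots> = real n * ?p n"
    proof (cases "j dvd n")
      case True
      then obtain k where k: "n = j * k" by auto
      with n obtain l where l: "k = Suc l" by (cases k) auto
      have "n - j = j * l" by (simp add: k l)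
      have "x / real j * y / (S * f) * (real j * S) = x * (y / f)" if "S \<noteq> 0" "f \<noteq> 0" for S f y
        using that assms by (simp add: field_simps)
      from this[of "real (Suc l)" "fact l" "(x / real j) ^ l"]
      have "(x / real j) ^ Suc l / fact (Suc l) * (real j * real (Suc l)) = x * ((x / real j) ^ l / fact l)"
        by (simp only: power_Suc fact_Suc of_nat_mult) simp
      moreover have "n div j = Suc l" using assms unfolding k l by simp
      moreover have "(n - j) div j = l" "j dvd n - j" using assms by (simp_all add: \<open>n - j = j * l\<close>)
      moreover have "real n = real j * real (Suc l)" by (simp only: k l of_nat_mult)
      moreover have "j \<le> n" using True n by (auto dest: dvd_imp_le)
      ultimately show ?thesis using True by (simp only: if_True mult.commute)
    next
      case False
      then show ?thesis using n by (auto simp: dvd_minus_self)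
    qed
    finally show "real n * ?p n = (\<Sum>i=1..n. (if i = j then x else 0) * ?p (n - i))" by simp
  qed simp
  then show ?thesis by simp
qed

lemma hcoef_single_sums:
  assumes "1 \<le> j"
  shows "hcoef (\<lambda>i. if i = j then x else 0) sums exp (x / real j)"
proof -
  have "strict_mono (\<lambda>k. j * k)" using assms by (simp add: strict_mono_def)
  then have "((\<lambda>k. hcoef (\<lambda>i. if i = j then x else 0) (j * k)) sums exp (x / real j)) \<longleftrightarrow>
    hcoef (\<lambda>i. if i = j then x else 0) sums exp (x / real j)"
  proof (rule sums_mono_reindex)
    fix n assume "n \<notin> range (\<lambda>k. j * k)"
    then have "\<not> j dvd n" by (auto elim!: dvdE)
    then show "hcoef (\<lambda>i. if i = j then x else 0) n = 0" by (simp add: hcoef_single[OF assms])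
  qed
  moreover have "(\<lambda>k. hcoef (\<lambda>i. if i = j then x else 0) (j * k)) sums exp (x / real j)"
    using exp_converges[of "x / real j"] assms by (simp add: hcoef_single[OF assms] divide_inverse mult_ac)
  ultimately show ?thesis by simp
qed

text \<open>Evaluation of the generating function at 1, where finite support settles convergence.
  Each induction step splits off the longest cycle length as a Cauchy factor.\<close>

lemma hcoef_finite_sums:
  assumes "\<And>j. 1 \<le> j \<Longrightarrow> 0 \<le> u j" "\<And>j. J < j \<Longrightarrow> u j = 0"
  shows "hcoef u sums exp (\<Sum>j=1..J. u j / real j)" using assms
proof (induction J arbitrary: u)
  case 0
  have "hcoef u n = hcoef (\<lambda>i. if i = 1 then 0 else 0) n" for n using 0 by (intro hcoef_cong) auto
  then show ?case using hcoef_single_sums[of 1 0] by (simp add: sums_def)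
next
  case (Suc J)
  let ?a = "\<lambda>i. if i = Suc J then 0 else u i" and ?b = "\<lambda>i. if i = Suc J then u (Suc J) else 0"
  have a: "hcoef ?a sums exp (\<Sum>j=1..J. ?a j / real j)" using Suc.prems by (intro Suc.IH) (auto simp: not_less less_Suc_eq_le Suc_lessI)
  have b: "hcoef ?b sums exp (u (Suc J) / real (Suc J))" by (intro hcoef_single_sums) simp
  have nn: "0 \<le> hcoef ?a n" "0 \<le> hcoef ?b n" for n using Suc.prems by (auto intro!: hcoef_nonneg)
  have "(\<lambda>n. \<Sum>i\<le>n. hcoef ?a i * hcoef ?b (n - i)) sums ((\<Sum>n. hcoef ?a n) * (\<Sum>n. hcoef ?b n))"
    using a b nn by (intro Cauchy_product_sums) (auto simp: sums_iff)
  also have "(\<lambda>n. \<Sum>i\<le>n. hcoef ?a i * hcoef ?b (n - i)) = hcoef (\<lambda>j. ?a j + ?b j)" by (rule ext) (simp only: hcoef_add)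
  also have "(\<lambda>j. ?a j + ?b j) = u" by auto
  also have "(\<Sum>n. hcoef ?a n) * (\<Sum>n. hcoef ?b n) =
      exp (\<Sum>j=1..J. u j / real j) * exp (u (Suc J) / real (Suc J))" using a b by (simp add: sums_iff)
  also have "\<dots> = exp (\<Sum>j=1..Suc J. u j / real j)" by (simp add: exp_add)
  finally show ?case .
qed

text \<open>Weights beyond \<open>n\<close> do not enter the coefficients up to \<open>n\<close>, so
  they may be set to 0 and the finite evaluation applies.\<close>

lemma hcoef_sum_le_exp:
  assumes "\<And>j. 1 \<le> j \<Longrightarrow> 0 \<le> u j"
  shows "(\<Sum>i\<le>n. hcoef u i) \<le> exp (\<Sum>j=1..n. u j / real j)"
proof -
  let ?v = "\<lambda>j. if j \<le> n then u j else 0"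
  have s: "hcoef ?v sums exp (\<Sum>j=1..n. ?v j / real j)" using assms by (intro hcoef_finite_sums) auto
  have "(\<Sum>i\<le>n. hcoef u i) = (\<Sum>i\<le>n. hcoef ?v i)" by (intro sum.cong hcoef_cong) auto
  also have "\<dots> \<le> (\<Sum>i. hcoef ?v i)" using s assms by (intro sum_le_suminf) (auto simp: sums_iff intro!: hcoef_nonneg)
  also have "\<dots> = exp (\<Sum>j=1..n. u j / real j)" using s by (simp add: sums_iff)
  finally show ?thesis .
qed

lemma hcoef_le_exp:
  assumes "\<And>j. 1 \<le> j \<Longrightarrow> 0 \<le> u j"
  shows "hcoef u n \<le> exp (\<Sum>j=1..n. u j / real j)"
proof -
  have "hcoef u n \<le> (\<Sum>i\<le>n. hcoef u i)" using assms by (intro member_le_sum) (auto intro: hcoef_nonneg)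
  then show ?thesis using hcoef_sum_le_exp[of u n] assms by fastforce
qed

text \<open>One term of the recursion, the others being nonnegative. It loses only a factor
  \<open>n\<close>, which is harmless against the stretched exponential bounds to come.\<close>

lemma hcoef_ge_term:
  assumes "\<And>j. 1 \<le> j \<Longrightarrow> 0 \<le> u j" "1 \<le> j" "j \<le> n"
  shows "u j * hcoef u (n - j) / real n \<le> hcoef u n"
proof -
  have "u j * hcoef u (n - j) \<le> (\<Sum>j=1..n. u j * hcoef u (n - j))"
    using assms by (intro member_le_sum) (auto intro!: mult_nonneg_nonneg hcoef_nonneg)
  then show ?thesis using assms unfolding hcoef_rec[symmetric] by (simp add: field_simps)
qed

lemma hcoef_pos:
  assumes "\<And>j. 1 \<le> j \<Longrightarrow> 0 < u j"
  shows "0 < hcoef u n"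
proof (cases "n = 0")
  case False
  then have "0 < u n * hcoef u (n - n) / real n" using assms by simp
  also have "\<dots> \<le> hcoef u n" using assms False by (intro hcoef_ge_term) (auto intro: less_imp_le)
  finally show ?thesis .
qed simp

text \<open>Chernoff's bound for \<open>\<Sum> j P\<^sub>j\<close> with independent Poisson variables \<open>P\<^sub>j\<close> of mean \<open>u j / j\<close>; up to
  the normalization \<open>exp (\<Sum> u j / j)\<close>, its distribution is \<open>hcoef u\<close>.\<close>

lemma exp_minus_one_le: "exp x - 1 \<le> x + x\<^sup>2 * exp x" if "0 \<le> x" for x :: real
proof -
  have "exp (-x) \<ge> 1 - x" using exp_ge_add_one_self[of "-x"] by simp
  then have "(1 - x) * exp x \<le> 1" by (simp add: exp_minus field_simps)
  moreover have "(1 - x) * exp x * (1 + x) \<le> 1 * (1 + x)" using calculation that by (intro mult_right_mono) auto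
  ultimately show ?thesis by (simp add: algebra_simps power2_eq_square)
qed

lemma exp_uminus_le: "exp (- x) \<le> 1 - x + x\<^sup>2" if "0 \<le> x" for x :: real
proof -
  have "1 + x \<le> exp x" by (rule exp_ge_add_one_self)
  then have "exp (-x) \<le> 1 / (1 + x)" using that by (simp add: exp_minus divide_simps)
  also have "\<dots> \<le> 1 - x + x\<^sup>2" using that by (simp add: divide_simps algebra_simps power2_eq_square)
  finally show ?thesis .
qed

lemma hcoef_chernoff:
  assumes u: "\<And>j. 1 \<le> j \<Longrightarrow> 0 \<le> u j" "\<And>j. J < j \<Longrightarrow> u j = 0" and "0 \<le> s" and "finite I"
  defines "\<mu> \<equiv> \<Sum>j=1..J. u j" and "P \<equiv> \<Sum>j=1..J. u j / real j"
    and "V \<equiv> \<Sum>j=1..J. real j * u j * exp (s * real j)"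
  assumes I: "\<And>n. n \<in> I \<Longrightarrow> a \<le> \<bar>real n - \<mu>\<bar>"
  shows "(\<Sum>n\<in>I. hcoef u n) \<le> 2 * exp (P - s * a + s\<^sup>2 * V)"
proof -
  \<comment> \<open>One estimate serves both tails: \<open>y\<close> is \<open>s\<close> above the
    mean and \<open>- s\<close> below it. Tilting by exp y multiplies the n-th coefficient by exp (y
    n), which pays for the distance \<open>a\<close>; the premise \<open>ex\<close> expands the
    tilted weights to first order, with the remainder collected in \<open>V\<close>.\<close>
  have key: "(\<Sum>n\<in>I'. hcoef u n) \<le> exp (P - s * a + s\<^sup>2 * V)"
    if "I' \<subseteq> I" "\<bar>y\<bar> = s" "\<And>n. n \<in> I' \<Longrightarrow> s * a \<le> y * (real n - \<mu>)"
       and ex: "\<And>x. 0 \<le> x \<Longrightarrow> exp (y * x) \<le> 1 + y * x + (s * x)\<^sup>2 * exp (s * x)" for I' y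
  proof -
    let ?v = "\<lambda>j. u j * exp y ^ j"
    have sm: "hcoef ?v sums exp (\<Sum>j=1..J. ?v j / real j)" using u by (intro hcoef_finite_sums) auto
    have "(\<Sum>n\<in>I'. hcoef u n) \<le> (\<Sum>n\<in>I'. exp (- s * a - y * \<mu>) * hcoef ?v n)"
    proof (rule sum_mono)
      fix n assume "n \<in> I'"
      then have "s * a \<le> y * (real n - \<mu>)" using that(3) by simp
      then have "1 \<le> exp (- s * a - y * \<mu> + y * real n)" by (simp add: algebra_simps)
      then have "hcoef u n * 1 \<le> hcoef u n * exp (- s * a - y * \<mu> + y * real n)"
        using hcoef_nonneg[of u n] u by (intro mult_left_mono) auto
      also have "\<dots> = exp (- s * a - y * \<mu>) * hcoef ?v n" unfolding hcoef_tilt by (simp only: exp_add exp_of_nat2_mult mult_ac)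
      finally show "hcoef u n \<le> exp (- s * a - y * \<mu>) * hcoef ?v n" by simp
    qed
    also have "\<dots> = exp (- s * a - y * \<mu>) * (\<Sum>n\<in>I'. hcoef ?v n)" by (simp add: sum_distrib_left)
    also have "(\<Sum>n\<in>I'. hcoef ?v n) \<le> (\<Sum>n. hcoef ?v n)"
      using sm u finite_subset[OF that(1) assms(4)] by (intro sum_le_suminf) (auto simp: sums_iff intro!: hcoef_nonneg)
    also have "(\<Sum>n. hcoef ?v n) = exp (\<Sum>j=1..J. ?v j / real j)" using sm by (simp add: sums_iff)
    also have "(\<Sum>j=1..J. ?v j / real j) \<le> (\<Sum>j=1..J. u j / real j + y * u j + s\<^sup>2 * (real j * u j * exp (s * real j)))"
    proof (rule sum_mono)
      fix j assume j: "j \<in> {1..J}"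
      have "?v j / real j = (u j / real j) * exp (y * real j)" by (simp add: exp_of_nat2_mult)
      also have "\<dots> \<le> (u j / real j) * (1 + y * real j + (s * real j)\<^sup>2 * exp (s * real j))" using j u ex by (intro mult_left_mono) auto
      also have "\<dots> = u j / real j + y * u j + s\<^sup>2 * (real j * u j * exp (s * real j))" using j by (simp add: field_simps power2_eq_square)
      finally show "?v j / real j \<le> \<dots>" .
    qed
    also have "\<dots> = P + y * \<mu> + s\<^sup>2 * V" by (simp add: P_def \<mu>_def V_def sum.distrib sum_distrib_left)
    finally show ?thesis by (simp flip: exp_add add: algebra_simps)
  qed
  let ?I1 = "{n \<in> I. \<mu> \<le> real n}" and ?I2 = "{n \<in> I. \<not> \<mu> \<le> real n}"
  have "(\<Sum>n\<in>?I1. hcoef u n) \<le> exp (P - s * a + s\<^sup>2 * V)"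
  proof (rule key[where y = s])
    fix x :: real assume x: "0 \<le> x"
    show "exp (s * x) \<le> 1 + s * x + (s * x)\<^sup>2 * exp (s * x)" using exp_minus_one_le[of "s * x"] x assms(3) by simp
  next
    fix n assume "n \<in> ?I1"
    then have "a \<le> real n - \<mu>" using I[of n] by simp
    then show "s * a \<le> s * (real n - \<mu>)" using assms(3) by (intro mult_left_mono)
  qed (use assms(3) in auto)
  moreover have "(\<Sum>n\<in>?I2. hcoef u n) \<le> exp (P - s * a + s\<^sup>2 * V)"
  proof (rule key[where y = "-s"])
    fix x :: real assume x: "0 \<le> x"
    have "(s * x)\<^sup>2 * 1 \<le> (s * x)\<^sup>2 * exp (s * x)" using x assms(3) by (intro mult_left_mono) auto
    then show "exp (- s * x) \<le> 1 + - s * x + (s * x)\<^sup>2 * exp (s * x)" using exp_uminus_le[of "s * x"] x assms(3) by simp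
  next
    fix n assume "n \<in> ?I2"
    then have "a \<le> \<mu> - real n" using I[of n] by simp
    then have "s * a \<le> s * (\<mu> - real n)" using assms(3) by (intro mult_left_mono)
    then show "s * a \<le> - s * (real n - \<mu>)" by (simp add: algebra_simps)
  qed (use assms(3) in auto)
  moreover have "(\<Sum>n\<in>I. hcoef u n) = (\<Sum>n\<in>?I1. hcoef u n) + (\<Sum>n\<in>?I2. hcoef u n)"
    using assms(4) by (subst sum.union_disjoint[symmetric]) (auto intro: sum.cong)
  ultimately show ?thesis by simp
qed

text \<open>In the convolution the term i = 0 is \<open>hcoef u n\<close>, and the other terms carry
  total mass at most exp (\<Sum> v j / j) - 1 of \<open>hcoef v\<close>. So a perturbation
  \<open>v\<close> of small weight changes the coefficient little, once the earlier coefficients are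
  bounded by \<open>D\<close>.\<close>

lemma hcoef_diff_bound:
  assumes "\<And>j. 1 \<le> j \<Longrightarrow> 0 \<le> u j" "\<And>j. 1 \<le> j \<Longrightarrow> 0 \<le> v j"
    and "\<And>i. 1 \<le> i \<Longrightarrow> i \<le> n \<Longrightarrow> hcoef (\<lambda>j. u j + v j) (n - i) \<le> D"
  shows "hcoef (\<lambda>j. u j + v j) n - hcoef u n \<le> (exp (\<Sum>j=1..n. v j / real j) - 1) * D"
    and "hcoef u n \<le> hcoef (\<lambda>j. u j + v j) n"
proof -
  show "hcoef u n \<le> hcoef (\<lambda>j. u j + v j) n" using assms by (intro hcoef_mono) auto
  have "(\<lambda>j. u j + v j) = (\<lambda>j. v j + u j)" by (simp add: add.commute)
  then have "hcoef (\<lambda>j. u j + v j) n = (\<Sum>i\<le>n. hcoef v i * hcoef u (n - i))" by (simp only: hcoef_add)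
  also have "\<dots> = hcoef u n + (\<Sum>i=1..n. hcoef v i * hcoef u (n - i))"
    by (subst atLeast0AtMost[symmetric], subst sum.atLeast_Suc_atMost) auto
  also have "(\<Sum>i=1..n. hcoef v i * hcoef u (n - i)) \<le> (\<Sum>i=1..n. hcoef v i * D)"
  proof (intro sum_mono mult_left_mono)
    fix i assume "i \<in> {1..n}"
    have "hcoef u (n - i) \<le> hcoef (\<lambda>j. u j + v j) (n - i)" using assms by (intro hcoef_mono) auto
    then show "hcoef u (n - i) \<le> D" using assms(3)[of i] \<open>i \<in> {1..n}\<close> by simp
  qed (use assms hcoef_nonneg in auto)
  also have "\<dots> = ((\<Sum>i\<le>n. hcoef v i) - 1) * D"
  proof -
    have "(\<Sum>i\<le>n. hcoef v i) = 1 + (\<Sum>i=1..n. hcoef v i)" by (subst atLeast0AtMost[symmetric], subst sum.atLeast_Suc_atMost) auto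
    then show ?thesis by (simp add: sum_distrib_right)
  qed
  finally have *: "hcoef (\<lambda>j. u j + v j) n - hcoef u n \<le> ((\<Sum>i\<le>n. hcoef v i) - 1) * D" by simp
  show "hcoef (\<lambda>j. u j + v j) n - hcoef u n \<le> (exp (\<Sum>j=1..n. v j / real j) - 1) * D"
  proof (cases "n = 0")
    case False
    have "0 \<le> hcoef (\<lambda>j. u j + v j) (n - 1)" using assms by (intro hcoef_nonneg) auto
    then have "0 \<le> D" using assms(3)[of 1] False by linarith
    then have "((\<Sum>i\<le>n. hcoef v i) - 1) * D \<le> (exp (\<Sum>j=1..n. v j / real j) - 1) * D"
      using hcoef_sum_le_exp[of v n] assms(2) by (intro mult_right_mono) auto
    then show ?thesis using * by linarith
  qed simp
qed

section \<open>Asymptotics of the coefficients\<close>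

text \<open>Regular variation of index \<open>p\<close>: the constant \<open>C\<close> cancels in
  the quotient.\<close>

lemma powr_ratio_tendsto:
  fixes a :: "nat \<Rightarrow> real" and k :: "nat \<Rightarrow> nat"
  assumes a: "(\<lambda>n. a n / real n powr p) \<longlonglongrightarrow> C" "C \<noteq> 0"
    and k: "(\<lambda>n. real (k n) / real n) \<longlonglongrightarrow> x" "0 < x"
  shows "filterlim k at_top sequentially" and "(\<lambda>n. a (k n) / a n) \<longlonglongrightarrow> x powr p"
proof -
  have "filterlim (\<lambda>n. real (k n) / real n * real n) at_top sequentially"
    by (rule filterlim_tendsto_pos_mult_at_top[OF k filterlim_real_sequentially])
  then have "filterlim (\<lambda>n. real (k n)) at_top sequentially"
    by (rule filterlim_at_top_mono) (auto intro!: eventually_mono[OF eventually_gt_at_top[of 0]])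
  then show kt: "filterlim k at_top sequentially" by (simp add: filterlim_sequentially_iff_filterlim_real)
  have "(\<lambda>n. (a (k n) / real (k n) powr p) / (a n / real n powr p) * (real (k n) / real n) powr p)
      \<longlonglongrightarrow> C / C * x powr p" using k a by (intro tendsto_intros filterlim_compose[OF a(1) kt]) auto
  then have "(\<lambda>n. (a (k n) / real (k n) powr p) / (a n / real n powr p) * (real (k n) / real n) powr p)
      \<longlonglongrightarrow> x powr p" using a(2) by simp
  then show "(\<lambda>n. a (k n) / a n) \<longlonglongrightarrow> x powr p"
  proof (rule Lim_transform_eventually)
    have "eventually (\<lambda>n. 0 < k n) sequentially" by (rule eventually_compose_filterlim[OF eventually_gt_at_top kt])
    then show "eventually (\<lambda>n. (a (k n) / real (k n) powr p) / (a n / real n powr p) * (real (k n) / real n) powr p = a (k n) / a n) sequentially"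
      using eventually_gt_at_top[of 0] by eventually_elim (simp add: powr_divide)
  qed
qed

text \<open>The coefficients of (1 - x)^(- \<theta>), the normalization of the Ewens distribution
  with constant cycle weight \<theta>.\<close>

definition ewens_coef :: "real \<Rightarrow> nat \<Rightarrow> real" where
  "ewens_coef \<theta> n = pochhammer \<theta> n / fact n"

lemma ewens_coef_pos: "0 < \<theta> \<Longrightarrow> 0 < ewens_coef \<theta> n" by (simp add: ewens_coef_def pochhammer_pos)

lemma ewens_coef_Suc: "ewens_coef \<theta> (Suc n) = ewens_coef \<theta> n * (\<theta> + real n) / real (Suc n)"
  by (simp add: ewens_coef_def pochhammer_Suc field_simps)

lemma ewens_coef_sum: "\<theta> * (\<Sum>i<n. ewens_coef \<theta> i) = real n * ewens_coef \<theta> n"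
proof (induction n)
  case (Suc n)
  have "\<theta> * (\<Sum>i<Suc n. ewens_coef \<theta> i) = real n * ewens_coef \<theta> n + \<theta> * ewens_coef \<theta> n" using Suc by (simp add: distrib_left)
  also have "\<dots> = real (Suc n) * ewens_coef \<theta> (Suc n)" by (simp add: ewens_coef_Suc field_simps)
  finally show ?case .
qed simp

lemma hcoef_const: "hcoef (\<lambda>_. \<theta>) n = ewens_coef \<theta> n"
proof -
  have "ewens_coef \<theta> n = hcoef (\<lambda>_. \<theta>) n"
  proof (rule hcoef_unique)
    fix n :: nat
    have "(\<Sum>j=1..n. \<theta> * ewens_coef \<theta> (n - j)) = \<theta> * (\<Sum>j=1..n. ewens_coef \<theta> (n - j))" by (simp add: sum_distrib_left)
    also have "(\<Sum>j=1..n. ewens_coef \<theta> (n - j)) = (\<Sum>i<n. ewens_coef \<theta> i)"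
      by (rule sum.reindex_bij_witness[of _ "\<lambda>i. n - i" "\<lambda>j. n - j"]) auto
    finally show "real n * ewens_coef \<theta> n = (\<Sum>j=1..n. \<theta> * ewens_coef \<theta> (n - j))" by (simp add: ewens_coef_sum)
  qed (simp add: ewens_coef_def)
  then show ?thesis by simp
qed

lemma ewens_coef_asymp:
  assumes "0 < \<theta>"
  shows "(\<lambda>n. ewens_coef \<theta> n / real n powr (\<theta> - 1)) \<longlonglongrightarrow> inverse (Gamma \<theta>)"
proof -
  \<comment> \<open>The series for 1 / Gamma has one Pochhammer factor more and the power
    n^\<theta>; the factor n / (\<theta> + n) corrects both and tends to 1.\<close>
  have "(\<lambda>n. rGamma_series \<theta> n * (real n / (\<theta> + real n))) \<longlonglongrightarrow> rGamma \<theta> * 1" by (intro tendsto_mult rGamma_series_LIMSEQ) real_asymp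
  then have "(\<lambda>n. rGamma_series \<theta> n * (real n / (\<theta> + real n))) \<longlonglongrightarrow> inverse (Gamma \<theta>)" by (simp add: rGamma_inverse_Gamma)
  then show ?thesis
  proof (rule Lim_transform_eventually)
    show "eventually (\<lambda>n. rGamma_series \<theta> n * (real n / (\<theta> + real n)) =
        ewens_coef \<theta> n / real n powr (\<theta> - 1)) sequentially" using eventually_gt_at_top[of 0]
    proof eventually_elim
      case (elim n)
      have "exp (\<theta> * ln (real n)) = real n powr (\<theta> - 1) * real n" using elim by (simp add: powr_def algebra_simps exp_diff)
      moreover have "\<theta> + real n \<noteq> 0" using assms by linarith
      ultimately show ?case using elim by (simp add: rGamma_series_def ewens_coef_def pochhammer_Suc)
    qed
  qed
qed

lemma ewens_coef_mono:
  assumes "1 \<le> \<theta>" "m \<le> n"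
  shows "ewens_coef \<theta> m \<le> ewens_coef \<theta> n"
proof (rule lift_Suc_mono_le[OF _ assms(2)])
  fix n
  have "ewens_coef \<theta> n * 1 \<le> ewens_coef \<theta> n * ((\<theta> + real n) / real (Suc n))"
    using assms ewens_coef_pos[of \<theta> n] by (intro mult_left_mono) auto
  then show "ewens_coef \<theta> n \<le> ewens_coef \<theta> (Suc n)" by (simp add: ewens_coef_Suc)
qed

lemma ewens_coef_antimono:
  assumes "0 < \<theta>" "\<theta> \<le> 1" "m \<le> n"
  shows "ewens_coef \<theta> n \<le> ewens_coef \<theta> m"
proof (rule lift_Suc_antimono_le[OF _ assms(3)])
  fix n
  have "ewens_coef \<theta> n * ((\<theta> + real n) / real (Suc n)) \<le> ewens_coef \<theta> n * 1"
    using assms ewens_coef_pos[of \<theta> n] by (intro mult_left_mono) auto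
  then show "ewens_coef \<theta> (Suc n) \<le> ewens_coef \<theta> n" by (simp add: ewens_coef_Suc)
qed

text \<open>Only the term i = 0 of the sum formula is kept. The resulting bound n / \<theta> for the
  reciprocal coefficient is what is available when the coefficients decrease.\<close>

lemma ewens_coef_ge:
  assumes "0 < \<theta>"
  shows "\<theta> \<le> real (Suc n) * ewens_coef \<theta> (Suc n)"
proof -
  have "ewens_coef \<theta> 0 \<le> (\<Sum>i<Suc n. ewens_coef \<theta> i)" using ewens_coef_pos[OF assms] by (intro member_le_sum) (auto intro: less_imp_le)
  then have "\<theta> * 1 \<le> \<theta> * (\<Sum>i<Suc n. ewens_coef \<theta> i)" using assms by (intro mult_left_mono) (auto simp: ewens_coef_def)
  then show ?thesis using ewens_coef_sum[of \<theta> "Suc n"] by (simp del: sum.lessThan_Suc)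
qed

lemma hcoef_summable:
  assumes "summable (\<lambda>j. u (Suc j) / real (Suc j))" "\<And>j. 1 \<le> j \<Longrightarrow> 0 \<le> u j"
  shows "summable (hcoef u)"
proof (rule bounded_imp_summable)
  fix n
  have "(\<Sum>j=1..n. u j / real j) = (\<Sum>j<n. u (Suc j) / real (Suc j))" by (rule sum.reindex_bij_witness[of _ Suc "\<lambda>j. j - 1"]) auto
  also have "\<dots> \<le> (\<Sum>j. u (Suc j) / real (Suc j))" using assms by (intro sum_le_suminf) auto
  finally show "(\<Sum>i\<le>n. hcoef u i) \<le> exp (\<Sum>j. u (Suc j) / real (Suc j))"
    using hcoef_sum_le_exp[of u n] assms by (meson exp_le_cancel_iff order_trans)
qed (use assms in \<open>auto intro: hcoef_nonneg\<close>)

text \<open>By the recursion, n times the coefficient is the convolution of the two summable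
  sequences \<open>u\<close> and \<open>hcoef u\<close>.\<close>

lemma hcoef_moment_summable:
  assumes "summable (\<lambda>j. u (Suc j))" "\<And>j. 1 \<le> j \<Longrightarrow> 0 \<le> u j"
  shows "summable (\<lambda>n. real n * hcoef u n)"
proof -
  let ?u = "\<lambda>j. if j = 0 then 0 else u j"
  have su: "summable ?u" using assms(1) by (subst summable_Suc_iff[symmetric]) simp
  have "summable (\<lambda>j. u (Suc j) / real (Suc j))"
    using assms by (intro summable_comparison_test'[OF assms(1)]) (auto simp: field_simps mult_left_le)
  then have sh: "summable (hcoef u)" using assms by (intro hcoef_summable) auto
  have "summable (\<lambda>n. \<Sum>j\<le>n. ?u j * hcoef u (n - j))" using su sh assms hcoef_nonneg[of u] by (intro summable_Cauchy_product) auto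
  also have "(\<lambda>n. \<Sum>j\<le>n. ?u j * hcoef u (n - j)) = (\<lambda>n. real n * hcoef u n)"
  proof
    fix n
    have "(\<Sum>j\<le>n. ?u j * hcoef u (n - j)) = (\<Sum>j=1..n. u j * hcoef u (n - j))" by (rule sum.mono_neutral_cong_right) auto
    then show "(\<Sum>j\<le>n. ?u j * hcoef u (n - j)) = real n * hcoef u n" by (simp add: hcoef_rec)
  qed
  finally show ?thesis .
qed

text \<open>For weights of mixed sign, positivity of the sum is not visible termwise. The series of
  the positive part of \<open>u\<close> is the product of the series of \<open>u\<close> and of the
  negative part, and its sum is at least 1; hence neither factor vanishes, and the second is
  nonnegative.\<close>

lemma hcoef_suminf_pos:
  assumes "summable (\<lambda>j. \<bar>u (Suc j)\<bar> / real (Suc j))"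
  shows "summable (\<lambda>n. \<bar>hcoef u n\<bar>)" and "0 < (\<Sum>n. hcoef u n)"
proof -
  let ?p = "\<lambda>j. max 0 (u j)" and ?m = "\<lambda>j. max 0 (- u j)"
  have "summable (hcoef (\<lambda>j. \<bar>u j\<bar>))" using assms by (intro hcoef_summable) auto
  then show s: "summable (\<lambda>n. \<bar>hcoef u n\<bar>)" by (rule summable_comparison_test'[of _ 0]) (use hcoef_abs_le in auto)
  have sp: "summable (hcoef ?p)" by (rule hcoef_summable, rule summable_comparison_test'[OF assms, of 0])
       (auto simp: divide_simps split: if_splits)
  have sm: "summable (hcoef ?m)" by (rule hcoef_summable, rule summable_comparison_test'[OF assms, of 0])
       (auto simp: divide_simps split: if_splits)
  have m0: "0 \<le> hcoef ?m n" "0 \<le> hcoef ?p n" for n by (auto intro: hcoef_nonneg)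
  have "(\<lambda>n. \<Sum>i\<le>n. hcoef u i * hcoef ?m (n - i)) sums ((\<Sum>n. hcoef u n) * (\<Sum>n. hcoef ?m n))"
    using s sm m0 by (intro Cauchy_product_sums) auto
  also have "(\<lambda>n. \<Sum>i\<le>n. hcoef u i * hcoef ?m (n - i)) = hcoef (\<lambda>j. u j + ?m j)" by (rule ext) (simp only: hcoef_add)
  also have "(\<lambda>j. u j + ?m j) = ?p" by auto
  finally have eq: "(\<Sum>n. hcoef ?p n) = (\<Sum>n. hcoef u n) * (\<Sum>n. hcoef ?m n)" by (simp add: sums_iff)
  have "(\<Sum>n<1. hcoef ?p n) \<le> (\<Sum>n. hcoef ?p n)" using sp m0 by (intro sum_le_suminf) auto
  then have "0 < (\<Sum>n. hcoef u n) * (\<Sum>n. hcoef ?m n)" using eq by simp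
  moreover have "0 \<le> (\<Sum>n. hcoef ?m n)" using sm m0 by (intro suminf_nonneg) auto
  ultimately show "0 < (\<Sum>n. hcoef u n)" by (auto simp: zero_less_mult_iff)
qed

lemma ewens_ratio_tendsto:
  assumes "0 < \<theta>"
  shows "(\<lambda>n. ewens_coef \<theta> (n - i) / ewens_coef \<theta> n) \<longlonglongrightarrow> 1"
proof -
  have "(\<lambda>n. real (n - i) / real n) \<longlonglongrightarrow> 1"
  proof (rule Lim_transform_eventually)
    show "(\<lambda>n. (real n - real i) / real n) \<longlonglongrightarrow> 1" by real_asymp
    show "eventually (\<lambda>n. (real n - real i) / real n = real (n - i) / real n) sequentially"
      using eventually_ge_at_top[of i] by eventually_elim (simp add: of_nat_diff)
  qed
  from powr_ratio_tendsto(2)[OF ewens_coef_asymp[OF assms] _ this]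
  show ?thesis using assms by (simp add: Gamma_real_pos less_imp_neq[symmetric])
qed

lemma summable_tail_tendsto:
  fixes f :: "nat \<Rightarrow> real"
  assumes "summable f" "\<And>n. 0 \<le> f n"
  shows "(\<lambda>n. \<Sum>i | n < 2 * i \<and> i \<le> n. f i) \<longlonglongrightarrow> 0"
proof (rule tendsto_sandwich[where f = "\<lambda>_. 0" and h = "\<lambda>n. \<Sum>i. f (i + n div 2)"])
  have t: "(\<lambda>k. \<Sum>i. f (i + k)) \<longlonglongrightarrow> 0" using suminf_exist_split2[OF assms(1)] .
  show "(\<lambda>n. \<Sum>i. f (i + n div 2)) \<longlonglongrightarrow> 0" by (rule filterlim_compose[OF t]) (rule filterlim_at_top_div_const_nat, simp)
  show "eventually (\<lambda>n. (\<Sum>i | n < 2 * i \<and> i \<le> n. f i) \<le> (\<Sum>i. f (i + n div 2))) sequentially"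
  proof (intro always_eventually allI)
    fix n
    have "(\<Sum>i | n < 2 * i \<and> i \<le> n. f i) \<le> (\<Sum>i\<in>{n div 2..<n div 2 + (n + 1)}. f i)" using assms by (intro sum_mono2) auto
    also have "\<dots> = (\<Sum>i<n + 1. f (i + n div 2))" by (rule sum.reindex_bij_witness[of _ "\<lambda>i. i + n div 2" "\<lambda>i. i - n div 2"]) auto
    also have "\<dots> \<le> (\<Sum>i. f (i + n div 2))" using assms by (intro sum_le_suminf summable_ignore_initial_segment) auto
    finally show "(\<Sum>i | n < 2 * i \<and> i \<le> n. f i) \<le> (\<Sum>i. f (i + n div 2))" .
  qed
qed (use assms in \<open>auto intro!: always_eventually sum_nonneg\<close>)

text \<open>The quotient of coefficients tends to 1 for each fixed \<open>i\<close>, so only a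
  dominating bound is missing. For \<theta> \<ge> 1 the quotient is at most 1. For \<theta> < 1 it
  is bounded only as long as \<open>i\<close> stays below n / 2, and the other half of the sum needs
  the first moment of \<open>H\<close>.\<close>

lemma ewens_convolution_tendsto:
  assumes \<theta>: "0 < \<theta>" and H: "summable (\<lambda>n. \<bar>H n\<bar>)"
    and cases: "1 \<le> \<theta> \<or> (\<theta> \<le> 1 \<and> summable (\<lambda>n. real n * \<bar>H n\<bar>))"
  shows "(\<lambda>n. (\<Sum>i\<le>n. H i * ewens_coef \<theta> (n - i)) / ewens_coef \<theta> n) \<longlonglongrightarrow> (\<Sum>n. H n)"
proof -
  let ?c = "ewens_coef \<theta>" and ?q = "\<lambda>P n i. if P n i then H i * (ewens_coef \<theta> (n - i) / ewens_coef \<theta> n) else 0"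
  have pos: "0 < ?c n" for n by (rule ewens_coef_pos[OF \<theta>])
  have dom: "(\<lambda>n. \<Sum>i. ?q P n i) \<longlonglongrightarrow> (\<Sum>n. H n)"
    if B: "\<And>n i. P n i \<Longrightarrow> ?c (n - i) / ?c n \<le> B" and ev: "\<And>i. eventually (\<lambda>n. P n i) sequentially"
    for P :: "nat \<Rightarrow> nat \<Rightarrow> bool" and B
  proof -
    have "eventually (\<lambda>x. (case x of (i, n) \<Rightarrow> norm (?q P n i) \<le> \<bar>H i\<bar> * max 0 B))
       (at_top \<times>\<^sub>F sequentially)"
    proof (intro always_eventually allI, clarify)
      fix i n
      have "\<bar>H i\<bar> * (?c (n - i) / ?c n) \<le> \<bar>H i\<bar> * max 0 B" if "P n i" using B[OF that] by (intro mult_left_mono) auto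
      moreover have "\<bar>?c (n - i) / ?c n\<bar> = ?c (n - i) / ?c n" using pos by (simp add: less_imp_le)
      ultimately show "norm (?q P n i) \<le> \<bar>H i\<bar> * max 0 B" using pos[of n] pos[of "n - i"] by (cases "P n i") (auto simp: abs_mult)
    qed
    moreover have "(\<lambda>n. ?q P n i) \<longlonglongrightarrow> H i" for i
    proof (rule Lim_transform_eventually)
      show "(\<lambda>n. H i * (?c (n - i) / ?c n)) \<longlonglongrightarrow> H i" using tendsto_mult[OF tendsto_const ewens_ratio_tendsto[OF \<theta>], of "H i" i] by simp
      show "eventually (\<lambda>n. H i * (?c (n - i) / ?c n) = (?q P n i)) sequentially" using ev[of i] by eventually_elim simp
    qed
    ultimately show ?thesis
      using H by (intro tannerys_theorem[where M = "\<lambda>i. \<bar>H i\<bar> * max 0 B", THEN conjunct2, THEN conjunct2]) (auto intro: summable_mult2)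
  qed
  have fin: "(\<Sum>i. ?q P n i) = (\<Sum>i | P n i. H i * ?c (n - i)) / ?c n"
    if "\<And>n i. P n i \<Longrightarrow> i \<le> n" for P :: "nat \<Rightarrow> nat \<Rightarrow> bool" and n
  proof -
    have "finite {i. P n i}" by (rule finite_subset[of _ "{..n}"]) (use that in auto)
    then have "(\<Sum>i. ?q P n i) = (\<Sum>i | P n i. ?q P n i)" by (intro suminf_finite) auto
    also have "\<dots> = (\<Sum>i | P n i. H i * ?c (n - i)) / ?c n" by (simp add: sum_divide_distrib)
    finally show ?thesis .
  qed
  show ?thesis
  proof (cases "1 \<le> \<theta>")
    case True
    have "(\<lambda>n. \<Sum>i. if i \<le> n then H i * (?c (n - i) / ?c n) else 0) \<longlonglongrightarrow> (\<Sum>n. H n)"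
      using pos True by (intro dom[of _ 1]) (auto intro: ewens_coef_mono eventually_ge_at_top)
    then show ?thesis using fin[of "\<lambda>n i. i \<le> n"] by (simp add: atMost_def)
  next
    case False
    then have le1: "\<theta> \<le> 1" and mom: "summable (\<lambda>n. real n * \<bar>H n\<bar>)" using cases by auto
    \<comment> \<open>This is n / 2 rounded up, the smallest value of n - i under 2 i \<le> n; as
      the coefficients decrease, the quotient at \<open>?k n\<close> bounds all the others.\<close>
    let ?k = "\<lambda>n::nat. n - n div 2"
    have "(\<lambda>n. real (?k n) / real n) \<longlonglongrightarrow> 1/2"
    proof (rule tendsto_sandwich)
      show "(\<lambda>n::nat. 1/2 :: real) \<longlonglongrightarrow> 1/2" by simp
      show "(\<lambda>n::nat. (real n + 1) / 2 / real n) \<longlonglongrightarrow> 1/2" by real_asymp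
      have *: "real n \<le> 2 * real (n - n div 2)" "real (n - n div 2) \<le> (real n + 1) / 2" for n :: nat
      proof -
        have "n \<le> 2 * (n - n div 2)" "2 * (n - n div 2) \<le> n + 1" by presburger+
        then have "real n \<le> real (2 * (n - n div 2))" "real (2 * (n - n div 2)) \<le> real (n + 1)" by (simp_all only: of_nat_le_iff)
        then show "real n \<le> 2 * real (n - n div 2)" "real (n - n div 2) \<le> (real n + 1) / 2" by simp_all
      qed
      show "eventually (\<lambda>n. 1/2 \<le> real (?k n) / real n) sequentially"
        using eventually_gt_at_top[of 0] by eventually_elim (use * in \<open>simp add: field_simps\<close>)
      show "eventually (\<lambda>n. real (?k n) / real n \<le> (real n + 1) / 2 / real n) sequentially"
        by (intro always_eventually allI divide_right_mono *) simp
    qed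
    from powr_ratio_tendsto(2)[OF ewens_coef_asymp[OF \<theta>] _ this]
    have "(\<lambda>n. ?c (?k n) / ?c n) \<longlonglongrightarrow> (1/2) powr (\<theta> - 1)" using \<theta> by (simp add: Gamma_real_pos less_imp_neq[symmetric])
    then have "Bseq (\<lambda>n. ?c (?k n) / ?c n)" by (intro convergent_imp_Bseq) (auto simp: convergent_def)
    then obtain B where B': "\<And>n. norm (?c (?k n) / ?c n) \<le> B" by (auto simp: Bseq_def simp del: real_norm_def)
    have B: "?c (?k n) / ?c n \<le> B" for n using B'[of n] unfolding real_norm_def by linarith
    have b: "?c (n - i) / ?c n \<le> B" if "2 * i \<le> n" for n i
    proof -
      have "?c (n - i) / ?c n \<le> ?c (?k n) / ?c n" using that pos[of n] \<theta> le1 by (intro divide_right_mono ewens_coef_antimono) auto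
      then show ?thesis using B[of n] by linarith
    qed
    have "(\<lambda>n. \<Sum>i. if 2 * i \<le> n then H i * (?c (n - i) / ?c n) else 0) \<longlonglongrightarrow> (\<Sum>n. H n)"
      using b by (intro dom[of _ B]) (auto intro: eventually_ge_at_top)
    then have L1: "(\<lambda>n. (\<Sum>i | 2 * i \<le> n. H i * ?c (n - i)) / ?c n) \<longlonglongrightarrow> (\<Sum>n. H n)" by (subst (asm) fin) auto
    \<comment> \<open>Here \<open>i\<close> exceeds n / 2. The reciprocal of \<open>?c n\<close>
      costs n / \<theta>, and the factor 2 i / n, which is at least 1, trades this \<open>n\<close>
      for the first moment of \<open>H\<close>.\<close>
    have L2: "(\<lambda>n. (\<Sum>i | n < 2 * i \<and> i \<le> n. H i * ?c (n - i)) / ?c n) \<longlonglongrightarrow> 0"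
    proof (rule Lim_null_comparison)
      show "(\<lambda>n. 2 / \<theta> * (\<Sum>i | n < 2 * i \<and> i \<le> n. real i * \<bar>H i\<bar>)) \<longlonglongrightarrow> 0"
        by (rule tendsto_mult_right_zero[OF summable_tail_tendsto[OF mom]]) simp
      show "eventually (\<lambda>n. norm ((\<Sum>i | n < 2 * i \<and> i \<le> n. H i * ?c (n - i)) / ?c n) \<le>
          2 / \<theta> * (\<Sum>i | n < 2 * i \<and> i \<le> n. real i * \<bar>H i\<bar>)) sequentially" using eventually_gt_at_top[of 0]
      proof eventually_elim
        case (elim n)
        have inv: "1 / ?c n \<le> real n / \<theta>"
        proof -
          obtain m where m: "n = Suc m" using elim by (cases n) auto
          have "\<theta> \<le> real n * ?c n" using ewens_coef_ge[OF \<theta>, of m] m by simp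
          then show ?thesis using pos[of n] \<theta> by (simp add: divide_simps mult.commute)
        qed
        have "norm ((\<Sum>i | n < 2 * i \<and> i \<le> n. H i * ?c (n - i)) / ?c n) \<le>
           (\<Sum>i | n < 2 * i \<and> i \<le> n. \<bar>H i * ?c (n - i)\<bar>) / ?c n" using pos[of n] by (auto simp: abs_divide intro!: divide_right_mono)
        also have "\<dots> \<le> (\<Sum>i | n < 2 * i \<and> i \<le> n. (2 * real i / real n) * \<bar>H i\<bar>) / ?c n"
        proof (intro divide_right_mono sum_mono)
          fix i assume i: "i \<in> {i. n < 2 * i \<and> i \<le> n}"
          have "?c (n - i) \<le> ?c 0" using \<theta> le1 by (intro ewens_coef_antimono) auto
          also have "?c 0 = 1" by (simp add: ewens_coef_def)
          also have "1 \<le> 2 * real i / real n" using i elim by (simp add: field_simps)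
          finally have "\<bar>H i\<bar> * ?c (n - i) \<le> \<bar>H i\<bar> * (2 * real i / real n)" by (intro mult_left_mono) auto
          then show "\<bar>H i * ?c (n - i)\<bar> \<le> (2 * real i / real n) * \<bar>H i\<bar>" using pos[of "n - i"] by (simp add: abs_mult mult.commute)
        qed (use pos[of n] in auto)
        also have "\<dots> = (1 / ?c n) * (\<Sum>i | n < 2 * i \<and> i \<le> n. (2 * real i / real n) * \<bar>H i\<bar>)" by simp
        also have "\<dots> \<le> (real n / \<theta>) * (\<Sum>i | n < 2 * i \<and> i \<le> n. (2 * real i / real n) * \<bar>H i\<bar>)"
          using inv by (intro mult_right_mono sum_nonneg) auto
        also have "\<dots> = 2 / \<theta> * (\<Sum>i | n < 2 * i \<and> i \<le> n. real i * \<bar>H i\<bar>)" using elim by (simp add: sum_distrib_left mult_ac)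
        finally show ?case .
      qed
    qed
    have "(\<Sum>i\<le>n. H i * ?c (n - i)) / ?c n = (\<Sum>i | 2 * i \<le> n. H i * ?c (n - i)) / ?c n
       + (\<Sum>i | n < 2 * i \<and> i \<le> n. H i * ?c (n - i)) / ?c n" for n
    proof -
      have "{..n} = {i. 2 * i \<le> n} \<union> {i. n < 2 * i \<and> i \<le> n}" by auto
      moreover have "finite {i. 2 * i \<le> n}" by (rule finite_subset[of _ "{..n}"]) auto
      ultimately have "(\<Sum>i\<le>n. H i * ?c (n - i)) = (\<Sum>i | 2 * i \<le> n. H i * ?c (n - i)) + (\<Sum>i | n < 2 * i \<and> i \<le> n. H i * ?c (n - i))"
        by (simp only:) (rule sum.union_disjoint, auto)
      then show ?thesis by (simp add: add_divide_distrib)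
    qed
    then show ?thesis using tendsto_add[OF L1 L2] by simp
  qed
qed

text \<open>Writing \<open>t\<close> as \<theta> plus a perturbation factors the series into (1 -
  x)^(- \<theta>) and a series with absolutely summable coefficients of positive sum, so the order
  of the singularity at 1 is unchanged.\<close>

lemma hcoef_asymp:
  assumes \<theta>: "0 < \<theta>"
    and cases: "(1 \<le> \<theta> \<and> summable (\<lambda>j. \<bar>t (Suc j) - \<theta>\<bar> / real (Suc j))) \<or>
      (\<theta> \<le> 1 \<and> summable (\<lambda>j. \<bar>t (Suc j) - \<theta>\<bar>))"
  obtains C where "0 < C" "(\<lambda>n. hcoef t n / real n powr (\<theta> - 1)) \<longlonglongrightarrow> C"
proof -
  let ?v = "\<lambda>j. t j - \<theta>"
  have s1: "summable (\<lambda>j. \<bar>?v (Suc j)\<bar> / real (Suc j))" using cases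
  proof (elim disjE conjE)
    assume "summable (\<lambda>j. \<bar>t (Suc j) - \<theta>\<bar>)"
    then show ?thesis by (rule summable_comparison_test'[of _ 0]) (auto simp: field_simps mult_left_le)
  qed
  have H: "summable (\<lambda>n. \<bar>hcoef ?v n\<bar>)" "0 < (\<Sum>n. hcoef ?v n)" using hcoef_suminf_pos[OF s1] by auto
  have "(\<lambda>n. (\<Sum>i\<le>n. hcoef ?v i * ewens_coef \<theta> (n - i)) / ewens_coef \<theta> n) \<longlonglongrightarrow> (\<Sum>n. hcoef ?v n)"
  proof (rule ewens_convolution_tendsto[OF \<theta> H(1)])
    show "1 \<le> \<theta> \<or> (\<theta> \<le> 1 \<and> summable (\<lambda>n. real n * \<bar>hcoef ?v n\<bar>))" using cases
    proof (elim disjE conjE)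
      assume "\<theta> \<le> 1" "summable (\<lambda>j. \<bar>t (Suc j) - \<theta>\<bar>)"
      then have "summable (\<lambda>n. real n * hcoef (\<lambda>j. \<bar>?v j\<bar>) n)" by (intro hcoef_moment_summable) auto
      then have "summable (\<lambda>n. real n * \<bar>hcoef ?v n\<bar>)"
        by (rule summable_comparison_test'[of _ 0]) (auto intro!: mult_left_mono hcoef_abs_le)
      then show ?thesis using \<open>\<theta> \<le> 1\<close> by simp
    qed simp
  qed
  moreover have "(\<Sum>i\<le>n. hcoef ?v i * ewens_coef \<theta> (n - i)) = hcoef t n" for n
  proof -
    have "hcoef (\<lambda>j. ?v j + \<theta>) n = (\<Sum>i\<le>n. hcoef ?v i * ewens_coef \<theta> (n - i))" using hcoef_add[of ?v "\<lambda>_. \<theta>" n] by (simp add: hcoef_const)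
    then show ?thesis by simp
  qed
  ultimately have "(\<lambda>n. hcoef t n / ewens_coef \<theta> n) \<longlonglongrightarrow> (\<Sum>n. hcoef ?v n)" by simp
  from tendsto_mult[OF this ewens_coef_asymp[OF \<theta>]]
  have "(\<lambda>n. hcoef t n / real n powr (\<theta> - 1)) \<longlonglongrightarrow> (\<Sum>n. hcoef ?v n) * inverse (Gamma \<theta>)"
    using ewens_coef_pos[OF \<theta>] by (simp add: less_imp_neq[symmetric])
  then show ?thesis using H(2) \<theta> by (intro that[of "(\<Sum>n. hcoef ?v n) * inverse (Gamma \<theta>)"]) auto
qed

section \<open>Random permutations with asymptotically constant cycle weights\<close>

locale cycle_weights =
  fixes t :: "nat \<Rightarrow> real" and \<theta> c0 C0 C :: real
  assumes c0: "0 < c0" and t_lower: "\<And>j. 1 \<le> j \<Longrightarrow> c0 \<le> t j" and t_upper: "\<And>j. 1 \<le> j \<Longrightarrow> t j \<le> C0"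
    and t_lim: "t \<longlonglongrightarrow> \<theta>" and C_pos: "0 < C"
    and asymp: "(\<lambda>n. hcoef t n / real n powr (\<theta> - 1)) \<longlonglongrightarrow> C"
begin

lemma t_pos: "1 \<le> j \<Longrightarrow> 0 < t j" using c0 t_lower by (meson less_le_trans)

lemma C0_pos: "0 < C0" using c0 t_lower[of 1] t_upper[of 1] by simp

lemma theta_pos: "0 < \<theta>"
proof -
  have "c0 \<le> \<theta>" by (rule tendsto_lowerbound[OF t_lim]) (auto intro!: eventually_sequentiallyI[of 1] t_lower)
  then show ?thesis using c0 by linarith
qed

abbreviation A :: "nat \<Rightarrow> real" where "A \<equiv> hcoef t"

lemma A_pos: "0 < A n" by (rule hcoef_pos) (rule t_pos)

lemma A_ratio:
  assumes "(\<lambda>n. real (k n) / real n) \<longlonglongrightarrow> x" "0 < x"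
  shows "(\<lambda>n. A (k n) / A n) \<longlonglongrightarrow> x powr (\<theta> - 1)" using powr_ratio_tendsto(2)[OF asymp _ assms] C_pos by simp

lemma A_shift: "(\<lambda>n. A (n - j) / A n) \<longlonglongrightarrow> 1"
proof -
  have "(\<lambda>n. real (n - j) / real n) \<longlonglongrightarrow> 1"
  proof (rule Lim_transform_eventually)
    show "(\<lambda>n. (real n - real j) / real n) \<longlonglongrightarrow> 1" by real_asymp
    show "eventually (\<lambda>n. (real n - real j) / real n = real (n - j) / real n) sequentially"
      using eventually_ge_at_top[of j] by eventually_elim (simp add: of_nat_diff)
  qed
  from A_ratio[OF this] show ?thesis by simp
qed

text \<open>The numbers t j A (n - j) / (n A n) are the probabilities of the length of the cycle of
  a given point, and any bounded set of lengths has vanishing probability; so a null sequence has a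
  vanishing average. The lower bound \<open>c0\<close> converts the kernel without \<open>t\<close>
  into this one.\<close>

lemma kernel_null:
  assumes "s \<longlonglongrightarrow> 0"
  shows "(\<lambda>n. (\<Sum>j=1..n. \<bar>s j\<bar> * A (n - j)) / (real n * A n)) \<longlonglongrightarrow> 0"
proof (rule LIMSEQ_I)
  fix e :: real assume e: "0 < e"
  define e' where "e' = e * c0 / 2"
  have "0 < e'" using e c0 by (simp add: e'_def)
  with assms obtain J where J: "\<And>j. J \<le> j \<Longrightarrow> \<bar>s j\<bar> < e'" by (auto simp: LIMSEQ_def dist_real_def)
  have "(\<lambda>n. \<Sum>j<J. \<bar>s j\<bar> * (A (n - j) / A n * (1 / real n))) \<longlonglongrightarrow> (\<Sum>j<J. \<bar>s j\<bar> * (1 * 0))" by (intro tendsto_intros A_shift lim_1_over_n)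
  then have "(\<lambda>n. \<Sum>j<J. \<bar>s j\<bar> * (A (n - j) / A n * (1 / real n))) \<longlonglongrightarrow> 0" by simp
  then have "eventually (\<lambda>n. (\<Sum>j<J. \<bar>s j\<bar> * (A (n - j) / A n * (1 / real n))) < e / 2) sequentially"
    using e by (intro order_tendstoD(2)[where y = 0]) auto
  then have "eventually (\<lambda>n. norm ((\<Sum>j=1..n. \<bar>s j\<bar> * A (n - j)) / (real n * A n) - 0) < e) sequentially" using eventually_gt_at_top[of 0]
  proof eventually_elim
    case (elim n)
    have nA: "0 < real n * A n" using elim A_pos by simp
    have "(\<Sum>j=1..n. \<bar>s j\<bar> * A (n - j)) \<le> (\<Sum>j=1..n. (e' / c0) * (t j * A (n - j)) + (if j < J then \<bar>s j\<bar> * A (n - j) else 0))"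
    proof (rule sum_mono)
      fix j assume j: "j \<in> {1..n}"
      have "e' * A (n - j) \<le> (e' / c0) * (t j * A (n - j))"
        using t_lower[of j] j c0 A_pos[of "n - j"] \<open>0 < e'\<close> by (auto simp: field_simps intro!: mult_left_mono)
      moreover have "\<bar>s j\<bar> * A (n - j) \<le> e' * A (n - j)" if "\<not> j < J" using J[of j] that A_pos[of "n - j"] by (intro mult_right_mono) auto
      moreover have "0 \<le> e' * A (n - j)" using \<open>0 < e'\<close> A_pos[of "n - j"] by simp
      ultimately show "\<bar>s j\<bar> * A (n - j) \<le> (e' / c0) * (t j * A (n - j)) + (if j < J then \<bar>s j\<bar> * A (n - j) else 0)"
        by (smt (verit, best))
    qed
    also have "\<dots> = (e' / c0) * (real n * A n) + (\<Sum>j=1..n. if j < J then \<bar>s j\<bar> * A (n - j) else 0)"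
      by (simp add: sum.distrib hcoef_rec sum_distrib_left)
    also have "(\<Sum>j=1..n. if j < J then \<bar>s j\<bar> * A (n - j) else 0) = (\<Sum>j\<in>{1..n} \<inter> {..<J}. \<bar>s j\<bar> * A (n - j))"
      by (subst sum.inter_restrict) auto
    also have "\<dots> \<le> (\<Sum>j<J. \<bar>s j\<bar> * A (n - j))" using A_pos by (intro sum_mono2) (auto simp: less_imp_le)
    finally have "(\<Sum>j=1..n. \<bar>s j\<bar> * A (n - j)) / (real n * A n)
        \<le> ((e' / c0) * (real n * A n) + (\<Sum>j<J. \<bar>s j\<bar> * A (n - j))) / (real n * A n)" using nA by (intro divide_right_mono) auto
    also have "\<dots> = e / 2 + (\<Sum>j<J. \<bar>s j\<bar> * (A (n - j) / A n * (1 / real n)))"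
      using nA c0 elim A_pos[of n] by (simp add: add_divide_distrib e'_def sum_divide_distrib mult.commute)
    finally have "(\<Sum>j=1..n. \<bar>s j\<bar> * A (n - j)) / (real n * A n) < e" using elim by linarith
    moreover have "0 \<le> (\<Sum>j=1..n. \<bar>s j\<bar> * A (n - j)) / (real n * A n)"
      using nA A_pos by (intro divide_nonneg_pos sum_nonneg mult_nonneg_nonneg) (auto intro: less_imp_le)
    ultimately show ?case by simp
  qed
  then show "\<exists>no. \<forall>n\<ge>no. norm ((\<Sum>j=1..n. \<bar>s j\<bar> * A (n - j)) / (real n * A n) - 0) < e" by (simp add: eventually_sequentially)
qed

text \<open>For constant \<open>t\<close> the sum over j > x n would be \<theta> times the sum of A
  i over i < k n, which is also what the recursion at \<open>k n\<close> gives for k A k, with k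
  about (1 - x) n. Replacing \<open>t\<close> by \<theta> costs errors as in
  \<open>kernel_null\<close> at \<open>n\<close> and at \<open>k n\<close>; the quotient k A k / (n
  A n) yields (1 - x) (1 - x)^(\<theta> - 1).\<close>

lemma kernel_tail:
  assumes x: "0 \<le> x" "x < 1"
  shows "(\<lambda>n. (\<Sum>j | j \<le> n \<and> x * real n < real j. t j * A (n - j)) / (real n * A n)) \<longlonglongrightarrow> (1 - x) powr \<theta>"
proof -
  define k where "k n = n - nat \<lfloor>x * real n\<rfloor>" for n
  have fl: "nat \<lfloor>x * real n\<rfloor> \<le> n" for n
  proof -
    have "x * real n \<le> real n" using x by (simp add: mult_left_le_one_le)
    then show ?thesis by linarith
  qed
  have kb: "(1 - x) * real n \<le> real (k n)" "real (k n) \<le> (1 - x) * real n + 1" for n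
  proof -
    have "real (k n) = real n - of_int \<lfloor>x * real n\<rfloor>" using fl[of n] x by (simp add: k_def of_nat_diff)
    then show "(1 - x) * real n \<le> real (k n)" "real (k n) \<le> (1 - x) * real n + 1" by (simp_all add: algebra_simps) linarith+
  qed
  have kl: "(\<lambda>n. real (k n) / real n) \<longlonglongrightarrow> 1 - x"
  proof (rule tendsto_sandwich)
    show "(\<lambda>n::nat. 1 - x) \<longlonglongrightarrow> 1 - x" by simp
    show "(\<lambda>n::nat. (1 - x) + 1 / real n) \<longlonglongrightarrow> 1 - x" by real_asymp
    show "eventually (\<lambda>n. 1 - x \<le> real (k n) / real n) sequentially"
      using eventually_gt_at_top[of 0] by eventually_elim (use kb in \<open>simp add: field_simps\<close>)
    show "eventually (\<lambda>n. real (k n) / real n \<le> (1 - x) + 1 / real n) sequentially"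
      using eventually_gt_at_top[of 0] by eventually_elim (use kb in \<open>simp add: field_simps\<close>)
  qed
  have kt: "filterlim k at_top sequentially" using powr_ratio_tendsto(1)[OF asymp _ kl] C_pos x by simp
  let ?R = "\<lambda>n. real (k n) * A (k n) / (real n * A n)"
  have R: "?R \<longlonglongrightarrow> (1 - x) powr \<theta>"
  proof -
    have "(\<lambda>n. (real (k n) / real n) * (A (k n) / A n)) \<longlonglongrightarrow> (1 - x) * (1 - x) powr (\<theta> - 1)" using kl x by (intro tendsto_mult A_ratio) auto
    also have "(1 - x) * (1 - x) powr (\<theta> - 1) = (1 - x) powr \<theta>" using x by (simp add: powr_diff)
    finally show ?thesis by simp
  qed
  have s0: "(\<lambda>j. t j - \<theta>) \<longlonglongrightarrow> 0" using t_lim by (simp add: LIM_zero)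
  let ?S = "\<lambda>n. (\<Sum>j=1..n. \<bar>t j - \<theta>\<bar> * A (n - j))"
  have E1: "(\<lambda>n. ?S n / (real n * A n)) \<longlonglongrightarrow> 0" by (rule kernel_null[OF s0])
  have E2: "(\<lambda>n. ?S (k n) / (real (k n) * A (k n)) * ?R n) \<longlonglongrightarrow> 0 * (1 - x) powr \<theta>" by (intro tendsto_mult R filterlim_compose[OF E1 kt])
  have reidx: "(\<Sum>j=1..n. f j * A (n - j)) = (\<Sum>i<n. f (n - i) * A i)" for n f
    by (rule sum.reindex_bij_witness[of _ "\<lambda>i. n - i" "\<lambda>j. n - j"]) auto
  have main: "\<bar>(\<Sum>j | j \<le> n \<and> x * real n < real j. t j * A (n - j)) / (real n * A n) - ?R n\<bar>
     \<le> ?S n / (real n * A n) + ?S (k n) / (real (k n) * A (k n)) * ?R n" if "0 < k n" for n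
  proof -
    have n: "0 < n" using that by (simp add: k_def)
    have kn: "k n \<le> n" by (simp add: k_def)
    have "(\<Sum>j | j \<le> n \<and> x * real n < real j. t j * A (n - j)) = (\<Sum>i<k n. t (n - i) * A i)"
    proof (rule sum.reindex_bij_witness[of _ "\<lambda>i. n - i" "\<lambda>j. n - j"])
      have *: "x * real n < real j \<longleftrightarrow> nat \<lfloor>x * real n\<rfloor> < j" for j :: nat using x by (simp add: floor_less_iff nat_less_iff)
      show "n - a \<in> {..<k n}" if "a \<in> {j. j \<le> n \<and> x * real n < real j}" for a using that fl[of n] by (auto simp: * k_def)
      show "n - b \<in> {j. j \<le> n \<and> x * real n < real j}" if "b \<in> {..<k n}" for b
        using that fl[of n] unfolding mem_Collect_eq * by (auto simp: k_def)
    qed (auto simp: k_def)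
    moreover have "real (k n) * A (k n) = (\<Sum>i<k n. t (k n - i) * A i)" unfolding hcoef_rec reidx ..
    ultimately have "(\<Sum>j | j \<le> n \<and> x * real n < real j. t j * A (n - j)) - real (k n) * A (k n)
      = (\<Sum>i<k n. (t (n - i) - \<theta>) * A i) - (\<Sum>i<k n. (t (k n - i) - \<theta>) * A i)" by (simp add: left_diff_distrib sum_subtractf)
    then have "\<bar>(\<Sum>j | j \<le> n \<and> x * real n < real j. t j * A (n - j)) - real (k n) * A (k n)\<bar>
      \<le> \<bar>\<Sum>i<k n. (t (n - i) - \<theta>) * A i\<bar> + \<bar>\<Sum>i<k n. (t (k n - i) - \<theta>) * A i\<bar>" by linarith
    also have "\<dots> \<le> (\<Sum>i<k n. \<bar>t (n - i) - \<theta>\<bar> * A i) + (\<Sum>i<k n. \<bar>t (k n - i) - \<theta>\<bar> * A i)"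
      using A_pos by (intro add_mono order_trans[OF sum_abs] sum_mono) (auto simp: abs_mult less_imp_le)
    also have "(\<Sum>i<k n. \<bar>t (n - i) - \<theta>\<bar> * A i) \<le> (\<Sum>i<n. \<bar>t (n - i) - \<theta>\<bar> * A i)"
      using kn A_pos by (intro sum_mono2) (auto simp: less_imp_le)
    also have "\<dots> = ?S n" by (rule reidx[where f = "\<lambda>j. \<bar>t j - \<theta>\<bar>", symmetric])
    also have "(\<Sum>i<k n. \<bar>t (k n - i) - \<theta>\<bar> * A i) = ?S (k n)" by (rule reidx[where f = "\<lambda>j. \<bar>t j - \<theta>\<bar>", symmetric])
    finally have "\<bar>(\<Sum>j | j \<le> n \<and> x * real n < real j. t j * A (n - j)) - real (k n) * A (k n)\<bar> / (real n * A n)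
      \<le> (?S n + ?S (k n)) / (real n * A n)" using A_pos[of n] by (intro divide_right_mono) auto
    moreover have "?S (k n) / (real (k n) * A (k n)) * ?R n = ?S (k n) / (real n * A n)" using that A_pos[of "k n"] by simp
    moreover have "(a - b) / c = a / c - b / c" for a b c :: real by (rule diff_divide_distrib)
    ultimately show ?thesis using A_pos[of n] n by (simp add: abs_divide add_divide_distrib flip: diff_divide_distrib)
  qed
  have "(\<lambda>n. (\<Sum>j | j \<le> n \<and> x * real n < real j. t j * A (n - j)) / (real n * A n) - ?R n) \<longlonglongrightarrow> 0"
  proof (rule Lim_null_comparison)
    show "(\<lambda>n. ?S n / (real n * A n) + ?S (k n) / (real (k n) * A (k n)) * ?R n) \<longlonglongrightarrow> 0" using tendsto_add[OF E1 E2] by simp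
    show "eventually (\<lambda>n. norm ((\<Sum>j | j \<le> n \<and> x * real n < real j. t j * A (n - j)) / (real n * A n) - ?R n)
        \<le> ?S n / (real n * A n) + ?S (k n) / (real (k n) * A (k n)) * ?R n) sequentially"
      using eventually_compose_filterlim[OF eventually_gt_at_top[of 0] kt] by eventually_elim (use main in simp)
  qed
  from tendsto_add[OF this R] show ?thesis by simp
qed

end

section \<open>Stick breaking\<close>

lemma stick_law_distribution:
  assumes "0 < \<theta>"
  shows "real_distribution (stick_law \<theta>)"
    and "cdf (stick_law \<theta>) x = 1 - (1 - max 0 (min 1 x)) powr \<theta>"
proof -
  let ?F = "\<lambda>s::real. 1 - (1 - max 0 (min 1 s)) powr \<theta>"
  have cont: "continuous_on UNIV ?F" using assms(1) by (intro continuous_intros continuous_on_powr') auto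
  have mono: "?F x \<le> ?F y" if "x \<le> y" for x y using that assms(1) by (auto intro!: powr_mono2)
  have right: "continuous (at_right a) ?F" for a
    using cont by (meson UNIV_I continuous_on_eq_continuous_within continuous_within_subset subset_UNIV)
  have bot: "(?F \<longlongrightarrow> 0) at_bot" by (rule tendsto_eventually, rule eventually_at_bot_linorderI[of 0]) auto
  have top: "(?F \<longlongrightarrow> 1) at_top" by (rule tendsto_eventually, rule eventually_at_top_linorderI[of 1]) auto
  show "real_distribution (stick_law \<theta>)" unfolding stick_law_def by (intro real_distribution_interval_measure mono right bot top)
  show "cdf (stick_law \<theta>) x = ?F x" unfolding stick_law_def by (subst cdf_interval_measure[OF mono right bot]) auto
qed

lemma stick_law_AE:
  assumes "0 < \<theta>"
  shows "AE x in stick_law \<theta>. 0 \<le> x \<and> x \<le> 1"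
proof -
  interpret real_distribution "stick_law \<theta>" by (rule stick_law_distribution[OF assms])
  have "prob {..1} = 1" using stick_law_distribution(2)[OF assms, of 1] by (simp add: cdf_def)
  then have 1: "AE x in stick_law \<theta>. x \<in> {..1}" by (intro prob_eq_1[THEN iffD1]) auto
  have "prob {..x} = 0" if "x < 0" for x using stick_law_distribution(2)[OF assms, of x] that by (simp add: cdf_def)
  then have "AE y in stick_law \<theta>. y \<notin> {.. - 1 / real (Suc n)}" for n by (intro AE_not_in) (auto simp: null_sets_def emeasure_eq_measure)
  then have "AE y in stick_law \<theta>. \<forall>n. y \<notin> {.. - 1 / real (Suc n)}" by (simp only: AE_all_countable) simp
  then have 2: "AE y in stick_law \<theta>. 0 \<le> y"
  proof eventually_elim
    case (elim y)
    show ?case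
    proof (rule ccontr)
      assume "\<not> 0 \<le> y"
      then obtain n where "1 / real (Suc n) < - y" using nat_approx_posE[of "-y"] by auto
      with elim show False by (auto dest: spec[of _ n])
    qed
  qed
  from 1 2 show ?thesis by eventually_elim auto
qed

text \<open>The first piece exceeds 1/2 with positive probability, so the remaining length shrinks
  by a factor of mean less than 1. This makes it geometrically accurate to stop the breaking after
  \<open>k\<close> steps.\<close>

lemma stick_law_contraction:
  assumes "0 < \<theta>"
  shows "(LINT x|stick_law \<theta>. 1 - x) < 1" and "0 \<le> (LINT x|stick_law \<theta>. 1 - x)"
    and "integrable (stick_law \<theta>) (\<lambda>x. 1 - x)"
proof -
  interpret real_distribution "stick_law \<theta>" by (rule stick_law_distribution[OF assms])
  have ae: "AE x in stick_law \<theta>. 0 \<le> x \<and> x \<le> 1" by (rule stick_law_AE[OF assms])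
  show int: "integrable (stick_law \<theta>) (\<lambda>x. 1 - x)"
  proof (rule integrable_const_bound[where B = 1])
    show "AE x in stick_law \<theta>. norm (1 - x) \<le> 1" using ae by eventually_elim auto
  qed simp
  show "0 \<le> (LINT x|stick_law \<theta>. 1 - x)" by (rule integral_nonneg_AE) (use ae in \<open>auto elim!: eventually_mono\<close>)
  have "(LINT x|stick_law \<theta>. 1 - x) \<le> (LINT x|stick_law \<theta>. 1 - 1/2 * (indicator {1/2<..} x :: real))"
  proof (rule integral_mono_AE[OF int])
    show "integrable (stick_law \<theta>) (\<lambda>x. 1 - 1/2 * (indicator {1/2<..} x :: real))"
      by (rule integrable_const_bound[where B = 2]) (auto simp: indicator_def)
    show "AE x in stick_law \<theta>. 1 - x \<le> 1 - 1/2 * (indicator {1/2<..} x :: real)" using ae by eventually_elim (auto simp: indicator_def)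
  qed
  also have "\<dots> = 1 - 1/2 * measure (stick_law \<theta>) {1/2<..}"
  proof -
    have "integrable (stick_law \<theta>) (indicator {1/2<..} :: real \<Rightarrow> real)"
      by (rule integrable_const_bound[where B = 1]) (auto simp: indicator_def)
    then show ?thesis using prob_space by (subst Bochner_Integration.integral_diff) auto
  qed
  also have "\<dots> < 1" using stick_law_tail(2)[OF assms, of "1/2"] by simp
  finally show "(LINT x|stick_law \<theta>. 1 - x) < 1" .
qed

text \<open>The mean of the product of \<open>g\<close> over the first \<open>k\<close> pieces of a
  stick of length \<open>c\<close>, times \<open>b\<close> of the remaining length, computed by
  conditioning on the first break. The boundary function \<open>b\<close> will be 1 or a cut-off
  near 0.\<close>

fun stick_iter :: "real \<Rightarrow> (real \<Rightarrow> real) \<Rightarrow> (real \<Rightarrow> real) \<Rightarrow> nat \<Rightarrow> real \<Rightarrow> real" where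
  "stick_iter \<theta> g b 0 c = b c"
| "stick_iter \<theta> g b (Suc k) c = (LINT x|stick_law \<theta>. g (c * x) * stick_iter \<theta> g b k (c * (1 - x)))"

lemma stick_iter_measurable:
  assumes "0 < \<theta>" and [measurable]: "g \<in> borel_measurable borel" "b \<in> borel_measurable borel"
  shows "stick_iter \<theta> g b k \<in> borel_measurable borel"
proof (induction k)
  case (Suc k)
  interpret real_distribution "stick_law \<theta>" by (rule stick_law_distribution[OF assms(1)])
  note [measurable] = Suc.IH
  have "(\<lambda>c. LINT x|stick_law \<theta>. g (c * x) * stick_iter \<theta> g b k (c * (1 - x))) \<in> borel_measurable borel"
    by (rule borel_measurable_lebesgue_integral) measurable
  also have "(\<lambda>c. LINT x|stick_law \<theta>. g (c * x) * stick_iter \<theta> g b k (c * (1 - x))) = stick_iter \<theta> g b (Suc k)" by auto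
  finally show ?case .
next
  case 0
  have "stick_iter \<theta> g b 0 = b" by auto
  then show ?case by simp
qed

lemma stick_iter_bounds:
  assumes "0 < \<theta>" and [measurable]: "g \<in> borel_measurable borel" "b \<in> borel_measurable borel"
    and "\<And>x. 0 \<le> g x" "\<And>x. g x \<le> 1" "\<And>x. 0 \<le> b x" "\<And>x. b x \<le> 1"
  shows "0 \<le> stick_iter \<theta> g b k c \<and> stick_iter \<theta> g b k c \<le> 1"
proof (induction k arbitrary: c)
  case (Suc k)
  interpret real_distribution "stick_law \<theta>" by (rule stick_law_distribution[OF assms(1)])
  have [measurable]: "stick_iter \<theta> g b k \<in> borel_measurable borel" using assms by (intro stick_iter_measurable) auto
  have "(LINT x|stick_law \<theta>. g (c * x) * stick_iter \<theta> g b k (c * (1 - x))) \<le> (LINT x|stick_law \<theta>. 1)"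
    using Suc assms by (intro integral_mono integrable_const_bound[where B = 1])
       (auto intro!: mult_le_one simp: abs_mult)
  moreover have "prob UNIV = 1" using prob_space by simp
  ultimately show ?case using Suc assms by (auto intro!: integral_nonneg_AE)
qed (use assms in auto)

text \<open>Only the boundary functions differ, by at most \<open>B\<close> times the remaining
  length, and the mean of that length contracts at every break.\<close>

lemma stick_iter_diff:
  assumes \<theta>: "0 < \<theta>" and [measurable]: "g \<in> borel_measurable borel" "b \<in> borel_measurable borel"
    and g: "\<And>x. 0 \<le> g x" "\<And>x. g x \<le> 1" and b: "\<And>x. 0 \<le> b x" "\<And>x. b x \<le> 1"
    and B: "\<And>x. 0 \<le> x \<Longrightarrow> 1 - b x \<le> B * x" and "0 \<le> c" "0 \<le> B"
  shows "stick_iter \<theta> g (\<lambda>_. 1) k c - stick_iter \<theta> g b k c \<le> B * (LINT x|stick_law \<theta>. 1 - x) ^ k * c" using \<open>0 \<le> c\<close>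
proof (induction k arbitrary: c)
  case 0
  then show ?case using B[of c] by simp
next
  case (Suc k)
  interpret real_distribution "stick_law \<theta>" by (rule stick_law_distribution[OF \<theta>])
  let ?f = "stick_iter \<theta> g (\<lambda>_. 1) k" and ?h = "stick_iter \<theta> g b k"
  have bd: "0 \<le> ?f x \<and> ?f x \<le> 1" "0 \<le> ?h x \<and> ?h x \<le> 1" for x using stick_iter_bounds[OF \<theta>] g b by auto
  have [measurable]: "?f \<in> borel_measurable borel" "?h \<in> borel_measurable borel" using \<theta> by (auto intro!: stick_iter_measurable)
  have i: "integrable (stick_law \<theta>) (\<lambda>x. g (c * x) * ?f (c * (1 - x)))"
     "integrable (stick_law \<theta>) (\<lambda>x. g (c * x) * ?h (c * (1 - x)))"
    using bd g by (auto intro!: integrable_const_bound[where B = 1] AE_I2 mult_le_one simp: abs_mult)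
  have "stick_iter \<theta> g (\<lambda>_. 1) (Suc k) c - stick_iter \<theta> g b (Suc k) c
      = (LINT x|stick_law \<theta>. g (c * x) * ?f (c * (1 - x)) - g (c * x) * ?h (c * (1 - x)))" using i by simp
  also have "\<dots> \<le> (LINT x|stick_law \<theta>. (B * (LINT x|stick_law \<theta>. 1 - x) ^ k * c) * (1 - x))"
  proof (intro integral_mono_AE Bochner_Integration.integrable_diff i)
    show "integrable (stick_law \<theta>) (\<lambda>x. (B * (LINT x|stick_law \<theta>. 1 - x) ^ k * c) * (1 - x))"
      by (rule integrable_mult_right) (rule stick_law_contraction(3)[OF \<theta>])
    show "AE x in stick_law \<theta>. g (c * x) * ?f (c * (1 - x)) - g (c * x) * ?h (c * (1 - x))
       \<le> (B * (LINT x|stick_law \<theta>. 1 - x) ^ k * c) * (1 - x)" using stick_law_AE[OF \<theta>]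
    proof eventually_elim
      case (elim x)
      have cx: "0 \<le> c * (1 - x)" using elim Suc.prems by simp
      have R: "0 \<le> B * (LINT x|stick_law \<theta>. 1 - x) ^ k * (c * (1 - x))" using stick_law_contraction(2)[OF \<theta>] \<open>0 \<le> B\<close> cx by simp
      have "g (c * x) * (?f (c * (1 - x)) - ?h (c * (1 - x))) \<le> g (c * x) * (B * (LINT x|stick_law \<theta>. 1 - x) ^ k * (c * (1 - x)))"
        by (rule mult_left_mono[OF Suc.IH[OF cx] g(1)])
      also have "\<dots> \<le> 1 * (B * (LINT x|stick_law \<theta>. 1 - x) ^ k * (c * (1 - x)))" by (rule mult_right_mono[OF g(2) R])
      finally show ?case by (simp add: algebra_simps)
    qed
  qed
  also have "\<dots> = B * (LINT x|stick_law \<theta>. 1 - x) ^ Suc k * c" by simp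
  finally show ?case .
qed

text \<open>Stick breaking is self-similar: the pieces after the first are those of a fresh stick of
  length c (1 - x). \<open>S.PiM_iter\<close> splits the first coordinate off the infinite product
  accordingly.\<close>

lemma stick_iter_eq_integral:
  assumes \<theta>: "0 < \<theta>" and g[measurable]: "g \<in> borel_measurable borel" and "\<And>x. 0 \<le> g x" "\<And>x. g x \<le> 1"
  shows "stick_iter \<theta> g (\<lambda>_. 1) k c = (LINT X|PiM UNIV (\<lambda>_. stick_law \<theta>). (\<Prod>i<k. g (c * stick_breaking X i)))"
proof (induction k arbitrary: c)
  interpret real_distribution "stick_law \<theta>" by (rule stick_law_distribution[OF \<theta>])
  case 0
  have "prob_space (PiM UNIV (\<lambda>_::nat. stick_law \<theta>))" by (rule prob_space_PiM) unfold_locales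
  from prob_space.prob_space[OF this] show ?case by simp
next
  case (Suc k)
  interpret real_distribution "stick_law \<theta>" by (rule stick_law_distribution[OF \<theta>])
  interpret S: sequence_space "stick_law \<theta>" by unfold_locales
  interpret P: pair_prob_space "stick_law \<theta>" "PiM UNIV (\<lambda>_::nat. stick_law \<theta>)" by unfold_locales
  have sb[measurable]: "(\<lambda>X. stick_breaking X i) \<in> borel_measurable (PiM UNIV (\<lambda>_. stick_law \<theta>))" for i
    unfolding stick_breaking_def by measurable
  have bd: "norm (\<Prod>i<k. g (c i)) \<le> 1" for c :: "nat \<Rightarrow> real" and k using assms by (auto simp: abs_prod intro!: prod_le_1)
  have sbS: "stick_breaking (case_nat x X) (Suc i) = (1 - x) * stick_breaking X i" for x X i
    unfolding stick_breaking_def by (subst prod.lessThan_Suc_shift) simp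
  have sb0: "stick_breaking (case_nat x X) 0 = x" for x X by (simp add: stick_breaking_def)
  have "(LINT X|PiM UNIV (\<lambda>_. stick_law \<theta>). (\<Prod>i<Suc k. g (c * stick_breaking X i)))
     = (LINT X|distr (stick_law \<theta> \<Otimes>\<^sub>M PiM UNIV (\<lambda>_. stick_law \<theta>)) (PiM UNIV (\<lambda>_. stick_law \<theta>)) (\<lambda>(s, \<omega>). case_nat s \<omega>).
          (\<Prod>i<Suc k. g (c * stick_breaking X i)))" by (simp only: S.PiM_iter)
  also have "\<dots> = (LINT p|(stick_law \<theta> \<Otimes>\<^sub>M PiM UNIV (\<lambda>_. stick_law \<theta>)).
         (\<Prod>i<Suc k. g (c * stick_breaking (case p of (s, \<omega>) \<Rightarrow> case_nat s \<omega>) i)))" by (subst integral_distr) measurable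
  also have "\<dots> = (LINT p|(stick_law \<theta> \<Otimes>\<^sub>M PiM UNIV (\<lambda>_. stick_law \<theta>)).
         (case p of (x, X) \<Rightarrow> g (c * x) * (\<Prod>i<k. g (c * (1 - x) * stick_breaking X i))))" by (intro Bochner_Integration.integral_cong refl)
       (auto simp: prod.lessThan_Suc_shift sbS sb0 mult.assoc split: prod.split simp del: prod.lessThan_Suc)
  also have "\<dots> = (LINT x|stick_law \<theta>. LINT X|PiM UNIV (\<lambda>_. stick_law \<theta>). g (c * x) * (\<Prod>i<k. g (c * (1 - x) * stick_breaking X i)))"
  proof (subst P.integral_fst'[symmetric])
    show "integrable (stick_law \<theta> \<Otimes>\<^sub>M PiM UNIV (\<lambda>_. stick_law \<theta>))
       (\<lambda>p. case p of (x, X) \<Rightarrow> g (c * x) * (\<Prod>i<k. g (c * (1 - x) * stick_breaking X i)))"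
      using bd assms by (intro P.P.integrable_const_bound[where B = 1])
         (auto simp: abs_mult intro!: mult_le_one AE_I2 split: prod.split)
  qed simp
  also have "\<dots> = stick_iter \<theta> g (\<lambda>_. 1) (Suc k) c" by (simp add: Suc)
  finally show ?case by simp
qed

section \<open>Rooted cycle lengths and their stick-breaking limit\<close>

context cycle_weights
begin

lemma A_rec_quot: "0 < n \<Longrightarrow> (\<Sum>j=1..n. t j * A (n - j)) / (real n * A n) = 1" unfolding hcoef_rec[symmetric] using A_pos[of n] by simp

text \<open>The law of the length of the cycle of a fixed element of \<open>n\<close> elements.\<close>

definition first_cycle :: "nat \<Rightarrow> nat pmf" where
  "first_cycle n = (if n = 0 then return_pmf 0
     else embed_pmf (\<lambda>j. if 1 \<le> j \<and> j \<le> n then t j * A (n - j) / (real n * A n) else 0))"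

lemma pmf_first_cycle:
  assumes "0 < n"
  shows "pmf (first_cycle n) j = (if 1 \<le> j \<and> j \<le> n then t j * A (n - j) / (real n * A n) else 0)"
proof -
  let ?f = "\<lambda>j. if 1 \<le> j \<and> j \<le> n then t j * A (n - j) / (real n * A n) else 0"
  have nn: "0 \<le> ?f j" for j using t_pos[of j] A_pos by (auto intro!: divide_nonneg_nonneg mult_nonneg_nonneg simp: less_imp_le)
  have "(\<integral>\<^sup>+ j. ennreal (?f j) \<partial>count_space UNIV) = (\<integral>\<^sup>+ j. ennreal (?f j) \<partial>count_space {1..n})" by (rule nn_integral_count_space_eq) auto
  also have "\<dots> = (\<Sum>j=1..n. ennreal (?f j))" by (subst nn_integral_count_space_finite) auto
  also have "\<dots> = ennreal (\<Sum>j=1..n. ?f j)" using nn by (intro sum_ennreal)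
  also have "(\<Sum>j=1..n. ?f j) = (\<Sum>j=1..n. t j * A (n - j)) / (real n * A n)" unfolding sum_divide_distrib by (rule sum.cong) auto
  also have "\<dots> = 1" using assms by (rule A_rec_quot)
  finally have "pmf (embed_pmf ?f) j = ?f j" using nn by (intro pmf_embed_pmf) auto
  then show ?thesis using assms by (simp add: first_cycle_def)
qed

lemma set_pmf_first_cycle: "set_pmf (first_cycle n) \<subseteq> {..n}"
proof (cases "n = 0")
  case False
  then show ?thesis by (auto simp: set_pmf_iff pmf_first_cycle split: if_splits)
qed (simp add: first_cycle_def)

lemma first_cycle_integral:
  assumes "0 < n"
  shows "measure_pmf.expectation (first_cycle n) f = (\<Sum>j=1..n. t j * A (n - j) / (real n * A n) * f j)"
proof -
  have "measure_pmf.expectation (first_cycle n) f = (\<Sum>j\<in>{1..n}. f j * pmf (first_cycle n) j)"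
    by (rule integral_measure_pmf_real) (auto simp: set_pmf_iff pmf_first_cycle[OF assms] split: if_splits)
  also have "\<dots> = (\<Sum>j=1..n. t j * A (n - j) / (real n * A n) * f j)" by (intro sum.cong) (auto simp: pmf_first_cycle[OF assms])
  finally show ?thesis .
qed

definition first_cycle_law :: "nat \<Rightarrow> real measure" where
  "first_cycle_law n = distr (measure_pmf (first_cycle n)) borel (\<lambda>j. real j / real n)"

lemma first_cycle_law_distribution: "real_distribution (first_cycle_law n)"
proof -
  interpret prob_space "first_cycle_law n" unfolding first_cycle_law_def by (rule measure_pmf.prob_space_distr) simp
  show ?thesis by unfold_locales (simp_all add: first_cycle_law_def)
qed

lemma cdf_first_cycle_law:
  assumes "0 < n"
  shows "cdf (first_cycle_law n) x = 1 - (\<Sum>j | 1 \<le> j \<and> j \<le> n \<and> x * real n < real j. t j * A (n - j)) / (real n * A n)"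
proof -
  interpret real_distribution "first_cycle_law n" by (rule first_cycle_law_distribution)
  have "cdf (first_cycle_law n) x = 1 - prob {x<..}"
  proof -
    have "{x<..} = space (first_cycle_law n) - {..x}" by auto
    then show ?thesis using prob_compl[of "{..x}"] by (simp add: cdf_def)
  qed
  also have "prob {x<..} = measure_pmf.prob (first_cycle n) {j. x < real j / real n}"
    unfolding first_cycle_law_def by (subst measure_distr) (auto simp: vimage_def)
  also have "\<dots> = measure_pmf.expectation (first_cycle n) (indicator {j. x < real j / real n})" by simp
  also have "\<dots> = (\<Sum>j=1..n. t j * A (n - j) / (real n * A n) * indicator {j. x < real j / real n} j)"
    by (rule first_cycle_integral[OF assms])
  also have "\<dots> = (\<Sum>j\<in>{j\<in>{1..n}. x * real n < real j}. t j * A (n - j) / (real n * A n))"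
    using assms by (subst sum.inter_filter) (auto simp: indicator_def field_simps intro!: sum.cong)
  also have "\<dots> = (\<Sum>j | 1 \<le> j \<and> j \<le> n \<and> x * real n < real j. t j * A (n - j)) / (real n * A n)"
    unfolding sum_divide_distrib by (rule sum.cong) auto
  finally show ?thesis .
qed

text \<open>Distribution functions converge pointwise: \<open>kernel_tail\<close> covers 0 \<le> x <
  1, and outside this range the values are already those of the limit for every positive
  size.\<close>

lemma first_cycle_weak_conv:
  assumes n: "filterlim n at_top sequentially"
  shows "weak_conv_m (\<lambda>N. first_cycle_law (n N)) (stick_law \<theta>)" unfolding weak_conv_m_def weak_conv_def
proof (intro allI impI)
  fix x
  have ev: "eventually (\<lambda>N. 0 < n N) sequentially" by (rule eventually_compose_filterlim[OF eventually_gt_at_top n])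
  have eq: "cdf (stick_law \<theta>) x = 1 - (1 - max 0 (min 1 x)) powr \<theta>" by (rule stick_law_distribution(2)[OF theta_pos])
  let ?T = "\<lambda>n x. (\<Sum>j | 1 \<le> j \<and> j \<le> n \<and> x * real n < real j. t j * A (n - j)) / (real n * A n)"
  have "(\<lambda>N. 1 - ?T (n N) x) \<longlonglongrightarrow> cdf (stick_law \<theta>) x"
  proof -
    consider "x < 0" | "0 \<le> x" "x < 1" | "1 \<le> x" by linarith
    then show ?thesis
    proof cases
      case 1
      have "?T m x = 1" if "0 < m" for m
      proof -
        have "x * real m < real j" for j using 1 that by (metis mult_neg_pos of_nat_0_le_iff of_nat_0_less_iff order_less_le_trans)
        then have "{j. 1 \<le> j \<and> j \<le> m \<and> x * real m < real j} = {1..m}" by auto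
        then show ?thesis using that by (simp only: A_rec_quot)
      qed
      then have "eventually (\<lambda>N. 1 - ?T (n N) x = 0) sequentially" using ev by (auto elim: eventually_mono)
      then show ?thesis using 1 eq by (auto intro: tendsto_eventually)
    next
      case 2
      have "?T m x = (\<Sum>j | j \<le> m \<and> x * real m < real j. t j * A (m - j)) / (real m * A m)" for m
      proof -
        have "0 < j" if "x * real m < real j" for j
          using that 2 by (metis mult_nonneg_nonneg not_less of_nat_0_le_iff of_nat_0_less_iff order_trans)
        then have "{j. 1 \<le> j \<and> j \<le> m \<and> x * real m < real j} = {j. j \<le> m \<and> x * real m < real j}" by (auto simp: Suc_le_eq)
        then show ?thesis by simp
      qed
      then have "(\<lambda>N. 1 - ?T (n N) x) = (\<lambda>N. 1 - (\<Sum>j | j \<le> n N \<and> x * real (n N) < real j. t j * A (n N - j)) / (real (n N) * A (n N)))"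
        by (simp only:)
      moreover have "\<dots> \<longlonglongrightarrow> 1 - (1 - x) powr \<theta>" by (intro tendsto_diff tendsto_const filterlim_compose[OF kernel_tail[OF 2] n])
      moreover have "cdf (stick_law \<theta>) x = 1 - (1 - x) powr \<theta>" using 2 eq by simp
      ultimately show ?thesis by (simp only:)
    next
      case 3
      have "?T m x = 0" for m
      proof -
        have "\<not> x * real m < real j" if "j \<le> m" for j
        proof -
          have "real j \<le> 1 * real m" using that by simp
          also have "\<dots> \<le> x * real m" using 3 by (intro mult_right_mono) auto
          finally show ?thesis by simp
        qed
        then have *: "{j. 1 \<le> j \<and> j \<le> m \<and> x * real m < real j} = {}" by blast
        show ?thesis unfolding * by simp
      qed
      then have "(\<lambda>N. 1 - ?T (n N) x) = (\<lambda>N. 1 - 0)" by (simp only:)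
      moreover have "cdf (stick_law \<theta>) x = 1 - 0" using 3 eq theta_pos by simp
      ultimately show ?thesis by (simp only: tendsto_const)
    qed
  qed
  then show "(\<lambda>N. cdf (first_cycle_law (n N)) x) \<longlonglongrightarrow> cdf (stick_law \<theta>) x"
    by (rule Lim_transform_eventually) (use ev in eventually_elim, simp add: cdf_first_cycle_law)
qed

text \<open>The discrete counterpart of \<open>stick_iter\<close>: cycles of successive roots are
  removed from \<open>n\<close> points, their lengths being measured in units of \<open>s\<close>,
  and \<open>b\<close> sees what is left after \<open>k\<close> cycles.\<close>

primrec cycle_iter :: "(real \<Rightarrow> real) \<Rightarrow> (real \<Rightarrow> real) \<Rightarrow> real \<Rightarrow> nat \<Rightarrow> nat \<Rightarrow> real" where
  "cycle_iter g b s 0 n = b (real n / s)"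
| "cycle_iter g b s (Suc k) n = measure_pmf.expectation (first_cycle n) (\<lambda>j. g (real j / s) * cycle_iter g b s k (n - j))"

lemma pmf_expectation_bounds:
  fixes f :: "nat \<Rightarrow> real"
  assumes "\<And>x. 0 \<le> f x" "\<And>x. f x \<le> 1"
  shows "0 \<le> measure_pmf.expectation p f" "measure_pmf.expectation p f \<le> 1"
proof -
  show "0 \<le> measure_pmf.expectation p f" using assms by (intro integral_nonneg_AE) auto
  have "measure_pmf.expectation p f \<le> measure_pmf.expectation p (\<lambda>_. 1)"
    using assms by (intro integral_mono measure_pmf.integrable_const_bound[where B = 1]) auto
  then show "measure_pmf.expectation p f \<le> 1" by simp
qed

lemma cycle_iter_bounds:
  assumes "\<And>x. 0 \<le> g x" "\<And>x. g x \<le> 1" "\<And>x. 0 \<le> b x" "\<And>x. b x \<le> 1"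
  shows "0 \<le> cycle_iter g b s k n \<and> cycle_iter g b s k n \<le> 1"
proof (induction k arbitrary: n)
  case (Suc k)
  then show ?case using assms by (auto intro!: pmf_expectation_bounds mult_nonneg_nonneg mult_le_one)
qed (use assms in auto)

text \<open>When all points together are short on the scale \<open>s\<close>, every value of
  \<open>g\<close> and \<open>b\<close> that occurs is 1. This settles remaining lengths that tend
  to 0, for which the number of points need not grow and the limit law of the first cycle says
  nothing.\<close>

lemma cycle_iter_small:
  assumes "0 < s" "real n / s \<le> \<delta>" and "\<And>x. x \<le> \<delta> \<Longrightarrow> g x = 1" "\<And>x. x \<le> \<delta> \<Longrightarrow> b x = 1"
  shows "cycle_iter g b s k n = 1" using assms(2)
proof (induction k arbitrary: n)
  case (Suc k)
  have "cycle_iter g b s (Suc k) n = measure_pmf.expectation (first_cycle n) (\<lambda>j. 1)" unfolding cycle_iter.simps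
  proof (rule integral_cong_AE)
    show "AE j in measure_pmf (first_cycle n). g (real j / s) * cycle_iter g b s k (n - j) = 1"
    proof (rule AE_pmfI)
      fix j assume "j \<in> set_pmf (first_cycle n)"
      then have "j \<le> n" using set_pmf_first_cycle by auto
      then have "real j / s \<le> real n / s" "real (n - j) / s \<le> real n / s" using assms(1) by (auto intro!: divide_right_mono)
      then show "g (real j / s) * cycle_iter g b s k (n - j) = 1" using Suc assms(3) by auto
    qed
  qed auto
  then show ?case by simp
qed (use assms(4) in auto)

lemma stick_iter_0:
  assumes "g 0 = 1" "b 0 = 1"
  shows "stick_iter \<theta> g b k 0 = 1"
proof (induction k)
  case (Suc k)
  interpret real_distribution "stick_law \<theta>" by (rule stick_law_distribution[OF theta_pos])
  have "prob UNIV = 1" using prob_space by simp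
  then show ?case using Suc assms by simp
qed (use assms in auto)

text \<open>Rounding y n to the nearest integer recovers \<open>j\<close> exactly from y = j / n and
  is invisible on the scale \<open>s\<close> in the limit. It extends functions of the cycle length
  to functions of a real variable.\<close>

lemma rounded_ratio_tendsto:
  fixes s y :: "nat \<Rightarrow> real" and n :: "nat \<Rightarrow> nat"
  assumes s: "\<And>N. 0 < s N" "filterlim s at_top sequentially"
    and n: "(\<lambda>N. real (n N) / s N) \<longlonglongrightarrow> c" and y: "y \<longlonglongrightarrow> x" and "0 \<le> x" "x \<le> 1" "0 \<le> c"
  shows "(\<lambda>N. real (nat \<lfloor>y N * real (n N) + 1/2\<rfloor>) / s N) \<longlonglongrightarrow> c * x"
    and "(\<lambda>N. real (n N - nat \<lfloor>y N * real (n N) + 1/2\<rfloor>) / s N) \<longlonglongrightarrow> c * (1 - x)"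
proof -
  let ?m = "\<lambda>N. nat \<lfloor>y N * real (n N) + 1/2\<rfloor>"
  have is0: "(\<lambda>N. 1 / 2 / s N) \<longlonglongrightarrow> 0" by (rule tendsto_divide_0[OF tendsto_const filterlim_at_top_imp_at_infinity[OF s(2)]])
  have b: "max 0 (y N * (real (n N) / s N) - 1 / 2 / s N) \<le> real (?m N) / s N"
      "real (?m N) / s N \<le> max 0 (y N * (real (n N) / s N) + 1 / 2 / s N)" for N
  proof -
    have m: "max 0 (y N * real (n N) - 1/2) \<le> real (?m N)" "real (?m N) \<le> max 0 (y N * real (n N) + 1/2)" by linarith+
    have e: "max 0 (y N * (real (n N) / s N) - 1 / 2 / s N) = max 0 (y N * real (n N) - 1/2) / s N"
      "max 0 (y N * (real (n N) / s N) + 1 / 2 / s N) = max 0 (y N * real (n N) + 1/2) / s N"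
      using s(1)[of N] by (auto simp: max_def field_simps)
    show "max 0 (y N * (real (n N) / s N) - 1 / 2 / s N) \<le> real (?m N) / s N"
      "real (?m N) / s N \<le> max 0 (y N * (real (n N) / s N) + 1 / 2 / s N)"
      unfolding e using s(1)[of N] by (intro divide_right_mono m; simp)+
  qed
  show 1: "(\<lambda>N. real (?m N) / s N) \<longlonglongrightarrow> c * x"
  proof (rule tendsto_sandwich[OF always_eventually always_eventually])
    have "(\<lambda>N. max 0 (y N * (real (n N) / s N) - 1 / 2 / s N)) \<longlonglongrightarrow> max 0 (x * c - 0)" by (intro tendsto_intros y n is0)
    then show "(\<lambda>N. max 0 (y N * (real (n N) / s N) - 1 / 2 / s N)) \<longlonglongrightarrow> c * x" using assms by (simp add: max_def mult.commute)
    have "(\<lambda>N. max 0 (y N * (real (n N) / s N) + 1 / 2 / s N)) \<longlonglongrightarrow> max 0 (x * c + 0)" by (intro tendsto_intros y n is0)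
    then show "(\<lambda>N. max 0 (y N * (real (n N) / s N) + 1 / 2 / s N)) \<longlonglongrightarrow> c * x" using assms by (simp add: max_def mult.commute)
  qed (use b in auto)
  have "(\<lambda>N. max 0 (real (n N) / s N - real (?m N) / s N)) \<longlonglongrightarrow> max 0 (c - c * x)" by (intro tendsto_intros n 1)
  moreover have "max 0 (real (n N) / s N - real (?m N) / s N) = real (n N - ?m N) / s N" for N
  proof -
    have "real (n N - ?m N) = max 0 (real (n N) - real (?m N))" by linarith
    then show ?thesis using s(1)[of N] by (auto simp: max_def field_simps)
  qed
  moreover have "0 \<le> c * (1 - x)" using assms by simp
  ultimately show "(\<lambda>N. real (n N - ?m N) / s N) \<longlonglongrightarrow> c * (1 - x)" by (simp add: max_def algebra_simps)
qed

text \<open>The induction runs over all sequences \<open>n\<close> and limits \<open>c\<close> at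
  once, because the sizes left after the first cycle form another sequence of this kind with limit c
  (1 - x).\<close>

lemma cycle_iter_tendsto:
  fixes s :: "nat \<Rightarrow> real"
  assumes s: "\<And>N. 0 < s N" "filterlim s at_top sequentially" and "0 < \<delta>"
    and g: "continuous_on UNIV g" "\<And>x. 0 \<le> g x" "\<And>x. g x \<le> 1" "\<And>x. x \<le> \<delta> \<Longrightarrow> g x = 1"
    and b: "continuous_on UNIV b" "\<And>x. 0 \<le> b x" "\<And>x. b x \<le> 1" "\<And>x. x \<le> \<delta> \<Longrightarrow> b x = 1"
  shows "(\<lambda>N. real (n N) / s N) \<longlonglongrightarrow> c \<Longrightarrow> 0 \<le> c \<Longrightarrow>
    (\<lambda>N. cycle_iter g b (s N) k (n N)) \<longlonglongrightarrow> stick_iter \<theta> g b k c"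
proof (induction k arbitrary: n c)
  case 0
  have "isCont b c" using b(1) by (simp add: continuous_on_eq_continuous_at)
  then show ?case using 0 by (auto intro: isCont_tendsto_compose)
next
  case (Suc k)
  have [measurable]: "g \<in> borel_measurable borel" "b \<in> borel_measurable borel"
    using g(1) b(1) by (auto intro: borel_measurable_continuous_onI)
  have [measurable]: "stick_iter \<theta> g b k \<in> borel_measurable borel" by (rule stick_iter_measurable[OF theta_pos]) auto
  show ?case
  proof (cases "c = 0")
    case True
    then have "eventually (\<lambda>N. real (n N) / s N < \<delta>) sequentially" using Suc.prems(1) \<open>0 < \<delta>\<close> by (auto intro: order_tendstoD)
    then have "eventually (\<lambda>N. cycle_iter g b (s N) (Suc k) (n N) = 1) sequentially"
      by eventually_elim (rule cycle_iter_small[OF s(1) _ g(4) b(4)], auto)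
    moreover have "stick_iter \<theta> g b (Suc k) 0 = 1" using g(4) b(4) \<open>0 < \<delta>\<close> by (intro stick_iter_0) auto
    ultimately show ?thesis using True by (metis tendsto_eventually)
  next
    case False
    then have "0 < c" using Suc.prems(2) by simp
    have "filterlim (\<lambda>N. real (n N) / s N * s N) at_top sequentially"
      by (rule filterlim_tendsto_pos_mult_at_top[OF Suc.prems(1) \<open>0 < c\<close> s(2)])
    then have "filterlim (\<lambda>N. real (n N)) at_top sequentially" using s(1) by (simp add: less_imp_neq[symmetric])
    then have nt: "filterlim n at_top sequentially" by (simp add: filterlim_sequentially_iff_filterlim_real)
    \<comment> \<open>On a common probability space the relative lengths of the first cycles
      converge pointwise, so the induction hypothesis applies along the sequence of remaining sizes
      of each sample point; dominated convergence leads back to expectations.\<close>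
    from Skorohod[OF first_cycle_law_distribution stick_law_distribution(1)[OF theta_pos] first_cycle_weak_conv[OF nt]]
    obtain \<Omega> :: "real measure" and Y Y0 where
      "prob_space \<Omega>" and om': "\<forall>N. Y N \<in> measurable \<Omega> borel" "\<forall>N. distr \<Omega> borel (Y N) = first_cycle_law (n N)"
        "Y0 \<in> measurable \<Omega> lborel" and om5: "distr \<Omega> borel Y0 = stick_law \<theta>"
        and "\<forall>x\<in>space \<Omega>. (\<lambda>N. Y N x) \<longlonglongrightarrow> Y0 x" by blast
    then have om: "Y N \<in> measurable \<Omega> borel" "distr \<Omega> borel (Y N) = first_cycle_law (n N)"
        "Y0 \<in> measurable \<Omega> borel" "x \<in> space \<Omega> \<Longrightarrow> (\<lambda>N. Y N x) \<longlonglongrightarrow> Y0 x" for N x by (auto simp: measurable_lborel2)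
    interpret prob_space \<Omega> by fact
    note [measurable] = om(1) om(3)
    let ?m = "\<lambda>N y. nat \<lfloor>y * real (n N) + 1/2\<rfloor>"
    let ?G = "\<lambda>N y. g (real (?m N y) / s N) * cycle_iter g b (s N) k (n N - ?m N y)"
    have [measurable]: "?G N \<in> borel_measurable borel" for N
    proof -
      have "(\<lambda>z::int. g (real (nat z) / s N) * cycle_iter g b (s N) k (n N - nat z)) \<in> borel_measurable (count_space UNIV)" by simp
      from measurable_compose[OF _ this, of "\<lambda>y. \<lfloor>y * real (n N) + 1/2\<rfloor>" borel]
      show ?thesis by simp
    qed
    have bd: "0 \<le> cycle_iter g b (s N) k i" "cycle_iter g b (s N) k i \<le> 1" for N i using cycle_iter_bounds[of g b] g b by auto
    have eq: "cycle_iter g b (s N) (Suc k) (n N) = (LINT \<omega>|\<Omega>. ?G N (Y N \<omega>))" if "0 < n N" for N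
    proof -
      have "(LINT \<omega>|\<Omega>. ?G N (Y N \<omega>)) = (LINT y|distr \<Omega> borel (Y N). ?G N y)" by (rule integral_distr[symmetric]) auto
      also have "\<dots> = (LINT y|first_cycle_law (n N). ?G N y)" by (simp only: om(2))
      also have "\<dots> = measure_pmf.expectation (first_cycle (n N)) (\<lambda>j. ?G N (real j / real (n N)))"
        unfolding first_cycle_law_def by (rule integral_distr) auto
      also have "(\<lambda>j. ?G N (real j / real (n N))) = (\<lambda>j. g (real j / s N) * cycle_iter g b (s N) k (n N - j))"
      proof
        fix j
        have "?m N (real j / real (n N)) = j" using that by simp
        then show "?G N (real j / real (n N)) = g (real j / s N) * cycle_iter g b (s N) k (n N - j)" by simp
      qed
      finally show ?thesis by simp
    qed
    have "(\<lambda>N. LINT \<omega>|\<Omega>. ?G N (Y N \<omega>)) \<longlonglongrightarrow> (LINT \<omega>|\<Omega>. g (c * Y0 \<omega>) * stick_iter \<theta> g b k (c * (1 - Y0 \<omega>)))"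
    proof (rule integral_dominated_convergence[where w = "\<lambda>_. 1"])
      have "AE x in distr \<Omega> borel Y0. 0 \<le> x \<and> x \<le> 1" unfolding om5 by (rule stick_law_AE[OF theta_pos])
      then have "AE \<omega> in \<Omega>. 0 \<le> Y0 \<omega> \<and> Y0 \<omega> \<le> 1" by (subst (asm) AE_distr_iff) auto
      then show "AE \<omega> in \<Omega>. (\<lambda>N. ?G N (Y N \<omega>)) \<longlonglongrightarrow> g (c * Y0 \<omega>) * stick_iter \<theta> g b k (c * (1 - Y0 \<omega>))" using AE_space
      proof eventually_elim
        case (elim \<omega>)
        note r = rounded_ratio_tendsto[OF s Suc.prems(1) om(4)[OF elim(2)] elim(1)[THEN conjunct1] elim(1)[THEN conjunct2] Suc.prems(2)]
        show ?case
        proof (intro tendsto_mult)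
          have "isCont g (c * Y0 \<omega>)" using g(1) by (simp add: continuous_on_eq_continuous_at)
          then show "(\<lambda>N. g (real (?m N (Y N \<omega>)) / s N)) \<longlonglongrightarrow> g (c * Y0 \<omega>)" by (rule isCont_tendsto_compose[OF _ r(1)])
          show "(\<lambda>N. cycle_iter g b (s N) k (n N - ?m N (Y N \<omega>))) \<longlonglongrightarrow> stick_iter \<theta> g b k (c * (1 - Y0 \<omega>))"
            using elim Suc.prems(2) by (intro Suc.IH r(2)) auto
        qed
      qed
      show "AE \<omega> in \<Omega>. norm (?G N (Y N \<omega>)) \<le> 1" for N using bd g by (auto simp: abs_mult intro!: mult_le_one)
    qed auto
    also have "(LINT \<omega>|\<Omega>. g (c * Y0 \<omega>) * stick_iter \<theta> g b k (c * (1 - Y0 \<omega>)))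
       = (LINT x|distr \<Omega> borel Y0. g (c * x) * stick_iter \<theta> g b k (c * (1 - x)))" by (rule integral_distr[symmetric]) auto
    also have "\<dots> = stick_iter \<theta> g b (Suc k) c" by (simp add: om5)
    finally show ?thesis
    proof (rule Lim_transform_eventually)
      show "eventually (\<lambda>N. (LINT \<omega>|\<Omega>. ?G N (Y N \<omega>)) = cycle_iter g b (s N) (Suc k) (n N)) sequentially"
        using eventually_compose_filterlim[OF eventually_gt_at_top[of 0] nt] by eventually_elim (use eq in simp)
    qed
  qed
qed

text \<open>The mean of the product of g (length / s) over all cycles, since \<open>g\<close>
  multiplies the weight of each cycle and \<open>A n\<close> normalizes.\<close>

definition cycle_functional :: "(real \<Rightarrow> real) \<Rightarrow> real \<Rightarrow> nat \<Rightarrow> real" where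
  "cycle_functional g s n = hcoef (\<lambda>j. t j * g (real j / s)) n / A n"

text \<open>The recursion for the coefficients, read as conditioning on the cycle of one
  point.\<close>

lemma cycle_functional_rec:
  assumes "0 < n"
  shows "cycle_functional g s n =
    measure_pmf.expectation (first_cycle n) (\<lambda>j. g (real j / s) * cycle_functional g s (n - j))"
proof -
  have nz: "A j \<noteq> 0" for j using A_pos[of j] by simp
  have "real n * hcoef (\<lambda>j. t j * g (real j / s)) n / (real n * A n) =
     (\<Sum>j=1..n. t j * A (n - j) / (real n * A n) * (g (real j / s) * cycle_functional g s (n - j)))"
    unfolding hcoef_rec[of n "\<lambda>j. t j * g (real j / s)"] sum_divide_distrib cycle_functional_def using nz by (intro sum.cong) auto
  then show ?thesis using assms by (simp add: first_cycle_integral cycle_functional_def)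
qed

lemma cycle_functional_bounds:
  assumes "\<And>x. 0 \<le> g x" "\<And>x. g x \<le> 1"
  shows "0 \<le> cycle_functional g s n \<and> cycle_functional g s n \<le> 1"
proof -
  have "hcoef (\<lambda>j. t j * g (real j / s)) n \<le> A n" using assms t_pos by (intro hcoef_mono) (auto intro!: mult_left_le simp: less_imp_le)
  moreover have "0 \<le> hcoef (\<lambda>j. t j * g (real j / s)) n" using assms t_pos by (intro hcoef_nonneg) (auto simp: less_imp_le)
  ultimately show ?thesis using A_pos[of n] by (simp add: cycle_functional_def)
qed

lemma cycle_functional_small:
  assumes "0 < s" "real n / s \<le> \<delta>" "\<And>x. x \<le> \<delta> \<Longrightarrow> g x = 1"
  shows "cycle_functional g s n = 1"
proof -
  have "hcoef (\<lambda>j. t j * g (real j / s)) n = A n"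
  proof (rule hcoef_cong)
    fix j assume "j \<le> n"
    then have "real j / s \<le> real n / s" using assms(1) by (intro divide_right_mono) auto
    then show "t j * g (real j / s) = t j" using assms by simp
  qed
  then show ?thesis using A_pos[of n] by (simp add: cycle_functional_def)
qed

text \<open>The points left after \<open>k\<close> cycles contribute a factor in [0, 1], which
  equals 1 if they number at most \<delta> s. So the factor lies between the cut-off
  \<open>b\<close>, which vanishes from \<delta> on, and 1; conditioning on one more cycle preserves
  both bounds.\<close>

lemma cycle_functional_between:
  assumes s: "0 < s" and g: "\<And>x. 0 \<le> g x" "\<And>x. g x \<le> 1" "\<And>x. x \<le> \<delta> \<Longrightarrow> g x = 1" and "0 < \<delta>"
    and b: "\<And>x. 0 \<le> b x" "\<And>x. b x \<le> 1" "\<And>x. \<delta> \<le> x \<Longrightarrow> b x = 0" "b 0 = 1"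
  shows "cycle_iter g b s k n \<le> cycle_functional g s n \<and> cycle_functional g s n \<le> cycle_iter g (\<lambda>_. 1) s k n"
proof (induction k arbitrary: n)
  case 0
  show ?case
  proof (cases "real n / s \<le> \<delta>")
    case True
    then have "cycle_functional g s n = 1" by (rule cycle_functional_small[OF s _ g(3)])
    then show ?thesis using b by simp
  next
    case False
    then have "b (real n / s) = 0" using b(3) by simp
    then show ?thesis using cycle_functional_bounds[OF g(1,2)] by simp
  qed
next
  case (Suc k)
  show ?case
  proof (cases "n = 0")
    case True
    have [simp]: "g 0 = 1" using g(3) \<open>0 < \<delta>\<close> by simp
    have "cycle_functional g s 0 = 1" by (simp add: cycle_functional_def)
    moreover have "cycle_iter g b' s l 0 = 1" if "b' 0 = 1" for b' l using that by (induction l) (auto simp: first_cycle_def)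
    ultimately show ?thesis using True b(4) by (simp del: cycle_iter.simps)
  next
    case False
    then have n: "0 < n" by simp
    note bd = cycle_functional_bounds[of g s] cycle_iter_bounds[of g b s k] cycle_iter_bounds[of g "\<lambda>_. 1" s k]
    show ?thesis unfolding cycle_functional_rec[OF n] cycle_iter.simps using bd g b Suc
      by (intro conjI integral_mono measure_pmf.integrable_const_bound[where B = 1])
         (auto intro!: mult_left_mono mult_le_one AE_pmfI simp: abs_mult)
  qed
qed

text \<open>The number \<open>k\<close> of cycles is fixed before \<open>N\<close> grows: both
  bounds of \<open>cycle_functional_between\<close> then converge, and their limits differ by at
  most a constant times \<kappa>^k.\<close>

lemma cycle_functional_tendsto:
  fixes s :: "nat \<Rightarrow> real"
  assumes s: "\<And>N. 0 < s N" "filterlim s at_top sequentially" and \<delta>: "0 < \<delta>"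
    and g: "continuous_on UNIV g" "\<And>x. 0 \<le> g x" "\<And>x. g x \<le> 1" "\<And>x. x \<le> \<delta> \<Longrightarrow> g x = 1"
    and n: "(\<lambda>N. real (n N) / s N) \<longlonglongrightarrow> 1"
    and L: "(\<lambda>k. stick_iter \<theta> g (\<lambda>_. 1) k 1) \<longlonglongrightarrow> L"
  shows "(\<lambda>N. cycle_functional g (s N) (n N)) \<longlonglongrightarrow> L"
proof (rule LIMSEQ_I)
  fix e :: real assume e: "0 < e"
  \<comment> \<open>A cut-off equal to 1 up to \<delta> / 2 and to 0 from \<delta> on; its slope is
    the constant 2 / \<delta> in the bound on 1 - b x.\<close>
  define b where "b = (\<lambda>x::real. max 0 (min 1 (2 - 2 * x / \<delta>)))"
  have "continuous_on UNIV b" using \<delta> unfolding b_def by (intro continuous_intros) auto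
  moreover have "0 \<le> b x" "b x \<le> 1" "x \<le> \<delta> / 2 \<Longrightarrow> b x = 1" "\<delta> \<le> x \<Longrightarrow> b x = 0" "0 \<le> x \<Longrightarrow> 1 - b x \<le> 2 / \<delta> * x" for x
    using \<delta> unfolding b_def by (auto simp: field_simps max_def min_def)
  ultimately have b: "continuous_on UNIV b" "\<And>x. 0 \<le> b x" "\<And>x. b x \<le> 1" "\<And>x. x \<le> \<delta> / 2 \<Longrightarrow> b x = 1"
     "\<And>x. \<delta> \<le> x \<Longrightarrow> b x = 0" "\<And>x. 0 \<le> x \<Longrightarrow> 1 - b x \<le> 2 / \<delta> * x" by auto
  define \<kappa> where "\<kappa> = (LINT x|stick_law \<theta>. 1 - x)"
  have \<kappa>: "0 \<le> \<kappa>" "\<kappa> < 1" using stick_law_contraction[OF theta_pos] by (auto simp: \<kappa>_def)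
  have "(\<lambda>k. 2 / \<delta> * \<kappa> ^ k) \<longlonglongrightarrow> 2 / \<delta> * 0" using \<kappa> by (intro tendsto_intros LIMSEQ_power_zero) auto
  then have "eventually (\<lambda>k. 2 / \<delta> * \<kappa> ^ k < e / 3) sequentially" using e by (intro order_tendstoD(2)[where y = 0]) auto
  moreover have "eventually (\<lambda>k. \<bar>stick_iter \<theta> g (\<lambda>_. 1) k 1 - L\<bar> < e / 3) sequentially"
    using tendstoD[OF L, of "e / 3"] e by (simp add: dist_real_def)
  ultimately have "eventually (\<lambda>k. 2 / \<delta> * \<kappa> ^ k < e / 3 \<and> \<bar>stick_iter \<theta> g (\<lambda>_. 1) k 1 - L\<bar> < e / 3) sequentially" by eventually_elim simp
  then obtain k where k: "2 / \<delta> * \<kappa> ^ k < e / 3" "\<bar>stick_iter \<theta> g (\<lambda>_. 1) k 1 - L\<bar> < e / 3" by (auto simp: eventually_sequentially)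
  have gm: "g \<in> borel_measurable borel" "b \<in> borel_measurable borel" using g(1) b(1) by (auto intro: borel_measurable_continuous_onI)
  have d: "stick_iter \<theta> g (\<lambda>_. 1) k 1 - stick_iter \<theta> g b k 1 < e / 3"
    using stick_iter_diff[OF theta_pos gm g(2,3) b(2,3,6), of 1 k] \<delta> k(1) by (simp add: \<kappa>_def)
  have u: "(\<lambda>N. cycle_iter g (\<lambda>_. 1) (s N) k (n N)) \<longlonglongrightarrow> stick_iter \<theta> g (\<lambda>_. 1) k 1" by (rule cycle_iter_tendsto[OF s \<delta> g _ _ _ _ n]) auto
  have l: "(\<lambda>N. cycle_iter g b (s N) k (n N)) \<longlonglongrightarrow> stick_iter \<theta> g b k 1"
    using \<delta> by (intro cycle_iter_tendsto[OF s _ g(1-3) _ b(1-4) n, of "\<delta> / 2"]) (auto intro: g(4))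
  have "eventually (\<lambda>N. \<bar>cycle_iter g (\<lambda>_. 1) (s N) k (n N) - stick_iter \<theta> g (\<lambda>_. 1) k 1\<bar> < e / 3) sequentially"
    using tendstoD[OF u, of "e / 3"] e by (simp add: dist_real_def)
  moreover have "eventually (\<lambda>N. \<bar>cycle_iter g b (s N) k (n N) - stick_iter \<theta> g b k 1\<bar> < e / 3) sequentially"
    using tendstoD[OF l, of "e / 3"] e by (simp add: dist_real_def)
  ultimately have "eventually (\<lambda>N. norm (cycle_functional g (s N) (n N) - L) < e) sequentially"
  proof eventually_elim
    case (elim N)
    have "b 0 = 1" using b(4) \<delta> by simp
    with cycle_functional_between[of "s N" g \<delta> b k "n N"] s(1)[of N] g(2-4) \<delta> b(2,3,5)
    have "cycle_iter g b (s N) k (n N) \<le> cycle_functional g (s N) (n N) \<and>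
       cycle_functional g (s N) (n N) \<le> cycle_iter g (\<lambda>_. 1) (s N) k (n N)" by blast
    then show ?case using elim k d by (simp only: real_norm_def) linarith
  qed
  then show "\<exists>no. \<forall>N\<ge>no. norm (cycle_functional g (s N) (n N) - L) < e" by (simp add: eventually_sequentially)
qed

end

section \<open>Poisson-Dirichlet limits\<close>

text \<open>The Kingman simplex with total mass at most \<open>b\<close>. The inequality, rather
  than equality, makes it compact in the product topology, since mass may escape into small
  entries.\<close>

definition mass_simplex :: "real \<Rightarrow> (nat \<Rightarrow> real) set" where
  "mass_simplex b = {y. (\<forall>i. 0 \<le> y i) \<and> decseq y \<and> (\<forall>n. (\<Sum>i<n. y i) \<le> b)}"

text \<open>The entries up to index \<open>i\<close> are at least \<open>y i\<close> by monotonicity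
  and share the mass \<open>b\<close>, so all but boundedly many entries are below \<delta>.\<close>

lemma mass_simplex_entry:
  assumes "y \<in> mass_simplex b" "b < real n * \<delta>" "n \<le> i"
  shows "y i < \<delta>"
proof -
  have "real n * y i \<le> (\<Sum>j<n. y j)" using assms(1,3) sum_mono[of "{..<n}" "\<lambda>_. y i" y] by (auto simp: mass_simplex_def decseq_def)
  also have "\<dots> < real n * \<delta>" using assms(1,2) by (auto simp: mass_simplex_def intro: le_less_trans)
  finally show ?thesis by (simp add: mult_less_cancel_left)
qed

lemma compact_mass_simplex: "compact (mass_simplex b)"
proof -
  have "compactin (product_topology (\<lambda>_. euclidean) UNIV) (PiE UNIV (\<lambda>_::nat. {0..b}))" by (subst compactin_PiE) auto
  then have c: "compact (PiE UNIV (\<lambda>_::nat. {0..b}))" by (simp add: euclidean_product_topology)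
  have eq: "mass_simplex b = (\<Inter>i. {y. 0 \<le> y i}) \<inter> (\<Inter>i. {y. y (Suc i) \<le> y i}) \<inter> (\<Inter>n. {y. (\<Sum>i<n. y i) \<le> b})"
    by (auto simp: mass_simplex_def decseq_Suc_iff)
  have "closed (mass_simplex b)"
    unfolding eq by (intro closed_Int closed_INT ballI closed_Collect_le continuous_intros continuous_on_product_coordinates)
  moreover have "mass_simplex b \<subseteq> PiE UNIV (\<lambda>_::nat. {0..b})"
  proof
    fix y assume y: "y \<in> mass_simplex b"
    have "y i \<le> b" for i
    proof -
      have "y i \<le> (\<Sum>j<Suc i. y j)" using y by (intro member_le_sum) (auto simp: mass_simplex_def)
      also have "\<dots> \<le> b" using y unfolding mass_simplex_def by blast
      finally show ?thesis .
    qed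
    then show "y \<in> PiE UNIV (\<lambda>_. {0..b})" using y by (auto simp: mass_simplex_def)
  qed
  ultimately show ?thesis using c by (metis compact_Int_closed inf.absorb_iff2)
qed

definition test_fun :: "real \<Rightarrow> (real \<Rightarrow> real) \<Rightarrow> bool" where
  "test_fun \<delta> g \<longleftrightarrow> 0 < \<delta> \<and> continuous_on UNIV g \<and> (\<forall>x. 0 \<le> g x \<and> g x \<le> 1) \<and> (\<forall>x\<le>\<delta>. g x = 1)"

lemma test_fun_prod:
  assumes "test_fun \<delta> g" "y \<in> mass_simplex b" "b < real n * \<delta>" "n \<le> m"
  shows "(\<Prod>i<m. g (y i)) = (\<Prod>i<n. g (y i))"
proof (rule prod.mono_neutral_right)
  show "\<forall>i\<in>{..<m} - {..<n}. g (y i) = 1" using mass_simplex_entry[OF assms(2,3)] assms(1) by (auto simp: test_fun_def less_imp_le)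
qed (use assms(4) in auto)

text \<open>The linear span of the order-free products. The rule \<open>cong\<close> permits changes
  off the simplex: products with different numbers of factors agree on the simplex, where all
  further entries lie below the threshold, but not on all sequences.\<close>

inductive_set test_span :: "real \<Rightarrow> ((nat \<Rightarrow> real) \<Rightarrow> real) set" for b where
  prod: "test_fun \<delta> g \<Longrightarrow> b < real n * \<delta> \<Longrightarrow> (\<lambda>y. \<Prod>i<n. g (y i)) \<in> test_span b"
| scale: "f \<in> test_span b \<Longrightarrow> (\<lambda>y. c * f y) \<in> test_span b"
| add: "f \<in> test_span b \<Longrightarrow> h \<in> test_span b \<Longrightarrow> (\<lambda>y. f y + h y) \<in> test_span b"
| cong: "f \<in> test_span b \<Longrightarrow> continuous_on UNIV h \<Longrightarrow> (\<And>y. y \<in> mass_simplex b \<Longrightarrow> h y = f y) \<Longrightarrow> h \<in> test_span b"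

lemma test_span_continuous: "f \<in> test_span b \<Longrightarrow> continuous_on UNIV f"
proof (induction rule: test_span.induct)
  case (prod \<delta> g n)
  then have "continuous_on UNIV (\<lambda>y::nat \<Rightarrow> real. g (y i))" for i
    by (intro continuous_on_compose2[of UNIV g UNIV "\<lambda>y. y i"] continuous_on_product_coordinates) (auto simp: test_fun_def)
  then show ?case by (intro continuous_intros)
qed (auto intro: continuous_intros)

text \<open>After both products are extended to a common number of factors, their product belongs to
  the test function g g' with the smaller threshold.\<close>

lemma test_span_mult_prod:
  assumes g: "test_fun \<delta> g" "b < real n * \<delta>" and h: "h \<in> test_span b"
  shows "(\<lambda>y. (\<Prod>i<n. g (y i)) * h y) \<in> test_span b" using h
proof (induction rule: test_span.induct)
  case (prod \<delta>' g' n')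
  let ?m = "max n n'" and ?d = "min \<delta> \<delta>'" and ?g = "\<lambda>x. g x * g' x"
  have tf: "test_fun ?d ?g" using g(1) prod(1) by (auto simp: test_fun_def intro!: continuous_intros mult_le_one)
  obtain k :: nat where k: "b < real k * ?d" using tf reals_Archimedean3[of ?d, THEN spec, of b] by (auto simp: test_fun_def)
  let ?k = "max k ?m"
  have "real k * ?d \<le> real ?k * ?d" using tf by (intro mult_right_mono) (auto simp: test_fun_def)
  then have kb: "b < real ?k * ?d" using k by linarith
  show ?case
  proof (rule test_span.cong[OF test_span.prod[OF tf kb]])
    show "continuous_on UNIV (\<lambda>y. (\<Prod>i<n. g (y i)) * (\<Prod>i<n'. g' (y i)))"
      by (rule continuous_on_mult[OF test_span_continuous[OF test_span.prod[OF g]] test_span_continuous[OF test_span.prod[OF prod]]])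
    fix y assume y: "y \<in> mass_simplex b"
    have "(\<Prod>i<n. g (y i)) = (\<Prod>i<?k. g (y i))" by (rule test_fun_prod[OF g(1) y g(2), symmetric]) simp
    moreover have "(\<Prod>i<n'. g' (y i)) = (\<Prod>i<?k. g' (y i))" by (rule test_fun_prod[OF prod(1) y prod(2), symmetric]) simp
    ultimately show "(\<Prod>i<n. g (y i)) * (\<Prod>i<n'. g' (y i)) = (\<Prod>i<?k. ?g (y i))" by (simp add: prod.distrib)
  qed
next
  case (scale f c)
  then show ?case using test_span.scale[OF scale.IH, of c] by (simp only: mult.left_commute)
next
  case (add f h)
  then show ?case using test_span.add[OF add.IH] by (simp only: distrib_left)
next
  case (cong f h)
  show ?case
    by (rule test_span.cong[OF cong.IH continuous_on_mult[OF test_span_continuous[OF test_span.prod[OF g]] cong(2)]]) (simp add: cong(3))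
qed

lemma test_span_mult:
  assumes "f \<in> test_span b" and h: "h \<in> test_span b"
  shows "(\<lambda>y. f y * h y) \<in> test_span b" using assms(1)
proof (induction rule: test_span.induct)
  case (prod \<delta> g n)
  then show ?case by (rule test_span_mult_prod[OF _ _ h])
next
  case (scale f c)
  then show ?case using test_span.scale[OF scale.IH, of c] by (simp only: mult.assoc)
next
  case (add f f')
  then show ?case using test_span.add[OF add.IH] by (simp only: distrib_right)
next
  case (cong f f')
  show ?case by (rule test_span.cong[OF cong.IH continuous_on_mult[OF cong(2) test_span_continuous[OF h]]]) (simp add: cong(3))
qed

text \<open>At the first index where the sequences differ, the threshold \<delta> lies between the
  two entries. From there on \<open>z\<close> yields only factors 1, whereas \<open>y\<close> yields
  the factor 1/2.\<close>

lemma test_fun_separates: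
  fixes y z :: "nat \<Rightarrow> real"
  assumes "y \<in> mass_simplex b" "z \<in> mass_simplex b" "\<And>j. j < i \<Longrightarrow> y j = z j" "z i < y i" "0 < b"
  shows "\<exists>f\<in>test_span b. f y \<noteq> f z"
proof -
  define \<delta> where "\<delta> = (z i + y i) / 2"
  \<comment> \<open>Values in [1/2, 1] keep the common factors before index \<open>i\<close>
    positive, so that they can be cancelled; the slope is chosen to give g (y i) = 1/2.\<close>
  define g where "g x = max (1/2) (min 1 (1 - (x - \<delta>) / (2 * (y i - \<delta>))))" for x
  have z0: "0 \<le> z i" using assms(2) by (auto simp: mass_simplex_def)
  have d: "0 < \<delta>" "\<delta> < y i" "z i < \<delta>" using assms(4) z0 by (auto simp: \<delta>_def field_simps)
  have tf: "test_fun \<delta> g" unfolding test_fun_def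
  proof (intro conjI allI impI)
    show "continuous_on UNIV g" unfolding g_def using d by (intro continuous_intros) auto
    fix x assume "x \<le> \<delta>"
    then have "(x - \<delta>) / (2 * (y i - \<delta>)) \<le> 0" using d by (intro divide_nonpos_pos) auto
    then show "g x = 1" by (simp add: g_def)
  qed (use d in \<open>auto simp: g_def\<close>)
  have gpos: "0 < g x" for x by (simp add: g_def)
  have gy: "g (y i) = 1/2" using d by (simp add: g_def)
  obtain n0 :: nat where "b < real n0 * \<delta>" using reals_Archimedean3[OF d(1)] by auto
  define n where "n = max n0 (Suc i)"
  have "real n0 * \<delta> \<le> real n * \<delta>" using d by (intro mult_right_mono) (auto simp: n_def)
  then have n: "b < real n * \<delta>" using \<open>b < real n0 * \<delta>\<close> by linarith
  let ?P = "\<Prod>j<i. g (y j)"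
  have split: "(\<Prod>j<n. g (x j)) = (\<Prod>j<i. g (x j)) * (\<Prod>j\<in>{i..<n}. g (x j))" for x
    by (subst prod.union_disjoint[symmetric]) (auto simp: n_def intro!: prod.cong)
  have "(\<Prod>j\<in>{i..<n}. g (z j)) = 1"
  proof (rule prod.neutral, rule ballI)
    fix j assume "j \<in> {i..<n}"
    then have "z j \<le> z i" using assms(2) by (auto simp: mass_simplex_def decseq_def)
    then show "g (z j) = 1" using tf d by (auto simp: test_fun_def)
  qed
  then have 1: "(\<Prod>j<n. g (z j)) = ?P" using assms(3) by (subst split) simp
  have "(\<Prod>j\<in>{i..<n}. g (y j)) = g (y i) * (\<Prod>j\<in>{i..<n} - {i}. g (y j))" by (rule prod.remove) (auto simp: n_def)
  also have "\<dots> \<le> g (y i) * 1" using tf by (intro mult_left_mono prod_le_1) (auto simp: test_fun_def)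
  finally have "?P * (\<Prod>j\<in>{i..<n}. g (y j)) \<le> ?P * (1/2)"
    using gpos gy by (intro mult_left_mono) (auto intro!: prod_nonneg simp: less_imp_le)
  moreover have "0 < ?P" using gpos by (intro prod_pos) auto
  ultimately have "(\<Prod>j<n. g (y j)) < (\<Prod>j<n. g (z j))" unfolding 1 by (subst split) linarith
  then show ?thesis by (intro bexI[OF _ test_span.prod[OF tf n]]) simp
qed

lemma test_span_dense:
  assumes "continuous_on UNIV F" "0 < e" "0 < b"
  shows "\<exists>r\<in>test_span b. \<forall>y\<in>mass_simplex b. \<bar>F y - r y\<bar> < e"
proof -
  have 1: "(\<lambda>_. 1) \<in> test_span b"
  proof -
    have tf: "test_fun 1 (\<lambda>_. 1)" by (simp add: test_fun_def)
    obtain n :: nat where "b < real n" using reals_Archimedean2 by blast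
    then show ?thesis using test_span.prod[OF tf, of b n] by simp
  qed
  interpret function_ring_on "test_span b" "mass_simplex b"
  proof
    show "compact (mass_simplex b)" by (rule compact_mass_simplex)
    show "continuous_on (mass_simplex b) f" if "f \<in> test_span b" for f
      by (rule continuous_on_subset[OF test_span_continuous[OF that] subset_UNIV])
    show "(\<lambda>x. f x + g x) \<in> test_span b" if "f \<in> test_span b" "g \<in> test_span b" for f g using that by (rule test_span.add)
    show "(\<lambda>x. f x * g x) \<in> test_span b" if "f \<in> test_span b" "g \<in> test_span b" for f g using that by (rule test_span_mult)
    show "(\<lambda>_. c) \<in> test_span b" for c using test_span.scale[OF 1, of c] by simp
    show "\<exists>f\<in>test_span b. f x \<noteq> f y" if xy: "x \<in> mass_simplex b" "y \<in> mass_simplex b" "x \<noteq> y" for x y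
    proof -
      define i where "i = (LEAST i. x i \<noteq> y i)"
      have "\<exists>i. x i \<noteq> y i" using xy(3) by auto
      then have i: "x i \<noteq> y i" unfolding i_def by (rule LeastI_ex)
      have less: "x j = y j" if "j < i" for j using not_less_Least that unfolding i_def by blast
      show ?thesis
      proof (cases "x i < y i")
        case True
        have "\<exists>f\<in>test_span b. f y \<noteq> f x" by (rule test_fun_separates[OF xy(2,1) _ True assms(3)]) (use less in simp)
        then show ?thesis by metis
      next
        case False
        then show ?thesis by (intro test_fun_separates[OF xy(1,2) _ _ assms(3), of i] less) (use i in auto)
      qed
    qed
  qed
  have "continuous_on (mass_simplex b) F" using assms(1) by (rule continuous_on_subset) simp
  from Stone_Weierstrass_basic[OF this assms(2)] show ?thesis by blast
qed

lemma mass_simplex_integrable: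
  fixes N' :: "'a measure" and W :: "'a \<Rightarrow> nat \<Rightarrow> real" and f :: "(nat \<Rightarrow> real) \<Rightarrow> real"
  assumes "prob_space N'" and [measurable]: "W \<in> measurable N' borel" and "AE \<omega> in N'. W \<omega> \<in> mass_simplex b"
    and "continuous_on UNIV f"
  shows "integrable N' (\<lambda>\<omega>. f (W \<omega>))"
proof -
  interpret prob_space N' by fact
  have [measurable]: "f \<in> borel_measurable borel" using assms(4) by (rule borel_measurable_continuous_onI)
  have "compact (f ` mass_simplex b)" by (intro compact_continuous_image compact_mass_simplex continuous_on_subset[OF assms(4)]) simp
  then obtain B where B: "\<And>y. y \<in> mass_simplex b \<Longrightarrow> norm (f y) \<le> B" using compact_imp_bounded bounded_iff by (metis image_eqI)
  have "AE \<omega> in N'. norm (f (W \<omega>)) \<le> B" using assms(3) by eventually_elim (rule B)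
  then show ?thesis by (rule integrable_const_bound) simp
qed

lemma mass_simplex_integral_cong:
  fixes N' :: "'a measure" and W :: "'a \<Rightarrow> nat \<Rightarrow> real" and f h :: "(nat \<Rightarrow> real) \<Rightarrow> real"
  assumes "prob_space N'" and [measurable]: "W \<in> measurable N' borel" and "AE \<omega> in N'. W \<omega> \<in> mass_simplex b"
    and "continuous_on UNIV f" "continuous_on UNIV h" "\<And>y. y \<in> mass_simplex b \<Longrightarrow> h y = f y"
  shows "(LINT \<omega>|N'. f (W \<omega>)) = (LINT \<omega>|N'. h (W \<omega>))"
proof (rule integral_cong_AE)
  have [measurable]: "f \<in> borel_measurable borel" "h \<in> borel_measurable borel"
    using assms(4,5) by (auto intro: borel_measurable_continuous_onI)
  show "(\<lambda>\<omega>. f (W \<omega>)) \<in> borel_measurable N'" "(\<lambda>\<omega>. h (W \<omega>)) \<in> borel_measurable N'" by measurable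
  show "AE \<omega> in N'. f (W \<omega>) = h (W \<omega>)" using assms(3) by eventually_elim (simp add: assms(6))
qed

lemma mass_simplex_integral_close:
  fixes N' :: "'a measure" and W :: "'a \<Rightarrow> nat \<Rightarrow> real" and F :: "(nat \<Rightarrow> real) \<Rightarrow> real"
  assumes "prob_space N'" "W \<in> measurable N' borel" "AE \<omega> in N'. W \<omega> \<in> mass_simplex b"
    "continuous_on UNIV F" "r \<in> test_span b" "\<forall>y\<in>mass_simplex b. \<bar>F y - r y\<bar> < e"
  shows "\<bar>(LINT \<omega>|N'. F (W \<omega>)) - (LINT \<omega>|N'. r (W \<omega>))\<bar> \<le> e"
proof -
  interpret prob_space N' by fact
  have i: "integrable N' (\<lambda>\<omega>. F (W \<omega>))" "integrable N' (\<lambda>\<omega>. r (W \<omega>))"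
    using assms mass_simplex_integrable[OF assms(1-3)] by (auto intro: test_span_continuous)
  have "\<bar>(LINT \<omega>|N'. F (W \<omega>)) - (LINT \<omega>|N'. r (W \<omega>))\<bar> = \<bar>LINT \<omega>|N'. F (W \<omega>) - r (W \<omega>)\<bar>" using i by simp
  also have "\<dots> \<le> (LINT \<omega>|N'. \<bar>F (W \<omega>) - r (W \<omega>)\<bar>)" by (rule integral_abs_bound)
  also have "\<dots> \<le> (LINT \<omega>|N'. e)"
  proof (rule integral_mono_AE)
    show "AE \<omega> in N'. \<bar>F (W \<omega>) - r (W \<omega>)\<bar> \<le> e" using assms(3) by eventually_elim (use assms(6) in force)
  qed (use i in auto)
  also have "\<dots> = e" using prob_space by simp
  finally show ?thesis .
qed
text \<open>Density of the span in the uniform norm on the compact simplex extends convergence from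
  order-free products to all continuous functions. The hypotheses start at \<open>N0\<close> because
  they will be available for large boxes only.\<close>

lemma mass_simplex_weak_convergence:
  fixes M :: "nat \<Rightarrow> 'a measure" and Y :: "nat \<Rightarrow> 'a \<Rightarrow> nat \<Rightarrow> real"
    and M' :: "'b measure" and Z :: "'b \<Rightarrow> nat \<Rightarrow> real" and F :: "(nat \<Rightarrow> real) \<Rightarrow> real"
  assumes M: "\<And>N. N0 \<le> N \<Longrightarrow> prob_space (M N)" "\<And>N. N0 \<le> N \<Longrightarrow> Y N \<in> measurable (M N) borel"
      "\<And>N. N0 \<le> N \<Longrightarrow> AE \<omega> in M N. Y N \<omega> \<in> mass_simplex b"
    and M': "prob_space M'" "Z \<in> measurable M' borel" "AE \<omega> in M'. Z \<omega> \<in> mass_simplex b"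
    and "0 < b"
    and conv: "\<And>\<delta> g n. test_fun \<delta> g \<Longrightarrow> b < real n * \<delta> \<Longrightarrow>
       (\<lambda>N. LINT \<omega>|M N. (\<Prod>i<n. g (Y N \<omega> i))) \<longlonglongrightarrow> (LINT \<omega>|M'. (\<Prod>i<n. g (Z \<omega> i)))"
    and F: "continuous_on UNIV F"
  shows "(\<lambda>N. LINT \<omega>|M N. F (Y N \<omega>)) \<longlonglongrightarrow> (LINT \<omega>|M'. F (Z \<omega>))"
proof -
  have int: "integrable (M N) (\<lambda>\<omega>. f (Y N \<omega>))" if "N0 \<le> N" "f \<in> test_span b" for N f
    by (rule mass_simplex_integrable[OF M[OF that(1)] test_span_continuous[OF that(2)]])
  have int': "integrable M' (\<lambda>\<omega>. f (Z \<omega>))" if "f \<in> test_span b" for f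
    by (rule mass_simplex_integrable[OF M' test_span_continuous[OF that]])
  have span: "(\<lambda>N. LINT \<omega>|M N. r (Y N \<omega>)) \<longlonglongrightarrow> (LINT \<omega>|M'. r (Z \<omega>))" if "r \<in> test_span b" for r using that
  proof (induction rule: test_span.induct)
    case (scale f c)
    then show ?case by (simp add: tendsto_mult)
  next
    case (add f h)
    have ev: "eventually (\<lambda>N. (LINT \<omega>|M N. f (Y N \<omega>)) + (LINT \<omega>|M N. h (Y N \<omega>)) = (LINT \<omega>|M N. f (Y N \<omega>) + h (Y N \<omega>))) sequentially"
      using eventually_ge_at_top[of N0] by eventually_elim (intro Bochner_Integration.integral_add[symmetric] int add)
    have "(LINT \<omega>|M'. f (Z \<omega>)) + (LINT \<omega>|M'. h (Z \<omega>)) = (LINT \<omega>|M'. f (Z \<omega>) + h (Z \<omega>))"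
      by (intro Bochner_Integration.integral_add[symmetric] int' add)
    then show ?case using Lim_transform_eventually[OF tendsto_add[OF add.IH] ev] by simp
  next
    case (cong f h)
    have ev: "eventually (\<lambda>N. (LINT \<omega>|M N. f (Y N \<omega>)) = (LINT \<omega>|M N. h (Y N \<omega>))) sequentially" using eventually_ge_at_top[of N0]
      by eventually_elim (rule mass_simplex_integral_cong[OF M test_span_continuous[OF cong(1)] cong(2,3)])
    show ?case
      using Lim_transform_eventually[OF cong.IH ev] mass_simplex_integral_cong[OF M' test_span_continuous[OF cong(1)] cong(2,3)] by simp
  qed (rule conv)
  show ?thesis
  proof (rule LIMSEQ_I)
    fix e :: real assume e: "0 < e"
    obtain r where r: "r \<in> test_span b" "\<forall>y\<in>mass_simplex b. \<bar>F y - r y\<bar> < e / 3"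
      using test_span_dense[OF F, of "e / 3" b] e \<open>0 < b\<close> by auto
    have "eventually (\<lambda>N. \<bar>(LINT \<omega>|M N. r (Y N \<omega>)) - (LINT \<omega>|M'. r (Z \<omega>))\<bar> < e / 3) sequentially"
      using tendstoD[OF span[OF r(1)], of "e / 3"] e by (simp add: dist_real_def)
    then have "eventually (\<lambda>N. norm ((LINT \<omega>|M N. F (Y N \<omega>)) - (LINT \<omega>|M'. F (Z \<omega>))) < e) sequentially" using eventually_ge_at_top[of N0]
    proof eventually_elim
      case (elim N)
      show ?case using mass_simplex_integral_close[OF M[OF elim(2)] F r] mass_simplex_integral_close[OF M' F r] elim(1) unfolding real_norm_def by linarith
    qed
    then show "\<exists>no. \<forall>N\<ge>no. norm ((LINT \<omega>|M N. F (Y N \<omega>)) - (LINT \<omega>|M'. F (Z \<omega>))) < e" by (simp add: eventually_sequentially)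
  qed
qed

section \<open>The decreasing rearrangement and the Poisson-Dirichlet law\<close>

text \<open>Where the supremum does not exist, \<open>Sup\<close> takes a fixed value.\<close>

lemma borel_measurable_cSUP_real:
  fixes F :: "'i \<Rightarrow> 'a \<Rightarrow> real"
  assumes I: "countable I" "I \<noteq> {}" and F[measurable]: "\<And>i. i \<in> I \<Longrightarrow> F i \<in> borel_measurable M"
  shows "(\<lambda>x. SUP i\<in>I. F i x) \<in> borel_measurable M"
proof -
  let ?B = "{x \<in> space M. \<exists>m::nat. \<forall>i\<in>I. F i x \<le> real m}"
  have B[measurable]: "?B \<in> sets M" using I(1) by measurable
  have Bdd: "x \<in> ?B \<longleftrightarrow> x \<in> space M \<and> bdd_above ((\<lambda>i. F i x) ` I)" for x
  proof -
    have "(\<exists>m::nat. \<forall>i\<in>I. F i x \<le> real m) \<longleftrightarrow> (\<exists>z. \<forall>i\<in>I. F i x \<le> z)" by (meson order_trans real_arch_simple)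
    then show ?thesis by (simp add: bdd_above_def)
  qed
  have "(\<lambda>x. SUP i\<in>I. F i x * indicator ?B x) \<in> borel_measurable M"
  proof (rule borel_measurable_cSUP[OF I(1)])
    fix x assume "x \<in> space M"
    then show "bdd_above ((\<lambda>i. F i x * indicator ?B x) ` I)" using Bdd[of x] by (cases "x \<in> ?B") (auto simp: bdd_above_def)
  qed (use B F in measurable)
  then have "(\<lambda>x. if x \<in> ?B then (SUP i\<in>I. F i x * indicator ?B x) else Sup (UNIV::real set)) \<in> borel_measurable M"
    using B by (intro measurable_If_set) auto
  also have "?this \<longleftrightarrow> ?thesis"
  proof (rule measurable_cong)
    fix x assume x: "x \<in> space M"
    show "(if x \<in> ?B then (SUP i\<in>I. F i x * indicator ?B x) else Sup UNIV) = (SUP i\<in>I. F i x)"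
    proof (cases "x \<in> ?B")
      case True
      then show ?thesis by (simp del: mem_Collect_eq)
    next
      case False
      then have nb: "\<not> (\<forall>y\<in>(\<lambda>i. F i x) ` I. y \<le> z)" for z using Bdd[of x] x unfolding bdd_above_def by blast
      have "\<not> (\<forall>y\<in>(UNIV::real set). y \<le> z)" for z by (auto intro: exI[of _ "z + 1"])
      with nb have "(\<forall>y\<in>(UNIV::real set). y \<le> z) \<longleftrightarrow> (\<forall>y\<in>(\<lambda>i. F i x) ` I. y \<le> z)" for z by blast
      then have "Sup (UNIV::real set) = (SUP i\<in>I. F i x)" unfolding Sup_real_def by (simp only:)
      then show ?thesis using False by (simp del: mem_Collect_eq)
    qed
  qed
  finally show ?thesis .
qed

lemma measurable_decreasing_rearrangement:
  "decreasing_rearrangement \<in> measurable (PiM UNIV (\<lambda>_. borel)) (PiM UNIV (\<lambda>_. borel))"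
proof (rule measurable_PiM_single')
  fix n :: nat
  have ne: "{I::nat set. finite I \<and> card I = Suc n} \<noteq> {}" by (auto intro!: exI[of _ "{..n}"])
  have "countable {I::nat set. finite I \<and> card I = Suc n}" by (rule countable_subset[OF _ countable_Collect_finite]) auto
  from borel_measurable_cSUP_real[OF this ne, of "\<lambda>I w. Min (w ` I)" "PiM UNIV (\<lambda>_. borel)"]
  show "(\<lambda>w. decreasing_rearrangement w n) \<in> borel_measurable (PiM UNIV (\<lambda>_. borel))" unfolding decreasing_rearrangement_def by auto
qed auto

context
  fixes w :: "nat \<Rightarrow> real"
  assumes w: "\<And>i. 0 \<le> w i" "\<And>n. (\<Sum>i<n. w i) \<le> 1"
begin

lemma finite_large_entries:
  assumes "0 < \<delta>"
  shows "finite {i. \<delta> \<le> w i}"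
proof (rule ccontr)
  assume "infinite {i. \<delta> \<le> w i}"
  obtain m :: nat where m: "1 < real m * \<delta>" using reals_Archimedean3[OF assms] by blast
  obtain T where T: "T \<subseteq> {i. \<delta> \<le> w i}" "finite T" "card T = m" using infinite_arbitrarily_large[OF \<open>infinite _\<close>, of m] by auto
  obtain n where n: "T \<subseteq> {..<n}" using finite_nat_iff_bounded T(2) by blast
  have "real m * \<delta> \<le> (\<Sum>i\<in>T. w i)" using sum_mono[of T "\<lambda>_. \<delta>" w] T by auto
  also have "\<dots> \<le> (\<Sum>i<n. w i)" using n w by (intro sum_mono2) auto
  also have "\<dots> \<le> 1" by (rule w)
  finally show False using m by simp
qed

lemma rearrangement_bdd: "bdd_above ((\<lambda>I. Min (w ` I)) ` {I. finite I \<and> card I = Suc n})"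
proof (rule bdd_aboveI2)
  fix I :: "nat set" assume "I \<in> {I. finite I \<and> card I = Suc n}"
  then obtain i where i: "i \<in> I" "finite I" by (metis (mono_tags) card.empty ex_in_conv mem_Collect_eq nat.distinct(1))
  then have "Min (w ` I) \<le> w i" by simp
  also have "w i \<le> (\<Sum>j<Suc i. w j)" using w by (intro member_le_sum) auto
  also have "\<dots> \<le> 1" by (rule w)
  finally show "Min (w ` I) \<le> 1" .
qed

lemma decreasing_rearrangement_ge:
  assumes "finite I" "card I = Suc n" "\<And>i. i \<in> I \<Longrightarrow> x \<le> w i"
  shows "x \<le> decreasing_rearrangement w n"
proof -
  have "I \<noteq> {}" using assms by auto
  then have "x \<le> Min (w ` I)" using assms by simp
  also have "\<dots> \<le> decreasing_rearrangement w n"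
    unfolding decreasing_rearrangement_def using assms by (intro cSUP_upper rearrangement_bdd) auto
  finally show ?thesis .
qed

lemma decreasing_rearrangement_le:
  assumes "\<And>I. finite I \<Longrightarrow> card I = Suc n \<Longrightarrow> \<exists>i\<in>I. w i \<le> x"
  shows "decreasing_rearrangement w n \<le> x" unfolding decreasing_rearrangement_def
proof (rule cSUP_least)
  show "{I::nat set. finite I \<and> card I = Suc n} \<noteq> {}" by (auto intro!: exI[of _ "{..n}"])
  fix I :: "nat set" assume "I \<in> {I. finite I \<and> card I = Suc n}"
  then obtain i where "i \<in> I" "w i \<le> x" "finite I" using assms by blast
  then show "Min (w ` I) \<le> x" by (meson Min_le finite_imageI image_eqI order_trans)
qed

lemma decreasing_rearrangement_nonneg: "0 \<le> decreasing_rearrangement w n" by (rule decreasing_rearrangement_ge[of "{..n}"]) (auto simp: w)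

lemma decseq_decreasing_rearrangement: "decseq (decreasing_rearrangement w)"
proof (rule decseq_SucI)
  fix n
  show "decreasing_rearrangement w (Suc n) \<le> decreasing_rearrangement w n"
  proof (rule decreasing_rearrangement_le)
    fix I :: "nat set" assume I: "finite I" "card I = Suc (Suc n)"
    then obtain i where i: "i \<in> I" "\<And>j. j \<in> I \<Longrightarrow> w i \<le> w j" using arg_min_if_finite[of I w] by (metis card.empty nat.distinct(1) not_le)
    then obtain J where J: "J \<subseteq> I" "card J = Suc n" "finite J" using I by (metis card_Diff_singleton diff_Suc_1 finite_Diff Diff_subset)
    have "w i \<le> decreasing_rearrangement w n" using J i by (intro decreasing_rearrangement_ge[of J]) auto
    then show "\<exists>i\<in>I. w i \<le> decreasing_rearrangement w n" using i by blast
  qed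
qed

text \<open>No permutation need sort \<open>w\<close>: with infinitely many positive entries and a
  zero among them, the zero has no place. But the entries from \<delta> on are finite in number;
  sorting these describes the rearrangement down to \<delta>.\<close>

lemma decreasing_rearrangement_threshold:
  assumes "0 < \<delta>"
  obtains m e where "bij_betw e {..<m} {i. \<delta> \<le> w i}"
    "\<And>n. n < m \<Longrightarrow> decreasing_rearrangement w n = w (e n)"
    "\<And>n. m \<le> n \<Longrightarrow> decreasing_rearrangement w n \<le> \<delta>"
proof -
  let ?T = "{i. \<delta> \<le> w i}"
  have fin: "finite ?T" by (rule finite_large_entries[OF assms])
  define xs where "xs = sort_key (\<lambda>i. - w i) (sorted_list_of_set ?T)"
  define m where "m = length xs"
  have xs: "set xs = ?T" "distinct xs" using fin by (auto simp: xs_def)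
  have bij: "bij_betw (\<lambda>n. xs ! n) {..<m} ?T" using bij_betw_nth[OF xs(2), of "{..<m}" ?T] xs(1) by (simp add: m_def)
  have "sorted (map (\<lambda>i. - w i) xs)" by (simp add: xs_def)
  then have dec: "w (xs ! j) \<le> w (xs ! i)" if "i \<le> j" "j < m" for i j
    using sorted_nth_mono[of "map (\<lambda>i. - w i) xs" i j] that by (simp add: m_def)
  \<comment> \<open>Among any n + 1 indices one lies outside the first \<open>n\<close> of the list;
    its entry bounds the minimum over these indices.\<close>
  have out: "\<exists>i\<in>I. i \<notin> (\<lambda>n. xs ! n) ` {..<n}" if "finite I" "card I = Suc n" for I n
  proof (rule ccontr)
    assume "\<not> ?thesis"
    then have "I \<subseteq> (\<lambda>n. xs ! n) ` {..<n}" by blast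
    then have "card I \<le> card ((\<lambda>n. xs ! n) ` {..<n})" by (intro card_mono) auto
    also have "\<dots> \<le> n" using card_image_le[of "{..<n}" "\<lambda>n. xs ! n"] by simp
    finally show False using that by simp
  qed
  show ?thesis
  proof (rule that[OF bij])
    fix n assume n: "n < m"
    show "decreasing_rearrangement w n = w (xs ! n)"
    proof (rule antisym)
      show "w (xs ! n) \<le> decreasing_rearrangement w n"
      proof (rule decreasing_rearrangement_ge[of "(\<lambda>n. xs ! n) ` {..n}"])
        have "inj_on (\<lambda>n. xs ! n) {..n}" using bij n by (auto simp: bij_betw_def intro: inj_on_subset)
        then show "card ((\<lambda>n. xs ! n) ` {..n}) = Suc n" by (simp add: card_image)
      qed (use dec n in auto)
      show "decreasing_rearrangement w n \<le> w (xs ! n)"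
      proof (rule decreasing_rearrangement_le)
        fix I :: "nat set" assume "finite I" "card I = Suc n"
        then obtain i where i: "i \<in> I" "i \<notin> (\<lambda>n. xs ! n) ` {..<n}" using out by blast
        have "w i \<le> w (xs ! n)"
        proof (cases "\<delta> \<le> w i")
          case True
          then obtain j where j: "j < m" "i = xs ! j" using bij by (auto simp: bij_betw_def)
          then have "n \<le> j" using i(2) by (meson image_eqI lessThan_iff not_less)
          then show ?thesis using dec j by simp
        next
          case False
          moreover have "\<delta> \<le> w (xs ! n)" using bij n by (auto simp: bij_betw_def)
          ultimately show ?thesis by simp
        qed
        then show "\<exists>i\<in>I. w i \<le> w (xs ! n)" using i by blast
      qed
    qed
  next
    fix n assume n: "m \<le> n"
    show "decreasing_rearrangement w n \<le> \<delta>"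
    proof (rule decreasing_rearrangement_le)
      fix I :: "nat set" assume "finite I" "card I = Suc n"
      then obtain i where i: "i \<in> I" "i \<notin> (\<lambda>n. xs ! n) ` {..<n}" using out by blast
      have "i \<notin> ?T" using i(2) bij n unfolding bij_betw_def by force
      then show "\<exists>i\<in>I. w i \<le> \<delta>" using i by (intro bexI[of _ i]) auto
    qed
  qed
qed

text \<open>With threshold e / (n + 1), the entries above it are distinct entries of
  \<open>w\<close>, of total at most 1, and at most \<open>n\<close> others add at most
  \<open>e\<close>.\<close>

lemma decreasing_rearrangement_mass: "decreasing_rearrangement w \<in> mass_simplex 1"
proof -
  let ?d = "decreasing_rearrangement w"
  have "(\<Sum>i<n. ?d i) \<le> 1" for n
  proof (rule field_le_epsilon)
    fix e :: real assume e: "0 < e"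
    define \<delta> where "\<delta> = e / (real n + 1)"
    have \<delta>: "0 < \<delta>" "real n * \<delta> \<le> e" using e by (auto simp: \<delta>_def field_simps)
    obtain m f where f: "bij_betw f {..<m} {i. \<delta> \<le> w i}" "\<And>n. n < m \<Longrightarrow> ?d n = w (f n)"
      "\<And>n. m \<le> n \<Longrightarrow> ?d n \<le> \<delta>" by (rule decreasing_rearrangement_threshold[OF \<delta>(1)]) blast
    obtain N where N: "{i. \<delta> \<le> w i} \<subseteq> {..<N}" using finite_large_entries[OF \<delta>(1)] finite_nat_iff_bounded by blast
    have "(\<Sum>i<n. ?d i) \<le> (\<Sum>i<n. (if i < m then w (f i) else 0) + \<delta>)" using f \<delta> by (intro sum_mono) (auto simp: not_less)
    also have "\<dots> = (\<Sum>i<n. (if i < m then w (f i) else 0)) + real n * \<delta>" by (simp add: sum.distrib)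
    also have "(\<Sum>i<n. (if i < m then w (f i) else 0)) = (\<Sum>i\<in>{..<n} \<inter> {..<m}. w (f i))" by (subst sum.inter_restrict) auto
    also have "\<dots> \<le> (\<Sum>i<m. w (f i))" using w by (intro sum_mono2) auto
    also have "\<dots> = (\<Sum>i\<in>{i. \<delta> \<le> w i}. w i)" by (rule sum.reindex_bij_betw[OF f(1)])
    also have "\<dots> \<le> (\<Sum>i<N. w i)" using N w by (intro sum_mono2) auto
    also have "\<dots> \<le> 1" by (rule w)
    finally show "(\<Sum>i<n. ?d i) \<le> 1 + e" using \<delta>(2) by simp
  qed
  then show ?thesis using decreasing_rearrangement_nonneg decseq_decreasing_rearrangement by (simp add: mass_simplex_def)
qed

text \<open>Only entries from \<delta> on contribute factors other than 1. The product in the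
  original order is constant once it has passed all of them, and it then equals the product in
  sorted order; this removes the sorting from the definition of PD.\<close>

lemma decreasing_rearrangement_prod:
  assumes g: "test_fun \<delta> g" and n: "1 < real n * \<delta>"
  shows "(\<lambda>k. \<Prod>i<k. g (w i)) \<longlonglongrightarrow> (\<Prod>i<n. g (decreasing_rearrangement w i))"
proof -
  let ?d = "decreasing_rearrangement w"
  have \<delta>: "0 < \<delta>" and g1: "\<And>x. x \<le> \<delta> \<Longrightarrow> g x = 1" using g by (auto simp: test_fun_def)
  obtain m f where f: "bij_betw f {..<m} {i. \<delta> \<le> w i}" "\<And>n. n < m \<Longrightarrow> ?d n = w (f n)"
      "\<And>n. m \<le> n \<Longrightarrow> ?d n \<le> \<delta>" by (rule decreasing_rearrangement_threshold[OF \<delta>(1)]) blast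
  obtain N where N: "{i. \<delta> \<le> w i} \<subseteq> {..<N}" using finite_large_entries[OF \<delta>(1)] finite_nat_iff_bounded by blast
  have "m \<le> n"
  proof (rule ccontr)
    assume "\<not> m \<le> n"
    then have "n < m" by simp
    then have "\<delta> \<le> w (f n)" using f(1) by (auto simp: bij_betw_def)
    then show False using f(2)[OF \<open>n < m\<close>] mass_simplex_entry[OF decreasing_rearrangement_mass n, of n] by simp
  qed
  have "(\<Prod>i<n. g (?d i)) = (\<Prod>i<m. g (?d i))" by (rule prod.mono_neutral_right) (use \<open>m \<le> n\<close> g1 f(3) in auto)
  also have "\<dots> = (\<Prod>i<m. g (w (f i)))" using f(2) by (intro prod.cong) auto
  also have "\<dots> = (\<Prod>i\<in>{i. \<delta> \<le> w i}. g (w i))" by (rule prod.reindex_bij_betw[OF f(1)])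
  finally have eq: "(\<Prod>i<n. g (?d i)) = (\<Prod>i\<in>{i. \<delta> \<le> w i}. g (w i))" .
  have "(\<Prod>i<k. g (w i)) = (\<Prod>i<n. g (?d i))" if "N \<le> k" for k
    unfolding eq by (rule prod.mono_neutral_right) (use that N g1 in \<open>auto simp: not_le less_imp_le\<close>)
  then show ?thesis by (intro tendsto_eventually eventually_sequentiallyI[of N])
qed

end

text \<open>The sum of the pieces telescopes to 1 minus the product of the remaining
  fractions.\<close>

lemma stick_breaking_bounds:
  assumes "\<And>i. 0 \<le> X i \<and> X i \<le> 1"
  shows "0 \<le> stick_breaking X i" "(\<Sum>i<n. stick_breaking X i) \<le> 1"
proof -
  have "(\<Sum>i<n. stick_breaking X i) = 1 - (\<Prod>i<n. 1 - X i)" for n by (induction n) (simp_all add: stick_breaking_def algebra_simps)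
  moreover have "0 \<le> (\<Prod>i<n. 1 - X i)" for n using assms by (intro prod_nonneg) auto
  ultimately show "(\<Sum>i<n. stick_breaking X i) \<le> 1" by simp
  show "0 \<le> stick_breaking X i" unfolding stick_breaking_def using assms by (intro mult_nonneg_nonneg prod_nonneg) auto
qed

text \<open>For the last claim, \<open>stick_iter\<close> is the mean of the product over the first
  \<open>k\<close> GEM entries in their own order; these products converge almost surely to the
  sorted one and are bounded by 1.\<close>

lemma PD_properties:
  assumes \<theta>: "0 < \<theta>"
  shows prob_space_PD: "prob_space (PD \<theta>)"
    and sets_PD: "sets (PD \<theta>) = sets (PiM UNIV (\<lambda>_. borel))"
    and AE_PD: "AE p in PD \<theta>. p \<in> mass_simplex 1"
    and PD_functional: "\<And>g \<delta> n. test_fun \<delta> g \<Longrightarrow> 1 < real n * \<delta> \<Longrightarrow>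
      (\<lambda>k. stick_iter \<theta> g (\<lambda>_. 1) k 1) \<longlonglongrightarrow> (LINT p|PD \<theta>. (\<Prod>i<n. g (p i)))"
proof -
  interpret real_distribution "stick_law \<theta>" by (rule stick_law_distribution[OF \<theta>])
  interpret S: product_prob_space "\<lambda>_::nat. stick_law \<theta>" UNIV by unfold_locales
  let ?S = "PiM UNIV (\<lambda>_::nat. stick_law \<theta>)" and ?B = "PiM UNIV (\<lambda>_::nat. borel :: real measure)"
  have pS: "prob_space ?S" by (rule prob_space_PiM) unfold_locales
  have [measurable]: "stick_breaking \<in> measurable ?S ?B"
  proof (rule measurable_PiM_single')
    show "(\<lambda>X. stick_breaking X i) \<in> borel_measurable ?S" for i unfolding stick_breaking_def by measurable
  qed auto
  note [measurable] = measurable_decreasing_rearrangement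
  have pG: "prob_space (GEM \<theta>)" unfolding GEM_def by (rule prob_space.prob_space_distr[OF pS]) simp
  have sG: "sets (GEM \<theta>) = sets ?B" by (simp add: GEM_def)
  show "prob_space (PD \<theta>)" unfolding PD_def by (rule prob_space.prob_space_distr[OF pG]) (simp add: sG cong: measurable_cong_sets)
  show sP: "sets (PD \<theta>) = sets ?B" by (simp add: PD_def)
  have eq: "PD \<theta> = distr ?S ?B (\<lambda>X. decreasing_rearrangement (stick_breaking X))"
    unfolding PD_def GEM_def by (subst distr_distr) (auto simp: comp_def)
  have meas: "{p \<in> space ?B. p \<in> mass_simplex 1} \<in> sets ?B"
  proof -
    have "mass_simplex 1 \<in> sets borel" by (intro borel_compact compact_mass_simplex)
    then show ?thesis by (simp add: sets_PiM_equal_borel space_PiM)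
  qed
  have ae: "AE X in ?S. \<forall>i. 0 \<le> X i \<and> X i \<le> 1"
  proof (subst AE_all_countable, rule allI)
    fix i :: nat
    have "AE x in stick_law \<theta>. 0 \<le> x \<and> x \<le> 1" by (rule stick_law_AE[OF \<theta>])
    then show "AE X in ?S. 0 \<le> X i \<and> X i \<le> 1" by (rule S.AE_component[rotated]) simp
  qed
  show "AE p in PD \<theta>. p \<in> mass_simplex 1" unfolding eq
  proof (subst AE_distr_iff)
    show "AE X in ?S. decreasing_rearrangement (stick_breaking X) \<in> mass_simplex 1"
      using ae by eventually_elim (intro decreasing_rearrangement_mass stick_breaking_bounds, auto)
  qed (use meas in auto)
  fix g \<delta> n assume g: "test_fun \<delta> g" and n: "1 < real n * \<delta>"
  have [measurable]: "g \<in> borel_measurable borel" using g by (auto simp: test_fun_def intro: borel_measurable_continuous_onI)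
  have "(\<lambda>k. LINT X|?S. (\<Prod>i<k. g (stick_breaking X i)))
     \<longlonglongrightarrow> (LINT X|?S. (\<Prod>i<n. g (decreasing_rearrangement (stick_breaking X) i)))"
  proof (rule integral_dominated_convergence[where w = "\<lambda>_. 1"])
    show "AE X in ?S. (\<lambda>k. \<Prod>i<k. g (stick_breaking X i)) \<longlonglongrightarrow> (\<Prod>i<n. g (decreasing_rearrangement (stick_breaking X) i))" using ae
    proof eventually_elim
      case (elim X)
      then show ?case by (intro decreasing_rearrangement_prod[OF _ _ g n] stick_breaking_bounds) auto
    qed
    show "AE X in ?S. norm (\<Prod>i<k. g (stick_breaking X i)) \<le> 1" for k using g by (auto simp: abs_prod test_fun_def intro!: AE_I2 prod_le_1)
    show "integrable ?S (\<lambda>_. 1 :: real)" by (rule finite_measure.integrable_const[OF prob_space.finite_measure[OF pS]])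
  qed measurable
  moreover have "(LINT X|?S. (\<Prod>i<k. g (stick_breaking X i))) = stick_iter \<theta> g (\<lambda>_. 1) k 1" for k
    using stick_iter_eq_integral[OF \<theta>, of g k 1] g by (simp add: test_fun_def)
  moreover have "(LINT X|?S. (\<Prod>i<n. g (decreasing_rearrangement (stick_breaking X) i))) = (LINT p|PD \<theta>. (\<Prod>i<n. g (p i)))"
    unfolding eq by (rule integral_distr[symmetric]) measurable
  ultimately show "(\<lambda>k. stick_iter \<theta> g (\<lambda>_. 1) k 1) \<longlonglongrightarrow> (LINT p|PD \<theta>. (\<Prod>i<n. g (p i)))" by simp
qed

section \<open>Sums over permutations\<close>

text \<open>The permutation \<open>p\<close> sends \<open>a\<close> to \<open>b\<close>, and the
  point that \<open>q\<close> sends to \<open>b\<close> to \<open>a\<close>: the new point is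
  inserted into the cycle of \<open>b\<close> just before \<open>b\<close>, and the other cycles are
  untouched.\<close>

lemma orbit_transpose_comp:
  assumes q: "q permutes T" "finite T" and a: "a \<notin> T" and b: "b \<in> T"
  defines "p \<equiv> Transposition.transpose a b \<circ> q"
  shows "orbit p a = insert a (orbit q b)"
    and "y \<in> orbit q b \<Longrightarrow> orbit p y = insert a (orbit q b)"
    and "y \<in> T \<Longrightarrow> y \<notin> orbit q b \<Longrightarrow> orbit p y = orbit q y"
proof -
  have qa: "q a = a" using q(1) a by (simp add: permutes_not_in)
  have pa: "p a = b" by (simp add: p_def qa)
  have py: "p y = (if q y = b then a else q y)" if "y \<in> T" for y
  proof -
    have "q y \<noteq> a" using that q(1) a by (metis permutes_in_image)
    then show ?thesis by (simp add: p_def Transposition.transpose_def)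
  qed
  have OT: "orbit q b \<subseteq> T" by (rule permutes_orbit_subset[OF q(1) b])
  have perm: "permutation q" using q permutation_permutes by blast
  have bO: "b \<in> orbit q b" by (rule permutation_self_in_orbit[OF perm])
  have sub: "orbit p a \<subseteq> insert a (orbit q b)"
  proof
    fix y assume "y \<in> orbit p a"
    then show "y \<in> insert a (orbit q b)"
    proof induction
      case base then show ?case using pa bO by simp
    next
      case (step y)
      show ?case
      proof (cases "y = a")
        case False
        then have "y \<in> orbit q b" using step by simp
        then have "y \<in> T" using OT by blast
        from py[OF this] show ?thesis using orbit.step[OF \<open>y \<in> orbit q b\<close>] by auto
      qed (use pa bO in simp)
    qed
  qed
  have "b \<in> orbit p a" using orbit.base[of p a] pa by simp
  have sup: "y \<in> orbit p a" if "y \<in> orbit q b" for y using that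
  proof induction
    case base
    show ?case
    proof (cases "q b = b")
      case False
      then have "p b = q b" using py[OF b] by simp
      then show ?thesis using orbit.step[OF \<open>b \<in> orbit p a\<close>] by simp
    qed (use \<open>b \<in> orbit p a\<close> in simp)
  next
    case (step y)
    then have yT: "y \<in> T" using OT by blast
    show ?case
    proof (cases "q y = b")
      case False
      then have "p y = q y" using py[OF yT] by simp
      then show ?thesis using orbit.step[OF step.IH] by simp
    qed (use \<open>b \<in> orbit p a\<close> in simp)
  qed
  have "p permutes insert a T" unfolding p_def by (intro permutes_compose permutes_subset[OF q(1)] permutes_swap_id) (use b in auto)
  then have permp: "permutation p" using q(2) permutation_permutes by blast
  show main: "orbit p a = insert a (orbit q b)" using sub sup permutation_self_in_orbit[OF permp, of a] by blast
  show "orbit p y = insert a (orbit q b)" if "y \<in> orbit q b"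
    using orbit_cyclic_eq3[OF cyclic_on_orbit'[OF permp] sup[OF that]] main by simp
  show "orbit p y = orbit q y" if y: "y \<in> T" "y \<notin> orbit q b"
  proof (rule orbit_cong[OF permutation_self_in_orbit[OF perm]])
    fix s assume s: "s \<in> orbit q y"
    have sT: "s \<in> T" using permutes_orbit_subset[OF q(1) y(1)] s by blast
    have "q s \<noteq> b"
    proof
      assume "q s = b"
      then have "b \<in> orbit q y" using orbit.step[OF s] by simp
      then have "y \<in> orbit q b" by (rule orbit_swap[OF permutation_self_in_orbit[OF perm]])
      then show False using y(2) by simp
    qed
    then show "p s = q s" using py[OF sT] by simp
  qed
qed

definition cycle_weight :: "(nat \<Rightarrow> real) \<Rightarrow> 'a set set \<Rightarrow> real" where
  "cycle_weight u \<C> = (\<Prod>C\<in>\<C>. u (card C))"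

text \<open>Every permutation of \<open>S\<close> arises uniquely by inserting the root
  \<open>a\<close> into a permutation of the other points, either alone or before some
  \<open>b\<close>. The cycle of the root has its own weight \<open>v\<close>, because insertion
  makes the cycle of \<open>b\<close> longer by one, which shifts \<open>v\<close> in the induction
  hypothesis. The unrooted sum is the case v = u together with the recursion.\<close>

lemma cycle_weight_rooted:
  fixes S :: "'a set"
  assumes "finite S" "a \<in> S"
  shows "(\<Sum>\<pi> | \<pi> permutes S. v (card (orbit \<pi> a)) * cycle_weight u (orbit \<pi> ` S - {orbit \<pi> a}))
    = fact (card S - 1) * (\<Sum>j=1..card S. v j * hcoef u (card S - j))" (is ?A)
    and "(\<Sum>\<pi> | \<pi> permutes S. cycle_weight u (orbit \<pi> ` S)) = fact (card S) * hcoef u (card S)" (is ?B)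
proof -
  have "\<forall>v a. a \<in> S \<longrightarrow> (\<Sum>\<pi> | \<pi> permutes S. v (card (orbit \<pi> a)) * cycle_weight u (orbit \<pi> ` S - {orbit \<pi> a}))
    = fact (card S - 1) * (\<Sum>j=1..card S. v j * hcoef u (card S - j))"
    and "(\<Sum>\<pi> | \<pi> permutes S. cycle_weight u (orbit \<pi> ` S)) = fact (card S) * hcoef u (card S)" using assms(1)
  proof (induction "card S" arbitrary: S)
    case 0
    {
      case 1
      then show ?case using 0 by auto
    next
      case 2
      then have [simp]: "S = {}" using 0 by auto
      show ?case by (simp add: cycle_weight_def permutes_empty)
    }
  next
    case (Suc m)
    have R: "(\<Sum>\<pi> | \<pi> permutes S. v (card (orbit \<pi> a)) * cycle_weight u (orbit \<pi> ` S - {orbit \<pi> a}))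
      = fact (card S - 1) * (\<Sum>j=1..card S. v j * hcoef u (card S - j))"
      if a: "a \<in> S" and fin: "finite S" for v a
    proof -
      define T where "T = S - {a}"
      have T: "finite T" "a \<notin> T" "S = insert a T" "card T = m" using a fin Suc(3)[symmetric] by (auto simp: T_def)
      let ?t = "\<lambda>b q. Transposition.transpose a b \<circ> q"
      note IH = Suc(1)[OF T(4)[symmetric] T(1)] Suc(2)[OF T(4)[symmetric] T(1)]
      let ?f = "\<lambda>\<pi>. v (card (orbit \<pi> a)) * cycle_weight u (orbit \<pi> ` S - {orbit \<pi> a})"
      \<comment> \<open>For b = a the transposition is the identity, so \<open>a\<close> is a fixed
        point, that is, a cycle of length 1.\<close>
      have A: "(\<Sum>q | q permutes T. ?f (?t a q)) = v 1 * (fact m * hcoef u m)"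
      proof -
        have "?f (?t a q) = v 1 * cycle_weight u (orbit q ` T)" if q: "q permutes T" for q
        proof -
          have oa: "orbit q a = {a}" using q T(2) by (simp add: orbit_eq_singleton_iff permutes_not_in)
          have "{a} \<notin> orbit q ` T" using permutes_orbit_subset[OF q] T(2) by fastforce
          then show ?thesis using oa T(3) by simp
        qed
        then have "(\<Sum>q | q permutes T. ?f (?t a q)) = (\<Sum>q | q permutes T. v 1 * cycle_weight u (orbit q ` T))" by (intro sum.cong) auto
        then show ?thesis using IH(2) T(4) by (simp flip: sum_distrib_left)
      qed
      have B: "(\<Sum>q | q permutes T. ?f (?t b q)) = fact (m - 1) * (\<Sum>j=1..m. v (Suc j) * hcoef u (m - j))"
        if b: "b \<in> T" for b
      proof -
        have "?f (?t b q) = v (Suc (card (orbit q b))) * cycle_weight u (orbit q ` T - {orbit q b})"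
          if q: "q permutes T" for q
        proof -
          note o = orbit_transpose_comp[OF q T(1,2) b]
          have perm: "permutation q" using q T(1) permutation_permutes by blast
          have OT: "orbit q b \<subseteq> T" by (rule permutes_orbit_subset[OF q b])
          have aO: "a \<notin> orbit q b" using OT T(2) by blast
          have c: "card (insert a (orbit q b)) = Suc (card (orbit q b))" using aO finite_subset[OF OT T(1)] by simp
          have "orbit (?t b q) ` S - {orbit (?t b q) a} = orbit q ` T - {orbit q b}"
          proof (intro set_eqI iffI)
            fix C assume "C \<in> orbit (?t b q) ` S - {orbit (?t b q) a}"
            then obtain y where y: "y \<in> S" "C = orbit (?t b q) y" "C \<noteq> insert a (orbit q b)" using o(1) by auto
            then have "y \<in> T" "y \<notin> orbit q b" using o T(3) by auto
            then have "C = orbit q y" using o(3) y by simp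
            moreover have "orbit q y \<noteq> orbit q b" using \<open>y \<notin> orbit q b\<close> permutation_self_in_orbit[OF perm, of y] by blast
            ultimately show "C \<in> orbit q ` T - {orbit q b}" using \<open>y \<in> T\<close> by blast
          next
            fix C assume C: "C \<in> orbit q ` T - {orbit q b}"
            then obtain y where y: "y \<in> T" "C = orbit q y" "C \<noteq> orbit q b" by blast
            then have "y \<notin> orbit q b" using orbit_cyclic_eq3[OF cyclic_on_orbit'[OF perm]] by blast
            then have "C = orbit (?t b q) y" using o(3) y by simp
            moreover have "a \<notin> C" using y permutes_orbit_subset[OF q y(1)] T(2) by blast
            ultimately show "C \<in> orbit (?t b q) ` S - {orbit (?t b q) a}" using y T(3) o(1) by auto
          qed
          then show ?thesis using c by (simp only: o(1))
        qed
        then have "(\<Sum>q | q permutes T. ?f (?t b q)) =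
          (\<Sum>q | q permutes T. v (Suc (card (orbit q b))) * cycle_weight u (orbit q ` T - {orbit q b}))" by (intro sum.cong) auto
        then show ?thesis using IH(1)[THEN spec, of "\<lambda>j. v (Suc j)", THEN spec, of b] b T(4) by simp
      qed
      have "(\<Sum>\<pi> | \<pi> permutes S. ?f \<pi>) = (\<Sum>b\<in>insert a T. \<Sum>q | q permutes T. ?f (?t b q))"
        unfolding T(3)[symmetric] using sum_over_permutations_insert[OF T(1,2), of ?f] T(3) by simp
      also have "\<dots> = (\<Sum>q | q permutes T. ?f (?t a q)) + (\<Sum>b\<in>T. \<Sum>q | q permutes T. ?f (?t b q))" using T(1,2) by (rule sum.insert)
      also have "(\<Sum>b\<in>T. \<Sum>q | q permutes T. ?f (?t b q)) = (\<Sum>b\<in>T. fact (m - 1) * (\<Sum>j=1..m. v (Suc j) * hcoef u (m - j)))"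
        using B by (intro sum.cong) auto
      also have "\<dots> = fact m * (\<Sum>j=1..m. v (Suc j) * hcoef u (m - j))" using T(4) by (cases m) auto
      also have "(\<Sum>j=1..m. v (Suc j) * hcoef u (m - j)) = (\<Sum>j=2..Suc m. v j * hcoef u (Suc m - j))"
        by (rule sum.reindex_bij_witness[of _ "\<lambda>j. j - 1" Suc]) auto
      also have "(\<Sum>q | q permutes T. ?f (?t a q)) + fact m * (\<Sum>j=2..Suc m. v j * hcoef u (Suc m - j))
         = fact m * (\<Sum>j=1..Suc m. v j * hcoef u (Suc m - j))"
        unfolding A by (subst (2) sum.atLeast_Suc_atMost) (auto simp: algebra_simps numeral_2_eq_2)
      finally show ?thesis using Suc(3)[symmetric] by simp
    qed
    {
      case 1
      then show ?case using R by blast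
    next
      case 2
      obtain a where a: "a \<in> S" using Suc(3) by (metis card.empty ex_in_conv nat.distinct(1))
      have "cycle_weight u (orbit \<pi> ` S) = u (card (orbit \<pi> a)) * cycle_weight u (orbit \<pi> ` S - {orbit \<pi> a})" for \<pi>
        unfolding cycle_weight_def using a 2 by (intro prod.remove) auto
      then have "(\<Sum>\<pi> | \<pi> permutes S. cycle_weight u (orbit \<pi> ` S))
        = fact (card S - 1) * (\<Sum>j=1..card S. u j * hcoef u (card S - j))" using R[OF a 2, of u] by simp
      also have "\<dots> = fact (card S) * hcoef u (card S)"
        using Suc(3)[symmetric] by (simp only: hcoef_rec[symmetric] fact_Suc diff_Suc_1) simp
      finally show ?case .
    }
  qed
  then show ?A ?B using assms(2) by blast+
qed

lemma finite_perms: "finite (perms N)" by (simp add: perms_def finite_permutations)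

lemma perms_permutation: "\<pi> \<in> perms N \<Longrightarrow> permutation \<pi>" unfolding perms_def using permutation_permutes by blast

lemma sum_cycle_weight:
  "(\<Sum>\<pi>\<in>perms N. cycle_weight u (cycle_sets N \<pi>)) = fact N * hcoef u N"
proof (cases "N = 0")
  case True
  then show ?thesis by (simp add: perms_def cycle_sets_def cycle_weight_def permutes_empty)
next
  case False
  then show ?thesis using cycle_weight_rooted(2)[of "{1..N}" 1 u] by (simp add: perms_def cycle_sets_def)
qed

lemma orbit_partition:
  assumes "\<pi> \<in> perms N"
  shows "finite (cycle_sets N \<pi>)" "\<Union> (cycle_sets N \<pi>) = {1..N}" "disjoint (cycle_sets N \<pi>)"
    and "C \<in> cycle_sets N \<pi> \<Longrightarrow> i \<in> C \<Longrightarrow> orbit \<pi> i = C"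
    and "C \<in> cycle_sets N \<pi> \<Longrightarrow> finite C \<and> C \<noteq> {} \<and> C \<subseteq> {1..N}"
proof -
  have p: "\<pi> permutes {1..N}" using assms by (simp add: perms_def)
  note perm = perms_permutation[OF assms]
  show "finite (cycle_sets N \<pi>)" by (simp add: cycle_sets_def)
  show "\<Union> (cycle_sets N \<pi>) = {1..N}"
    using permutes_orbit_subset[OF p] permutation_self_in_orbit[OF perm] unfolding cycle_sets_def by blast
  show o: "orbit \<pi> i = C" if "C \<in> cycle_sets N \<pi>" "i \<in> C" for C i
    using that orbit_cyclic_eq3[OF cyclic_on_orbit'[OF perm]] unfolding cycle_sets_def by blast
  show "disjoint (cycle_sets N \<pi>)" unfolding disjoint_def using o by blast
  show "finite C \<and> C \<noteq> {} \<and> C \<subseteq> {1..N}" if "C \<in> cycle_sets N \<pi>"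
  proof -
    from that obtain i where i: "i \<in> {1..N}" "C = orbit \<pi> i" unfolding cycle_sets_def by blast
    then have "C \<subseteq> {1..N}" using permutes_orbit_subset[OF p] by blast
    then show ?thesis using i(2) orbit_nonempty[of \<pi> i] by (auto intro: finite_subset)
  qed
qed

lemma sum_over_points:
  assumes "\<pi> \<in> perms N"
  shows "(\<Sum>i=1..N. f (orbit \<pi> i)) = (\<Sum>C\<in>cycle_sets N \<pi>. real (card C) * f C)"
proof -
  note P = orbit_partition[OF assms]
  have "(\<Sum>i\<in>\<Union> (cycle_sets N \<pi>). f (orbit \<pi> i)) = (\<Sum>C\<in>cycle_sets N \<pi>. \<Sum>i\<in>C. f (orbit \<pi> i))"
    using P(5) P(3) by (subst sum.Union_disjoint) (auto simp: disjoint_def comp_def)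
  also have "\<dots> = (\<Sum>C\<in>cycle_sets N \<pi>. \<Sum>i\<in>C. f C)" using P(4) by (intro sum.cong) auto
  finally show ?thesis using P(2) by simp
qed

lemma prod_over_points:
  fixes f :: "nat set \<Rightarrow> real"
  assumes "\<pi> \<in> perms N"
  shows "(\<Prod>i=1..N. f (orbit \<pi> i)) = (\<Prod>C\<in>cycle_sets N \<pi>. f C ^ card C)"
proof -
  note P = orbit_partition[OF assms]
  have "(\<Prod>i\<in>\<Union> (cycle_sets N \<pi>). f (orbit \<pi> i)) = (\<Prod>C\<in>cycle_sets N \<pi>. \<Prod>i\<in>C. f (orbit \<pi> i))"
    using P(5) P(3) by (subst prod.Union_disjoint) (auto simp: disjoint_def comp_def)
  also have "\<dots> = (\<Prod>C\<in>cycle_sets N \<pi>. \<Prod>i\<in>C. f C)" using P(4) by (intro prod.cong) auto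
  finally show ?thesis using P(2) by simp
qed

text \<open>Size biasing: summing over cycles with factor \<open>card C\<close> is summing over
  points, and by symmetry each of the \<open>N\<close> points contributes the same rooted
  sum.\<close>

lemma sum_cycle_weight_length:
  assumes N: "0 < N"
  shows "(\<Sum>\<pi>\<in>perms N. cycle_weight u (cycle_sets N \<pi>) * (\<Sum>C\<in>cycle_sets N \<pi>. real (card C) * f (card C)))
    = fact N * (\<Sum>j=1..N. f j * u j * hcoef u (N - j))"
proof -
  have one: "(\<Sum>\<pi>\<in>perms N. cycle_weight u (cycle_sets N \<pi>) * f (card (orbit \<pi> i)))
     = fact (N - 1) * (\<Sum>j=1..N. f j * u j * hcoef u (N - j))" if i: "i \<in> {1..N}" for i
  proof -
    have "cycle_weight u (cycle_sets N \<pi>) * f (card (orbit \<pi> i)) =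
       (f (card (orbit \<pi> i)) * u (card (orbit \<pi> i))) * cycle_weight u (orbit \<pi> ` {1..N} - {orbit \<pi> i})" for \<pi>
    proof -
      have "cycle_weight u (cycle_sets N \<pi>) = u (card (orbit \<pi> i)) * cycle_weight u (orbit \<pi> ` {1..N} - {orbit \<pi> i})"
        unfolding cycle_weight_def cycle_sets_def using i by (intro prod.remove) auto
      then show ?thesis by simp
    qed
    then have "(\<Sum>\<pi>\<in>perms N. cycle_weight u (cycle_sets N \<pi>) * f (card (orbit \<pi> i))) =
      (\<Sum>\<pi> | \<pi> permutes {1..N}. (f (card (orbit \<pi> i)) * u (card (orbit \<pi> i))) * cycle_weight u (orbit \<pi> ` {1..N} - {orbit \<pi> i}))"
      by (simp only: perms_def)
    then show ?thesis using cycle_weight_rooted(1)[of "{1..N}" i "\<lambda>j. f j * u j" u] i by simp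
  qed
  have "(\<Sum>\<pi>\<in>perms N. cycle_weight u (cycle_sets N \<pi>) * (\<Sum>C\<in>cycle_sets N \<pi>. real (card C) * f (card C)))
     = (\<Sum>\<pi>\<in>perms N. \<Sum>i=1..N. cycle_weight u (cycle_sets N \<pi>) * f (card (orbit \<pi> i)))"
    by (intro sum.cong refl) (simp only: sum_over_points[symmetric, of _ N "\<lambda>C. f (card C)"] sum_distrib_left)
  also have "\<dots> = (\<Sum>i=1..N. \<Sum>\<pi>\<in>perms N. cycle_weight u (cycle_sets N \<pi>) * f (card (orbit \<pi> i)))" by (rule sum.swap)
  also have "\<dots> = (\<Sum>i=1..N. fact (N - 1) * (\<Sum>j=1..N. f j * u j * hcoef u (N - j)))" using one by (intro sum.cong) auto
  also have "\<dots> = fact N * (\<Sum>j=1..N. f j * u j * hcoef u (N - j))" using N by (cases N) auto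
  finally show ?thesis .
qed

lemma cycle_length_mset:
  assumes \<pi>: "\<pi> \<in> perms N"
  defines "xs \<equiv> sorted_cycle_lengths N \<pi>"
  shows "mset xs = image_mset card (mset_set (cycle_sets N \<pi>))"
    and "length xs \<le> i \<Longrightarrow> cycle_length N \<pi> i = 0"
    and "i \<le> j \<Longrightarrow> cycle_length N \<pi> j \<le> cycle_length N \<pi> i"
    and "(\<Prod>i<length xs. h (cycle_length N \<pi> i)) = (\<Prod>C\<in>cycle_sets N \<pi>. h (card C) :: real)"
    and "(\<Sum>i<length xs. h (cycle_length N \<pi> i)) = (\<Sum>C\<in>cycle_sets N \<pi>. h (card C) :: real)"
proof -
  note P = orbit_partition[OF \<pi>]
  show m: "mset xs = image_mset card (mset_set (cycle_sets N \<pi>))" by (simp add: xs_def sorted_cycle_lengths_def)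
  have nth: "cycle_length N \<pi> i = xs ! i" if "i < length xs" for i using that by (simp add: cycle_length_def xs_def)
  show zero: "cycle_length N \<pi> i = 0" if "length xs \<le> i" for i using that by (simp add: cycle_length_def xs_def)
  show "cycle_length N \<pi> j \<le> cycle_length N \<pi> i" if "i \<le> j"
  proof (cases "j < length xs")
    case True
    have "sorted (rev xs)" by (simp add: xs_def sorted_cycle_lengths_def)
    then have "xs ! j \<le> xs ! i" using that True by (simp add: sorted_rev_nth_mono)
    then show ?thesis using nth that True by simp
  qed (simp add: zero)
  have "(\<Prod>i<length xs. h (cycle_length N \<pi> i)) = (\<Prod>i<length xs. h (xs ! i))" using nth by (intro prod.cong) auto
  also have "\<dots> = prod_list (map h xs)" by (simp add: prod.list_conv_set_nth atLeast0LessThan)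
  also have "\<dots> = prod_mset (image_mset h (mset xs))" by (metis mset_map prod_mset_prod_list)
  also have "\<dots> = (\<Prod>C\<in>cycle_sets N \<pi>. h (card C))" unfolding m by (simp add: image_mset.compositionality comp_def prod_unfold_prod_mset)
  finally show "(\<Prod>i<length xs. h (cycle_length N \<pi> i)) = (\<Prod>C\<in>cycle_sets N \<pi>. h (card C))" .
  have "(\<Sum>i<length xs. h (cycle_length N \<pi> i)) = (\<Sum>i<length xs. h (xs ! i))" using nth by (intro sum.cong) auto
  also have "\<dots> = sum_list (map h xs)" by (simp add: sum_list_sum_nth atLeast0LessThan)
  also have "\<dots> = sum_mset (image_mset h (mset xs))" by (metis mset_map sum_mset_sum_list)
  also have "\<dots> = (\<Sum>C\<in>cycle_sets N \<pi>. h (card C))" unfolding m by (simp add: image_mset.compositionality comp_def sum_unfold_sum_mset)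
  finally show "(\<Sum>i<length xs. h (cycle_length N \<pi> i)) = (\<Sum>C\<in>cycle_sets N \<pi>. h (card C))" .
qed

section \<open>Condensation in the zero mode\<close>

text \<open>\<open>m N j\<close> stands for the sum of \<open>exp (- j \<epsilon> k)\<close> over the nonzero modes \<open>k\<close>, in a box that contains \<open>N\<close> points.\<close>

locale canonical_ensemble = cycle_weights t \<theta> c0 C0 C for t \<theta> c0 C0 C +
  fixes m :: "nat \<Rightarrow> nat \<Rightarrow> real" and \<gamma> :: "nat \<Rightarrow> real" and s c :: real
  assumes m_nonneg: "0 \<le> m N j"
    and m_lim: "1 \<le> j \<Longrightarrow> (\<lambda>N. m N j / real N) \<longlonglongrightarrow> \<gamma> j"
    and m_tail: "0 < e \<Longrightarrow> \<exists>J. eventually (\<lambda>N. (\<Sum>j\<in>{J<..N}. m N j) \<le> e * real N) sequentially"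
    and m_decay: "eventually (\<lambda>N. \<forall>j\<ge>1. \<forall>i. m N (j + i) \<le> exp (- (c * real N powr (- s)) * real i) * m N j) sequentially"
    and s: "0 \<le> s" "s < 1" and c: "0 < c"
begin

definition "w N j = t j + t j * m N j"

definition "Y N n = hcoef (w N) n"

abbreviation "B N \<equiv> hcoef (\<lambda>j. t j * m N j)"

lemma t_nonneg: "1 \<le> j \<Longrightarrow> 0 \<le> t j" using t_pos[of j] by simp

lemma lam_nonneg: "1 \<le> j \<Longrightarrow> 0 \<le> t j * m N j" using t_nonneg m_nonneg by simp

lemma w_ge: "1 \<le> j \<Longrightarrow> c0 \<le> w N j" unfolding w_def using t_lower[of j] lam_nonneg[of j N] by linarith

lemma w_pos: "1 \<le> j \<Longrightarrow> 0 < w N j" using w_ge[of j N] c0 by linarith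

lemma Y_pos: "0 < Y N n" unfolding Y_def by (intro hcoef_pos w_pos)

lemma B_nonneg: "0 \<le> B N n" by (intro hcoef_nonneg lam_nonneg)

lemma Y_split: "Y N n = (\<Sum>M\<le>n. A M * B N (n - M))" unfolding Y_def w_def[abs_def] by (rule hcoef_add)

lemma Y_ge: "1 \<le> j \<Longrightarrow> j \<le> n \<Longrightarrow> c0 / real n * Y N (n - j) \<le> Y N n"
proof -
  assume j: "1 \<le> j" "j \<le> n"
  have "c0 * Y N (n - j) / real n \<le> w N j * Y N (n - j) / real n"
    using j w_ge[of j N] Y_pos[of N "n - j"] by (intro divide_right_mono mult_right_mono) auto
  also have "\<dots> \<le> Y N n" unfolding Y_def using j by (intro hcoef_ge_term) (auto intro!: less_imp_le[OF w_pos])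
  finally show ?thesis by simp
qed

lemma m_sum_bound: obtains C1 where "0 < C1" "eventually (\<lambda>N. (\<Sum>j=1..N. m N j) \<le> C1 * real N) sequentially"
proof -
  obtain J where J: "eventually (\<lambda>N. (\<Sum>j\<in>{J<..N}. m N j) \<le> 1 * real N) sequentially" using m_tail[of 1] by auto
  have "(\<lambda>N. \<Sum>j=1..J. m N j / real N) \<longlonglongrightarrow> (\<Sum>j=1..J. \<gamma> j)" by (intro tendsto_sum m_lim) auto
  then have "eventually (\<lambda>N. (\<Sum>j=1..J. m N j / real N) < (\<Sum>j=1..J. \<gamma> j) + 1) sequentially" by (rule order_tendstoD) simp
  then have "eventually (\<lambda>N. (\<Sum>j=1..N. m N j) \<le> (max 0 (\<Sum>j=1..J. \<gamma> j) + 2) * real N) sequentially" using J eventually_gt_at_top[of 0]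
  proof eventually_elim
    case (elim N)
    have "(\<Sum>j=1..N. m N j) \<le> (\<Sum>j\<in>{1..J} \<union> {J<..N}. m N j)" using m_nonneg by (intro sum_mono2) auto
    also have "\<dots> = (\<Sum>j=1..J. m N j) + (\<Sum>j\<in>{J<..N}. m N j)" by (rule sum.union_disjoint) auto
    also have "(\<Sum>j=1..J. m N j) = (\<Sum>j=1..J. m N j / real N) * real N" using elim(3) by (simp add: sum_distrib_right)
    also have "\<dots> \<le> ((\<Sum>j=1..J. \<gamma> j) + 1) * real N" using elim(1) by (intro mult_right_mono) auto
    also have "\<dots> \<le> (max 0 (\<Sum>j=1..J. \<gamma> j) + 1) * real N" by (intro mult_right_mono) auto
    finally show ?case using elim(2) by (simp add: algebra_simps)
  qed
  then show ?thesis by (intro that[of "max 0 (\<Sum>j=1..J. \<gamma> j) + 2"]) auto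
qed

lemma lam_sum_le: "(\<Sum>j\<in>I. t j * m N j) \<le> C0 * (\<Sum>j\<in>I. m N j)" if "I \<subseteq> {1..}"
  unfolding sum_distrib_left using that t_upper m_nonneg by (intro sum_mono mult_right_mono) auto

lemma gamma_nonneg: "1 \<le> j \<Longrightarrow> 0 \<le> \<gamma> j" using m_lim m_nonneg by (intro tendsto_lowerbound[OF m_lim]) auto

text \<open>The ratio of the critical density to the density, see
  \<open>critical_density_eq\<close>; \<kappa> < 1 is the condensed phase.\<close>

definition "\<kappa> = (\<Sum>n. t (Suc n) * \<gamma> (Suc n))"

text \<open>The uniform tail bound \<open>m_tail\<close> prevents mass from escaping to large
  \<open>j\<close>, so limit and sum may be interchanged; in particular \<kappa> is finite.\<close>

lemma lam_lim:
  shows "summable (\<lambda>n. t (Suc n) * \<gamma> (Suc n))"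
    and "(\<lambda>N. (\<Sum>j=1..N. t j * m N j) / real N) \<longlonglongrightarrow> \<kappa>"
proof -
  obtain C1 where C1: "0 < C1" "eventually (\<lambda>N. (\<Sum>j=1..N. m N j) \<le> C1 * real N) sequentially" by (rule m_sum_bound)
  have reidx: "(\<Sum>n<J. t (Suc n) * \<gamma> (Suc n)) = (\<Sum>j=1..J. t j * \<gamma> j)" for J by (rule sum.reindex_bij_witness[of _ "\<lambda>j. j - 1" Suc]) auto
  have lim: "(\<lambda>N. (\<Sum>j=1..J. t j * m N j) / real N) \<longlonglongrightarrow> (\<Sum>j=1..J. t j * \<gamma> j)" for J
  proof -
    have "(\<lambda>N. \<Sum>j=1..J. t j * (m N j / real N)) \<longlonglongrightarrow> (\<Sum>j=1..J. t j * \<gamma> j)" by (intro tendsto_intros m_lim) auto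
    then show ?thesis by (simp add: sum_divide_distrib)
  qed
  have nn: "0 \<le> t (Suc n) * \<gamma> (Suc n)" for n using t_nonneg gamma_nonneg by simp
  have bd: "(\<Sum>j=1..J. t j * \<gamma> j) \<le> C0 * C1" for J
  proof (rule tendsto_upperbound[OF lim])
    show "eventually (\<lambda>N. (\<Sum>j=1..J. t j * m N j) / real N \<le> C0 * C1) sequentially"
      using C1(2) eventually_ge_at_top[of J] eventually_gt_at_top[of 0]
    proof eventually_elim
      case (elim N)
      have "(\<Sum>j=1..J. t j * m N j) \<le> (\<Sum>j=1..N. t j * m N j)" using elim lam_nonneg by (intro sum_mono2) auto
      also have "\<dots> \<le> C0 * (\<Sum>j=1..N. m N j)" by (rule lam_sum_le) auto
      also have "\<dots> \<le> C0 * (C1 * real N)" using elim C0_pos by (intro mult_left_mono) auto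
      finally show ?case using elim by (simp add: field_simps)
    qed
  qed simp
  show sm: "summable (\<lambda>n. t (Suc n) * \<gamma> (Suc n))"
  proof (rule bounded_imp_summable)
    show "(\<Sum>k\<le>n. t (Suc k) * \<gamma> (Suc k)) \<le> C0 * C1" for n using bd[of "Suc n"] reidx[of "Suc n"] by (simp add: lessThan_Suc_atMost)
  qed (rule nn)
  show "(\<lambda>N. (\<Sum>j=1..N. t j * m N j) / real N) \<longlonglongrightarrow> \<kappa>"
  proof (rule LIMSEQ_I)
    fix e :: real assume e: "0 < e"
    obtain J1 where J1: "eventually (\<lambda>N. (\<Sum>j\<in>{J1<..N}. m N j) \<le> e / (3 * C0) * real N) sequentially"
      using m_tail[of "e / (3 * C0)"] e C0_pos by auto
    have "(\<lambda>J. (\<Sum>n<J. t (Suc n) * \<gamma> (Suc n))) \<longlonglongrightarrow> \<kappa>" unfolding \<kappa>_def using sm by (rule summable_LIMSEQ)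
    from tendstoD[OF this, of "e / 3"] e
    have "eventually (\<lambda>J. \<bar>(\<Sum>j=1..J. t j * \<gamma> j) - \<kappa>\<bar> < e / 3) sequentially" unfolding reidx by (simp add: dist_real_def)
    then obtain J where J: "J1 \<le> J" "\<bar>(\<Sum>j=1..J. t j * \<gamma> j) - \<kappa>\<bar> < e / 3"
      using eventually_ge_at_top[of J1] by (metis (mono_tags, lifting) eventually_sequentially nle_le)
    have "eventually (\<lambda>N. \<bar>(\<Sum>j=1..J. t j * m N j) / real N - (\<Sum>j=1..J. t j * \<gamma> j)\<bar> < e / 3) sequentially"
      using tendstoD[OF lim, of "e / 3" J] e by (simp add: dist_real_def)
    then have "eventually (\<lambda>N. norm ((\<Sum>j=1..N. t j * m N j) / real N - \<kappa>) < e) sequentially"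
      using J1 eventually_ge_at_top[of J] eventually_gt_at_top[of 0]
    proof eventually_elim
      case (elim N)
      have "{1..N} = {1..J} \<union> {J<..N}" using elim(3) by auto
      then have "(\<Sum>j=1..N. t j * m N j) = (\<Sum>j=1..J. t j * m N j) + (\<Sum>j\<in>{J<..N}. t j * m N j)"
        by (simp only:) (rule sum.union_disjoint, auto)
      then have "(\<Sum>j=1..N. t j * m N j) / real N = (\<Sum>j=1..J. t j * m N j) / real N + (\<Sum>j\<in>{J<..N}. t j * m N j) / real N"
        by (simp add: add_divide_distrib)
      moreover have "(\<Sum>j\<in>{J<..N}. t j * m N j) / real N \<le> e / 3"
      proof -
        have "(\<Sum>j\<in>{J<..N}. t j * m N j) \<le> C0 * (\<Sum>j\<in>{J<..N}. m N j)" by (rule lam_sum_le) auto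
        also have "(\<Sum>j\<in>{J<..N}. m N j) \<le> (\<Sum>j\<in>{J1<..N}. m N j)" using J(1) m_nonneg by (intro sum_mono2) auto
        also have "\<dots> \<le> e / (3 * C0) * real N" using elim by simp
        finally show ?thesis using C0_pos elim by (simp add: field_simps)
      qed
      moreover have "0 \<le> (\<Sum>j\<in>{J<..N}. t j * m N j) / real N" using lam_nonneg by (intro divide_nonneg_nonneg sum_nonneg) auto
      ultimately show ?case using elim(1) J(2) unfolding real_norm_def by linarith
    qed
    then show "\<exists>no. \<forall>N\<ge>no. norm ((\<Sum>j=1..N. t j * m N j) / real N - \<kappa>) < e" by (simp add: eventually_sequentially)
  qed
qed

abbreviation "tilted_mean N \<tau> \<equiv> \<Sum>j=1..N. real j * (t j * m N j) * exp (\<tau> * real N powr (- s) * real j)"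

text \<open>This bounds the quadratic term of the Chernoff estimate. Decay over half the index gives
  m N j a factor exp (- r (j - 1) / 2) times the value at half the index, with r = c N^(- s). The
  tilt uses at most r j / 4 of this exponent, and the rest absorbs the factor \<open>j\<close> at
  the price 4 / r, of order N^s; the sum of m N over the halved indices is of order N.\<close>

lemma variance_bound:
  obtains C2 where "0 < C2" "eventually (\<lambda>N. \<forall>\<tau>. 0 \<le> \<tau> \<longrightarrow> \<tau> \<le> c / 4 \<longrightarrow>
     tilted_mean N \<tau> \<le> C2 * real N powr (1 + s)) sequentially"
proof -
  obtain C1 where C1: "0 < C1" "eventually (\<lambda>N. (\<Sum>j=1..N. m N j) \<le> C1 * real N) sequentially" by (rule m_sum_bound)
  define C2 where "C2 = C0 * (4 / c) * exp (c / 2) * (2 * C1)"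
  show ?thesis
  proof (rule that)
    show "0 < C2" using C0_pos C1 c by (simp add: C2_def)
    show "eventually (\<lambda>N. \<forall>\<tau>. 0 \<le> \<tau> \<longrightarrow> \<tau> \<le> c / 4 \<longrightarrow>
     tilted_mean N \<tau> \<le> C2 * real N powr (1 + s)) sequentially" using C1(2) m_decay eventually_ge_at_top[of 1]
    proof (eventually_elim, intro allI impI)
      case (elim N)
      fix \<tau> :: real assume \<tau>: "0 \<le> \<tau>" "\<tau> \<le> c / 4"
      define r where "r = c * real N powr (- s)"
      have r: "0 < r" "r \<le> c" using elim c s powr_mono[of "-s" 0 "real N"] by (auto simp: r_def mult_left_le)
      \<comment> \<open>Rounding up keeps the index at least 1. The map is injective on the even and
        on the odd numbers, whence the factor 2 below.\<close>
      define h :: "nat \<Rightarrow> nat" where "h j = (j + 1) div 2" for j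
      have bnd: "real j * (t j * m N j) * exp (\<tau> * real N powr (- s) * real j) \<le> C0 * (4 / r) * exp (c / 2) * m N (h j)"
        if j: "j \<in> {1..N}" for j
      proof -
        have hj: "1 \<le> h j" "h j + (j div 2) = j" "real j - 1 \<le> 2 * real (j div 2)" using j by (auto simp: h_def)
        have "m N j \<le> exp (- r * real (j div 2)) * m N (h j)" using elim(2)[rule_format, of "h j" "j div 2"] hj by (simp add: r_def)
        also have "\<dots> \<le> exp (- r * ((real j - 1) / 2)) * m N (h j)" using hj r m_nonneg by (intro mult_right_mono) auto
        finally have mj: "m N j \<le> exp (- r * ((real j - 1) / 2)) * m N (h j)" .
        have \<tau>r: "\<tau> * real N powr (- s) \<le> r / 4" using mult_right_mono[OF \<tau>(2), of "real N powr (- s)"] by (simp add: r_def)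
        have "real j * (t j * m N j) * exp (\<tau> * real N powr (- s) * real j)
          \<le> real j * (C0 * (exp (- r * ((real j - 1) / 2)) * m N (h j))) * exp (r / 4 * real j)"
          using mj \<tau>r t_upper[of j] t_nonneg[of j] j m_nonneg C0_pos by (intro mult_mono mult_left_mono) (auto intro!: mult_right_mono)
        also have "\<dots> = C0 * (real j * (exp (- r * ((real j - 1) / 2)) * exp (r / 4 * real j))) * m N (h j)" by simp
        also have "exp (- r * ((real j - 1) / 2)) * exp (r / 4 * real j) = exp (r / 2) * exp (- (r / 4 * real j))"
          by (simp flip: exp_add add: field_simps)
        also have "real j * (exp (r / 2) * exp (- (r / 4 * real j))) = (4 / r) * exp (r / 2) * ((r / 4 * real j) * exp (- (r / 4 * real j)))"
          using r by simp
        also have "C0 * \<dots> * m N (h j) \<le> C0 * ((4 / r) * exp (c / 2) * 1) * m N (h j)"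
        proof (intro mult_right_mono mult_left_mono mult_mono)
          have "r / 4 * real j \<le> exp (r / 4 * real j)" using exp_ge_add_one_self[of "r / 4 * real j"] by linarith
          then show "r / 4 * real j * exp (- (r / 4 * real j)) \<le> 1" by (simp add: exp_minus field_simps)
        qed (use r C0_pos m_nonneg in auto)
        finally show ?thesis by simp
      qed
      have half: "(\<Sum>j\<in>A. m N (h j)) \<le> (\<Sum>j=1..N. m N j)" if "A \<subseteq> {1..N}" "inj_on h A" for A
      proof -
        have "(\<Sum>j\<in>A. m N (h j)) = (\<Sum>i\<in>h ` A. m N i)" using that(2) by (simp add: sum.reindex)
        also have "\<dots> \<le> (\<Sum>j=1..N. m N j)" using m_nonneg that(1) by (intro sum_mono2) (force simp: h_def)+
        finally show ?thesis .
      qed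
      let ?E = "{1..N} \<inter> {j. even j}" and ?O = "{1..N} \<inter> {j. odd j}"
      have "(\<Sum>j=1..N. m N (h j)) = (\<Sum>j\<in>?E. m N (h j)) + (\<Sum>j\<in>?O. m N (h j))"
        by (subst sum.union_disjoint[symmetric]) (auto intro: sum.cong)
      moreover have "inj_on h ?E" by (rule inj_onI) (auto simp: h_def elim!: evenE)
      moreover have "inj_on h ?O" by (rule inj_onI) (auto simp: h_def elim!: oddE)
      ultimately have "(\<Sum>j=1..N. m N (h j)) \<le> 2 * (\<Sum>j=1..N. m N j)" using half[of ?E] half[of ?O] by simp
      then have hs: "(\<Sum>j=1..N. m N (h j)) \<le> 2 * (C1 * real N)" using elim(1) by linarith
      have "tilted_mean N \<tau>
        \<le> (\<Sum>j=1..N. C0 * (4 / r) * exp (c / 2) * m N (h j))" by (rule sum_mono[OF bnd])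
      also have "\<dots> = C0 * (4 / r) * exp (c / 2) * (\<Sum>j=1..N. m N (h j))" by (simp add: sum_distrib_left)
      also have "\<dots> \<le> C0 * (4 / r) * exp (c / 2) * (2 * (C1 * real N))" using hs r C0_pos by (intro mult_left_mono) auto
      also have "\<dots> = C2 * real N powr (1 + s)" using elim(3) c by (simp add: C2_def r_def powr_add powr_minus field_simps)
      finally show "tilted_mean N \<tau> \<le> C2 * real N powr (1 + s)" .
    qed
  qed
qed

text \<open>Truncation at \<open>N\<close> gives finite support, so that the series can be evaluated
  at 1, and does not change the coefficients up to \<open>N\<close>.\<close>

definition "lam_trunc N j = (if j \<le> N then t j * m N j else 0)"

definition "log_total N = (\<Sum>j=1..N. t j * m N j / real j)"

lemma lam_trunc:
  "1 \<le> j \<Longrightarrow> 0 \<le> lam_trunc N j" "N < j \<Longrightarrow> lam_trunc N j = 0" "n \<le> N \<Longrightarrow> hcoef (lam_trunc N) n = B N n"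
  "hcoef (lam_trunc N) sums exp (log_total N)"
proof -
  show 1: "1 \<le> j \<Longrightarrow> 0 \<le> lam_trunc N j" "N < j \<Longrightarrow> lam_trunc N j = 0" for j using lam_nonneg by (auto simp: lam_trunc_def)
  show "n \<le> N \<Longrightarrow> hcoef (lam_trunc N) n = B N n" by (rule hcoef_cong) (simp add: lam_trunc_def)
  have "hcoef (lam_trunc N) sums exp (\<Sum>j=1..N. lam_trunc N j / real j)" by (rule hcoef_finite_sums[OF 1])
  then show "hcoef (lam_trunc N) sums exp (log_total N)" by (simp add: log_total_def lam_trunc_def)
qed

text \<open>The tilt is \<tau> N^(- s): its linear gain is \<tau> \<delta> N^(1 - s) / 2 and its
  quadratic cost at most \<tau>^2 \<open>C2\<close> N^(1 - s), so a small constant \<tau> leaves a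
  gain of order N^(1 - s). Half of \<delta> is spent on replacing the exact mean by \<kappa>
  N.\<close>

lemma lam_concentration:
  assumes "0 < \<delta>"
  obtains c' where "0 < c'" "eventually (\<lambda>N. \<forall>I. finite I \<longrightarrow> (\<forall>n\<in>I. \<delta> * real N \<le> \<bar>real n - \<kappa> * real N\<bar>) \<longrightarrow>
     (\<Sum>n\<in>I. hcoef (lam_trunc N) n) \<le> 2 * exp (log_total N) * exp (- (c' * real N powr (1 - s)))) sequentially"
proof -
  obtain C2 where C2: "0 < C2" and V: "eventually (\<lambda>N. \<forall>\<tau>. 0 \<le> \<tau> \<longrightarrow> \<tau> \<le> c / 4 \<longrightarrow>
     tilted_mean N \<tau> \<le> C2 * real N powr (1 + s)) sequentially" by (rule variance_bound)
  \<comment> \<open>The first bound keeps the tilt within the range of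
    \<open>variance_bound\<close>; the second makes the quadratic cost at most half of the linear
    gain.\<close>
  define \<tau> where "\<tau> = min (c / 4) (\<delta> / (4 * C2))"
  have \<tau>: "0 < \<tau>" "\<tau> \<le> c / 4" "\<tau> * C2 \<le> \<delta> / 4" using c C2 assms by (auto simp: \<tau>_def min_def field_simps)
  show ?thesis
  proof (rule that)
    show "0 < \<tau> * \<delta> / 4" using \<tau> assms by simp
    have "eventually (\<lambda>N. \<bar>(\<Sum>j=1..N. t j * m N j) / real N - \<kappa>\<bar> < \<delta> / 2) sequentially"
      using tendstoD[OF lam_lim(2), of "\<delta> / 2"] assms by (simp add: dist_real_def)
    then show "eventually (\<lambda>N. \<forall>I. finite I \<longrightarrow> (\<forall>n\<in>I. \<delta> * real N \<le> \<bar>real n - \<kappa> * real N\<bar>) \<longrightarrow>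
     (\<Sum>n\<in>I. hcoef (lam_trunc N) n) \<le> 2 * exp (log_total N) * exp (- (\<tau> * \<delta> / 4 * real N powr (1 - s)))) sequentially"
      using V eventually_gt_at_top[of 0]
    proof (eventually_elim, intro allI impI)
      case (elim N)
      fix I :: "nat set" assume I: "finite I" "\<forall>n\<in>I. \<delta> * real N \<le> \<bar>real n - \<kappa> * real N\<bar>"
      let ?\<mu> = "\<Sum>j=1..N. lam_trunc N j" and ?\<sigma> = "\<tau> * real N powr (- s)"
      let ?V = "\<Sum>j=1..N. real j * lam_trunc N j * exp (?\<sigma> * real j)"
      have \<mu>: "?\<mu> = (\<Sum>j=1..N. t j * m N j)" by (intro sum.cong) (auto simp: lam_trunc_def)
      have "\<bar>?\<mu> / real N - \<kappa>\<bar> * real N \<le> \<delta> / 2 * real N" using elim(1) unfolding \<mu> by (intro mult_right_mono) auto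
      moreover have "\<bar>?\<mu> / real N - \<kappa>\<bar> * real N = \<bar>?\<mu> - \<kappa> * real N\<bar>"
      proof -
        have "\<bar>?\<mu> / real N - \<kappa>\<bar> * real N = \<bar>(?\<mu> / real N - \<kappa>) * real N\<bar>" by (simp add: abs_mult)
        then show ?thesis using elim by (simp add: algebra_simps)
      qed
      ultimately have I': "\<delta> / 2 * real N \<le> \<bar>real n - ?\<mu>\<bar>" if "n \<in> I" for n using I(2)[rule_format, OF that] by linarith
      have "(\<Sum>n\<in>I. hcoef (lam_trunc N) n) \<le> 2 * exp ((\<Sum>j=1..N. lam_trunc N j / real j) - ?\<sigma> * (\<delta> / 2 * real N) + ?\<sigma>\<^sup>2 * ?V)"
        using \<tau> I(1) I' by (intro hcoef_chernoff lam_trunc) auto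
      also have "(\<Sum>j=1..N. lam_trunc N j / real j) = log_total N" by (simp add: log_total_def lam_trunc_def)
      finally have le: "(\<Sum>n\<in>I. hcoef (lam_trunc N) n) \<le> 2 * exp (log_total N - ?\<sigma> * (\<delta> / 2 * real N) + ?\<sigma>\<^sup>2 * ?V)" .
      have V: "?V \<le> C2 * real N powr (1 + s)"
      proof -
        have "?V = tilted_mean N \<tau>" by (intro sum.cong) (auto simp: lam_trunc_def)
        then show ?thesis using elim(2) \<tau> by simp
      qed
      have "?\<sigma>\<^sup>2 * ?V \<le> ?\<sigma>\<^sup>2 * (C2 * real N powr (1 + s))" by (rule mult_left_mono[OF V]) simp
      also have "\<dots> = \<tau> * (\<tau> * C2) * real N powr (1 - s)"
      proof -
        have "(real N powr (- s))\<^sup>2 * real N powr (1 + s) = real N powr (1 - s)"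
          using elim(3) by (simp add: power2_eq_square powr_add[symmetric])
        then show ?thesis by (simp add: power_mult_distrib power2_eq_square mult_ac)
      qed
      also have "\<dots> \<le> \<tau> * (\<delta> / 4) * real N powr (1 - s)" using \<tau> by (intro mult_right_mono mult_left_mono) auto
      finally have e1: "?\<sigma>\<^sup>2 * ?V \<le> \<tau> * (\<delta> / 4) * real N powr (1 - s)" .
      have e2: "?\<sigma> * (\<delta> / 2 * real N) = \<tau> * (\<delta> / 2) * real N powr (1 - s)"
      proof -
        have "real N powr (- s) * real N = real N powr (1 - s)" using elim(3) by (simp add: powr_diff powr_minus field_simps)
        then show ?thesis by (simp add: mult_ac)
      qed
      have "log_total N - ?\<sigma> * (\<delta> / 2 * real N) + ?\<sigma>\<^sup>2 * ?V \<le> log_total N + - (\<tau> * \<delta> / 4 * real N powr (1 - s))"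
        using e1 unfolding e2 by (simp add: algebra_simps)
      then have "exp (log_total N - ?\<sigma> * (\<delta> / 2 * real N) + ?\<sigma>\<^sup>2 * ?V) \<le> exp (log_total N) * exp (- (\<tau> * \<delta> / 4 * real N powr (1 - s)))"
        unfolding exp_add[symmetric] by simp
      with le show "(\<Sum>n\<in>I. hcoef (lam_trunc N) n) \<le> 2 * exp (log_total N) * exp (- (\<tau> * \<delta> / 4 * real N powr (1 - s)))" by linarith
    qed
  qed
qed

lemma A_le_powr: obtains K where "0 < K" "\<And>n N. n \<le> N \<Longrightarrow> 1 \<le> N \<Longrightarrow> A n \<le> K * real N powr \<theta>"
proof -
  have "Bseq (\<lambda>n. A n / real n powr (\<theta> - 1))" using asymp by (intro convergent_imp_Bseq) (auto simp: convergent_def)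
  then obtain K where K: "0 < K" "\<And>n. norm (A n / real n powr (\<theta> - 1)) \<le> K" by (auto simp: Bseq_def simp del: real_norm_def)
  show ?thesis
  proof (rule that[of "K + 1"])
    fix n N :: nat assume n: "n \<le> N" "1 \<le> N"
    have N1: "1 \<le> real N powr \<theta>" using n theta_pos by (simp add: ge_one_powr_ge_zero)
    show "A n \<le> (K + 1) * real N powr \<theta>"
    proof (cases "n = 0")
      case True
      then show ?thesis using N1 K(1) mult_mono[of 1 "K + 1" 1 "real N powr \<theta>"] by simp
    next
      case False
      have "A n \<le> K * real n powr (\<theta> - 1)" using K(2)[of n] False A_pos[of n] by (simp add: divide_le_eq)
      \<comment> \<open>The exponent is raised to \<theta>, which is positive, because n^(\<theta> -
        1) need not increase with \<open>n\<close>.\<close>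
      also have "real n powr (\<theta> - 1) \<le> real n powr \<theta>" using False by (intro powr_mono) auto
      also have "real n powr \<theta> \<le> real N powr \<theta>" using n theta_pos by (intro powr_mono2) auto
      finally show ?thesis using K(1) N1 by (simp add: algebra_simps)
    qed
  qed (use K in auto)
qed

lemma A_ge: "n \<le> N \<Longrightarrow> min 1 c0 / (real N + 1) \<le> A n"
proof (cases "n = 0")
  case True
  have "min 1 c0 / (real N + 1) \<le> 1" using c0 by (simp add: divide_le_eq)
  then show ?thesis using True by simp
next
  case False
  assume n: "n \<le> N"
  have "min 1 c0 / (real N + 1) \<le> c0 / real n" using n False c0 by (intro frac_le) auto
  also have "\<dots> \<le> t n * A (n - n) / real n" using False t_lower[of n] by (simp add: divide_right_mono)
  also have "\<dots> \<le> A n" using False t_nonneg by (intro hcoef_ge_term) auto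
  finally show ?thesis .
qed

end

context canonical_ensemble
begin

text \<open>The law of the number of points in the zero mode.\<close>

definition "zero_mode N M = A M * B N (N - M) / Y N N"

lemma zero_mode_nonneg: "0 \<le> zero_mode N M" using A_pos[of M] B_nonneg[of N "N - M"] Y_pos[of N N] by (simp add: zero_mode_def)

lemma zero_mode_sum: "(\<Sum>M\<le>N. zero_mode N M) = 1"
  using Y_pos[of N N] unfolding zero_mode_def sum_divide_distrib[symmetric] Y_split[symmetric] by simp

text \<open>For \<kappa> < 1, exceeding \<open>N\<close> is a deviation of at least (1 - \<kappa>)
  N, so the coefficients of the nonzero modes up to \<open>N\<close> carry at least half of the
  total mass exp (\<open>log_total N\<close>). The zero mode fills up to \<open>N\<close> points at
  polynomial cost by \<open>A_ge\<close>.\<close>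

lemma Y_lower:
  assumes "\<kappa> < 1"
  shows "eventually (\<lambda>N. min 1 c0 / (real N + 1) * (exp (log_total N) / 2) \<le> Y N N) sequentially"
proof -
  obtain c' where c': "0 < c'" "eventually (\<lambda>N. \<forall>I. finite I \<longrightarrow> (\<forall>n\<in>I. (1 - \<kappa>) * real N \<le> \<bar>real n - \<kappa> * real N\<bar>) \<longrightarrow>
     (\<Sum>n\<in>I. hcoef (lam_trunc N) n) \<le> 2 * exp (log_total N) * exp (- (c' * real N powr (1 - s)))) sequentially"
    by (rule lam_concentration[of "1 - \<kappa>"]) (use assms in auto)
  have "(\<lambda>N::nat. exp (- (c' * real N powr (1 - s)))) \<longlonglongrightarrow> 0" using c'(1) s by real_asymp
  then have "eventually (\<lambda>N. exp (- (c' * real N powr (1 - s))) < 1/4) sequentially" by (rule order_tendstoD) simp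
  then show ?thesis using c'(2)
  proof eventually_elim
    case (elim N)
    have tail: "(\<Sum>n\<in>I. hcoef (lam_trunc N) n) \<le> exp (log_total N) / 2" if "finite I" "\<And>n. n \<in> I \<Longrightarrow> N < n" for I
    proof -
      have "(\<Sum>n\<in>I. hcoef (lam_trunc N) n) \<le> 2 * exp (log_total N) * exp (- (c' * real N powr (1 - s)))"
      proof (rule elim(2)[rule_format, OF that(1)])
        fix n assume "n \<in> I"
        then have "real N \<le> real n" using that(2) by (simp add: less_imp_le)
        then show "(1 - \<kappa>) * real N \<le> \<bar>real n - \<kappa> * real N\<bar>" by (simp add: algebra_simps)
      qed
      also have "\<dots> \<le> 2 * exp (log_total N) * (1/4)" using elim(1) by (intro mult_left_mono) auto
      finally show ?thesis by simp
    qed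
    have "exp (log_total N) \<le> (\<Sum>n\<le>N. B N n) + exp (log_total N) / 2"
    proof (rule LIMSEQ_le_const2)
      show "(\<lambda>n. \<Sum>i<n. hcoef (lam_trunc N) i) \<longlonglongrightarrow> exp (log_total N)" using lam_trunc(4) by (simp add: sums_def)
      have "(\<Sum>i<n. hcoef (lam_trunc N) i) \<le> (\<Sum>n\<le>N. B N n) + exp (log_total N) / 2" for n
      proof -
        have "(\<Sum>i<n. hcoef (lam_trunc N) i) \<le> (\<Sum>i\<in>{..N} \<union> {N<..<n}. hcoef (lam_trunc N) i)"
          by (intro sum_mono2 hcoef_nonneg lam_trunc) auto
        also have "\<dots> = (\<Sum>i\<le>N. hcoef (lam_trunc N) i) + (\<Sum>i\<in>{N<..<n}. hcoef (lam_trunc N) i)" by (rule sum.union_disjoint) auto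
        also have "(\<Sum>i\<le>N. hcoef (lam_trunc N) i) = (\<Sum>n\<le>N. B N n)" by (intro sum.cong lam_trunc) auto
        finally show ?thesis using tail[of "{N<..<n}"] by simp
      qed
      then show "\<exists>no. \<forall>n\<ge>no. (\<Sum>i<n. hcoef (lam_trunc N) i) \<le> (\<Sum>n\<le>N. B N n) + exp (log_total N) / 2" by blast
    qed
    then have "exp (log_total N) / 2 \<le> (\<Sum>n\<le>N. B N n)" by simp
    then have "min 1 c0 / (real N + 1) * (exp (log_total N) / 2) \<le> min 1 c0 / (real N + 1) * (\<Sum>n\<le>N. B N n)"
      using c0 by (intro mult_left_mono) auto
    also have "\<dots> = (\<Sum>M\<le>N. min 1 c0 / (real N + 1) * B N (N - M))"
      unfolding sum_distrib_left by (rule sum.reindex_bij_witness[of _ "\<lambda>M. N - M" "\<lambda>M. N - M"]) auto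
    also have "\<dots> \<le> (\<Sum>M\<le>N. A M * B N (N - M))" using B_nonneg by (intro sum_mono mult_right_mono A_ge) auto
    finally show ?case by (simp add: Y_split)
  qed
qed

abbreviation "deviation N M \<equiv> \<bar>real M / real N - (1 - \<kappa>)\<bar>"

text \<open>If the zero mode misses (1 - \<kappa>) N, the nonzero modes miss \<kappa> N by the same
  amount. The factor exp (\<open>log_total N\<close>) cancels against \<open>Y_lower\<close>, and
  what remains is a polynomial in N times exp (- c' N^(1 - s)).\<close>

lemma zero_mode_concentration:
  assumes "\<kappa> < 1" "0 < \<delta>"
  shows "(\<lambda>N. \<Sum>M | M \<le> N \<and> \<delta> \<le> deviation N M. zero_mode N M) \<longlonglongrightarrow> 0"
proof -
  obtain c' where c': "0 < c'" "eventually (\<lambda>N. \<forall>I. finite I \<longrightarrow> (\<forall>n\<in>I. \<delta> * real N \<le> \<bar>real n - \<kappa> * real N\<bar>) \<longrightarrow>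
     (\<Sum>n\<in>I. hcoef (lam_trunc N) n) \<le> 2 * exp (log_total N) * exp (- (c' * real N powr (1 - s)))) sequentially"
    by (rule lam_concentration[OF assms(2)])
  obtain K where K: "0 < K" "\<And>n N. n \<le> N \<Longrightarrow> 1 \<le> N \<Longrightarrow> A n \<le> K * real N powr \<theta>" by (rule A_le_powr) blast
  have "(\<lambda>N::nat. (real N + 1) * real N powr \<theta> * exp (- (c' * real N powr (1 - s)))) \<longlonglongrightarrow> 0" using c'(1) s by real_asymp
  from tendsto_mult_right_zero[OF this, of "4 * K / min 1 c0"]
  have z: "(\<lambda>N::nat. 4 * K / min 1 c0 * ((real N + 1) * real N powr \<theta> * exp (- (c' * real N powr (1 - s))))) \<longlonglongrightarrow> 0" .
  show ?thesis
  proof (rule tendsto_sandwich[OF _ _ tendsto_const z])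
    show "eventually (\<lambda>N. 0 \<le> (\<Sum>M | M \<le> N \<and> \<delta> \<le> deviation N M. zero_mode N M)) sequentially"
      using zero_mode_nonneg by (intro always_eventually allI sum_nonneg) auto
    show "eventually (\<lambda>N. (\<Sum>M | M \<le> N \<and> \<delta> \<le> deviation N M. zero_mode N M)
        \<le> 4 * K / min 1 c0 * ((real N + 1) * real N powr \<theta> * exp (- (c' * real N powr (1 - s))))) sequentially"
      using Y_lower[OF assms(1)] c'(2) eventually_ge_at_top[of 1]
    proof eventually_elim
      case (elim N)
      let ?I = "{M. M \<le> N \<and> \<delta> \<le> deviation N M}"
      let ?J = "(\<lambda>M. N - M) ` ?I"
      let ?E = "exp (- (c' * real N powr (1 - s)))"
      have fin: "finite ?I" by (rule finite_subset[of _ "{..N}"]) auto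
      have J: "(\<Sum>n\<in>?J. hcoef (lam_trunc N) n) \<le> 2 * exp (log_total N) * ?E"
      proof (rule elim(2)[rule_format])
        show "finite ?J" using fin by simp
        fix n assume "n \<in> ?J"
        then obtain M where M: "M \<le> N" "\<delta> \<le> deviation N M" "n = N - M" by auto
        have "\<delta> * real N \<le> deviation N M * real N" using M by (intro mult_right_mono) auto
        also have "\<dots> = \<bar>(real M / real N - (1 - \<kappa>)) * real N\<bar>" by (simp add: abs_mult)
        also have "(real M / real N - (1 - \<kappa>)) * real N = - (real n - \<kappa> * real N)"
          using M elim(3) by (simp add: of_nat_diff algebra_simps)
        finally show "\<delta> * real N \<le> \<bar>real n - \<kappa> * real N\<bar>" by simp
      qed
      have inj: "inj_on (\<lambda>M. N - M) ?I" by (rule inj_onI) auto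
      have "(\<Sum>M\<in>?I. A M * B N (N - M)) \<le> (\<Sum>M\<in>?I. K * real N powr \<theta> * hcoef (lam_trunc N) (N - M))"
        using K(2) elim(3) B_nonneg lam_trunc(3) by (intro sum_mono) (auto intro!: mult_right_mono)
      also have "\<dots> = K * real N powr \<theta> * (\<Sum>n\<in>?J. hcoef (lam_trunc N) n)" by (simp add: sum_distrib_left sum.reindex[OF inj])
      also have "\<dots> \<le> K * real N powr \<theta> * (2 * exp (log_total N) * ?E)" using J K(1) by (intro mult_left_mono) auto
      finally have num: "(\<Sum>M\<in>?I. A M * B N (N - M)) \<le> K * real N powr \<theta> * (2 * exp (log_total N) * ?E)" .
      have mpos: "0 < min 1 c0 / (real N + 1) * (exp (log_total N) / 2)" using c0 by simp
      have "(\<Sum>M\<in>?I. zero_mode N M) = (\<Sum>M\<in>?I. A M * B N (N - M)) / Y N N" by (simp add: zero_mode_def sum_divide_distrib)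
      also have "\<dots> \<le> (K * real N powr \<theta> * (2 * exp (log_total N) * ?E)) / (min 1 c0 / (real N + 1) * (exp (log_total N) / 2))"
        using num elim(1) mpos K(1) by (intro frac_le) (auto intro!: mult_nonneg_nonneg simp: less_imp_le)
      also have "\<dots> = 4 * K / min 1 c0 * ((real N + 1) * real N powr \<theta> * ?E)"
      proof -
        have "min 1 c0 \<noteq> 0" using c0 by simp
        then show ?thesis by (simp add: divide_simps)
      qed
      finally show ?case .
    qed
  qed
qed

lemma extraction:
  assumes "\<And>k. \<exists>\<^sub>F N in sequentially. Q (k::nat) (N::nat)"
  obtains r where "strict_mono r" "\<And>k. Q k (r k)"
proof -
  have ex: "\<exists>N'>N. Q k N'" for k N using assms[of k] by (auto simp: frequently_sequentially intro: Suc_le_lessD dest: spec[of _ "Suc N"])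
  have "\<exists>r. \<forall>k. Q k (r k) \<and> r k < r (Suc k)"
  proof (rule dependent_nat_choice)
    show "\<exists>N. Q 0 N" using ex by blast
    show "\<exists>N'. Q (Suc k) N' \<and> N < N'" for N k using ex[of N "Suc k"] by blast
  qed
  then show ?thesis using that by (auto simp: strict_mono_Suc_iff)
qed

text \<open>The hypothesis concerns sequences only, which is the form in which
  \<open>cycle_functional_tendsto\<close> can be applied. It implies uniform closeness to
  \<open>L\<close> near the ratio 1 - \<kappa>: otherwise violating pairs with deviation below 1 /
  (k + 1) would form a sequence contradicting it. Concentration does the rest.\<close>

lemma zero_mode_average:
  assumes \<kappa>: "\<kappa> < 1" and bd: "\<And>N M. \<bar>f N M\<bar> \<le> F"
    and lim: "\<And>r M. strict_mono r \<Longrightarrow> (\<And>k. M k \<le> r k) \<Longrightarrow> (\<lambda>k. real (M k) / real (r k)) \<longlonglongrightarrow> 1 - \<kappa> \<Longrightarrow>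
      (\<lambda>k. f (r k) (M k)) \<longlonglongrightarrow> L"
  shows "(\<lambda>N. \<Sum>M\<le>N. zero_mode N M * f N M) \<longlonglongrightarrow> L"
proof (rule LIMSEQ_I)
  fix e :: real assume e: "0 < e"
  let ?near = "\<lambda>d. eventually (\<lambda>N. \<forall>M\<le>N. deviation N M < d \<longrightarrow> \<bar>f N M - L\<bar> < e / 2) sequentially"
  have "\<exists>\<delta>>0. ?near \<delta>"
  proof (rule ccontr)
    assume neg: "\<not> ?thesis"
    define Q where "Q k N = (\<exists>M\<le>N. deviation N M < 1 / real (Suc k) \<and> e / 2 \<le> \<bar>f N M - L\<bar>)" for k N
    have "\<exists>\<^sub>F N in sequentially. Q k N" for k
    proof -
      have "\<not> ?near (1 / real (Suc k))"
      proof
        assume "?near (1 / real (Suc k))"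
        then have "\<exists>\<delta>>0. ?near \<delta>" by (intro exI[of _ "1 / real (Suc k)"] conjI) auto
        with neg show False by contradiction
      qed
      then show ?thesis unfolding not_eventually Q_def by (elim frequently_elim1) (auto simp: not_less)
    qed
    then obtain r where r: "strict_mono r" "\<And>k. Q k (r k)" using extraction[of Q] by blast
    then obtain M where M: "\<And>k. M k \<le> r k" "\<And>k. \<bar>real (M k) / real (r k) - (1 - \<kappa>)\<bar> < 1 / real (Suc k)"
       "\<And>k. e / 2 \<le> \<bar>f (r k) (M k) - L\<bar>" unfolding Q_def by metis
    have "(\<lambda>k. real (M k) / real (r k) - (1 - \<kappa>)) \<longlonglongrightarrow> 0"
      by (rule Lim_null_comparison[OF _ LIMSEQ_Suc[OF lim_1_over_n]]) (use M(2) in \<open>auto intro!: always_eventually less_imp_le simp del: of_nat_Suc\<close>)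
    then have "(\<lambda>k. f (r k) (M k)) \<longlonglongrightarrow> L" by (intro lim[OF r(1) M(1)]) (simp add: LIM_zero_iff)
    then have "eventually (\<lambda>k. \<bar>f (r k) (M k) - L\<bar> < e / 2) sequentially"
      using e by (auto dest: tendstoD[of _ _ _ "e / 2"] simp: dist_real_def)
    then show False using M(3) by (auto simp: eventually_sequentially not_less[symmetric])
  qed
  then obtain \<delta> where \<delta>: "0 < \<delta>" and
    near: "?near \<delta>" by blast
  define D where "D = F + \<bar>L\<bar> + 1"
  have D: "\<bar>f N M - L\<bar> \<le> D" "0 < D" for N M using bd[of N M] by (auto simp: D_def)
  have "eventually (\<lambda>N. (\<Sum>M | M \<le> N \<and> \<delta> \<le> deviation N M. zero_mode N M) < e / 2 / D) sequentially"
    using e D by (intro order_tendstoD(2)[OF zero_mode_concentration[OF \<kappa> \<delta>]]) auto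
  with near have "eventually (\<lambda>N. norm ((\<Sum>M\<le>N. zero_mode N M * f N M) - L) < e) sequentially"
  proof eventually_elim
    case (elim N)
    have fin: "finite {M. M \<le> N \<and> \<delta> \<le> deviation N M}" by (rule finite_subset[of _ "{..N}"]) auto
    have "(\<Sum>M\<le>N. zero_mode N M * f N M) - L = (\<Sum>M\<le>N. zero_mode N M * f N M) - (\<Sum>M\<le>N. zero_mode N M) * L" by (simp add: zero_mode_sum)
    also have "\<dots> = (\<Sum>M\<le>N. zero_mode N M * (f N M - L))" by (simp add: sum_distrib_right sum_subtractf right_diff_distrib)
    finally have "\<bar>(\<Sum>M\<le>N. zero_mode N M * f N M) - L\<bar> \<le> (\<Sum>M\<le>N. \<bar>zero_mode N M * (f N M - L)\<bar>)" by (simp only: sum_abs)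
    also have "\<dots> \<le> (\<Sum>M\<le>N. zero_mode N M * (e / 2) + (if \<delta> \<le> deviation N M then zero_mode N M * D else 0))"
    proof (rule sum_mono)
      fix M assume M: "M \<in> {..N}"
      have p: "0 \<le> zero_mode N M" by (rule zero_mode_nonneg)
      show "\<bar>zero_mode N M * (f N M - L)\<bar> \<le> zero_mode N M * (e / 2) + (if \<delta> \<le> deviation N M then zero_mode N M * D else 0)"
      proof (cases "\<delta> \<le> deviation N M")
        case True
        have "zero_mode N M * \<bar>f N M - L\<bar> \<le> zero_mode N M * D" using D p by (intro mult_left_mono) auto
        moreover have "0 \<le> zero_mode N M * (e / 2)" using p e by simp
        ultimately show ?thesis using True p by (simp add: abs_mult)
      next
        case False
        then have "zero_mode N M * \<bar>f N M - L\<bar> \<le> zero_mode N M * (e / 2)"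
          using elim(1) M p by (intro mult_left_mono) (auto simp: less_imp_le)
        then show ?thesis using False p by (simp add: abs_mult)
      qed
    qed
    also have "\<dots> = e / 2 + (\<Sum>M\<in>{M. M \<le> N \<and> \<delta> \<le> deviation N M}. zero_mode N M) * D"
    proof -
      have "(\<Sum>M\<le>N. if \<delta> \<le> deviation N M then zero_mode N M * D else 0)
        = (\<Sum>M\<in>{M. M \<le> N \<and> \<delta> \<le> deviation N M}. zero_mode N M * D)"
        using sum.inter_filter[of "{..N}" "\<lambda>M. zero_mode N M * D" "\<lambda>M. \<delta> \<le> deviation N M"] by simp
      moreover have "(\<Sum>M\<le>N. zero_mode N M * (e / 2)) = e / 2" unfolding sum_distrib_right[symmetric] zero_mode_sum by simp
      ultimately show ?thesis by (simp only: sum.distrib sum_distrib_right)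
    qed
    also have "\<dots> < e" using elim(2) D(2) by (simp add: field_simps)
    finally show ?case by simp
  qed
  then show "\<exists>no. \<forall>N\<ge>no. norm ((\<Sum>M\<le>N. zero_mode N M * f N M) - L) < e" by (simp add: eventually_sequentially)
qed

text \<open>Taking \<open>j\<close> points out of the zero mode changes its weight by A (M - j) / A
  M, so the quotient is the mean of this ratio under \<open>zero_mode\<close>. The zero mode is
  macroscopic, and the ratio tends to 1.\<close>

lemma Y_ratio:
  assumes "\<kappa> < 1"
  shows "(\<lambda>N. Y N (N - j) / Y N N) \<longlonglongrightarrow> 1"
proof -
  let ?f = "\<lambda>M. if j \<le> M then A (M - j) / A M else 0"
  have flim: "?f \<longlonglongrightarrow> 1" by (rule Lim_transform_eventually[OF A_shift[of j]]) (auto intro: eventually_mono[OF eventually_ge_at_top[of j]])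
  then have "Bseq ?f" by (intro convergent_imp_Bseq) (auto simp: convergent_def)
  then obtain F where F: "\<And>M. norm (?f M) \<le> F" by (auto simp: Bseq_def)
  have "(\<lambda>N. \<Sum>M\<le>N. zero_mode N M * ?f M) \<longlonglongrightarrow> 1"
  proof (rule zero_mode_average[OF assms, where f = "\<lambda>N M. ?f M" and F = F])
    show "\<bar>?f M\<bar> \<le> F" for M using F[of M] by simp
    fix r M :: "nat \<Rightarrow> nat" assume r: "strict_mono r" "(\<lambda>k. real (M k) / real (r k)) \<longlonglongrightarrow> 1 - \<kappa>"
    have "filterlim (\<lambda>k. real (M k) / real (r k) * real (r k)) at_top sequentially"
      using assms by (intro filterlim_tendsto_pos_mult_at_top[OF r(2)] filterlim_compose[OF filterlim_real_sequentially] filterlim_subseq r(1)) auto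
    then have "filterlim (\<lambda>k. real (M k)) at_top sequentially" by (rule filterlim_at_top_mono) (auto intro!: always_eventually)
    then have "filterlim M at_top sequentially" by (simp add: filterlim_sequentially_iff_filterlim_real)
    then show "(\<lambda>k. ?f (M k)) \<longlonglongrightarrow> 1" by (rule filterlim_compose[OF flim])
  qed
  then show ?thesis
  proof (rule Lim_transform_eventually)
    show "eventually (\<lambda>N. (\<Sum>M\<le>N. zero_mode N M * ?f M) = Y N (N - j) / Y N N) sequentially" using eventually_ge_at_top[of j]
    proof eventually_elim
      case (elim N)
      have "(\<Sum>M\<le>N. zero_mode N M * ?f M) = (\<Sum>M\<le>N. if j \<le> M then A (M - j) * B N (N - M) else 0) / Y N N"
        unfolding sum_divide_distrib zero_mode_def using A_pos by (intro sum.cong) (auto simp: less_imp_neq[symmetric])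
      also have "(\<Sum>M\<le>N. if j \<le> M then A (M - j) * B N (N - M) else 0) = (\<Sum>M\<in>{j..N}. A (M - j) * B N (N - M))"
        by (rule sum.mono_neutral_cong_right) auto
      also have "\<dots> = (\<Sum>M\<le>N - j. A M * B N (N - j - M))" by (rule sum.reindex_bij_witness[of _ "\<lambda>M. M + j" "\<lambda>M. M - j"]) (use elim in auto)
      finally show ?case by (simp add: Y_split)
    qed
  qed
qed

abbreviation "short_fraction K N \<equiv> (\<Sum>j=1..K. w N j * Y N (N - j)) / (real N * Y N N)"

text \<open>In w N j / N the contribution t j / N of the zero mode vanishes: cycles of fixed length
  hold a positive fraction of the points through the nonzero modes only.\<close>

lemma short_cycle_fraction:
  assumes "\<kappa> < 1"
  shows "(\<lambda>N. short_fraction K N) \<longlonglongrightarrow> (\<Sum>j=1..K. t j * \<gamma> j)"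
proof -
  have "(\<lambda>N. w N j / real N) \<longlonglongrightarrow> t j * \<gamma> j" if "1 \<le> j" for j
  proof -
    have "(\<lambda>N. t j * (1 / real N) + t j * (m N j / real N)) \<longlonglongrightarrow> t j * 0 + t j * \<gamma> j" by (intro tendsto_intros lim_1_over_n m_lim that)
    then show ?thesis by (simp add: w_def add_divide_distrib)
  qed
  then have "(\<lambda>N. \<Sum>j=1..K. (w N j / real N) * (Y N (N - j) / Y N N)) \<longlonglongrightarrow> (\<Sum>j=1..K. (t j * \<gamma> j) * 1)"
    by (intro tendsto_sum tendsto_mult Y_ratio assms) auto
  then show ?thesis by (simp add: sum_divide_distrib)
qed

text \<open>For j > \<delta> N the decay from j = 1 gives m N j a factor of order exp (- c \<delta>
  N^(1 - s)). The extra factor \<open>N\<close> anticipates the loss when smaller systems are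
  compared with the full one.\<close>

lemma long_nonzero_cycles:
  assumes "0 < \<delta>"
  shows "(\<lambda>N. real N * (\<Sum>j | j \<le> N \<and> \<delta> * real N < real j. t j * m N j)) \<longlonglongrightarrow> 0"
proof -
  obtain C1 where C1: "0 < C1" "eventually (\<lambda>N. (\<Sum>j=1..N. m N j) \<le> C1 * real N) sequentially" by (rule m_sum_bound)
  have z: "(\<lambda>N::nat. C0 * C1 * exp c * (real N ^ 3 * exp (- (c * \<delta> * real N powr (1 - s))))) \<longlonglongrightarrow> 0"
    using c assms s by (intro tendsto_mult_right_zero) real_asymp
  show ?thesis
  proof (rule tendsto_sandwich[OF _ _ tendsto_const z])
    show "eventually (\<lambda>N. 0 \<le> real N * (\<Sum>j | j \<le> N \<and> \<delta> * real N < real j. t j * m N j)) sequentially"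
    proof (intro always_eventually allI)
      fix N
      have "0 \<le> (\<Sum>j | j \<le> N \<and> \<delta> * real N < real j. t j * m N j)"
      proof (intro sum_nonneg lam_nonneg)
        fix j assume "j \<in> {j. j \<le> N \<and> \<delta> * real N < real j}"
        moreover have "0 \<le> \<delta> * real N" using assms by simp
        ultimately show "1 \<le> j" by (cases j) auto
      qed
      then show "0 \<le> real N * (\<Sum>j | j \<le> N \<and> \<delta> * real N < real j. t j * m N j)" by simp
    qed
    show "eventually (\<lambda>N. real N * (\<Sum>j | j \<le> N \<and> \<delta> * real N < real j. t j * m N j)
       \<le> C0 * C1 * exp c * (real N ^ 3 * exp (- (c * \<delta> * real N powr (1 - s))))) sequentially"
      using C1(2) m_decay eventually_ge_at_top[of 1]
    proof eventually_elim
      case (elim N)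
      let ?r = "c * real N powr (- s)"
      have r: "0 < ?r" "?r \<le> c" using elim c s powr_mono[of "-s" 0 "real N"] by (auto simp: mult_left_le)
      have rN: "?r * (\<delta> * real N) = c * \<delta> * real N powr (1 - s)" using elim(3) by (simp add: powr_diff powr_minus field_simps)
      have m1: "m N 1 \<le> C1 * real N" using elim(1,3) member_le_sum[of 1 "{1..N}" "m N"] m_nonneg by auto
      have "t j * m N j \<le> C0 * (exp c * exp (- (c * \<delta> * real N powr (1 - s))) * (C1 * real N))"
        if j: "j \<le> N" "\<delta> * real N < real j" for j
      proof -
        have "0 < real j" using assms j by (smt (verit) mult_nonneg_nonneg of_nat_0_le_iff)
        then have j1: "1 \<le> j" by simp
        have "m N j \<le> exp (- ?r * real (j - 1)) * m N 1" using elim(2)[rule_format, of 1 "j - 1"] j1 by simp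
        also have "\<dots> \<le> (exp c * exp (- (c * \<delta> * real N powr (1 - s)))) * (C1 * real N)"
        proof (intro mult_mono m1)
          have "- ?r * real (j - 1) = ?r - ?r * real j" using j1 by (simp add: of_nat_diff algebra_simps)
          also have "\<dots> \<le> c - ?r * (\<delta> * real N)" using r j by (intro diff_mono mult_left_mono) auto
          finally show "exp (- ?r * real (j - 1)) \<le> exp c * exp (- (c * \<delta> * real N powr (1 - s)))" unfolding rN by (simp flip: exp_add)
        qed (use m_nonneg in auto)
        finally show ?thesis using t_upper[OF j1] t_nonneg[OF j1] m_nonneg C0_pos by (intro mult_mono) auto
      qed
      then have "(\<Sum>j | j \<le> N \<and> \<delta> * real N < real j. t j * m N j)
         \<le> (\<Sum>j | j \<le> N \<and> \<delta> * real N < real j. C0 * (exp c * exp (- (c * \<delta> * real N powr (1 - s))) * (C1 * real N)))"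
        by (intro sum_mono) auto
      also have "\<dots> \<le> (\<Sum>j=1..N. C0 * (exp c * exp (- (c * \<delta> * real N powr (1 - s))) * (C1 * real N)))"
      proof (rule sum_mono2)
        show "{j. j \<le> N \<and> \<delta> * real N < real j} \<subseteq> {1..N}"
        proof
          fix j assume "j \<in> {j. j \<le> N \<and> \<delta> * real N < real j}"
          moreover from this have "0 < real j" using assms by (smt (verit) mem_Collect_eq mult_nonneg_nonneg of_nat_0_le_iff)
          ultimately show "j \<in> {1..N}" by auto
        qed
      qed (use C0_pos C1(1) in auto)
      also have "\<dots> = real N * (C0 * (exp c * exp (- (c * \<delta> * real N powr (1 - s))) * (C1 * real N)))" by simp
      finally have "real N * (\<Sum>j | j \<le> N \<and> \<delta> * real N < real j. t j * m N j)
         \<le> real N * (real N * (C0 * (exp c * exp (- (c * \<delta> * real N powr (1 - s))) * (C1 * real N))))" by (intro mult_left_mono) auto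
      then show ?case by (simp add: power3_eq_cube mult_ac)
    qed
  qed
qed

text \<open>If \<open>g\<close> is applied to the zero mode only, the quotient is the average of
  \<open>cycle_functional\<close> over the size of the zero mode, which converges. Applying
  \<open>g\<close> to the other modes as well changes nothing on cycles shorter than \<delta> \<nu>
  N, where \<open>g\<close> is 1, and longer ones have negligible weight in those modes.\<close>

lemma cycle_functional_limit:
  assumes \<kappa>: "\<kappa> < 1" and g: "test_fun \<delta> g"
    and L: "(\<lambda>k. stick_iter \<theta> g (\<lambda>_. 1) k 1) \<longlonglongrightarrow> L"
  shows "(\<lambda>N. hcoef (\<lambda>j. w N j * g (real j / ((1 - \<kappa>) * real N))) N / Y N N) \<longlonglongrightarrow> L"
proof -
  have \<delta>: "0 < \<delta>" and gc: "continuous_on UNIV g" and g01: "\<And>x. 0 \<le> g x" "\<And>x. g x \<le> 1" and g1: "\<And>x. x \<le> \<delta> \<Longrightarrow> g x = 1"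
    using g by (auto simp: test_fun_def)
  define \<nu> where "\<nu> = 1 - \<kappa>"
  have \<nu>: "0 < \<nu>" using \<kappa> by (simp add: \<nu>_def)
  \<comment> \<open>The maximum with 1 keeps the scale positive at N = 0 and changes nothing
    afterwards.\<close>
  define S where "S N = \<nu> * max 1 (real N)" for N
  have S: "0 < S N" "1 \<le> N \<Longrightarrow> S N = \<nu> * real N" for N using \<nu> by (auto simp: S_def)
  let ?g = "\<lambda>N j. g (real j / S N)"
  have cf: "\<bar>cycle_functional g (S N) M\<bar> \<le> 1" for N M using cycle_functional_bounds[of g "S N" M] g01 by simp
  have avg: "(\<lambda>N. \<Sum>M\<le>N. zero_mode N M * cycle_functional g (S N) M) \<longlonglongrightarrow> L"
  proof (rule zero_mode_average[OF \<kappa> cf])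
    fix r M :: "nat \<Rightarrow> nat" assume r: "strict_mono r" "(\<lambda>k. real (M k) / real (r k)) \<longlonglongrightarrow> 1 - \<kappa>"
    have rt: "filterlim r at_top sequentially" by (rule filterlim_subseq[OF r(1)])
    show "(\<lambda>k. cycle_functional g (S (r k)) (M k)) \<longlonglongrightarrow> L"
    proof (rule cycle_functional_tendsto[OF _ _ \<delta> gc g01 g1 _ L])
      show "0 < S (r k)" for k by (rule S)
      have "filterlim (\<lambda>N. \<nu> * real N) at_top sequentially"
        using \<nu> by (intro filterlim_tendsto_pos_mult_at_top[OF tendsto_const _ filterlim_real_sequentially]) auto
      then have "filterlim S at_top sequentially" by (rule filterlim_at_top_mono) (use \<nu> in \<open>auto simp: S_def intro!: always_eventually\<close>)
      then show "filterlim (\<lambda>k. S (r k)) at_top sequentially" by (rule filterlim_compose[OF _ rt])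
      have "(\<lambda>k. real (M k) / real (r k) / \<nu>) \<longlonglongrightarrow> (1 - \<kappa>) / \<nu>" using \<nu> by (intro tendsto_intros r(2)) auto
      then have "(\<lambda>k. real (M k) / real (r k) / \<nu>) \<longlonglongrightarrow> 1" using \<nu> by (simp add: \<nu>_def)
      then show "(\<lambda>k. real (M k) / S (r k)) \<longlonglongrightarrow> 1"
      proof (rule Lim_transform_eventually)
        show "eventually (\<lambda>k. real (M k) / real (r k) / \<nu> = real (M k) / S (r k)) sequentially"
          using eventually_compose_filterlim[OF eventually_ge_at_top[of 1] rt] by eventually_elim (simp add: S(2) mult.commute)
      qed
    qed
  qed
  \<comment> \<open>\<open>?u\<close> is the weight in the claim; adding \<open>?v\<close> restores
    weight 1 in place of \<open>g\<close> on the nonzero modes.\<close>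
  let ?u = "\<lambda>N j. w N j * ?g N j" and ?v = "\<lambda>N j. t j * m N j * (1 - ?g N j)"
  have uv: "(\<lambda>j. ?u N j + ?v N j) = (\<lambda>j. t j * ?g N j + t j * m N j)" for N by (rule ext) (simp add: w_def algebra_simps)
  have eqavg: "hcoef (\<lambda>j. ?u N j + ?v N j) N / Y N N = (\<Sum>M\<le>N. zero_mode N M * cycle_functional g (S N) M)" for N
  proof -
    have "hcoef (\<lambda>j. ?u N j + ?v N j) N = (\<Sum>M\<le>N. hcoef (\<lambda>j. t j * ?g N j) M * B N (N - M))" unfolding uv by (rule hcoef_add)
    also have "\<dots> / Y N N = (\<Sum>M\<le>N. zero_mode N M * cycle_functional g (S N) M)"
      unfolding sum_divide_distrib zero_mode_def cycle_functional_def using A_pos by (intro sum.cong) (auto simp: less_imp_neq[symmetric])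
    finally show ?thesis .
  qed
  define x where "x N = (\<Sum>j | j \<le> N \<and> (\<delta> * \<nu>) * real N < real j. t j * m N j)" for N
  have xlim: "(\<lambda>N. real N * x N) \<longlonglongrightarrow> 0" unfolding x_def using \<delta> \<nu> by (intro long_nonzero_cycles) simp
  have diff: "eventually (\<lambda>N. \<bar>hcoef (\<lambda>j. ?u N j + ?v N j) N / Y N N - hcoef (?u N) N / Y N N\<bar> \<le> 2 / c0 * (real N * x N)) sequentially"
  proof -
    have "eventually (\<lambda>N. real N * x N < 1) sequentially" by (rule order_tendstoD(2)[OF xlim]) simp
    then show ?thesis using eventually_ge_at_top[of 1]
    proof eventually_elim
      case (elim N)
      \<comment> \<open>By \<open>Y_ge\<close> the partition functions of smaller systems exceed the
        full one at most by the factor N / \<open>c0\<close>.\<close>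
      let ?D = "real N / c0 * Y N N"
      have u0: "0 \<le> ?u N j" "0 \<le> ?v N j" if "1 \<le> j" for j
        using g01 w_pos[OF that, of N] lam_nonneg[OF that, of N] by (auto intro!: mult_nonneg_nonneg simp: less_imp_le)
      have dom: "hcoef (\<lambda>j. ?u N j + ?v N j) (N - i) \<le> ?D" if "1 \<le> i" "i \<le> N" for i
      proof -
        have "hcoef (\<lambda>j. ?u N j + ?v N j) (N - i) \<le> Y N (N - i)" unfolding Y_def
        proof (rule hcoef_mono)
          fix j :: nat assume j: "1 \<le> j"
          show "0 \<le> ?u N j + ?v N j" using u0[OF j] by simp
          have "t j * ?g N j \<le> t j * 1" using t_nonneg[OF j] g01 by (intro mult_left_mono) auto
          then show "?u N j + ?v N j \<le> w N j" using fun_cong[OF uv[of N], of j] by (simp add: w_def)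
        qed
        also have "\<dots> \<le> ?D" using Y_ge[OF that, of N] c0 elim(2) by (simp add: field_simps)
        finally show ?thesis .
      qed
      have x0: "0 \<le> x N" unfolding x_def
      proof (intro sum_nonneg lam_nonneg)
        fix j assume "j \<in> {j. j \<le> N \<and> \<delta> * \<nu> * real N < real j}"
        moreover have "0 \<le> \<delta> * \<nu> * real N" using \<delta> \<nu> by simp
        ultimately show "1 \<le> j" by (cases j) auto
      qed
      have "(\<Sum>j=1..N. ?v N j / real j) \<le> (\<Sum>j=1..N. if (\<delta> * \<nu>) * real N < real j then t j * m N j else 0)"
      proof (rule sum_mono)
        fix j assume j: "j \<in> {1..N}"
        show "?v N j / real j \<le> (if (\<delta> * \<nu>) * real N < real j then t j * m N j else 0)"
        proof (cases "(\<delta> * \<nu>) * real N < real j")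
          case True
          have "?v N j / real j \<le> ?v N j" using j u0(2)[of j] mult_left_mono[of 1 "real j" "?v N j"] by (simp add: divide_le_eq)
          also have "\<dots> \<le> t j * m N j" using j lam_nonneg[of j N] g01 by (intro mult_left_le) auto
          finally show ?thesis using True by simp
        next
          case False
          then have "real j / S N \<le> \<delta>" using \<nu> elim(2) by (simp add: S(2) divide_le_eq mult_ac not_less)
          then show ?thesis using False g1 by simp
        qed
      qed
      also have "\<dots> = (\<Sum>j\<in>{j\<in>{1..N}. (\<delta> * \<nu>) * real N < real j}. t j * m N j)" by (rule sum.inter_filter[symmetric]) simp
      also have "{j\<in>{1..N}. (\<delta> * \<nu>) * real N < real j} = {j. j \<le> N \<and> (\<delta> * \<nu>) * real N < real j}"
      proof -
        have "0 \<le> \<delta> * \<nu> * real N" using \<delta> \<nu> by simp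
        then have "1 \<le> j" if "\<delta> * \<nu> * real N < real j" for j using that by (cases j) auto
        then show ?thesis by auto
      qed
      finally have vx: "(\<Sum>j=1..N. ?v N j / real j) \<le> x N" by (simp add: x_def)
      have x1: "x N \<le> 1"
      proof -
        have "1 * x N \<le> real N * x N" using elim(2) x0 by (intro mult_right_mono) auto
        then show ?thesis using elim(1) by simp
      qed
      have "exp (\<Sum>j=1..N. ?v N j / real j) - 1 \<le> exp (x N) - 1" using vx by simp
      also have "\<dots> \<le> 2 * x N" using exp_bound[OF x0 x1] mult_mono[OF x1 order_refl, of "x N"] x0 by (simp add: power2_eq_square)
      finally have ex: "exp (\<Sum>j=1..N. ?v N j / real j) - 1 \<le> 2 * x N" .
      have Dpos: "0 \<le> ?D" using c0 Y_pos[of N N] by simp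
      have "hcoef (\<lambda>j. ?u N j + ?v N j) N - hcoef (?u N) N \<le> (exp (\<Sum>j=1..N. ?v N j / real j) - 1) * ?D"
        by (rule hcoef_diff_bound(1)[OF u0 dom])
      also have "\<dots> \<le> 2 * x N * ?D" by (rule mult_right_mono[OF ex Dpos])
      finally have up: "hcoef (\<lambda>j. ?u N j + ?v N j) N - hcoef (?u N) N \<le> 2 * x N * ?D" .
      have lo: "hcoef (?u N) N \<le> hcoef (\<lambda>j. ?u N j + ?v N j) N" by (rule hcoef_diff_bound(2)[OF u0 dom])
      have "\<bar>hcoef (\<lambda>j. ?u N j + ?v N j) N / Y N N - hcoef (?u N) N / Y N N\<bar> = (hcoef (\<lambda>j. ?u N j + ?v N j) N - hcoef (?u N) N) / Y N N"
        using lo Y_pos[of N N] by (simp add: diff_divide_distrib[symmetric])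
      also have "\<dots> \<le> 2 * x N * ?D / Y N N" using up Y_pos[of N N] by (intro divide_right_mono) auto
      also have "\<dots> = 2 / c0 * (real N * x N)" using Y_pos[of N N] by simp
      finally show ?case .
    qed
  qed
  have "(\<lambda>N. hcoef (\<lambda>j. ?u N j + ?v N j) N / Y N N - hcoef (?u N) N / Y N N) \<longlonglongrightarrow> 0"
    by (rule Lim_null_comparison[OF _ tendsto_mult_right_zero[OF xlim, of "2 / c0"]]) (use diff in simp)
  from tendsto_diff[OF avg[folded eqavg] this]
  have "(\<lambda>N. hcoef (?u N) N / Y N N) \<longlonglongrightarrow> L" by simp
  then show ?thesis by (rule Lim_transform_eventually)
       (use eventually_ge_at_top[of 1] in \<open>eventually_elim, simp add: S(2) \<nu>_def\<close>)
qed

section \<open>Short cycles at and below the critical density\<close>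

lemma harmonic_bound: "1 \<le> N \<Longrightarrow> (\<Sum>j=1..N. 1 / real j) \<le> 1 + ln (real N)"
  using euler_mascheroni_sequence_decreasing[of 1 N] by (simp add: harm_def inverse_eq_divide)

text \<open>In the subcritical case the points would have to fit into few short cycles: the weight of such
  configurations is compared with that of configurations whose short cycles, tilted by a factor
  \<open>z\<^sup>j\<close> with \<open>z < 1\<close>, contain a fraction of about \<open>1 - \<delta> / 2\<close> of the points.\<close>

lemma subcritical_parameters:
  assumes \<kappa>: "1 \<le> \<kappa>" and \<delta>: "0 < \<delta>" "\<delta> < 1" and D: "0 < D"
  obtains K z where "1 \<le> K" "0 < z" "z < 1" "(\<Sum>j=1..K. t j * \<gamma> j * z ^ j) = 1 - \<delta> / 2"
    "D / real K \<le> (\<delta> / 8) * ln (1 / z)"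
proof -
  define \<phi> where "\<phi> K z = (\<Sum>j=1..K. t j * \<gamma> j * z ^ j)" for K and z :: real
  have nn: "0 \<le> t j * \<gamma> j" if "1 \<le> j" for j using t_nonneg gamma_nonneg that by simp
  have cont: "continuous_on S (\<phi> K)" for K S unfolding \<phi>_def by (intro continuous_intros)
  have \<phi>0: "\<phi> K 0 = 0" for K unfolding \<phi>_def by (intro sum.neutral) auto
  have mono: "\<phi> K z \<le> \<phi> K' z" if "K \<le> K'" "0 \<le> z" for K K' z unfolding \<phi>_def using that nn by (intro sum_mono2) auto
  have "(\<lambda>J. (\<Sum>n<J. t (Suc n) * \<gamma> (Suc n))) \<longlonglongrightarrow> \<kappa>" unfolding \<kappa>_def using lam_lim(1) by (rule summable_LIMSEQ)
  moreover have "(\<Sum>n<J. t (Suc n) * \<gamma> (Suc n)) = \<phi> J 1" for J unfolding \<phi>_def by (rule sum.reindex_bij_witness[of _ "\<lambda>j. j - 1" Suc]) auto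
  ultimately have "(\<lambda>J. \<phi> J 1) \<longlonglongrightarrow> \<kappa>" by simp
  then have "eventually (\<lambda>J. 1 - \<delta> / 4 < \<phi> J 1) sequentially" by (rule order_tendstoD) (use \<kappa> \<delta> in simp)
  then obtain K0 where K0: "1 - \<delta> / 4 < \<phi> K0 1" by (auto simp: eventually_sequentially)
  have "\<exists>z\<ge>0. z \<le> 1 \<and> \<phi> K0 z = 1 - \<delta> / 2" by (rule IVT') (use K0 \<delta> \<phi>0 cont in auto)
  then obtain z0 where z0: "0 \<le> z0" "z0 \<le> 1" "\<phi> K0 z0 = 1 - \<delta> / 2" by blast
  have z0': "0 < z0" "z0 < 1" using z0 \<phi>0[of K0] K0 \<delta> by (cases "z0 = 0"; cases "z0 = 1"; force)+
  have lz: "0 < (\<delta> / 8) * ln (1 / z0)" using z0' \<delta> by simp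
  obtain K1 :: nat where K1: "D / ((\<delta> / 8) * ln (1 / z0)) \<le> real K1" using real_arch_simple by blast
  \<comment> \<open>Enlarging \<open>K\<close> raises the function \<phi> and thus lowers the root,
    so ln (1 / z) only grows while D / K shrinks. This is why \<open>z0\<close> is found first, for
    a preliminary cut-off \<open>K0\<close>, and \<open>z\<close> afterwards.\<close>
  define K where "K = max (max K0 K1) 1"
  have "\<exists>z\<ge>0. z \<le> z0 \<and> \<phi> K z = 1 - \<delta> / 2" by (rule IVT') (use z0 mono[of K0 K z0] \<delta> \<phi>0 cont in \<open>auto simp: K_def\<close>)
  then obtain z where z: "0 \<le> z" "z \<le> z0" "\<phi> K z = 1 - \<delta> / 2" by blast
  have z': "0 < z" "z < 1" using z z0' \<phi>0[of K] \<delta> by (cases "z = 0"; force)+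
  show ?thesis
  proof (rule that[of K z])
    show "1 \<le> K" by (simp add: K_def)
    show "(\<Sum>j=1..K. t j * \<gamma> j * z ^ j) = 1 - \<delta> / 2" using z(3) by (simp add: \<phi>_def)
    have "D / ((\<delta> / 8) * ln (1 / z0)) \<le> real K" using K1 by (simp add: K_def)
    then have "D / real K \<le> (\<delta> / 8) * ln (1 / z0)" using lz by (simp add: field_simps K_def)
    also have "\<dots> \<le> (\<delta> / 8) * ln (1 / z)" using z z' z0' \<delta> by (intro mult_left_mono) (auto simp: frac_le)
    finally show "D / real K \<le> (\<delta> / 8) * ln (1 / z)" .
  qed (use z' in auto)
qed

definition "short_w K N j = (if j \<le> K then w N j else 0)"
definition "long_w K N j = (if j \<le> K then 0 else w N j)"

lemma short_long:
  "1 \<le> j \<Longrightarrow> 0 \<le> short_w K N j" "1 \<le> j \<Longrightarrow> 0 \<le> long_w K N j" "K < j \<Longrightarrow> short_w K N j = 0"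
  "Y N n = (\<Sum>i\<le>n. hcoef (short_w K N) i * hcoef (long_w K N) (n - i))"
proof -
  show "1 \<le> j \<Longrightarrow> 0 \<le> short_w K N j" "1 \<le> j \<Longrightarrow> 0 \<le> long_w K N j" "K < j \<Longrightarrow> short_w K N j = 0"
    using less_imp_le[OF w_pos, of j N] by (auto simp: short_w_def long_w_def)
  have "w N = (\<lambda>j. short_w K N j + long_w K N j)" by (auto simp: short_w_def long_w_def)
  then show "Y N n = (\<Sum>i\<le>n. hcoef (short_w K N) i * hcoef (long_w K N) (n - i))" unfolding Y_def by (simp only: hcoef_add)
qed

text \<open>Both sides are \<open>Y N N\<close> times the mean number of points in cycles of length
  at most \<open>K\<close>: on the left by size biasing, on the right by conditioning on this
  number.\<close>

lemma short_mean:
  assumes "K \<le> N"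
  shows "(\<Sum>j=1..K. w N j * Y N (N - j)) = (\<Sum>i\<le>N. real i * hcoef (short_w K N) i * hcoef (long_w K N) (N - i))"
proof -
  let ?S = "hcoef (short_w K N)" and ?T = "hcoef (long_w K N)"
  have "(\<Sum>i\<le>N. real i * ?S i * ?T (N - i)) = (\<Sum>i\<le>N. \<Sum>j=1..i. short_w K N j * ?S (i - j) * ?T (N - i))"
    by (simp only: hcoef_rec sum_distrib_right)
  also have "\<dots> = (\<Sum>(i, j)\<in>Sigma {..N} (\<lambda>i. {1..i}). short_w K N j * ?S (i - j) * ?T (N - i))" by (rule sum.Sigma) auto
  also have "\<dots> = (\<Sum>(j, i)\<in>Sigma {1..N} (\<lambda>j. {..N - j}). short_w K N j * ?S i * ?T (N - j - i))"
    by (rule sum.reindex_bij_witness[of _ "\<lambda>(j, i). (i + j, j)" "\<lambda>(i, j). (j, i - j)"]) auto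
  also have "\<dots> = (\<Sum>j=1..N. \<Sum>i\<le>N - j. short_w K N j * ?S i * ?T (N - j - i))" by (rule sum.Sigma[symmetric]) auto
  also have "\<dots> = (\<Sum>j=1..N. short_w K N j * Y N (N - j))" unfolding short_long(4)[of N _ K] sum_distrib_left by (simp add: mult.assoc)
  also have "\<dots> = (\<Sum>j=1..K. w N j * Y N (N - j))" by (rule sum.mono_neutral_cong_right) (use assms in \<open>auto simp: short_w_def\<close>)
  finally show ?thesis by simp
qed

text \<open>Under the weights tilted by z^j the number of points in short cycles concentrates near
  its mean, about (1 - \<delta> / 2) N. At most N + 1 values lie in the window and carry at least
  half of the mass, so one of them has a coefficient of the stated size. The margin \<delta> / 4
  consists of \<delta> / 8 for the mean and \<delta> / 8 for the window.\<close>

lemma short_cycle_pigeonhole: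
  assumes \<delta>: "0 < \<delta>" "\<delta> < 1" and K: "1 \<le> K" and z: "0 < z" "z < 1"
    and eq: "(\<Sum>j=1..K. t j * \<gamma> j * z ^ j) = 1 - \<delta> / 2"
  defines "P \<equiv> \<lambda>N. \<Sum>j=1..K. w N j * z ^ j / real j"
  shows "eventually (\<lambda>N. \<exists>i\<le>N. (1 - 3 * \<delta> / 4) * real N \<le> real i \<and> real i \<le> (1 - \<delta> / 4) * real N \<and>
    exp (P N) / (2 * (real N + 1)) \<le> hcoef (short_w K N) i * z ^ i) sequentially"
proof -
  \<comment> \<open>This bounds j exp (\<sigma> j) for j \<le> K and \<sigma> \<le> 1; then \<sigma>
    E \<le> \<delta> / 16 makes the quadratic term at most half of the linear gain \<sigma> \<delta>
    N / 8.\<close>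
  define E where "E = real K * exp (real K)"
  have E: "0 < E" using K by (simp add: E_def)
  define \<sigma> where "\<sigma> = min 1 (\<delta> / (16 * E))"
  have \<sigma>: "0 < \<sigma>" "\<sigma> \<le> 1" "\<sigma> * E \<le> \<delta> / 16" using \<delta> E by (auto simp: \<sigma>_def min_def field_simps)
  have wl: "(\<lambda>N. w N j / real N) \<longlonglongrightarrow> t j * \<gamma> j" if "1 \<le> j" for j
  proof -
    have "(\<lambda>N. t j * (1 / real N) + t j * (m N j / real N)) \<longlonglongrightarrow> t j * 0 + t j * \<gamma> j" by (intro tendsto_intros lim_1_over_n m_lim that)
    then show ?thesis by (simp add: w_def add_divide_distrib)
  qed
  let ?\<mu> = "\<lambda>N. \<Sum>j=1..K. w N j * z ^ j"
  have "(\<lambda>N. \<Sum>j=1..K. w N j / real N * z ^ j) \<longlonglongrightarrow> (\<Sum>j=1..K. t j * \<gamma> j * z ^ j)" by (intro tendsto_sum tendsto_mult tendsto_const wl) auto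
  then have \<mu>: "(\<lambda>N. ?\<mu> N / real N) \<longlonglongrightarrow> 1 - \<delta> / 2" unfolding eq by (simp add: sum_divide_distrib)
  have e1: "eventually (\<lambda>N. \<bar>?\<mu> N / real N - (1 - \<delta> / 2)\<bar> < \<delta> / 8) sequentially"
    using tendstoD[OF \<mu>, of "\<delta> / 8"] \<delta> by (simp add: dist_real_def)
  have "(\<lambda>N::nat. exp (- (\<sigma> * \<delta> / 16 * real N))) \<longlonglongrightarrow> 0" using \<sigma> \<delta> by real_asymp
  then have e2: "eventually (\<lambda>N. exp (- (\<sigma> * \<delta> / 16 * real N)) < 1/4) sequentially" by (rule order_tendstoD) simp
  show ?thesis using e1 e2 eventually_gt_at_top[of 0]
  proof eventually_elim
    case (elim N)
    let ?u = "\<lambda>j. short_w K N j * z ^ j"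
    let ?V = "\<Sum>j=1..K. real j * ?u j * exp (\<sigma> * real j)"
    have u: "1 \<le> j \<Longrightarrow> 0 \<le> ?u j" "K < j \<Longrightarrow> ?u j = 0" for j using short_long(1,3) z by auto
    have us: "(\<Sum>j=1..K. f j * ?u j) = (\<Sum>j=1..K. f j * (w N j * z ^ j))" for f by (intro sum.cong) (auto simp: short_w_def)
    have \<mu>N: "\<bar>?\<mu> N - (1 - \<delta> / 2) * real N\<bar> \<le> \<delta> / 8 * real N"
    proof -
      have "\<bar>?\<mu> N / real N - (1 - \<delta> / 2)\<bar> * real N \<le> \<delta> / 8 * real N" using elim(1) by (intro mult_right_mono) auto
      moreover have "\<bar>?\<mu> N / real N - (1 - \<delta> / 2)\<bar> * real N = \<bar>(?\<mu> N / real N - (1 - \<delta> / 2)) * real N\<bar>" by (simp add: abs_mult)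
      moreover have "(?\<mu> N / real N - (1 - \<delta> / 2)) * real N = ?\<mu> N - (1 - \<delta> / 2) * real N" using elim by (simp add: left_diff_distrib)
      ultimately show ?thesis by simp
    qed
    have \<mu>le: "?\<mu> N \<le> real N"
    proof -
      have "(1 - \<delta> / 2) * real N + \<delta> / 8 * real N \<le> 1 * real N" unfolding distrib_right[symmetric] using \<delta> by (intro mult_right_mono) auto
      then show ?thesis using \<mu>N by linarith
    qed
    have V: "?V \<le> E * real N"
    proof -
      have "?V \<le> (\<Sum>j=1..K. E * (w N j * z ^ j))"
      proof (rule sum_mono)
        fix j assume j: "j \<in> {1..K}"
        have "\<sigma> * real j \<le> 1 * real K" using \<sigma> j by (intro mult_mono) auto
        then have "real j * exp (\<sigma> * real j) \<le> E" unfolding E_def using j by (intro mult_mono) auto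
        then have "(real j * exp (\<sigma> * real j)) * (w N j * z ^ j) \<le> E * (w N j * z ^ j)"
          using j z w_pos[of j N] by (intro mult_right_mono) auto
        then show "real j * ?u j * exp (\<sigma> * real j) \<le> E * (w N j * z ^ j)" using j by (simp add: short_w_def mult_ac)
      qed
      also have "\<dots> = E * ?\<mu> N" by (simp add: sum_distrib_left)
      also have "\<dots> \<le> E * real N" using \<mu>le E by (intro mult_left_mono) auto
      finally show ?thesis .
    qed
    have tail: "(\<Sum>i\<in>I. hcoef ?u i) \<le> exp (P N) / 2"
      if I: "finite I" "\<And>i. i \<in> I \<Longrightarrow> \<delta> / 8 * real N \<le> \<bar>real i - ?\<mu> N\<bar>" for I
    proof -
      have "(\<Sum>i\<in>I. hcoef ?u i) \<le> 2 * exp ((\<Sum>j=1..K. ?u j / real j) - \<sigma> * (\<delta> / 8 * real N) + \<sigma>\<^sup>2 * ?V)"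
        using \<sigma> I us[of "\<lambda>_. 1"] by (intro hcoef_chernoff u) auto
      also have "\<dots> \<le> 2 * exp (P N + - (\<sigma> * \<delta> / 16 * real N))"
      proof -
        have "(\<Sum>j=1..K. ?u j / real j) = P N" using us[of "\<lambda>j. 1 / real j"] by (simp add: P_def)
        moreover have "\<sigma>\<^sup>2 * ?V \<le> \<sigma> * (\<delta> / 16) * real N"
        proof -
          have "\<sigma>\<^sup>2 * ?V \<le> \<sigma>\<^sup>2 * (E * real N)" by (rule mult_left_mono[OF V]) simp
          also have "\<dots> = \<sigma> * (\<sigma> * E) * real N" by (simp add: power2_eq_square)
          also have "\<dots> \<le> \<sigma> * (\<delta> / 16) * real N" using \<sigma> by (intro mult_right_mono mult_left_mono) auto
          finally show ?thesis .
        qed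
        moreover have "\<sigma> * (\<delta> / 8 * real N) = 2 * (\<sigma> * (\<delta> / 16) * real N)" "\<sigma> * \<delta> / 16 * real N = \<sigma> * (\<delta> / 16) * real N" by simp_all
        ultimately have "(\<Sum>j=1..K. ?u j / real j) - \<sigma> * (\<delta> / 8 * real N) + \<sigma>\<^sup>2 * ?V
           \<le> P N + - (\<sigma> * \<delta> / 16 * real N)" by linarith
        then show ?thesis by simp
      qed
      also have "\<dots> = 2 * exp (P N) * exp (- (\<sigma> * \<delta> / 16 * real N))" by (simp only: exp_add mult.assoc)
      also have "\<dots> \<le> 2 * exp (P N) * (1/4)" using elim(2) by (intro mult_left_mono) auto
      finally show ?thesis by simp
    qed
    define J where "J = {i. i \<le> N \<and> \<bar>real i - ?\<mu> N\<bar> < \<delta> / 8 * real N}"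
    have finJ: "finite J" by (rule finite_subset[of _ "{..N}"]) (auto simp: J_def)
    have cardJ: "card J \<le> N + 1" using card_mono[of "{..N}" J] by (auto simp: J_def)
    have bound: "(1 - 3 * \<delta> / 4) * real N \<le> real i \<and> real i \<le> (1 - \<delta> / 4) * real N" if "\<bar>real i - ?\<mu> N\<bar> < \<delta> / 8 * real N" for i
    proof -
      define x where "x = \<delta> * real N"
      have eqs: "(1 - \<delta> / 2) * real N = real N - x / 2" "\<delta> / 8 * real N = x / 8"
        "(1 - 3 * \<delta> / 4) * real N = real N - 3 * x / 4" "(1 - \<delta> / 4) * real N = real N - x / 4" by (simp_all add: x_def algebra_simps)
      show ?thesis using that \<mu>N unfolding eqs by linarith
    qed
    have notJ: "\<delta> / 8 * real N \<le> \<bar>real i - ?\<mu> N\<bar>" if "i \<notin> J" for i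
    proof (rule ccontr)
      assume neg: "\<not> ?thesis"
      then have "real i \<le> (1 - \<delta> / 4) * real N" using bound[of i] by (simp only: not_le)
      also have "\<dots> \<le> 1 * real N" using \<delta> by (intro mult_right_mono) auto
      finally have "i \<le> N" by simp
      then show False using that neg by (simp add: J_def)
    qed
    have sums: "hcoef ?u sums exp (P N)" using hcoef_finite_sums[of ?u K] u us[of "\<lambda>j. 1 / real j"] by (simp add: P_def)
    have "exp (P N) \<le> (\<Sum>i\<in>J. hcoef ?u i) + exp (P N) / 2"
    proof (rule LIMSEQ_le_const2)
      show "(\<lambda>n. \<Sum>i<n. hcoef ?u i) \<longlonglongrightarrow> exp (P N)" using sums by (simp add: sums_def)
      have "(\<Sum>i<n. hcoef ?u i) \<le> (\<Sum>i\<in>J. hcoef ?u i) + exp (P N) / 2" for n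
      proof -
        have "(\<Sum>i<n. hcoef ?u i) \<le> (\<Sum>i\<in>J \<union> ({..<n} - J). hcoef ?u i)" using finJ u by (intro sum_mono2 hcoef_nonneg) auto
        also have "\<dots> = (\<Sum>i\<in>J. hcoef ?u i) + (\<Sum>i\<in>{..<n} - J. hcoef ?u i)" using finJ by (intro sum.union_disjoint) auto
        also have "(\<Sum>i\<in>{..<n} - J. hcoef ?u i) \<le> exp (P N) / 2" using notJ by (intro tail) auto
        finally show ?thesis by simp
      qed
      then show "\<exists>no. \<forall>n\<ge>no. (\<Sum>i<n. hcoef ?u i) \<le> (\<Sum>i\<in>J. hcoef ?u i) + exp (P N) / 2" by blast
    qed
    then have big: "exp (P N) / 2 \<le> (\<Sum>i\<in>J. hcoef ?u i)" by simp
    have "\<exists>i\<in>J. exp (P N) / (2 * (real N + 1)) \<le> hcoef ?u i"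
    proof (rule ccontr)
      assume "\<not> ?thesis"
      then have less: "\<And>i. i \<in> J \<Longrightarrow> hcoef ?u i < exp (P N) / (2 * (real N + 1))" by (simp add: not_le)
      have "J \<noteq> {}" using big by auto
      then have "(\<Sum>i\<in>J. hcoef ?u i) < (\<Sum>i\<in>J. exp (P N) / (2 * (real N + 1)))" using finJ less by (intro sum_strict_mono) auto
      also have "\<dots> = real (card J) * (exp (P N) / (2 * (real N + 1)))" by simp
      also have "\<dots> \<le> real (N + 1) * (exp (P N) / (2 * (real N + 1)))"
        using cardJ by (intro mult_right_mono) (simp_all only: of_nat_le_iff, simp)
      also have "\<dots> = exp (P N) / 2" by (simp add: field_simps)
      finally show False using big by simp
    qed
    then obtain i where i: "i \<in> J" "exp (P N) / (2 * (real N + 1)) \<le> hcoef ?u i" by blast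
    then show ?case using bound[of i] unfolding hcoef_tilt J_def by (intro exI[of _ i]) (auto simp: mult.commute)
  qed
qed

text \<open>Configurations with at most (1 - \<delta>) N points in short cycles weigh at most exp P
  times z^(- (1 - \<delta>) N) times the weight of long cycles. The configurations from the
  pigeonhole lemma, with i \<ge> (1 - 3 \<delta> / 4) N, weigh at least exp P times z^(- i) up to
  polynomial factors. The quotient contains z^(\<delta> N / 4), and \<open>K\<close> is so large
  that the long cycles, with exponent \<open>C0\<close> \<open>C1\<close> N / K, cannot compensate
  it.\<close>

lemma subcritical_short_cycles:
  assumes \<kappa>: "1 \<le> \<kappa>" and \<delta>: "0 < \<delta>" "\<delta> < 1"
  shows "\<exists>K. eventually (\<lambda>N. 1 - short_fraction K N \<le> 2 * \<delta>) sequentially"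
proof -
  obtain C1 where C1: "0 < C1" "eventually (\<lambda>N. (\<Sum>j=1..N. m N j) \<le> C1 * real N) sequentially" by (rule m_sum_bound)
  obtain K z where Kz: "1 \<le> K" "0 < z" "z < 1" "(\<Sum>j=1..K. t j * \<gamma> j * z ^ j) = 1 - \<delta> / 2"
    "(C0 * C1) / real K \<le> (\<delta> / 8) * ln (1 / z)" by (rule subcritical_parameters[OF \<kappa> \<delta>, of "C0 * C1"]) (use C0_pos C1 in auto)
  define P where "P N = (\<Sum>j=1..K. w N j * z ^ j / real j)" for N
  \<comment> \<open>Half of the exponent in z^(\<delta> N / 4) = exp (- 2 l N): one \<open>l\<close>
    pays for the long cycles, the other makes the quotient vanish.\<close>
  define l where "l = (\<delta> / 8) * ln (1 / z)"
  have l: "0 < l" using Kz \<delta> by (simp add: l_def)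
  let ?R = "\<lambda>N::nat. 2 / c0 * (real N * (real N + 1) * exp (C0 * (1 + ln (real N)) - l * real N))"
  have "(\<lambda>N::nat. real N * (real N + 1) * exp (C0 * (1 + ln (real N)) - l * real N)) \<longlonglongrightarrow> 0" using C0_pos l by real_asymp
  then have Rl: "?R \<longlonglongrightarrow> 0" by (rule tendsto_mult_right_zero)
  have e1: "eventually (\<lambda>N. ?R N < \<delta>) sequentially" using \<delta> by (intro order_tendstoD(2)[OF Rl]) auto
  have e2: "eventually (\<lambda>N. real K < \<delta> / 4 * real N) sequentially" using \<delta> by real_asymp
  show ?thesis
  proof (rule exI[of _ K])
    show "eventually (\<lambda>N. 1 - short_fraction K N \<le> 2 * \<delta>) sequentially"
      using short_cycle_pigeonhole[OF \<delta> Kz(1-4)] C1(2) e1 e2 eventually_ge_at_top[of "max 1 K"]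
    proof eventually_elim
      case (elim N)
      have N: "1 \<le> N" "K \<le> N" using elim by auto
      let ?S = "hcoef (short_w K N)" and ?T = "hcoef (long_w K N)" and ?zp = "z powr (- ((1 - \<delta>) * real N))"
      let ?b = "\<lambda>n. if real n \<le> (1 - \<delta>) * real N then real N * (?S n * ?T (N - n)) else 0"
      have S0: "0 \<le> ?S i" and T0: "0 \<le> ?T i" for i using short_long(1,2) by (auto intro!: hcoef_nonneg)
      obtain i where i: "i \<le> N" "(1 - 3 * \<delta> / 4) * real N \<le> real i" "real i \<le> (1 - \<delta> / 4) * real N"
         "exp (P N) / (2 * (real N + 1)) \<le> ?S i * z ^ i" using elim(1) unfolding P_def by blast
      have "real K < real (N - i)" using i elim(4) by (simp add: of_nat_diff algebra_simps)
      then have Ki: "K < N - i" by simp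
      \<comment> \<open>A single cycle through all the remaining N - i points, admissible because N
        - i exceeds \<open>K\<close>.\<close>
      have Ti: "c0 / real N \<le> ?T (N - i)"
      proof -
        have "c0 / real N \<le> w N (N - i) / real (N - i)" using w_ge[of "N - i" N] Ki c0 by (intro frac_le) auto
        also have "\<dots> = long_w K N (N - i) * ?T (N - i - (N - i)) / real (N - i)" using Ki by (simp add: long_w_def)
        also have "\<dots> \<le> ?T (N - i)" using Ki short_long(2) by (intro hcoef_ge_term) auto
        finally show ?thesis .
      qed
      have Ylow: "exp (P N) / (2 * (real N + 1)) * (1 / z ^ i) * (c0 / real N) \<le> Y N N"
      proof -
        have "exp (P N) / (2 * (real N + 1)) * (1 / z ^ i) \<le> ?S i" using mult_right_mono[OF i(4), of "1 / z ^ i"] Kz by simp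
        then have "exp (P N) / (2 * (real N + 1)) * (1 / z ^ i) * (c0 / real N) \<le> ?S i * ?T (N - i)"
          using Ti c0 S0 by (intro mult_mono) auto
        also have "\<dots> \<le> Y N N" unfolding short_long(4)[of N N K] using i S0 T0 by (intro member_le_sum) auto
        finally show ?thesis .
      qed
      define Q where "Q = l * real N + C0 * (1 + ln (real N))"
      have Tup: "?T n \<le> exp Q" if "n \<le> N" for n
      proof -
        have "?T n \<le> exp (\<Sum>j=1..n. long_w K N j / real j)" by (rule hcoef_le_exp) (rule short_long)
        also have "(\<Sum>j=1..n. long_w K N j / real j) \<le> (\<Sum>j=1..N. long_w K N j / real j)" using that short_long(2) by (intro sum_mono2) auto
        also have "\<dots> \<le> (\<Sum>j=1..N. C0 * (1 / real j) + C0 / real K * m N j)"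
        proof (rule sum_mono)
          fix j assume j: "j \<in> {1..N}"
          show "long_w K N j / real j \<le> C0 * (1 / real j) + C0 / real K * m N j"
          proof (cases "j \<le> K")
            case True
            then show ?thesis using j C0_pos m_nonneg by (auto simp: long_w_def)
          next
            case False
            have "t j * m N j / real j \<le> C0 * m N j / real K"
              using False j Kz(1) t_upper[of j] m_nonneg[of N j] C0_pos by (intro frac_le mult_right_mono) auto
            moreover have "t j / real j \<le> C0 / real j" using j t_upper[of j] by (intro divide_right_mono) auto
            ultimately show ?thesis using False by (simp add: long_w_def w_def add_divide_distrib)
          qed
        qed
        also have "\<dots> = C0 * (\<Sum>j=1..N. 1 / real j) + C0 / real K * (\<Sum>j=1..N. m N j)" by (simp only: sum.distrib sum_distrib_left)
        also have "\<dots> \<le> C0 * (1 + ln (real N)) + C0 / real K * (C1 * real N)"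
          using harmonic_bound[OF N(1)] elim(2) C0_pos by (intro add_mono mult_left_mono) auto
        also have "C0 / real K * (C1 * real N) = (C0 * C1) / real K * real N" by simp
        also have "(C0 * C1) / real K * real N \<le> l * real N" using Kz(5) unfolding l_def by (intro mult_right_mono) auto
        finally show ?thesis by (simp add: Q_def add.commute)
      qed
      let ?bad = "{n. n \<le> N \<and> real n \<le> (1 - \<delta>) * real N}"
      have finb: "finite ?bad" by (rule finite_subset[of _ "{..N}"]) auto
      have zp: "z ^ n = z powr real n" for n using Kz by (simp add: powr_realpow)
      have Sz: "(\<Sum>n\<in>?bad. ?S n * z ^ n) \<le> exp (P N)"
      proof -
        let ?u = "\<lambda>j. short_w K N j * z ^ j"
        have u: "1 \<le> j \<Longrightarrow> 0 \<le> ?u j" "K < j \<Longrightarrow> ?u j = 0" for j using short_long(1,3) Kz by auto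
        have "(\<Sum>j=1..K. ?u j / real j) = P N" unfolding P_def by (intro sum.cong) (auto simp: short_w_def)
        with hcoef_finite_sums[of ?u K] u have "hcoef ?u sums exp (P N)" by simp
        then have "(\<Sum>n\<in>?bad. hcoef ?u n) \<le> exp (P N)"
          using finb u by (subst sums_unique) (auto intro!: sum_le_suminf hcoef_nonneg simp: sums_iff)
        moreover have "hcoef ?u n = ?S n * z ^ n" for n by (subst hcoef_tilt) (rule mult.commute)
        ultimately show ?thesis by (simp only:)
      qed
      have bad: "(\<Sum>n\<in>?bad. ?S n * ?T (N - n)) \<le> exp (P N) * ?zp * exp Q"
      proof -
        have "(\<Sum>n\<in>?bad. ?S n * ?T (N - n)) \<le> (\<Sum>n\<in>?bad. (?S n * z ^ n) * (?zp * exp Q))"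
        proof (rule sum_mono)
          fix n assume n: "n \<in> ?bad"
          have "1 \<le> z powr (real n - (1 - \<delta>) * real N)" using n Kz by (simp add: powr_def mult_nonpos_nonpos)
          also have "\<dots> = z ^ n * ?zp" unfolding zp by (simp flip: powr_add)
          finally have "?S n * 1 * ?T (N - n) \<le> ?S n * (z ^ n * ?zp) * exp Q" using S0 T0 Tup by (intro mult_mono) auto
          then show "?S n * ?T (N - n) \<le> (?S n * z ^ n) * (?zp * exp Q)" by (simp add: mult_ac)
        qed
        also have "\<dots> = (\<Sum>n\<in>?bad. ?S n * z ^ n) * (?zp * exp Q)" by (simp only: sum_distrib_right)
        also have "\<dots> \<le> exp (P N) * (?zp * exp Q)" using Sz by (intro mult_right_mono) auto
        finally show ?thesis by (simp only: mult.assoc)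
      qed
      have Ypos: "0 < Y N N" by (rule Y_pos)
      have gen: "a * x * q = (a / (2 * n1) * (1 / zi) * (c' / n)) * (2 / c' * (n * n1 * (zi * x * q)))"
        if "n1 \<noteq> 0" "zi \<noteq> 0" "c' \<noteq> 0" "n \<noteq> 0" for a x q n1 zi c' n :: real using that by simp
      have "exp (P N) * ?zp * exp Q
         = (exp (P N) / (2 * (real N + 1)) * (1 / z ^ i) * (c0 / real N)) * (2 / c0 * (real N * (real N + 1) * (z ^ i * ?zp * exp Q)))"
        using N Kz c0 by (intro gen) auto
      also have "\<dots> \<le> Y N N * ?R N"
      proof (rule mult_mono[OF Ylow])
        have "z ^ i * ?zp = z powr (real i - (1 - \<delta>) * real N)" unfolding zp by (simp flip: powr_add)
        also have "\<dots> \<le> z powr (\<delta> / 4 * real N)" using i(2) Kz by (intro powr_mono') (auto simp: algebra_simps)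
        also have "\<dots> = exp (- (2 * l) * real N)" using Kz by (simp add: powr_def l_def ln_div)
        finally have "z ^ i * ?zp * exp Q \<le> exp (- (2 * l) * real N) * exp Q" by (rule mult_right_mono) simp
        also have "\<dots> = exp (C0 * (1 + ln (real N)) - l * real N)" by (simp add: Q_def flip: exp_add)
        finally show "2 / c0 * (real N * (real N + 1) * (z ^ i * ?zp * exp Q)) \<le> ?R N" using c0 by (intro mult_left_mono) auto
      qed (use Ypos c0 Kz in auto)
      finally have bad2: "(\<Sum>n\<in>?bad. ?S n * ?T (N - n)) \<le> Y N N * \<delta>" using bad elim(3) Ypos mult_left_mono[of "?R N" \<delta> "Y N N"] by linarith
      \<comment> \<open>The mean number of points outside short cycles, times \<open>Y N N\<close>.
        It is at most \<delta> N in good configurations, and at most \<open>N\<close> in the bad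
        ones, whose weight is at most \<delta> \<open>Y N N\<close>.\<close>
      have "real N * Y N N - (\<Sum>n\<le>N. real n * ?S n * ?T (N - n)) = (\<Sum>n\<le>N. (real N - real n) * (?S n * ?T (N - n)))"
        unfolding short_long(4)[of N N K] by (simp add: sum_distrib_left left_diff_distrib sum_subtractf mult.assoc)
      also have "\<dots> \<le> (\<Sum>n\<le>N. \<delta> * real N * (?S n * ?T (N - n)) + ?b n)"
      proof (rule sum_mono)
        fix n assume n: "n \<in> {..N}"
        have p: "0 \<le> ?S n * ?T (N - n)" using S0 T0 by simp
        show "(real N - real n) * (?S n * ?T (N - n)) \<le> \<delta> * real N * (?S n * ?T (N - n)) + ?b n"
        proof (cases "real n \<le> (1 - \<delta>) * real N")
          case True
          have "(real N - real n) * (?S n * ?T (N - n)) \<le> real N * (?S n * ?T (N - n))" using p by (intro mult_right_mono) auto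
          moreover have "0 \<le> \<delta> * real N * (?S n * ?T (N - n))" using p \<delta> by simp
          ultimately show ?thesis using True by simp
        next
          case False
          then have "real N - real n \<le> \<delta> * real N" by (simp add: algebra_simps)
          then have "(real N - real n) * (?S n * ?T (N - n)) \<le> \<delta> * real N * (?S n * ?T (N - n))" using p by (rule mult_right_mono)
          then show ?thesis using False by simp
        qed
      qed
      also have "\<dots> = \<delta> * real N * Y N N + real N * (\<Sum>n\<in>?bad. ?S n * ?T (N - n))"
      proof -
        have "(\<Sum>n\<le>N. ?b n) = (\<Sum>n\<in>?bad. real N * (?S n * ?T (N - n)))"
          using sum.inter_filter[of "{..N}" "\<lambda>n. real N * (?S n * ?T (N - n))" "\<lambda>n. real n \<le> (1 - \<delta>) * real N"] by simp
        then show ?thesis unfolding short_long(4)[of N N K] by (simp only: sum.distrib sum_distrib_left)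
      qed
      also have "\<dots> \<le> \<delta> * real N * Y N N + real N * (Y N N * \<delta>)" using bad2 by (intro add_left_mono mult_left_mono) auto
      finally have fin: "real N * Y N N - (\<Sum>j=1..K. w N j * Y N (N - j)) \<le> 2 * \<delta> * (real N * Y N N)"
        unfolding short_mean[OF N(2)] by (simp add: algebra_simps)
      have NY: "0 < real N * Y N N" using N Ypos by simp
      have "1 - short_fraction K N = (real N * Y N N - (\<Sum>j=1..K. w N j * Y N (N - j))) / (real N * Y N N)"
      proof -
        have "real N * Y N N \<noteq> 0" using NY by linarith
        then have "real N * Y N N / (real N * Y N N) = 1" by (rule divide_self)
        then show ?thesis by (simp only: diff_divide_distrib)
      qed
      also have "\<dots> \<le> 2 * \<delta>" using fin NY by (simp add: divide_le_eq)
      finally show ?case .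
    qed
  qed
qed

end

section \<open>Fourier series on the torus\<close>

definition character :: "real^'d \<Rightarrow> real^'d \<Rightarrow> complex" where
  "character k x = cis (2 * pi * (k \<bullet> x))"

lemma character_add: "character k (x + y) = character k x * character k y"
  by (simp add: character_def inner_add_right distrib_left cis_mult)

lemma character_add_left: "character (k + l) x = character k x * character l x"
  by (simp add: character_def inner_add_left distrib_left cis_mult)

lemma character_0 [simp]: "character 0 x = 1" "character k 0 = 1" by (simp_all add: character_def)

lemma norm_character [simp]: "norm (character k x) = 1" by (simp add: character_def)

lemma continuous_character [continuous_intros]: "continuous_on S (character k)" unfolding character_def by (intro continuous_intros)

lemma character_measurable [measurable]: "character k \<in> borel_measurable borel"
  by (intro borel_measurable_continuous_onI continuous_intros)

lemma character_minus: "character (- k) x = character k (- x)" "character k x * character (- k) x = 1"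
  by (simp_all add: character_def cis_mult)

lemma int_lattice_range: "int_lattice = range (\<lambda>v. \<chi> i. real_of_int (v i))"
proof (intro set_eqI iffI)
  fix z :: "real^'d" assume "z \<in> int_lattice"
  then have "\<forall>i. \<exists>n. z $ i = of_int n" by (auto simp: int_lattice_def Ints_def)
  then obtain v where "\<And>i. z $ i = of_int (v i)" by metis
  then have "z = (\<chi> i. real_of_int (v i))" by (simp add: vec_eq_iff)
  then show "z \<in> range (\<lambda>v. \<chi> i. real_of_int (v i))" by blast
qed (auto simp: int_lattice_def)

lemma countable_int_lattice: "countable (int_lattice :: (real^'d) set)" unfolding int_lattice_range by (intro countable_image) simp

lemma infinite_int_lattice: "infinite (int_lattice :: (real^'d) set)"
proof
  assume fin: "finite (int_lattice :: (real^'d) set)"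
  have "inj (\<lambda>n::int. \<chi> i::'d. real_of_int n)" by (rule injI) (auto simp: vec_eq_iff)
  moreover have "range (\<lambda>n::int. \<chi> i::'d. real_of_int n) \<subseteq> int_lattice" by (auto simp: int_lattice_def)
  ultimately show False using fin by (meson finite_subset infinite_UNIV_int finite_imageD)
qed

lemma dual_lattice_props:
  fixes k l z :: "real^'d" and i :: 'd
  assumes "0 < L"
  shows "bij_betw (\<lambda>z. (1 / L) *\<^sub>R z) int_lattice (dual_lattice L :: (real^'d) set)"
    and "countable (dual_lattice L :: (real^'d) set)" "infinite (dual_lattice L :: (real^'d) set)" "(0 :: real^'d) \<in> dual_lattice L"
    and "k \<in> dual_lattice L \<Longrightarrow> l \<in> dual_lattice L \<Longrightarrow> k + l \<in> dual_lattice L"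
    and "k \<in> dual_lattice L \<Longrightarrow> - k \<in> dual_lattice L"
    and "axis i (1 / L) \<in> dual_lattice L"
    and "k \<in> dual_lattice L \<Longrightarrow> z \<in> int_lattice \<Longrightarrow> character k (L *\<^sub>R z) = 1"
proof -
  have inj: "inj_on (\<lambda>z. (1 / L) *\<^sub>R z) (int_lattice :: (real^'d) set)" using assms by (auto intro: inj_onI)
  then show "bij_betw (\<lambda>z. (1 / L) *\<^sub>R z) int_lattice (dual_lattice L :: (real^'d) set)" by (simp add: bij_betw_def dual_lattice_def)
  show "countable (dual_lattice L :: (real^'d) set)" unfolding dual_lattice_def by (intro countable_image countable_int_lattice)
  show "infinite (dual_lattice L :: (real^'d) set)" unfolding dual_lattice_def using finite_imageD[OF _ inj] infinite_int_lattice by blast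
  show "(0 :: real^'d) \<in> dual_lattice L" unfolding dual_lattice_def by (rule image_eqI[of _ _ 0]) (auto simp: int_lattice_def)
  have iff: "k \<in> dual_lattice L \<longleftrightarrow> (\<forall>i. L * k $ i \<in> \<int>)" for k :: "real^'d"
  proof
    assume "\<forall>i. L * k $ i \<in> \<int>"
    then have "L *\<^sub>R k \<in> int_lattice" by (simp add: int_lattice_def)
    then show "k \<in> dual_lattice L" unfolding dual_lattice_def using assms by (intro image_eqI[of _ _ "L *\<^sub>R k"]) auto
  qed (use assms in \<open>auto simp: dual_lattice_def int_lattice_def\<close>)
  show "k \<in> dual_lattice L \<Longrightarrow> l \<in> dual_lattice L \<Longrightarrow> k + l \<in> dual_lattice L" by (simp add: iff distrib_left)
  show "k \<in> dual_lattice L \<Longrightarrow> - k \<in> dual_lattice L" by (simp add: iff)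
  show "axis i (1 / L) \<in> dual_lattice L" using assms by (auto simp: iff axis_def)
  show "character k (L *\<^sub>R z) = 1" if "k \<in> dual_lattice L" "z \<in> int_lattice"
  proof -
    have "k \<bullet> (L *\<^sub>R z) = (\<Sum>i\<in>UNIV. (L * k $ i) * z $ i)" by (simp add: inner_vec_def algebra_simps)
    also have "\<dots> \<in> \<int>"
    proof (rule Ints_sum)
      show "(L * k $ i) * z $ i \<in> \<int>" for i by (rule Ints_mult) (use that in \<open>auto simp: iff int_lattice_def\<close>)
    qed
    finally obtain n where "k \<bullet> (L *\<^sub>R z) = of_int n" by (auto elim: Ints_cases)
    then show ?thesis unfolding character_def by (simp only:) (rule cis_multiple_2pi, simp)
  qed
qed

text \<open>Half-open boxes tile space without overlap under translation by L times the integer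
  lattice; they differ from the closed boxes of the model by null sets.\<close>

definition half_open_box :: "real^'d \<Rightarrow> real \<Rightarrow> (real^'d) set" where
  "half_open_box c L = {x. \<forall>i. c $ i \<le> x $ i \<and> x $ i < c $ i + L}"

lemma half_open_box_measurable [measurable]: "half_open_box c L \<in> sets borel" unfolding half_open_box_def by measurable

lemma half_open_box_subset: "half_open_box c L \<subseteq> cubic_box c L" by (auto simp: half_open_box_def cubic_box_def mem_box_cart less_imp_le)

lemma half_open_box_AE: "AE x in lborel. x \<in> half_open_box c L \<longleftrightarrow> x \<in> cubic_box c L"
proof -
  let ?a = c and ?b = "c + vec L"
  have "negligible (cbox ?a ?b - box ?a ?b)" by (rule negligible_frontier_interval)
  then have "cbox ?a ?b - box ?a ?b \<in> null_sets lebesgue" by (simp add: negligible_iff_null_sets)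
  then have "cbox ?a ?b - box ?a ?b \<in> null_sets lborel" by (auto simp: null_sets_def emeasure_completion)
  then have "AE x in lborel. x \<notin> cbox ?a ?b - box ?a ?b" by (rule AE_not_in)
  then show ?thesis
  proof eventually_elim
    case (elim x)
    then show ?case by (auto simp: half_open_box_def cubic_box_def mem_box_cart less_imp_le)
  qed
qed

lemma tile_unique:
  fixes y c :: "real^'d"
  assumes "0 < L"
  shows "\<exists>!z. z \<in> int_lattice \<and> y + L *\<^sub>R z \<in> half_open_box c L"
proof (rule ex1I)
  define z :: "real^'d" where "z = (\<chi> i. - of_int \<lfloor>(y $ i - c $ i) / L\<rfloor>)"
  have zi: "c $ i \<le> y $ i + L * z $ i" "y $ i + L * z $ i < c $ i + L" for i
  proof -
    have "of_int \<lfloor>(y $ i - c $ i) / L\<rfloor> \<le> (y $ i - c $ i) / L" "(y $ i - c $ i) / L < of_int \<lfloor>(y $ i - c $ i) / L\<rfloor> + 1" by linarith+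
    from mult_left_mono[OF this(1), of L] mult_strict_left_mono[OF this(2), of L]
    show "c $ i \<le> y $ i + L * z $ i" "y $ i + L * z $ i < c $ i + L" using assms by (simp_all add: z_def distrib_left)
  qed
  then show "z \<in> int_lattice \<and> y + L *\<^sub>R z \<in> half_open_box c L" by (auto simp: int_lattice_def half_open_box_def z_def)
  fix z' assume z': "z' \<in> int_lattice \<and> y + L *\<^sub>R z' \<in> half_open_box c L"
  show "z' = z"
  proof (unfold vec_eq_iff, rule allI)
    fix i
    have b: "c $ i \<le> y $ i + L * z' $ i" "y $ i + L * z' $ i < c $ i + L" using z' by (auto simp: half_open_box_def)
    obtain n where n: "z' $ i = of_int n" using z' by (auto simp: int_lattice_def elim: Ints_cases)
    have "(y $ i - c $ i) / L + of_int n \<ge> 0" "(y $ i - c $ i) / L + of_int n < 1"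
      using b assms unfolding n by (simp_all add: field_simps)
    then have "\<lfloor>(y $ i - c $ i) / L\<rfloor> = - n" by linarith
    then show "z' $ i = z $ i" by (simp add: z_def n)
  qed
qed

abbreviation lattice_enum :: "nat \<Rightarrow> real^'d" where
  "lattice_enum \<equiv> from_nat_into int_lattice"

lemma lattice_enum_bij: "bij_betw lattice_enum UNIV (int_lattice :: (real^'d) set)"
  by (rule bij_betw_from_nat_into[OF countable_int_lattice infinite_int_lattice])

lemma lborel_shift:
  fixes g :: "real^'d \<Rightarrow> 'b::{banach, second_countable_topology}"
  assumes [measurable]: "g \<in> borel_measurable borel"
  shows "(LINT x|lborel. g (x + t)) = (LINT x|lborel. g x)"
proof -
  have "(LINT x|lborel. g x) = (LINT x|distr lborel borel ((+) t). g x)" by (simp add: lborel_distr_plus)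
  also have "\<dots> = (LINT x|lborel. g (t + x))" by (rule integral_distr) simp_all
  finally show ?thesis by (simp add: add.commute)
qed

text \<open>Each point lies in exactly one lattice translate of the box, so the indicators sum to 1
  and the integral over space splits absolutely over the tiles.\<close>

lemma tile_sums:
  fixes g :: "real^'d \<Rightarrow> complex" and c :: "real^'d"
  assumes L: "0 < L" and g: "integrable lborel g"
  defines "I \<equiv> \<lambda>n y. indicator (half_open_box c L) (y + L *\<^sub>R lattice_enum n) :: real"
  shows "(\<lambda>n. LINT y|lborel. I n y *\<^sub>R g y) sums (LINT y|lborel. g y)"
    and "summable (\<lambda>n. LINT y|lborel. norm (I n y *\<^sub>R g y))"
    and "integrable lborel (\<lambda>y. I n y *\<^sub>R g y)"
proof -
  have gm[measurable]: "g \<in> borel_measurable borel" using g by (simp add: borel_measurable_integrable)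
  have Im[measurable]: "I n \<in> borel_measurable borel" for n
    unfolding I_def by (rule measurable_compose[OF _ borel_measurable_indicator[OF half_open_box_measurable]]) simp
  have one: "\<exists>n. (\<forall>m. I m y = (if m = n then 1 else 0))" for y
  proof -
    obtain z :: "real^'d" where z: "z \<in> int_lattice" "y + L *\<^sub>R z \<in> half_open_box c L"
      "\<And>z'. z' \<in> int_lattice \<Longrightarrow> y + L *\<^sub>R z' \<in> half_open_box c L \<Longrightarrow> z' = z" using tile_unique[OF L, of y c] by blast
    obtain n where n: "z = lattice_enum n" using lattice_enum_bij z(1) by (metis bij_betw_imp_surj_on image_iff)
    have "I m y = (if m = n then 1 else 0)" for m
    proof -
      have "lattice_enum m \<in> (int_lattice :: (real^'d) set)" using lattice_enum_bij by (metis bij_betw_imp_surj_on rangeI)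
      then have "y + L *\<^sub>R lattice_enum m \<in> half_open_box c L \<longleftrightarrow> lattice_enum m = z" using z(2) z(3)[of "lattice_enum m"] by blast
      also have "\<dots> \<longleftrightarrow> m = n" unfolding n by (rule inj_eq[OF bij_betw_imp_inj_on[OF lattice_enum_bij]])
      finally show ?thesis by (simp add: I_def indicator_def)
    qed
    then show ?thesis by blast
  qed
  show int: "integrable lborel (\<lambda>y. I n y *\<^sub>R g y)" for n
    by (rule Bochner_Integration.integrable_bound[OF g]) (auto simp: I_def indicator_def)
  have ns: "(\<lambda>n. norm (I n y *\<^sub>R g y)) sums norm (g y)" and s: "(\<lambda>n. I n y *\<^sub>R g y) sums g y" for y
  proof -
    obtain n where n: "\<And>m. I m y = (if m = n then 1 else 0)" using one by blast
    have "(\<lambda>m. norm (I m y *\<^sub>R g y)) = (\<lambda>m. if m = n then norm (g y) else 0)" by (auto simp: n)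
    then show "(\<lambda>n. norm (I n y *\<^sub>R g y)) sums norm (g y)" using sums_single[of n "\<lambda>_. norm (g y)"] by simp
    have "(\<lambda>m. I m y *\<^sub>R g y) = (\<lambda>m. if m = n then g y else 0)" by (auto simp: n)
    then show "(\<lambda>n. I n y *\<^sub>R g y) sums g y" using sums_single[of n "\<lambda>_. g y"] by simp
  qed
  have intn: "integrable lborel (\<lambda>y. norm (I n y *\<^sub>R g y))" for n by (rule integrable_norm[OF int])
  show sm: "summable (\<lambda>n. LINT y|lborel. norm (I n y *\<^sub>R g y))"
  proof (rule bounded_imp_summable)
    fix n
    have "(\<Sum>k\<le>n. LINT y|lborel. norm (I k y *\<^sub>R g y)) = (LINT y|lborel. (\<Sum>k\<le>n. norm (I k y *\<^sub>R g y)))"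
      by (rule Bochner_Integration.integral_sum[symmetric]) (rule intn)
    also have "\<dots> \<le> (LINT y|lborel. norm (g y))"
    proof (rule integral_mono)
      show "(\<Sum>k\<le>n. norm (I k y *\<^sub>R g y)) \<le> norm (g y)" for y
        unfolding sums_unique[OF ns[of y]] by (rule sum_le_suminf[OF sums_summable[OF ns[of y]]]) simp_all
      show "integrable lborel (\<lambda>y. \<Sum>k\<le>n. norm (I k y *\<^sub>R g y))" by (rule Bochner_Integration.integrable_sum) (rule intn)
      show "integrable lborel (\<lambda>y. norm (g y))" by (rule integrable_norm[OF g])
    qed
    finally show "(\<Sum>k\<le>n. LINT y|lborel. norm (I k y *\<^sub>R g y)) \<le> (LINT y|lborel. norm (g y))" .
  qed (rule integral_nonneg_AE, simp)
  have "(\<lambda>n. LINT y|lborel. I n y *\<^sub>R g y) sums (LINT y|lborel. (\<Sum>n. I n y *\<^sub>R g y))"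
    by (rule sums_integral[OF int _ sm]) (rule AE_I2, rule sums_summable[OF ns])
  also have "(\<lambda>y. \<Sum>n. I n y *\<^sub>R g y) = g" by (rule ext) (rule sums_unique[OF s, symmetric])
  finally show "(\<lambda>n. LINT y|lborel. I n y *\<^sub>R g y) sums (LINT y|lborel. g y)" .
qed

lemma box_integrable:
  fixes f :: "real^'d \<Rightarrow> complex"
  assumes "continuous_on UNIV f"
  shows "integrable lborel (\<lambda>x. indicator (half_open_box c L) x *\<^sub>R f x)"
proof -
  have int: "integrable lborel (\<lambda>x. indicator (cubic_box c L) x *\<^sub>R f x)"
    unfolding cubic_box_def by (rule borel_integrable_compact) (use assms in \<open>auto intro: continuous_on_subset\<close>)
  have [measurable]: "f \<in> borel_measurable borel" using assms by (rule borel_measurable_continuous_onI)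
  show ?thesis by (rule Bochner_Integration.integrable_bound[OF int], measurable)
       (use half_open_box_subset[of c L] in \<open>auto simp: indicator_def\<close>)
qed

definition box_integral :: "real^'d \<Rightarrow> real \<Rightarrow> (real^'d \<Rightarrow> complex) \<Rightarrow> complex" where
  "box_integral c L f = (LINT x|lborel. indicator (half_open_box c L) x *\<^sub>R f x)"

definition periodic :: "real \<Rightarrow> (real^'d \<Rightarrow> 'b) \<Rightarrow> bool" where
  "periodic L f \<longleftrightarrow> (\<forall>x. \<forall>z\<in>int_lattice. f (x + L *\<^sub>R z) = f x)"

lemma uminus_int_lattice: "bij_betw uminus int_lattice int_lattice" by (rule bij_betwI[of _ _ _ uminus]) (auto simp: int_lattice_def)

lemma lattice_enum_mem: "lattice_enum n \<in> int_lattice" by (rule from_nat_into) (metis infinite_int_lattice finite.emptyI)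

text \<open>Cutting each box along the tiles generated by the other gives two families of pieces. By
  periodicity the piece with index \<open>z\<close> in one family has the same integral as the piece
  with index \<open>- z\<close> in the other.\<close>

lemma box_integral_shift:
  fixes f :: "real^'d \<Rightarrow> complex" and c c' :: "real^'d"
  assumes L: "0 < L" and f: "continuous_on UNIV f" "periodic L f"
  shows "box_integral c L f = box_integral c' L f"
proof -
  have fm[measurable]: "f \<in> borel_measurable borel" using f(1) by (rule borel_measurable_continuous_onI)
  let ?B = "\<lambda>c x. indicator (half_open_box c L) x :: real"
  let ?g = "\<lambda>c x. ?B c x *\<^sub>R f x"
  let ?T = "\<lambda>z. (LINT y|lborel. ?B c' (y + L *\<^sub>R z) *\<^sub>R ?g c y)"
  let ?T' = "\<lambda>z. (LINT y|lborel. ?B c (y + L *\<^sub>R z) *\<^sub>R ?g c' y)"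
  have eq: "?T z = ?T' (- z)" if "z \<in> int_lattice" for z
  proof -
    have "?T' (- z) = (LINT y|lborel. ?B c (y + L *\<^sub>R z + L *\<^sub>R (- z)) *\<^sub>R ?g c' (y + L *\<^sub>R z))"
      by (rule lborel_shift[symmetric]) measurable
    also have "\<dots> = ?T z" using f(2) that by (intro Bochner_Integration.integral_cong) (auto simp: periodic_def mult.commute)
    finally show ?thesis by simp
  qed
  have hs: "((\<lambda>z. LINT y|lborel. ?B c2 (y + L *\<^sub>R z) *\<^sub>R ?g c1 y) has_sum box_integral c1 L f) int_lattice"
    (is "(?U has_sum _) _") for c1 c2
  proof -
    note t = tile_sums[OF L box_integrable[OF f(1), of c1 L], of c2]
    have "((\<lambda>n. ?U (lattice_enum n)) has_sum box_integral c1 L f) UNIV"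
    proof (rule norm_summable_imp_has_sum)
      show "summable (\<lambda>n. norm (?U (lattice_enum n)))"
        by (rule summable_comparison_test'[OF t(2), of 0]) (simp only: real_norm_def abs_norm_cancel, rule integral_norm_bound)
      show "(\<lambda>n. ?U (lattice_enum n)) sums box_integral c1 L f" using t(1) unfolding box_integral_def .
    qed
    then show ?thesis using has_sum_reindex_bij_betw[OF lattice_enum_bij, of ?U] by simp
  qed
  show ?thesis
  proof -
    have 1: "(?T has_sum box_integral c L f) int_lattice" by (rule hs)
    have "(?T' has_sum box_integral c' L f) int_lattice" by (rule hs)
    then have "((\<lambda>z. ?T' (- z)) has_sum box_integral c' L f) int_lattice"
      using has_sum_reindex_bij_betw[OF uminus_int_lattice, of ?T'] by simp
    then have "(?T has_sum box_integral c' L f) int_lattice" by (subst has_sum_cong[OF eq])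
    with 1 show ?thesis by (rule has_sum_unique)
  qed
qed

lemma periodic_character: "0 < L \<Longrightarrow> k \<in> dual_lattice L \<Longrightarrow> periodic L (character k)"
  by (simp add: periodic_def character_add dual_lattice_props(8))

lemma measure_half_open_box:
  assumes "0 < L"
  shows "measure lborel (half_open_box (c :: real^'d) L) = L ^ CARD('d)"
proof -
  have "measure lborel (half_open_box c L) = measure lborel (cubic_box c L)"
    by (rule measure_eq_AE) (use half_open_box_AE in \<open>auto simp: cubic_box_def\<close>)
  also have "\<dots> = (\<Prod>b\<in>Basis. (c + vec L - c) \<bullet> b)" unfolding cubic_box_def using assms
    by (subst measure_lborel_cbox_eq) (auto simp: Basis_vec_def inner_axis)
  also have "\<dots> = (\<Prod>i\<in>(UNIV::'d set). L)"
  proof -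
    have B: "(Basis :: (real^'d) set) = (\<lambda>i. axis i 1) ` UNIV" by (auto simp: Basis_vec_def)
    have "inj (\<lambda>i::'d. axis i (1::real))" by (auto simp: inj_def axis_eq_axis)
    then show ?thesis unfolding B by (subst prod.reindex) (auto simp: inner_axis)
  qed
  finally show ?thesis by simp
qed

text \<open>A translation by \<open>h\<close> with k \<bullet> h = 1/2 leaves the integral over a
  period unchanged and multiplies it by -1.\<close>

lemma character_orthogonal:
  fixes k :: "real^'d"
  assumes L: "0 < L" and k: "k \<in> dual_lattice L"
  shows "box_integral c L (character k) = (if k = 0 then of_real (L ^ CARD('d)) else 0)"
proof (cases "k = 0")
  case True
  have "box_integral c L (character k) = (LINT x|lborel. of_real (indicator (half_open_box c L) x))"
    unfolding box_integral_def True by (intro Bochner_Integration.integral_cong) (auto simp: scaleR_conv_of_real)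
  also have "\<dots> = of_real (measure lborel (half_open_box c L))" by simp
  finally show ?thesis using True measure_half_open_box[OF L, of c] by simp
next
  case False
  define h where "h = (1 / (2 * (k \<bullet> k))) *\<^sub>R k"
  have "k \<bullet> h = 1 / 2" using False by (simp add: h_def)
  then have kh: "character k h = -1" unfolding character_def by (simp only:) simp
  have "box_integral c L (character k) = box_integral (c + h) L (character k)"
    by (rule box_integral_shift[OF L _ periodic_character[OF L k]]) (rule continuous_character)
  also have "\<dots> = (LINT x|lborel. indicator (half_open_box (c + h) L) (x + h) *\<^sub>R character k (x + h))"
    unfolding box_integral_def by (rule lborel_shift[symmetric]) measurable
  also have "\<dots> = (LINT x|lborel. character k h * (indicator (half_open_box c L) x *\<^sub>R character k x))"
    by (intro Bochner_Integration.integral_cong) (auto simp: character_add half_open_box_def indicator_def)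
  also have "\<dots> = - box_integral c L (character k)" by (simp add: kh box_integral_def)
  finally show ?thesis using False by simp
qed

inductive_set trig_poly :: "real \<Rightarrow> (real^'d \<Rightarrow> complex) set" for L where
  char: "k \<in> dual_lattice L \<Longrightarrow> (\<lambda>x. a * character k x) \<in> trig_poly L"
| add: "f \<in> trig_poly L \<Longrightarrow> g \<in> trig_poly L \<Longrightarrow> (\<lambda>x. f x + g x) \<in> trig_poly L"

lemma trig_poly_mult:
  assumes L: "0 < L" and "f \<in> trig_poly L" "g \<in> trig_poly L"
  shows "(\<lambda>x. f x * g x) \<in> trig_poly L" using assms(2)
proof (induction rule: trig_poly.induct)
  case (char k a)
  show ?case using assms(3)
  proof (induction rule: trig_poly.induct)
    case (char l b)
    have "(\<lambda>x. (a * b) * character (k + l) x) \<in> trig_poly L"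
      using dual_lattice_props(5)[OF L \<open>k \<in> dual_lattice L\<close> char] by (rule trig_poly.char)
    then show ?case by (simp add: character_add_left mult_ac)
  next
    case (add f g)
    then show ?case using trig_poly.add[OF add.IH] by (simp add: distrib_left)
  qed
next
  case (add f f')
  then show ?case using trig_poly.add[OF add.IH] by (simp add: distrib_right)
qed

lemma trig_poly_const: "0 < L \<Longrightarrow> (\<lambda>_. a) \<in> trig_poly L" using trig_poly.char[of 0 L a] dual_lattice_props(4) by auto

lemma trig_poly_continuous: "f \<in> trig_poly L \<Longrightarrow> continuous_on UNIV f"
  by (induction rule: trig_poly.induct) (auto intro!: continuous_intros)

text \<open>The map \<open>E\<close> realizes the torus as a compact subset of complex
  \<open>d\<close>-space, through which periodic functions factor. There the real and imaginary
  parts of the coordinates separate points, and Stone-Weierstrass applies.\<close>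

lemma trig_poly_dense:
  fixes f :: "real^'d \<Rightarrow> real"
  assumes L: "0 < L" and f: "continuous_on UNIV f" "periodic L f" and e: "0 < e"
  shows "\<exists>h. (\<lambda>x. complex_of_real (h x)) \<in> trig_poly L \<and> (\<forall>x. \<bar>f x - h x\<bar> < e)"
proof -
  define E :: "real^'d \<Rightarrow> complex^'d" where "E x = (\<chi> i. character (axis i (1 / L)) x)" for x
  have Ec: "continuous_on S E" for S unfolding E_def by (intro continuous_on_vec_lambda continuous_intros)
  have E_inner: "axis i (1 / L) \<bullet> x = x $ i / L" for i and x :: "real^'d" by (simp add: inner_axis')
  define Q where "Q = cubic_box (0 :: real^'d) L"
  define T where "T = E ` Q"
  have Qc: "compact Q" by (simp add: Q_def cubic_box_def)
  have Tc: "compact T" unfolding T_def by (intro compact_continuous_image Ec Qc)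
  have E_eq: "f x = f y" if "E x = E y" for x y
  proof -
    have "(x $ i - y $ i) / L \<in> \<int>" for i
    proof -
      have "cis (2 * pi * (x $ i / L)) = cis (2 * pi * (y $ i / L))" using that by (simp add: E_def vec_eq_iff character_def E_inner)
      then have "cis (2 * pi * (x $ i / L) - 2 * pi * (y $ i / L)) = 1" by (simp flip: cis_divide)
      then have "cos (2 * pi * (x $ i / L) - 2 * pi * (y $ i / L)) = 1" by (simp add: complex_eq_iff)
      then obtain n :: int where "2 * pi * (x $ i / L) - 2 * pi * (y $ i / L) = of_int n * 2 * pi" by (auto simp: cos_one_2pi_int)
      then have "2 * pi * ((x $ i - y $ i) / L) = 2 * pi * of_int n" by (simp add: algebra_simps diff_divide_distrib)
      then have "(x $ i - y $ i) / L = of_int n" by (simp only: mult_cancel_left) simp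
      then show ?thesis by simp
    qed
    then have "(1 / L) *\<^sub>R (x - y) \<in> int_lattice" by (simp add: int_lattice_def)
    then have "f (y + L *\<^sub>R ((1 / L) *\<^sub>R (x - y))) = f y" using f(2) unfolding periodic_def by blast
    then show ?thesis using L by simp
  qed
  have rep: "\<exists>y\<in>Q. E y = E x \<and> f y = f x" for x
  proof -
    obtain z where z: "z \<in> int_lattice" "x + L *\<^sub>R z \<in> half_open_box 0 L" using tile_unique[OF L, of x 0] by blast
    have "x + L *\<^sub>R z \<in> Q" using z(2) half_open_box_subset unfolding Q_def by blast
    moreover have "E (x + L *\<^sub>R z) = E x"
      using dual_lattice_props(8)[OF L dual_lattice_props(7)[OF L] z(1)] by (simp add: E_def character_add)
    moreover have "f (x + L *\<^sub>R z) = f x" using f(2) z(1) by (auto simp: periodic_def)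
    ultimately show ?thesis by blast
  qed
  \<comment> \<open>The choice of a preimage is immaterial by \<open>E_eq\<close>.\<close>
  define ft where "ft u = f (SOME x. x \<in> Q \<and> E x = u)" for u
  have ftE: "ft (E x) = f x" if "x \<in> Q" for x
  proof -
    have "\<exists>y. y \<in> Q \<and> E y = E x" using that by blast
    then have "E (SOME y. y \<in> Q \<and> E y = E x) = E x" by (rule someI2_ex) blast
    then show ?thesis unfolding ft_def by (rule E_eq)
  qed
  \<comment> \<open>A continuous map from a compact to a Hausdorff space is closed, so
    \<open>E\<close> is a quotient map onto its image and continuity of \<open>f\<close> descends to
    \<open>ft\<close>.\<close>
  have ftc: "continuous_on T ft"
  proof -
    have cm: "continuous_map (top_of_set Q) (top_of_set T) E" using Ec by (auto simp: T_def)
    have "closed_map (top_of_set Q) (top_of_set T) E" by (rule continuous_imp_closed_map_gen[OF _ _ cm])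
         (use Qc in \<open>auto intro!: Hausdorff_imp_kc_space Hausdorff_space_subtopology compact_space_subtopology\<close>)
    then have "quotient_map (top_of_set Q) (top_of_set T) E" by (intro continuous_closed_imp_quotient_map cm) (auto simp: T_def)
    moreover have "continuous_map (top_of_set Q) euclideanreal (ft \<circ> E)"
    proof -
      have "continuous_on Q (ft \<circ> E)"
        by (subst continuous_on_cong[OF refl, of _ _ f]) (use ftE f(1) in \<open>auto intro: continuous_on_subset\<close>)
      then show ?thesis by simp
    qed
    ultimately have "continuous_map (top_of_set T) euclideanreal ft" by (rule continuous_compose_quotient_map)
    then show ?thesis by simp
  qed
  let ?R = "{h. continuous_on T h \<and> (\<lambda>x. complex_of_real (h (E x))) \<in> trig_poly L}"
  interpret function_ring_on ?R T
  proof
    show "compact T" by (rule Tc)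
    show "continuous_on T h" if "h \<in> ?R" for h using that by simp
    show "(\<lambda>x. h x + g x) \<in> ?R" if "h \<in> ?R" "g \<in> ?R" for h g
      using that trig_poly.add[of "\<lambda>x. complex_of_real (h (E x))" L "\<lambda>x. complex_of_real (g (E x))"] by (auto intro: continuous_intros)
    show "(\<lambda>x. h x * g x) \<in> ?R" if "h \<in> ?R" "g \<in> ?R" for h g
      using that trig_poly_mult[OF L, of "\<lambda>x. complex_of_real (h (E x))" "\<lambda>x. complex_of_real (g (E x))"] by (auto intro: continuous_intros)
    show "(\<lambda>_. a) \<in> ?R" for a using trig_poly_const[OF L] by auto
    show "\<exists>h\<in>?R. h u \<noteq> h v" if "u \<in> T" "v \<in> T" "u \<noteq> v" for u v
    proof -
      from that(3) obtain i where i: "u $ i \<noteq> v $ i" by (auto simp: vec_eq_iff)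
      let ?k = "axis i (1 / L) :: real^'d"
      note kd = dual_lattice_props(7)[OF L, of i] dual_lattice_props(6)[OF L dual_lattice_props(7)[OF L, of i]]
      have cc: "character (- ?k) x = cnj (character ?k x)" for x by (simp add: character_def cis_cnj)
      have Re: "(\<lambda>u::complex^'d. Re (u $ i)) \<in> ?R"
      proof -
        have "(\<lambda>x. (1/2) * character ?k x + (1/2) * character (- ?k) x) \<in> trig_poly L" by (intro trig_poly.add trig_poly.char kd)
        also have "(\<lambda>x. (1/2) * character ?k x + (1/2) * character (- ?k) x) = (\<lambda>x. complex_of_real (Re (E x $ i)))"
          by (rule ext) (simp add: cc E_def complex_eq_iff)
        finally show ?thesis by (auto intro!: continuous_intros)
      qed
      have Im: "(\<lambda>u::complex^'d. Im (u $ i)) \<in> ?R"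
      proof -
        have "(\<lambda>x. (- \<i> / 2) * character ?k x + (\<i> / 2) * character (- ?k) x) \<in> trig_poly L" by (intro trig_poly.add trig_poly.char kd)
        also have "(\<lambda>x. (- \<i> / 2) * character ?k x + (\<i> / 2) * character (- ?k) x) = (\<lambda>x. complex_of_real (Im (E x $ i)))"
          by (rule ext) (simp add: cc E_def complex_eq_iff)
        finally show ?thesis by (auto intro!: continuous_intros)
      qed
      show ?thesis
      proof (cases "Re (u $ i) = Re (v $ i)")
        case True
        then have "Im (u $ i) \<noteq> Im (v $ i)" using i by (auto simp: complex_eq_iff)
        then show ?thesis using Im by (intro bexI[OF _ Im])
      next
        case False
        then show ?thesis by (intro bexI[OF _ Re])
      qed
    qed
  qed
  from Stone_Weierstrass_basic[OF ftc e] obtain h where h: "h \<in> ?R" "\<forall>u\<in>T. \<bar>ft u - h u\<bar> < e" by (elim bexE)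
  show ?thesis
  proof (intro exI conjI allI)
    show "(\<lambda>x. complex_of_real (h (E x))) \<in> trig_poly L" using h(1) by simp
    fix x
    from rep[of x] obtain y where y: "y \<in> Q" "E y = E x" "f y = f x" by (elim bexE conjE)
    have "\<bar>ft (E y) - h (E y)\<bar> < e" using h(2) y(1) by (auto simp: T_def)
    then show "\<bar>f x - h (E x)\<bar> < e" using ftE[OF y(1)] y by simp
  qed
qed

lemma continuous_AE_zero:
  fixes r :: "real^'d \<Rightarrow> real"
  assumes r: "continuous_on UNIV r" and U: "open U" and ae: "AE x in lborel. x \<in> U \<longrightarrow> r x = 0" and y: "y \<in> U"
  shows "r y = 0"
proof (rule ccontr)
  assume ny: "r y \<noteq> 0"
  let ?V = "U \<inter> {x. r x \<noteq> 0}"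
  have V: "open ?V" by (intro open_Int U open_Collect_neq[OF r continuous_on_const])
  have "AE x in lborel. x \<notin> ?V" using ae by eventually_elim auto
  then have "?V \<in> null_sets lborel" using V by (subst AE_iff_null_sets) auto
  then have "negligible ?V" by (simp add: negligible_iff_null_sets null_sets_completionI)
  then show False using open_not_negligible[OF V] y ny by blast
qed

text \<open>A real function \<open>r\<close> orthogonal to all real trigonometric polynomials
  \<open>h\<close> satisfies \<integral> r^2 = \<integral> r (r - h), which is at most e \<integral>
  |r| once \<open>h\<close> is uniformly within \<open>e\<close> of \<open>r\<close>. Hence
  \<open>r\<close> vanishes almost everywhere on the box, and everywhere by continuity and
  periodicity.\<close>

lemma trig_coefficients_unique:
  fixes D :: "real^'d \<Rightarrow> complex"
  assumes L: "0 < L" and D: "continuous_on UNIV D" "periodic L D"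
    and zero: "\<And>k. k \<in> dual_lattice L \<Longrightarrow> box_integral c L (\<lambda>x. D x * character k x) = 0"
  shows "D = (\<lambda>_. 0)"
proof -
  let ?B = "half_open_box c L" and ?I = "\<lambda>x. indicator (half_open_box c L) x :: real"
  have bi: "integrable lborel (\<lambda>x. ?I x *\<^sub>R (D x * h x))" if "continuous_on UNIV h" for h
    by (intro box_integrable continuous_intros D that)
  have zp: "box_integral c L (\<lambda>x. D x * h x) = 0" if "h \<in> trig_poly L" for h using that
  proof (induction rule: trig_poly.induct)
    case (char k a)
    have "box_integral c L (\<lambda>x. D x * (a * character k x)) = (LINT x|lborel. a * (?I x *\<^sub>R (D x * character k x)))"
      unfolding box_integral_def by (intro Bochner_Integration.integral_cong) auto
    also have "\<dots> = a * box_integral c L (\<lambda>x. D x * character k x)" unfolding box_integral_def by (rule integral_mult_right_zero)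
    finally show ?case using zero[OF char] by simp
  next
    case (add f g)
    have "box_integral c L (\<lambda>x. D x * (f x + g x)) = (LINT x|lborel. ?I x *\<^sub>R (D x * f x) + ?I x *\<^sub>R (D x * g x))"
      unfolding box_integral_def by (intro Bochner_Integration.integral_cong) (auto simp: distrib_left scaleR_add_right)
    also have "\<dots> = box_integral c L (\<lambda>x. D x * f x) + box_integral c L (\<lambda>x. D x * g x)"
      unfolding box_integral_def by (intro Bochner_Integration.integral_add bi[OF trig_poly_continuous[OF add(1)]] bi[OF trig_poly_continuous[OF add(2)]])
    finally show ?case using add by simp
  qed
  \<comment> \<open>The functional \<phi> stands for \<open>Re\<close> and \<open>Im\<close>, so
    that the argument can be made for real functions.\<close>
  have part: "\<phi> (D x) = 0" if \<phi>: "bounded_linear \<phi>" "\<And>w a. \<phi> (w * complex_of_real a) = \<phi> w * a" for \<phi> :: "complex \<Rightarrow> real" and x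
  proof -
    define r where "r x = \<phi> (D x)" for x
    have rc: "continuous_on UNIV r" unfolding r_def by (intro bounded_linear.continuous_on[OF \<phi>(1)] D(1))
    have rp: "periodic L r" using D(2) by (simp add: periodic_def r_def)
    have lin: "\<phi> (?I x *\<^sub>R (D x * complex_of_real a)) = ?I x *\<^sub>R (r x * a)" for x a
      unfolding r_def \<phi>(2)[symmetric] by (rule linear_scale[OF bounded_linear.linear[OF \<phi>(1)]])
    have int: "integrable lborel (\<lambda>x. ?I x *\<^sub>R (r x * h x))" if h: "continuous_on UNIV h" for h :: "real^'d \<Rightarrow> real"
    proof -
      have "integrable lborel (\<lambda>x. ?I x *\<^sub>R (D x * complex_of_real (h x)))" by (intro bi continuous_intros h)
      from integrable_bounded_linear[OF \<phi>(1) this] show ?thesis unfolding lin .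
    qed
    have zr: "(LINT x|lborel. ?I x *\<^sub>R (r x * h x)) = 0" if h: "(\<lambda>x. complex_of_real (h x)) \<in> trig_poly L" for h
    proof -
      have i: "integrable lborel (\<lambda>x. ?I x *\<^sub>R (D x * complex_of_real (h x)))" by (intro bi trig_poly_continuous[OF h])
      have "(LINT x|lborel. ?I x *\<^sub>R (r x * h x)) = \<phi> (box_integral c L (\<lambda>x. D x * complex_of_real (h x)))"
        unfolding box_integral_def integral_bounded_linear[OF \<phi>(1) i, symmetric] lin ..
      then show ?thesis using zp[OF h] linear_0[OF bounded_linear.linear[OF \<phi>(1)]] by simp
    qed
    have i1: "integrable lborel (\<lambda>x. ?I x *\<^sub>R \<bar>r x\<bar>)" using integrable_norm[OF int[OF continuous_on_const, of 1]] by (simp add: abs_mult)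
    define a where "a = (LINT x|lborel. ?I x *\<^sub>R \<bar>r x\<bar>)"
    have A0: "0 \<le> a" unfolding a_def by (intro integral_nonneg_AE) auto
    let ?rr = "LINT x|lborel. ?I x *\<^sub>R (r x * r x)"
    have small: "?rr \<le> e * a" if e: "0 < e" for e
    proof -
      obtain h where h: "(\<lambda>x. complex_of_real (h x)) \<in> trig_poly L" "\<And>x. \<bar>r x - h x\<bar> < e" using trig_poly_dense[OF L rc rp e] by blast
      have hc: "continuous_on UNIV h"
      proof -
        have "continuous_on UNIV (\<lambda>x. Re (complex_of_real (h x)))" by (intro continuous_intros trig_poly_continuous[OF h(1)])
        then show ?thesis by simp
      qed
      have "?rr = ?rr - (LINT x|lborel. ?I x *\<^sub>R (r x * h x))" using zr[OF h(1)] by simp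
      also have "\<dots> = (LINT x|lborel. ?I x *\<^sub>R (r x * r x) - ?I x *\<^sub>R (r x * h x))"
        by (intro Bochner_Integration.integral_diff[symmetric] int rc hc)
      also have "\<dots> \<le> (LINT x|lborel. e * (?I x *\<^sub>R \<bar>r x\<bar>))"
      proof (rule integral_mono)
        show "integrable lborel (\<lambda>x. ?I x *\<^sub>R (r x * r x) - ?I x *\<^sub>R (r x * h x))"
          by (intro Bochner_Integration.integrable_diff int rc hc)
        show "integrable lborel (\<lambda>x. e * (?I x *\<^sub>R \<bar>r x\<bar>))" using i1 by (rule integrable_mult_right)
        fix x
        have "r x * (r x - h x) \<le> \<bar>r x\<bar> * \<bar>r x - h x\<bar>" by (metis abs_ge_self abs_mult)
        also have "\<dots> \<le> \<bar>r x\<bar> * e" using h(2)[of x] by (intro mult_left_mono) auto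
        finally have "?I x * (r x * (r x - h x)) \<le> ?I x * (\<bar>r x\<bar> * e)" by (intro mult_left_mono) auto
        then show "?I x *\<^sub>R (r x * r x) - ?I x *\<^sub>R (r x * h x) \<le> e * (?I x *\<^sub>R \<bar>r x\<bar>)" by (simp add: algebra_simps)
      qed
      also have "\<dots> = e * a" unfolding a_def by (rule integral_mult_right_zero)
      finally show ?thesis .
    qed
    have "?rr \<le> 0"
    proof (rule field_le_epsilon)
      fix e :: real assume e: "0 < e"
      have "0 < e / (a + 1)" using A0 e by (intro divide_pos_pos) linarith+
      then have "?rr \<le> e / (a + 1) * a" by (rule small)
      also have "\<dots> \<le> e" using A0 e by (simp add: divide_le_eq)
      finally show "?rr \<le> 0 + e" by simp
    qed
    moreover have "0 \<le> ?rr" by (intro integral_nonneg_AE) auto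
    ultimately have "?rr = 0" by (rule antisym)
    moreover have "AE x in lborel. 0 \<le> ?I x *\<^sub>R (r x * r x)" by simp
    ultimately have ae: "AE x in lborel. ?I x *\<^sub>R (r x * r x) = 0" using integral_nonneg_eq_0_iff_AE[OF int[OF rc]] by blast
    have "AE x in lborel. x \<in> box c (c + vec L) \<longrightarrow> r x = 0" using ae
    proof eventually_elim
      case (elim x)
      then show ?case by (auto simp: half_open_box_def mem_box_cart less_imp_le indicator_def split: if_splits)
    qed
    then have inner: "r y = 0" if "y \<in> box c (c + vec L)" for y by (rule continuous_AE_zero[OF rc open_box _ that])
    have hob: "r y = 0" if "y \<in> half_open_box c L" for y
    proof -
      have "y \<in> cbox c (c + vec L)" using that half_open_box_subset by (auto simp: cubic_box_def)
      also have "cbox c (c + vec L) = closure (box c (c + vec L))"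
      proof -
        have "box c (c + vec L) \<noteq> {}" using L by (auto simp: box_ne_empty Basis_vec_def inner_axis inner_add_left)
        then show ?thesis by (simp add: closure_box)
      qed
      finally have "y \<in> closure (box c (c + vec L))" .
      with continuous_constant_on_closure[of "box c (c + vec L)" r 0 y] inner continuous_on_subset[OF rc subset_UNIV]
      show ?thesis by blast
    qed
    obtain z where z: "z \<in> int_lattice" "x + L *\<^sub>R z \<in> half_open_box c L" using tile_unique[OF L, of x c] by blast
    have "r (x + L *\<^sub>R z) = r x" using rp z(1) unfolding periodic_def by blast
    then show "\<phi> (D x) = 0" using hob[OF z(2)] by (simp add: r_def)
  qed
  show ?thesis
  proof
    fix x show "D x = 0" using part[of Re x] part[of Im x] bounded_linear_Re bounded_linear_Im by (simp add: complex_eq_iff)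
  qed
qed

text \<open>A labelling invariant under \<pi> is constant on cycles and so amounts to a labelling of
  the cycles; the least element of a cycle serves as representative in the inverse map. Each label
  then occurs \<open>card C\<close> times in the product.\<close>

lemma finite_prod_PiE_cycles:
  fixes q :: "nat \<Rightarrow> real"
  assumes \<pi>: "\<pi> \<in> perms N"
  shows "(\<Sum>\<kappa> | \<kappa> \<in> PiE {1..N} (\<lambda>_. {..<n}) \<and> (\<forall>i\<in>{1..N}. \<kappa> (\<pi> i) = \<kappa> i). \<Prod>i=1..N. q (\<kappa> i))
    = (\<Prod>C\<in>cycle_sets N \<pi>. \<Sum>j<n. q j ^ card C)"
proof -
  note P = orbit_partition[OF \<pi>]
  have p: "\<pi> permutes {1..N}" using \<pi> by (simp add: perms_def)
  let ?K = "{\<kappa>. \<kappa> \<in> PiE {1..N} (\<lambda>_. {..<n}) \<and> (\<forall>i\<in>{1..N}. \<kappa> (\<pi> i) = \<kappa> i)}"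
  let ?F = "PiE (cycle_sets N \<pi>) (\<lambda>_. {..<n})"
  let ?f = "\<lambda>f. \<lambda>i\<in>{1..N}. f (orbit \<pi> i)" and ?g = "\<lambda>\<kappa>. \<lambda>C\<in>cycle_sets N \<pi>. \<kappa> (Min C)"
  have orb: "orbit \<pi> i \<in> cycle_sets N \<pi>" if "i \<in> {1..N}" for i using that by (simp add: cycle_sets_def)
  have \<pi>i: "\<pi> i \<in> {1..N}" if "i \<in> {1..N}" for i using that permutes_in_image[OF p] by blast
  have const: "\<kappa> j = \<kappa> i" if "\<kappa> \<in> ?K" "i \<in> {1..N}" "j \<in> orbit \<pi> i" for \<kappa> :: "nat \<Rightarrow> nat" and i j
  proof -
    have "j \<in> {1..N} \<and> \<kappa> j = \<kappa> i" using that(3)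
    proof induction
      case base
      then show ?case using that(1,2) \<pi>i[of i] by auto
    next
      case (step y)
      then show ?case using that(1) \<pi>i[of y] by auto
    qed
    then show ?thesis by simp
  qed
  have minC: "Min C \<in> C" "Min C \<in> {1..N}" if "C \<in> cycle_sets N \<pi>" for C using P(5)[OF that] Min_in[of C] by blast+
  have inv1: "?f (?g \<kappa>) = \<kappa>" if "\<kappa> \<in> ?K" for \<kappa>
  proof
    fix i show "?f (?g \<kappa>) i = \<kappa> i"
    proof (cases "i \<in> {1..N}")
      case True
      have "\<kappa> (Min (orbit \<pi> i)) = \<kappa> i" by (rule const[OF that True minC(1)[OF orb[OF True]]])
      then show ?thesis using True orb[OF True] by simp
    next
      case False
      moreover have "\<kappa> i = undefined" using that False by (auto simp: PiE_def extensional_def)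
      ultimately show ?thesis by auto
    qed
  qed
  have inv2: "?g (?f f) = f" if "f \<in> ?F" for f
  proof
    fix C show "?g (?f f) C = f C"
    proof (cases "C \<in> cycle_sets N \<pi>")
      case True
      then show ?thesis using minC[OF True] P(4)[OF True minC(1)[OF True]] by simp
    next
      case False
      then have "f C = undefined" using that by (auto simp: PiE_def extensional_def)
      then show ?thesis using False by simp
    qed
  qed
  have mem1: "?g \<kappa> \<in> ?F" if "\<kappa> \<in> ?K" for \<kappa> using that minC by (auto simp: PiE_def Pi_def)
  have mem2: "?f f \<in> ?K" if "f \<in> ?F" for f
  proof -
    have "?f f (\<pi> i) = ?f f i" if i: "i \<in> {1..N}" for i
    proof -
      have "orbit \<pi> (\<pi> i) = orbit \<pi> i" by (rule permutation_orbit_step[OF perms_permutation[OF \<pi>]])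
      then show ?thesis using i \<pi>i[OF i] by simp
    qed
    moreover have "?f f \<in> PiE {1..N} (\<lambda>_. {..<n})"
    proof
      show "?f f i \<in> {..<n}" if "i \<in> {1..N}" for i using that orb[OF that] \<open>f \<in> ?F\<close> by (auto simp: PiE_def Pi_def)
    qed auto
    ultimately show ?thesis by blast
  qed
  have "(\<Sum>\<kappa>\<in>?K. \<Prod>i=1..N. q (\<kappa> i)) = (\<Sum>f\<in>?F. \<Prod>C\<in>cycle_sets N \<pi>. q (f C) ^ card C)"
  proof (rule sum.reindex_bij_witness[of _ ?f ?g])
    fix \<kappa> assume \<kappa>: "\<kappa> \<in> ?K"
    have "(\<Prod>C\<in>cycle_sets N \<pi>. q (?g \<kappa> C) ^ card C) = (\<Prod>i=1..N. q (?g \<kappa> (orbit \<pi> i)))" by (rule prod_over_points[OF \<pi>, symmetric])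
    also have "\<dots> = (\<Prod>i=1..N. q (?f (?g \<kappa>) i))" by (intro prod.cong) auto
    finally show "(\<Prod>C\<in>cycle_sets N \<pi>. q (?g \<kappa> C) ^ card C) = (\<Prod>i=1..N. q (\<kappa> i))" unfolding inv1[OF \<kappa>] .
  qed (erule inv1 mem1 inv2 mem2)+
  also have "\<dots> = (\<Prod>C\<in>cycle_sets N \<pi>. \<Sum>j<n. q j ^ card C)" by (rule prod_sum_PiE[symmetric]) (use P(1) in auto)
  finally show ?thesis .
qed

section \<open>Fourier expansion of the periodized weight and integration over the points\<close>

locale torus_weight =
  fixes p :: "real^'d \<Rightarrow> real" and q :: "real^'d \<Rightarrow> real" and L :: real
  assumes L: "0 < L" and p_cont: "continuous_on UNIV p" and p_nonneg: "\<And>x. 0 \<le> p x" and p_int: "integrable lborel p"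
    and p_sum: "\<And>x. (\<lambda>z. p (x - L *\<^sub>R z)) summable_on int_lattice"
    and F_cont: "continuous_on UNIV (\<lambda>x. \<Sum>\<^sub>\<infinity>z\<in>int_lattice. p (x - L *\<^sub>R z))"
    and q_fourier: "\<And>k. (LINT x|lborel. complex_of_real (p x) * character (- k) x) = of_real (q k)"
    and q_bounds: "\<And>k. 0 \<le> q k" "\<And>k. q k \<le> 1"
    and q_sum: "q summable_on dual_lattice L"
begin

definition F :: "real^'d \<Rightarrow> real" where "F x = (\<Sum>\<^sub>\<infinity>z\<in>int_lattice. p (x - L *\<^sub>R z))"

lemma F_sums: "(\<lambda>n. p (x - L *\<^sub>R lattice_enum n)) sums F x"
proof -
  have "((\<lambda>z. p (x - L *\<^sub>R z)) has_sum F x) int_lattice" unfolding F_def using p_sum by (rule has_sum_infsum)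
  then have "((\<lambda>n. p (x - L *\<^sub>R lattice_enum n)) has_sum F x) UNIV"
    using has_sum_reindex_bij_betw[OF lattice_enum_bij, of "\<lambda>z. p (x - L *\<^sub>R z)"] by simp
  then show ?thesis by (rule has_sum_imp_sums)
qed

lemma F_nonneg: "0 \<le> F x" unfolding F_def using p_nonneg by (rule infsum_nonneg)

lemma F_continuous: "continuous_on UNIV F" using F_cont by (simp add: F_def[abs_def])

lemma F_periodic: "periodic L F" unfolding periodic_def
proof (intro allI ballI)
  fix x z :: "real^'d" assume z: "z \<in> int_lattice"
  have "bij_betw (\<lambda>y. y - z) int_lattice int_lattice" by (rule bij_betwI[of _ _ _ "\<lambda>y. y + z"]) (use z in \<open>auto simp: int_lattice_def\<close>)
  from infsum_reindex_bij_betw[OF this, of "\<lambda>y. p (x - L *\<^sub>R y)"]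
  show "F (x + L *\<^sub>R z) = F x" unfolding F_def by (simp add: algebra_simps)
qed

text \<open>Unfolding as in Poisson summation: the character is periodic, so the box integral of the
  periodization is the integral of \<open>p\<close> times the character over all of space.\<close>

lemma F_coefficient:
  assumes k: "k \<in> dual_lattice L"
  shows "box_integral c L (\<lambda>x. of_real (F x) * character (- k) x) = of_real (q k)"
proof -
  let ?g = "\<lambda>x. complex_of_real (p x) * character (- k) x"
  let ?B = "\<lambda>x. indicator (half_open_box c L) x :: real"
  have [measurable]: "p \<in> borel_measurable borel" using p_cont by (rule borel_measurable_continuous_onI)
  have g: "integrable lborel ?g" by (rule Bochner_Integration.integrable_bound[OF p_int]) (auto simp: norm_mult)
  note t = tile_sums[OF L g, of c]
  let ?f = "\<lambda>n x. ?B x *\<^sub>R (complex_of_real (p (x - L *\<^sub>R lattice_enum n)) * character (- k) x)"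
  have per: "character (- k) (x + - (L *\<^sub>R lattice_enum n)) = character (- k) x" for x n
  proof -
    have "character (- k) (x + - (L *\<^sub>R lattice_enum n) + L *\<^sub>R lattice_enum n) = character (- k) (x + - (L *\<^sub>R lattice_enum n))"
      using periodic_character[OF L dual_lattice_props(6)[OF L k]] lattice_enum_mem unfolding periodic_def by blast
    then show ?thesis by simp
  qed
  have h: "?B (x + - (L *\<^sub>R lattice_enum n) + L *\<^sub>R lattice_enum n) *\<^sub>R ?g (x + - (L *\<^sub>R lattice_enum n)) = ?f n x" for n x
    unfolding per by simp
  have shift: "(LINT y|lborel. ?B (y + L *\<^sub>R lattice_enum n) *\<^sub>R ?g y) = (LINT x|lborel. ?f n x)"
    "(LINT y|lborel. norm (?B (y + L *\<^sub>R lattice_enum n) *\<^sub>R ?g y)) = (LINT x|lborel. norm (?f n x))" for n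
    unfolding h[symmetric] by (rule lborel_shift[symmetric], measurable)+
  have fi: "integrable lborel (?f n)" for n by (intro box_integrable continuous_intros continuous_on_compose2[OF p_cont]) auto
  have s: "(\<lambda>n. ?f n x) sums (?B x *\<^sub>R (of_real (F x) * character (- k) x))" for x
    by (intro sums_scaleR_right sums_mult2 sums_of_real F_sums)
  have ns: "summable (\<lambda>n. norm (?f n x))" for x using sums_summable[OF F_sums[of x]] p_nonneg by (simp add: norm_mult summable_mult)
  have "(\<lambda>n. LINT x|lborel. ?f n x) sums (LINT x|lborel. (\<Sum>n. ?f n x))"
    by (rule sums_integral[OF fi AE_I2[OF ns]]) (use t(2) in \<open>simp only: shift\<close>)
  also have "(\<lambda>x. \<Sum>n. ?f n x) = (\<lambda>x. ?B x *\<^sub>R (of_real (F x) * character (- k) x))" by (rule ext) (rule sums_unique[OF s, symmetric])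
  finally have "(\<lambda>n. LINT x|lborel. ?f n x) sums box_integral c L (\<lambda>x. of_real (F x) * character (- k) x)" unfolding box_integral_def .
  moreover have "(\<lambda>n. LINT x|lborel. ?f n x) sums of_real (q k)" using t(1) unfolding shift q_fourier .
  ultimately show ?thesis by (rule sums_unique2)
qed

definition mode :: "nat \<Rightarrow> real^'d" where "mode = from_nat_into (dual_lattice L)"

lemma mode_bij: "bij_betw mode UNIV (dual_lattice L)"
  unfolding mode_def by (rule bij_betw_from_nat_into[OF dual_lattice_props(2,3)[OF L]])

lemma mode_mem: "mode n \<in> dual_lattice L" using mode_bij by (metis bij_betw_imp_surj_on rangeI)

lemma mode_inj: "mode i = mode j \<longleftrightarrow> i = j" by (rule inj_eq[OF bij_betw_imp_inj_on[OF mode_bij]])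

abbreviation "power_sum j \<equiv> \<Sum>\<^sub>\<infinity>k\<in>dual_lattice L. q k ^ j"

lemma q_power_sums:
  assumes "1 \<le> m"
  shows "(\<lambda>n. q (mode n) ^ m) sums power_sum m"
    and "(\<lambda>k. q k ^ m) summable_on dual_lattice L"
proof -
  have "q k ^ m \<le> q k" for k using power_decreasing[OF assms q_bounds(1,2), of k] by simp
  then show *: "(\<lambda>k. q k ^ m) summable_on dual_lattice L" using q_bounds by (intro summable_on_comparison_test[OF q_sum]) auto
  then have "((\<lambda>k. q k ^ m) has_sum power_sum m) (dual_lattice L)" by (rule has_sum_infsum)
  then have "((\<lambda>n. q (mode n) ^ m) has_sum power_sum m) UNIV" using has_sum_reindex_bij_betw[OF mode_bij, of "\<lambda>k. q k ^ m"] by simp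
  then show "(\<lambda>n. q (mode n) ^ m) sums power_sum m" by (rule has_sum_imp_sums)
qed

definition vol :: real where "vol = L ^ CARD('d)"

lemma vol_pos: "0 < vol" using L by (simp add: vol_def)

definition partial :: "nat \<Rightarrow> real^'d \<Rightarrow> complex" where
  "partial n x = (\<Sum>j<n. of_real (q (mode j) / vol) * character (mode j) x)"

lemma q_summable: "summable (\<lambda>j. q (mode j) / vol)" using sums_summable[OF q_power_sums(1)[of 1]] by (simp add: summable_divide)

lemma partial_bound: "norm (partial n x) \<le> (\<Sum>j. q (mode j) / vol)"
proof -
  have "norm (partial n x) \<le> (\<Sum>j<n. q (mode j) / vol)" unfolding partial_def using q_bounds vol_pos
    by (intro order_trans[OF norm_sum] sum_mono) (simp add: norm_mult norm_divide)
  also have "\<dots> \<le> (\<Sum>j. q (mode j) / vol)" using q_bounds vol_pos by (intro sum_le_suminf q_summable) auto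
  finally show ?thesis .
qed

text \<open>Summability of \<open>q\<close> makes the Fourier series converge uniformly to a
  continuous periodic \<open>G\<close>. It has the same coefficients as \<open>F\<close>, and
  coefficients determine a continuous periodic function.\<close>

lemma fourier_expansion: "(\<lambda>n. partial n x) \<longlonglongrightarrow> of_real (F x)"
proof -
  let ?f = "\<lambda>j x. of_real (q (mode j) / vol) * character (mode j) x"
  define G where "G x = (\<Sum>j. ?f j x)" for x
  have nf: "norm (?f j x) = q (mode j) / vol" for j x using q_bounds vol_pos by (simp add: norm_mult norm_divide)
  have sf: "summable (\<lambda>j. norm (?f j x))" for x unfolding nf by (rule q_summable)
  have ul: "uniform_limit UNIV partial G sequentially" unfolding partial_def[abs_def] G_def
    by (rule Weierstrass_m_test[OF _ q_summable]) (simp only: nf order_refl)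
  have pc: "continuous_on UNIV (partial n)" for n unfolding partial_def by (intro continuous_intros)
  have Gc: "continuous_on UNIV G" by (rule uniform_limit_theorem[OF _ ul]) (use pc in auto)
  have Gp: "periodic L G" using periodic_character[OF L mode_mem] unfolding periodic_def G_def by simp
  have coef: "box_integral 0 L (\<lambda>x. G x * character (- k) x) = of_real (q k)" if k: "k \<in> dual_lattice L" for k
  proof -
    let ?B = "\<lambda>x. indicator (half_open_box 0 L) x :: real"
    let ?h = "\<lambda>j x. ?B x *\<^sub>R (?f j x * character (- k) x)"
    have hi: "integrable lborel (?h j)" for j by (intro box_integrable continuous_intros)
    have hs: "(\<lambda>j. ?h j x) sums (?B x *\<^sub>R (G x * character (- k) x))" for x
      unfolding G_def by (intro sums_scaleR_right sums_mult2 summable_sums summable_norm_cancel[OF sf])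
    have hn: "norm (?h j x) = q (mode j) / vol * ?B x" for j x unfolding norm_scaleR norm_mult[of "?f j x"] nf by simp
    have hint: "(LINT x|lborel. norm (?h j x)) = q (mode j)" for j
    proof -
      have "measure lborel (half_open_box (0 :: real^'d) L) = vol" unfolding vol_def by (rule measure_half_open_box[OF L])
      then show ?thesis unfolding hn using vol_pos by simp
    qed
    have "(\<lambda>j. LINT x|lborel. ?h j x) sums (LINT x|lborel. (\<Sum>j. ?h j x))"
    proof (rule sums_integral[OF hi AE_I2])
      show "summable (\<lambda>j. norm (?h j x))" for x unfolding hn by (intro summable_mult2 q_summable)
      show "summable (\<lambda>j. LINT x|lborel. norm (?h j x))" unfolding hint using sums_summable[OF q_power_sums(1)[of 1]] by simp
    qed
    also have "(\<lambda>x. \<Sum>j. ?h j x) = (\<lambda>x. ?B x *\<^sub>R (G x * character (- k) x))" by (rule ext) (rule sums_unique[OF hs, symmetric])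
    finally have 1: "(\<lambda>j. LINT x|lborel. ?h j x) sums box_integral 0 L (\<lambda>x. G x * character (- k) x)" unfolding box_integral_def .
    have hj: "(LINT x|lborel. ?h j x) = (if mode j = k then of_real (q k) else 0)" for j
    proof -
      have h: "?h j x = of_real (q (mode j) / vol) * (?B x *\<^sub>R character (mode j + - k) x)" for x
        by (simp only: character_add_left mult.assoc mult_scaleR_right)
      have e: "(LINT x|lborel. ?B x *\<^sub>R character (mode j + - k) x) = (if mode j + - k = 0 then of_real vol else 0)"
        using character_orthogonal[OF L dual_lattice_props(5)[OF L mode_mem dual_lattice_props(6)[OF L k]], of 0 j]
        unfolding vol_def box_integral_def .
      show ?thesis
      proof (cases "mode j = k")
        case True
        then show ?thesis unfolding h integral_mult_right_zero e using vol_pos by simp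
      next
        case False
        then show ?thesis unfolding h integral_mult_right_zero e by simp
      qed
    qed
    obtain j0 where j0: "mode j0 = k" using mode_bij k by (metis bij_betw_imp_surj_on image_iff)
    have "(\<lambda>j. LINT x|lborel. ?h j x) = (\<lambda>j. if j = j0 then of_real (q k) else 0)"
      unfolding hj using mode_inj[of _ j0] unfolding j0 by (intro ext) (simp only:)
    then have "(\<lambda>j. LINT x|lborel. ?h j x) sums of_real (q k)" using sums_single[of j0 "\<lambda>_. of_real (q k) :: complex"] by (simp only:)
    with 1 show ?thesis by (rule sums_unique2)
  qed
  have "(\<lambda>x. of_real (F x) - G x) = (\<lambda>_. 0)"
  proof (rule trig_coefficients_unique[OF L, of _ 0])
    show "continuous_on UNIV (\<lambda>x. of_real (F x) - G x)" by (intro continuous_intros F_continuous Gc)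
    show "periodic L (\<lambda>x. of_real (F x) - G x)" using F_periodic Gp by (simp add: periodic_def)
    fix k :: "real^'d" assume k: "k \<in> dual_lattice L"
    let ?k = "- k"
    have kk: "?k \<in> dual_lattice L" using dual_lattice_props(6)[OF L k] .
    have i1: "integrable lborel (\<lambda>x. indicator (half_open_box 0 L) x *\<^sub>R (complex_of_real (F x) * character (- ?k) x))"
      by (rule box_integrable) (intro continuous_on_mult continuous_on_of_real F_continuous continuous_character)
    have i2: "integrable lborel (\<lambda>x. indicator (half_open_box 0 L) x *\<^sub>R (G x * character (- ?k) x))"
      by (rule box_integrable) (intro continuous_on_mult Gc continuous_character)
    have "box_integral 0 L (\<lambda>x. (of_real (F x) - G x) * character (- ?k) x)
        = box_integral 0 L (\<lambda>x. of_real (F x) * character (- ?k) x) - box_integral 0 L (\<lambda>x. G x * character (- ?k) x)"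
      unfolding box_integral_def left_diff_distrib scaleR_diff_right by (rule Bochner_Integration.integral_diff[OF i1 i2])
    then show "box_integral 0 L (\<lambda>x. (of_real (F x) - G x) * character k x) = 0" unfolding F_coefficient[OF kk] coef[OF kk] by simp
  qed
  from fun_cong[OF this, of x] have "of_real (F x) = G x" by simp
  then show ?thesis unfolding partial_def G_def using summable_LIMSEQ[OF summable_norm_cancel[OF sf]] by simp
qed

abbreviation box_measure :: "real^'d \<Rightarrow> (real^'d) measure" where
  "box_measure c \<equiv> restrict_space lborel (cubic_box c L)"

lemma finite_box_measure: "finite_measure (box_measure c)"
proof
  have "emeasure (box_measure c) (space (box_measure c)) = emeasure lborel (cubic_box c L)"
    by (simp add: emeasure_restrict_space cubic_box_def space_restrict_space)
  also have "\<dots> \<noteq> \<infinity>" unfolding cubic_box_def using emeasure_lborel_cbox_finite[of c "c + vec L"] by simp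
  finally show "emeasure (box_measure c) (space (box_measure c)) \<noteq> \<infinity>" .
qed

abbreviation box_power :: "real^'d \<Rightarrow> nat \<Rightarrow> (nat \<Rightarrow> real^'d) measure" where
  "box_power c N \<equiv> PiM {1..N} (\<lambda>_. box_measure c)"

lemma finite_box_power: "finite_measure (box_power c N)"
proof
  interpret fm: finite_measure "box_measure c" by (rule finite_box_measure)
  interpret PS: product_sigma_finite "\<lambda>_::nat. box_measure c" by unfold_locales
  have "emeasure (box_power c N) (PiE {1..N} (\<lambda>_. space (box_measure c)))
     = (\<Prod>i\<in>{1..N}. emeasure (box_measure c) (space (box_measure c)))" by (rule PS.emeasure_PiM) auto
  also have "\<dots> \<noteq> \<infinity>" by (simp add: ennreal_prod_eq_top power_eq_top_ennreal)
  finally show "emeasure (box_power c N) (space (box_power c N)) \<noteq> \<infinity>" by (simp add: space_PiM)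
qed

lemma integral_box_measure:
  assumes [measurable]: "f \<in> borel_measurable borel"
  shows "(LINT x|box_measure c. f x) = box_integral c L f"
proof -
  have [measurable]: "cubic_box c L \<in> sets borel" by (simp add: cubic_box_def)
  have "(LINT x|box_measure c. f x) = (LINT x|lborel. indicator (cubic_box c L) x *\<^sub>R f x)" by (rule integral_restrict_space) simp
  also have "\<dots> = box_integral c L f" unfolding box_integral_def
  proof (rule integral_cong_AE)
    show "AE x in lborel. indicator (cubic_box c L) x *\<^sub>R f x = indicator (half_open_box c L) x *\<^sub>R f x"
      using half_open_box_AE[of c L] by eventually_elim (auto simp: indicator_def)
  qed measurable
  finally show ?thesis .
qed

abbreviation "hops N \<pi> f x \<equiv> \<Prod>i=1..N. f (x i - x (\<pi> i))"

text \<open>The variable of point \<open>i\<close> occurs in two hops, so integrating it forces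
  equal modes on both; a mode is therefore carried unchanged around each cycle. The \<open>N\<close>
  factors \<open>vol\<close> from orthogonality cancel those of the coefficients.\<close>

lemma partial_product_integral:
  assumes \<pi>: "\<pi> \<in> perms N"
  shows "(LINT x|box_power c N. (hops N \<pi> (partial n) x))
    = of_real (\<Prod>C\<in>cycle_sets N \<pi>. \<Sum>j<n. q (mode j) ^ card C)"
proof -
  have p: "\<pi> permutes {1..N}" using \<pi> by (simp add: perms_def)
  interpret fm: finite_measure "box_measure c" by (rule finite_box_measure)
  interpret PS: product_sigma_finite "\<lambda>_::nat. box_measure c" by unfold_locales
  let ?M = "box_power c N"
  interpret PM: finite_measure ?M by (rule finite_box_power)
  let ?KK = "PiE {1..N} (\<lambda>_. {..<n})"
  let ?a = "\<lambda>j. complex_of_real (q (mode j) / vol)"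
  \<comment> \<open>The total frequency of \<open>x i\<close>: the hop leaving \<open>i\<close>
    contributes its mode, the hop arriving from \<open>inv \<pi> i\<close> the negative of its
    own.\<close>
  let ?e = "\<lambda>\<kappa> i. mode (\<kappa> i) + - mode (\<kappa> (inv \<pi> i))"
  have expand: "hops N \<pi> (partial n) x = (\<Sum>\<kappa>\<in>?KK. (\<Prod>i=1..N. ?a (\<kappa> i)) * (\<Prod>i=1..N. character (?e \<kappa> i) (x i)))" for x
  proof -
    have "hops N \<pi> (partial n) x = (\<Sum>\<kappa>\<in>?KK. \<Prod>i=1..N. ?a (\<kappa> i) * character (mode (\<kappa> i)) (x i - x (\<pi> i)))"
      unfolding partial_def by (rule prod_sum_PiE) auto
    also have "\<dots> = (\<Sum>\<kappa>\<in>?KK. (\<Prod>i=1..N. ?a (\<kappa> i)) * (\<Prod>i=1..N. character (?e \<kappa> i) (x i)))"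
    proof (rule sum.cong[OF refl])
      fix \<kappa>
      have "(\<Prod>i=1..N. character (mode (\<kappa> i)) (x i - x (\<pi> i)))
         = (\<Prod>i=1..N. character (mode (\<kappa> i)) (x i)) * (\<Prod>i=1..N. character (- mode (\<kappa> i)) (x (\<pi> i)))"
        unfolding prod.distrib[symmetric] character_minus(1) character_add[symmetric] by simp
      also have "(\<Prod>i=1..N. character (- mode (\<kappa> i)) (x (\<pi> i))) = (\<Prod>i=1..N. character (- mode (\<kappa> (inv \<pi> (\<pi> i)))) (x (\<pi> i)))"
        using permutes_inverses(2)[OF p] by simp
      also have "\<dots> = (\<Prod>i=1..N. character (- mode (\<kappa> (inv \<pi> i))) (x i))"
        by (rule prod.reindex_bij_betw[OF permutes_imp_bij[OF p], of "\<lambda>i. character (- mode (\<kappa> (inv \<pi> i))) (x i)"])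
      finally show "(\<Prod>i=1..N. ?a (\<kappa> i) * character (mode (\<kappa> i)) (x i - x (\<pi> i)))
         = (\<Prod>i=1..N. ?a (\<kappa> i)) * (\<Prod>i=1..N. character (?e \<kappa> i) (x i))" by (simp only: prod.distrib character_add_left)
    qed
    finally show ?thesis .
  qed
  have ci: "integrable (box_measure c) (character k)" for k
    by (rule fm.integrable_const_bound[where B = 1]) (auto intro: measurable_restrict_space1)
  have "integrable ?M (\<lambda>x. \<Prod>i=1..N. character (?e \<kappa> i) (x i))" for \<kappa> by (rule PS.product_integrable_prod) (use ci in auto)
  then have "(LINT x|?M. hops N \<pi> (partial n) x)
    = (\<Sum>\<kappa>\<in>?KK. LINT x|?M. (\<Prod>i=1..N. ?a (\<kappa> i)) * (\<Prod>i=1..N. character (?e \<kappa> i) (x i)))"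
    unfolding expand by (intro Bochner_Integration.integral_sum integrable_mult_right)
  also have "\<dots> = (\<Sum>\<kappa>\<in>?KK. if \<forall>i\<in>{1..N}. \<kappa> (\<pi> i) = \<kappa> i then of_real (\<Prod>i=1..N. q (mode (\<kappa> i))) else 0)"
  proof (rule sum.cong[OF refl])
    fix \<kappa> assume \<kappa>: "\<kappa> \<in> ?KK"
    have "(LINT x|?M. (\<Prod>i=1..N. ?a (\<kappa> i)) * (\<Prod>i=1..N. character (?e \<kappa> i) (x i)))
       = (\<Prod>i=1..N. ?a (\<kappa> i)) * (\<Prod>i=1..N. LINT x|box_measure c. character (?e \<kappa> i) x)"
      by (subst integral_mult_right_zero, subst PS.product_integral_prod) (use ci in auto)
    also have "\<dots> = (\<Prod>i=1..N. ?a (\<kappa> i) * (if \<kappa> i = \<kappa> (inv \<pi> i) then of_real vol else 0))"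
    proof -
      have "(LINT x|box_measure c. character (?e \<kappa> i) x) = (if \<kappa> i = \<kappa> (inv \<pi> i) then of_real vol else 0)" for i
        unfolding integral_box_measure[OF character_measurable] vol_def
        using character_orthogonal[OF L dual_lattice_props(5)[OF L mode_mem dual_lattice_props(6)[OF L mode_mem]], of c "\<kappa> i" "\<kappa> (inv \<pi> i)"]
        by (simp add: mode_inj)
      then show ?thesis by (simp only: prod.distrib)
    qed
    also have "\<dots> = (\<Prod>i=1..N. if \<kappa> i = \<kappa> (inv \<pi> i) then of_real (q (mode (\<kappa> i))) else 0)" using vol_pos by (intro prod.cong) auto
    also have "\<dots> = (if \<forall>i\<in>{1..N}. \<kappa> i = \<kappa> (inv \<pi> i) then of_real (\<Prod>i=1..N. q (mode (\<kappa> i))) else 0)"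
    proof (cases "\<forall>i\<in>{1..N}. \<kappa> i = \<kappa> (inv \<pi> i)")
      case True
      then show ?thesis by (simp add: of_real_prod)
    next
      case False
      then have "(\<Prod>i=1..N. if \<kappa> i = \<kappa> (inv \<pi> i) then of_real (q (mode (\<kappa> i))) else 0 :: complex) = 0" by (intro prod_zero) auto
      then show ?thesis using False by simp
    qed
    also have "(\<forall>i\<in>{1..N}. \<kappa> i = \<kappa> (inv \<pi> i)) \<longleftrightarrow> (\<forall>i\<in>{1..N}. \<kappa> (\<pi> i) = \<kappa> i)"
    proof
      assume a: "\<forall>i\<in>{1..N}. \<kappa> i = \<kappa> (inv \<pi> i)"
      show "\<forall>i\<in>{1..N}. \<kappa> (\<pi> i) = \<kappa> i"
      proof
        fix i assume "i \<in> {1..N}"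
        then have "\<pi> i \<in> {1..N}" using permutes_in_image[OF p] by blast
        from a[rule_format, OF this] show "\<kappa> (\<pi> i) = \<kappa> i" using permutes_inverses(2)[OF p] by simp
      qed
    next
      assume a: "\<forall>i\<in>{1..N}. \<kappa> (\<pi> i) = \<kappa> i"
      show "\<forall>i\<in>{1..N}. \<kappa> i = \<kappa> (inv \<pi> i)"
      proof
        fix i assume "i \<in> {1..N}"
        then have "inv \<pi> i \<in> {1..N}" using permutes_in_image[OF permutes_inv[OF p]] by blast
        from a[rule_format, OF this] show "\<kappa> i = \<kappa> (inv \<pi> i)" using permutes_inverses(1)[OF p] by simp
      qed
    qed
    finally show "(LINT x|?M. (\<Prod>i=1..N. ?a (\<kappa> i)) * (\<Prod>i=1..N. character (?e \<kappa> i) (x i)))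
       = (if \<forall>i\<in>{1..N}. \<kappa> (\<pi> i) = \<kappa> i then of_real (\<Prod>i=1..N. q (mode (\<kappa> i))) else 0)" .
  qed
  also have "\<dots> = (\<Sum>\<kappa>\<in>{\<kappa>\<in>?KK. \<forall>i\<in>{1..N}. \<kappa> (\<pi> i) = \<kappa> i}. of_real (\<Prod>i=1..N. q (mode (\<kappa> i))))"
    by (rule sum.inter_filter[symmetric]) (auto intro: finite_PiE)
  also have "\<dots> = of_real (\<Prod>C\<in>cycle_sets N \<pi>. \<Sum>j<n. q (mode j) ^ card C)"
    using arg_cong[OF finite_prod_PiE_cycles[OF \<pi>, where n = n and q = "\<lambda>j. q (mode j)"], of complex_of_real]
    by (simp only: of_real_sum of_real_prod)
  finally show ?thesis .
qed

text \<open>Passage to the limit of infinitely many modes, with the N-th power of the coefficient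
  sum as dominating constant.\<close>

lemma product_integral:
  assumes \<pi>: "\<pi> \<in> perms N"
  shows "(LINT x|box_power c N. (hops N \<pi> F x))
    = (\<Prod>C\<in>cycle_sets N \<pi>. power_sum (card C))"
    and "integrable (box_power c N) (\<lambda>x. hops N \<pi> F x)"
proof -
  let ?M = "box_power c N"
  have p: "\<pi> permutes {1..N}" using \<pi> by (simp add: perms_def)
  interpret fm: finite_measure "box_measure c" by (rule finite_box_measure)
  interpret PS: product_sigma_finite "\<lambda>_::nat. box_measure c" by unfold_locales
  interpret PM: finite_measure ?M by (rule finite_box_power)
  have comp: "(\<lambda>x. x i) \<in> measurable ?M borel" if "i \<in> {1..N}" for i
  proof -
    have "(\<lambda>x. x i) \<in> measurable ?M (box_measure c)" by (rule measurable_component_singleton[OF that])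
    then have "(\<lambda>x. (\<lambda>y. y) (x i)) \<in> measurable ?M borel" by (rule measurable_compose) (intro measurable_restrict_space1, simp)
    then show ?thesis .
  qed
  have \<pi>i: "\<pi> i \<in> {1..N}" if "i \<in> {1..N}" for i using that permutes_in_image[OF p] by blast
  have diffm: "(\<lambda>x. x i - x (\<pi> i)) \<in> measurable ?M borel" if "i \<in> {1..N}" for i by (intro borel_measurable_diff comp that \<pi>i)
  have Fm: "F \<in> borel_measurable borel" using F_continuous by (rule borel_measurable_continuous_onI)
  have pm: "partial n \<in> borel_measurable borel" for n unfolding partial_def by measurable
  have Fd: "(\<lambda>x. F (x i - x (\<pi> i))) \<in> borel_measurable ?M" if "i \<in> {1..N}" for i using diffm[OF that] Fm by (rule measurable_compose)
  have pd: "(\<lambda>x. partial n (x i - x (\<pi> i))) \<in> borel_measurable ?M" if "i \<in> {1..N}" for n i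
    using diffm[OF that] pm by (rule measurable_compose)
  have meas: "(\<lambda>x. hops N \<pi> F x) \<in> borel_measurable ?M" by (intro borel_measurable_prod Fd)
  define Q where "Q = (\<Sum>j. q (mode j) / vol)"
  have FQ: "F x \<le> Q" for x
  proof -
    have "norm (complex_of_real (F x)) \<le> Q"
      by (rule LIMSEQ_le_const2[OF tendsto_norm[OF fourier_expansion]]) (use partial_bound in \<open>auto simp: Q_def\<close>)
    then show ?thesis using F_nonneg[of x] by simp
  qed
  show int: "integrable ?M (\<lambda>x. hops N \<pi> F x)"
  proof (rule PM.integrable_const_bound[OF AE_I2 meas, where B = "Q ^ N"])
    fix x
    have "(hops N \<pi> F x) \<le> (\<Prod>i=1..N. Q)" by (intro prod_mono conjI F_nonneg FQ)
    moreover have "0 \<le> (hops N \<pi> F x)" by (intro prod_nonneg F_nonneg)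
    ultimately show "norm (hops N \<pi> F x) \<le> Q ^ N" by simp
  qed
  have "(\<lambda>n. LINT x|?M. (hops N \<pi> (partial n) x)) \<longlonglongrightarrow> (LINT x|?M. (\<Prod>i=1..N. complex_of_real (F (x i - x (\<pi> i)))))"
  proof (rule integral_dominated_convergence[where w = "\<lambda>_. Q ^ N"])
    show "(\<lambda>x. \<Prod>i=1..N. complex_of_real (F (x i - x (\<pi> i)))) \<in> borel_measurable ?M"
    proof (rule borel_measurable_prod)
      have "complex_of_real \<in> borel_measurable borel" by (intro borel_measurable_continuous_onI continuous_intros)
      then show "(\<lambda>x. complex_of_real (F (x i - x (\<pi> i)))) \<in> borel_measurable ?M" if "i \<in> {1..N}" for i
        by (rule measurable_compose[OF Fd[OF that]])
    qed
    show "(\<lambda>x. hops N \<pi> (partial n) x) \<in> borel_measurable ?M" for n by (intro borel_measurable_prod pd)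
    show "AE x in ?M. (\<lambda>n. hops N \<pi> (partial n) x) \<longlonglongrightarrow> (\<Prod>i=1..N. complex_of_real (F (x i - x (\<pi> i))))"
      by (intro AE_I2 tendsto_prod fourier_expansion)
    show "AE x in ?M. norm (hops N \<pi> (partial n) x) \<le> Q ^ N" for n
    proof (rule AE_I2)
      fix x
      have "(\<Prod>i=1..N. norm (partial n (x i - x (\<pi> i)))) \<le> (\<Prod>i=1..N. Q)" by (intro prod_mono) (use partial_bound in \<open>auto simp: Q_def\<close>)
      then show "norm (hops N \<pi> (partial n) x) \<le> Q ^ N" by (simp add: prod_norm)
    qed
  qed (rule PM.integrable_const)
  moreover have "(LINT x|?M. (\<Prod>i=1..N. complex_of_real (F (x i - x (\<pi> i))))) = of_real (LINT x|?M. hops N \<pi> F x)"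
    by (subst integral_complex_of_real[symmetric]) (simp only: of_real_prod)
  ultimately have "(\<lambda>n. complex_of_real (\<Prod>C\<in>cycle_sets N \<pi>. \<Sum>j<n. q (mode j) ^ card C)) \<longlonglongrightarrow> of_real (LINT x|?M. hops N \<pi> F x)"
    by (simp only: partial_product_integral[OF \<pi>])
  moreover have "(\<lambda>n. complex_of_real (\<Prod>C\<in>cycle_sets N \<pi>. \<Sum>j<n. q (mode j) ^ card C)) \<longlonglongrightarrow>
     of_real (\<Prod>C\<in>cycle_sets N \<pi>. power_sum (card C))"
  proof (intro tendsto_of_real tendsto_prod)
    fix C assume "C \<in> cycle_sets N \<pi>"
    then have "1 \<le> card C" using orbit_partition(5)[OF \<pi>] by (simp add: Suc_le_eq card_gt_0_iff)
    from q_power_sums(1)[OF this]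
    show "(\<lambda>n. \<Sum>j<n. q (mode j) ^ card C) \<longlonglongrightarrow> power_sum (card C)" unfolding sums_def .
  qed
  ultimately have "complex_of_real (LINT x|?M. hops N \<pi> F x) = of_real (\<Prod>C\<in>cycle_sets N \<pi>. power_sum (card C))" by (rule LIMSEQ_unique)
  then show "(LINT x|?M. hops N \<pi> F x) = (\<Prod>C\<in>cycle_sets N \<pi>. power_sum (card C))" by (simp only: of_real_eq_iff)
qed

end

section \<open>Boltzmann weights of a permutation\<close>

lemma exp_neg_nonneg: "0 \<le> exp_neg u" by (simp add: exp_neg_def)

lemma exp_neg_add: "a \<noteq> -\<infinity> \<Longrightarrow> b \<noteq> -\<infinity> \<Longrightarrow> exp_neg (a + b) = exp_neg a * exp_neg b" by (cases a; cases b) (auto simp: exp_neg_def mult_exp_exp)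

lemma exp_neg_sum:
  assumes "finite A" and "\<And>i. i \<in> A \<Longrightarrow> f i \<noteq> -\<infinity>"
  shows "exp_neg (sum f A) = (\<Prod>i\<in>A. exp_neg (f i))" and "sum f A \<noteq> -\<infinity>"
proof -
  have "exp_neg (sum f A) = (\<Prod>i\<in>A. exp_neg (f i)) \<and> sum f A \<noteq> -\<infinity>" using assms
  proof (induction A rule: finite_induct)
    case empty
    show ?case by (simp add: exp_neg_def)
  next
    case (insert x B)
    then have "exp_neg (sum f B) = (\<Prod>i\<in>B. exp_neg (f i))" "sum f B \<noteq> -\<infinity>" "f x \<noteq> -\<infinity>" by auto
    moreover from this(2,3) have "f x + sum f B \<noteq> -\<infinity>" by simp
    ultimately show ?case using insert.hyps exp_neg_add[of "f x" "sum f B"] by simp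
  qed
  then show "exp_neg (sum f A) = (\<Prod>i\<in>A. exp_neg (f i))" "sum f A \<noteq> -\<infinity>" by auto
qed

lemma periodized_weight_nonneg: "0 \<le> periodized_weight \<xi> L x"
  unfolding periodized_weight_def by (rule infsum_nonneg) (rule exp_neg_nonneg)

lemma exp_neg_periodized_jump: "exp_neg (periodized_jump \<xi> L x) = periodized_weight \<xi> L x"
  using periodized_weight_nonneg[of \<xi> L x] by (auto simp: periodized_jump_def exp_neg_def)

lemma cycle_count_sum:
  assumes "\<pi> \<in> perms N"
  shows "(\<Sum>l=1..N. \<alpha> l * real (cycle_count N \<pi> l)) = (\<Sum>C\<in>cycle_sets N \<pi>. \<alpha> (card C))"
proof -
  note P = orbit_partition[OF assms]
  have "card C \<in> {1..N}" if "C \<in> cycle_sets N \<pi>" for C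
    using P(5)[OF that] card_mono[of "{1..N}" C] by (auto simp: Suc_le_eq card_gt_0_iff intro: finite_subset)
  then have "(\<Sum>C\<in>cycle_sets N \<pi>. \<alpha> (card C)) = (\<Sum>l\<in>{1..N}. \<Sum>C | C \<in> cycle_sets N \<pi> \<and> card C = l. \<alpha> (card C))"
    by (intro sum.group[symmetric] P(1)) auto
  also have "\<dots> = (\<Sum>l=1..N. \<alpha> l * real (cycle_count N \<pi> l))" by (intro sum.cong refl) (simp add: cycle_count_def)
  finally show ?thesis by simp
qed

lemma exp_neg_hamiltonian:
  assumes "\<pi> \<in> perms N"
  shows "exp_neg (hamiltonian \<xi> \<alpha> L N x \<pi>)
    = (\<Prod>i=1..N. periodized_weight \<xi> L (x i - x (\<pi> i))) * (\<Prod>C\<in>cycle_sets N \<pi>. exp (- \<alpha> (card C)))"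
proof -
  have ne: "periodized_jump \<xi> L y \<noteq> -\<infinity>" for y by (simp add: periodized_jump_def)
  have "exp_neg (hamiltonian \<xi> \<alpha> L N x \<pi>)
     = exp_neg (\<Sum>i=1..N. periodized_jump \<xi> L (x i - x (\<pi> i))) * exp_neg (ereal (\<Sum>C\<in>cycle_sets N \<pi>. \<alpha> (card C)))"
    unfolding hamiltonian_def cycle_count_sum[OF assms] using exp_neg_sum(2)[of "{1..N}" "\<lambda>i. periodized_jump \<xi> L (x i - x (\<pi> i))"] ne
    by (intro exp_neg_add) auto
  also have "exp_neg (\<Sum>i=1..N. periodized_jump \<xi> L (x i - x (\<pi> i))) = (\<Prod>i=1..N. periodized_weight \<xi> L (x i - x (\<pi> i)))"
    using ne by (subst exp_neg_sum(1)) (auto simp: exp_neg_periodized_jump)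
  also have "exp_neg (ereal (\<Sum>C\<in>cycle_sets N \<pi>. \<alpha> (card C))) = (\<Prod>C\<in>cycle_sets N \<pi>. exp (- \<alpha> (card C)))"
    using orbit_partition(1)[OF assms] by (simp add: exp_neg_def sum_negf[symmetric] exp_sum del: sum_negf)
  finally show ?thesis .
qed

locale jump_ensemble =
  fixes \<xi> :: "real^'d \<Rightarrow> ereal"
  assumes jump: "jump_function \<xi>"
begin

definition p :: "real^'d \<Rightarrow> real" where "p x = exp_neg (\<xi> x)"

definition q :: "real^'d \<Rightarrow> real" where "q k = exp (- dispersion \<xi> k)"

lemma p_nonneg: "0 \<le> p x" by (simp add: p_def exp_neg_nonneg)

lemma p_continuous: "continuous_on UNIV p" using jump by (simp add: jump_function_def p_def[abs_def])

lemma p_integral: "integrable lborel p" "(LINT x|lborel. p x) = 1"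
  using jump by (auto simp: jump_function_def p_def[abs_def] has_bochner_integral_iff)

lemma fourier_weight_eq: "fourier_weight \<xi> k = (LINT x|lborel. of_real (p x) * character (- k) x)"
  unfolding fourier_weight_def p_def character_def by (intro Bochner_Integration.integral_cong) (auto simp: cis_conv_exp mult_ac)

lemma q_eq: "complex_of_real (q k) = fourier_weight \<xi> k" and q_pos: "0 < q k"
proof -
  have r: "fourier_weight \<xi> k \<in> \<real>" "0 < Re (fourier_weight \<xi> k)" using jump by (auto simp: jump_function_def)
  then have "q k = Re (fourier_weight \<xi> k)" by (simp add: q_def dispersion_def)
  then show "complex_of_real (q k) = fourier_weight \<xi> k" "0 < q k" using r by (auto simp: of_real_Re)
qed

lemma p_character_integrable: "integrable lborel (\<lambda>x. complex_of_real (p x) * character k x)"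
proof (rule Bochner_Integration.integrable_bound[OF p_integral(1)])
  have "p \<in> borel_measurable borel" using p_continuous by (rule borel_measurable_continuous_onI)
  then show "(\<lambda>x. complex_of_real (p x) * character k x) \<in> borel_measurable lborel" by measurable
qed (auto simp: norm_mult)

lemma q_le_1: "q k \<le> 1"
proof -
  have "q k = norm (fourier_weight \<xi> k)" using q_pos[of k] by (simp add: q_eq[symmetric])
  also have "\<dots> \<le> (LINT x|lborel. norm (complex_of_real (p x) * character (- k) x))"
    unfolding fourier_weight_eq by (rule integral_norm_bound)
  also have "\<dots> = 1" using p_integral(2) p_nonneg by (simp add: norm_mult)
  finally show ?thesis .
qed

lemma q_0: "q 0 = 1"
proof -
  have "complex_of_real (q 0) = 1" unfolding q_eq fourier_weight_eq using p_integral(2) by simp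
  then show ?thesis by simp
qed

definition good_side :: "real \<Rightarrow> bool" where
  "good_side L \<longleftrightarrow> 0 < L \<and> (\<forall>x. (\<lambda>z. p (x - L *\<^sub>R z)) summable_on int_lattice) \<and>
     continuous_on UNIV (periodized_weight \<xi> L) \<and> q summable_on dual_lattice L"

lemma eventually_good_side: "\<forall>\<^sub>F L in at_top. good_side L"
proof -
  have "\<forall>\<^sub>F L in at_top. (\<forall>x. (\<lambda>z. p (x - L *\<^sub>R z)) summable_on int_lattice) \<and> continuous_on UNIV (periodized_weight \<xi> L)"
    "\<forall>\<^sub>F L in at_top. q summable_on dual_lattice L" using jump by (auto simp: jump_function_def p_def q_def[abs_def])
  then show ?thesis using eventually_gt_at_top[of 0] by eventually_elim (auto simp: good_side_def)
qed

lemma torus_weight: "good_side L \<Longrightarrow> torus_weight p q L"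
proof
  assume g: "good_side L"
  show "0 < L" "q summable_on dual_lattice L" and "\<And>x. (\<lambda>z. p (x - L *\<^sub>R z)) summable_on int_lattice"
    using g by (auto simp: good_side_def)
  show "continuous_on UNIV (\<lambda>x. \<Sum>\<^sub>\<infinity>z\<in>int_lattice. p (x - L *\<^sub>R z))"
    using g by (simp add: good_side_def periodized_weight_def[abs_def] p_def)
qed (use p_continuous p_nonneg p_integral q_le_1 q_pos q_eq fourier_weight_eq in \<open>auto intro: less_imp_le\<close>)

lemma box_weight:
  fixes c :: "real^'d"
  assumes g: "good_side L" and \<pi>: "\<pi> \<in> perms N"
  shows "(LINT x|lebesgue_box_power c L N. exp_neg (hamiltonian \<xi> \<alpha> L N x \<pi>))
      = cycle_weight (\<lambda>j. exp (- \<alpha> j) * (\<Sum>\<^sub>\<infinity>k\<in>dual_lattice L. q k ^ j)) (cycle_sets N \<pi>)"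
    and "integrable (lebesgue_box_power c L N) (\<lambda>x. exp_neg (hamiltonian \<xi> \<alpha> L N x \<pi>))"
proof -
  interpret T: torus_weight p q L by (rule torus_weight[OF g])
  have F: "periodized_weight \<xi> L x = T.F x" for x by (simp add: periodized_weight_def T.F_def p_def)
  note P = T.product_integral[OF \<pi>, of c]
  show "integrable (lebesgue_box_power c L N) (\<lambda>x. exp_neg (hamiltonian \<xi> \<alpha> L N x \<pi>))"
    unfolding exp_neg_hamiltonian[OF \<pi>] F lebesgue_box_power_def by (rule integrable_mult_left) (rule P(2))
  show "(LINT x|lebesgue_box_power c L N. exp_neg (hamiltonian \<xi> \<alpha> L N x \<pi>))
      = cycle_weight (\<lambda>j. exp (- \<alpha> j) * (\<Sum>\<^sub>\<infinity>k\<in>dual_lattice L. q k ^ j)) (cycle_sets N \<pi>)"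
    unfolding exp_neg_hamiltonian[OF \<pi>] F lebesgue_box_power_def integral_mult_left_zero P(1)
    by (simp only: cycle_weight_def prod.distrib mult.commute)
qed

end

section \<open>Sums over the dual lattice\<close>

text \<open>A discrete comparison of n^(- \<beta>) with its integral, obtained from Young's
  inequality for (n - 1)^(1 - \<beta>) n^\<beta>.\<close>

lemma powr_telescope_bound:
  fixes n \<beta> :: real
  assumes "0 < \<beta>" "\<beta> < 1" "1 \<le> n"
  shows "(1 - \<beta>) * n powr (-\<beta>) \<le> n powr (1 - \<beta>) - (n - 1) powr (1 - \<beta>)"
proof (cases "n = 1")
  case True
  then show ?thesis using assms by simp
next
  case False
  with assms have n: "1 < n" by simp
  have "(n - 1) powr (1 - \<beta>) * n powr \<beta> \<le> (1 - \<beta>) * (n - 1) + \<beta> * n" using assms n by (intro Youngs_inequality_0) auto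
  also have "\<dots> = n - (1 - \<beta>)" by (simp add: algebra_simps)
  finally have "(n - 1) powr (1 - \<beta>) * n powr \<beta> * n powr (-\<beta>) \<le> (n - (1 - \<beta>)) * n powr (-\<beta>)" by (rule mult_right_mono) simp
  moreover have "n powr \<beta> * n powr (-\<beta>) = 1" using n by (simp add: powr_add[symmetric])
  moreover have "n * n powr (-\<beta>) = n powr (1 - \<beta>)" using n by (simp add: powr_mult_base)
  ultimately show ?thesis by (simp add: left_diff_distrib mult.assoc)
qed

lemma sum_powr_symmetric_le:
  fixes \<beta> :: real
  assumes "0 < \<beta>" "\<beta> < 1"
  shows "(\<Sum>n\<in>{- int m..int m}. (max 1 \<bar>real_of_int n\<bar>) powr (-\<beta>)) \<le> 1 + 2 / (1 - \<beta>) * real m powr (1 - \<beta>)"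
proof (induction m)
  case 0
  then show ?case by simp
next
  case (Suc m)
  let ?f = "\<lambda>n. (max 1 \<bar>real_of_int n\<bar>) powr (-\<beta>)" and ?s = "real (Suc m) powr (-\<beta>)"
  have "{- int (Suc m)..int (Suc m)} = insert (int (Suc m)) (insert (- int (Suc m)) {- int m..int m})" by auto
  then have "(\<Sum>n\<in>{- int (Suc m)..int (Suc m)}. ?f n) = 2 * ?s + (\<Sum>n\<in>{- int m..int m}. ?f n)" by (simp add: max_def add.commute)
  moreover have "(1 - \<beta>) * ?s \<le> real (Suc m) powr (1 - \<beta>) - real m powr (1 - \<beta>)"
    using powr_telescope_bound[OF assms, of "real (Suc m)"] by simp
  then have "2 * ?s \<le> 2 / (1 - \<beta>) * (real (Suc m) powr (1 - \<beta>) - real m powr (1 - \<beta>))"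
    using assms(2) by (simp add: pos_le_divide_eq mult.commute)
  ultimately show ?case using Suc.IH by (simp add: right_diff_distrib)
qed

lemma dual_lattice_coordinate:
  assumes "0 < L" "k \<in> dual_lattice L"
  shows "real_of_int \<lfloor>L * k $ i\<rfloor> = L * k $ i"
proof -
  obtain z where z: "z \<in> int_lattice" "k = (1 / L) *\<^sub>R z" using assms(2) by (auto simp: dual_lattice_def)
  have e: "L * k $ i = z $ i" using assms(1) z(2) by simp
  have "z $ i \<in> \<int>" using z(1) by (simp add: int_lattice_def)
  then obtain n where n: "z $ i = of_int n" by (rule Ints_cases)
  show ?thesis unfolding e n floor_of_int ..
qed

lemma dual_lattice_norm_ge:
  assumes "0 < L" "k \<in> dual_lattice L" "k \<noteq> 0"
  shows "1 / L \<le> norm k"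
proof -
  obtain i where i: "k $ i \<noteq> 0" using assms(3) by (auto simp: vec_eq_iff)
  have "L * k $ i = real_of_int \<lfloor>L * k $ i\<rfloor>" by (rule dual_lattice_coordinate[OF assms(1,2), symmetric])
  moreover have "L * k $ i \<noteq> 0" using i assms(1) by simp
  ultimately have "\<lfloor>L * k $ i\<rfloor> \<noteq> 0" by (metis of_int_0)
  then have "1 \<le> \<bar>real_of_int \<lfloor>L * k $ i\<rfloor>\<bar>" by linarith
  then have "1 \<le> L * \<bar>k $ i\<bar>" unfolding dual_lattice_coordinate[OF assms(1,2)] using assms(1) by (simp add: abs_mult)
  also have "\<dots> \<le> L * norm k" using assms(1) component_le_norm_cart[of k i] by (intro mult_left_mono) auto
  finally show ?thesis using assms(1) by (simp add: field_simps)
qed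

text \<open>The bound \<open>norm k \<ge> max (1 / L) \<bar>k $ i\<bar>\<close> in every coordinate turns the singular lattice sum into a
  product of one-dimensional sums.\<close>

lemma lattice_sum_le_product:
  fixes A :: "(real^'d) set"
  assumes L: "0 < L" and \<eta>: "0 < \<eta>" "\<eta> < real CARD('d)" and \<delta>: "0 < \<delta>"
    and A: "finite A" "A \<subseteq> {k \<in> dual_lattice L. k \<noteq> 0 \<and> norm k \<le> \<delta>}"
  defines "\<beta> \<equiv> \<eta> / real CARD('d)"
  shows "(\<Sum>k\<in>A. norm k powr (-\<eta>)) \<le> (L * (L powr (\<beta> - 1) + 2 / (1 - \<beta>) * \<delta> powr (1 - \<beta>))) ^ CARD('d)"
proof -
  have d: "0 < real CARD('d)" by simp
  have \<beta>: "0 < \<beta>" "\<beta> < 1" using \<eta> by (simp_all add: \<beta>_def)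
  define m where "m = nat \<lfloor>L * \<delta>\<rfloor>"
  let ?v = "\<lambda>k::real^'d. \<lambda>i. \<lfloor>L * k $ i\<rfloor>"
  let ?h = "\<lambda>n::int. (max 1 \<bar>real_of_int n\<bar> / L) powr (-\<beta>)"
  have AD: "k \<in> dual_lattice L" "k \<noteq> 0" "norm k \<le> \<delta>" if "k \<in> A" for k using A that by auto
  have coord: "real_of_int (?v k i) = L * k $ i" if "k \<in> A" for k i by (rule dual_lattice_coordinate[OF L AD(1)[OF that]])
  have inj: "inj_on ?v A"
  proof (rule inj_onI)
    fix k l assume kl: "k \<in> A" "l \<in> A" "?v k = ?v l"
    have "L * k $ i = L * l $ i" for i
      using coord[OF kl(1), symmetric] coord[OF kl(2)] arg_cong[OF fun_cong[OF kl(3), of i], of real_of_int]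
      by (rule trans[OF _ trans[rotated]])
    then show "k = l" using L by (simp add: vec_eq_iff)
  qed
  have rng: "?v k \<in> PiE UNIV (\<lambda>_. {- int m..int m})" if k: "k \<in> A" for k
  proof -
    have "?v k i \<in> {- int m..int m}" for i
    proof -
      have "\<bar>real_of_int (?v k i)\<bar> = L * \<bar>k $ i\<bar>" unfolding coord[OF k] using L by (simp add: abs_mult)
      also have "\<dots> \<le> L * \<delta>" using L component_le_norm_cart[of k i] AD(3)[OF k] by (intro mult_left_mono) auto
      finally have "\<bar>?v k i\<bar> \<le> \<lfloor>L * \<delta>\<rfloor>" by (simp add: le_floor_iff)
      moreover have "int m = \<lfloor>L * \<delta>\<rfloor>" using L \<delta> by (simp add: m_def)
      ultimately show ?thesis by auto
    qed
    then show ?thesis by (simp add: PiE_def Pi_def)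
  qed
  have term_le: "norm k powr (-\<eta>) \<le> (\<Prod>i\<in>UNIV. ?h (?v k i))" if k: "k \<in> A" for k
  proof -
    have nk: "0 < norm k" using AD(2)[OF k] by simp
    have "norm k powr (-\<eta>) = (norm k powr (-\<beta>)) ^ CARD('d)" using nk d by (simp add: powr_realpow[symmetric] powr_powr \<beta>_def)
    also have "\<dots> = (\<Prod>i\<in>(UNIV::'d set). norm k powr (-\<beta>))" by simp
    also have "\<dots> \<le> (\<Prod>i\<in>UNIV. ?h (?v k i))"
    proof (intro prod_mono conjI)
      fix i :: 'd
      have "\<bar>k $ i\<bar> \<le> norm k" by (rule component_le_norm_cart)
      then have "max 1 \<bar>real_of_int (?v k i)\<bar> / L \<le> norm k"
        using dual_lattice_norm_ge[OF L AD(1)[OF k] AD(2)[OF k]] L unfolding coord[OF k] by (auto simp: abs_mult field_simps max_def)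
      moreover have "0 < max 1 \<bar>real_of_int (?v k i)\<bar> / L" using L by (simp add: max_def)
      ultimately show "norm k powr (-\<beta>) \<le> ?h (?v k i)" using \<beta> by (intro powr_mono2') auto
    qed simp
    finally show ?thesis .
  qed
  have "(\<Sum>k\<in>A. norm k powr (-\<eta>)) \<le> (\<Sum>k\<in>A. \<Prod>i\<in>UNIV. ?h (?v k i))" by (intro sum_mono term_le)
  also have "\<dots> = (\<Sum>g\<in>?v ` A. \<Prod>i\<in>UNIV. ?h (g i))" by (simp add: sum.reindex[OF inj])
  also have "\<dots> \<le> (\<Sum>g\<in>PiE UNIV (\<lambda>_. {- int m..int m}). \<Prod>i\<in>(UNIV::'d set). ?h (g i))"
    using rng by (intro sum_mono2 finite_PiE prod_nonneg) auto
  also have "\<dots> = (\<Prod>i\<in>(UNIV::'d set). \<Sum>n\<in>{- int m..int m}. ?h n)" by (rule prod_sum_PiE[symmetric]) auto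
  also have "\<dots> = (\<Sum>n\<in>{- int m..int m}. ?h n) ^ CARD('d)" by simp
  also have "\<dots> \<le> (L * (L powr (\<beta> - 1) + 2 / (1 - \<beta>) * \<delta> powr (1 - \<beta>))) ^ CARD('d)"
  proof (rule power_mono)
    have "?h n = L powr \<beta> * (max 1 \<bar>real_of_int n\<bar>) powr (-\<beta>)" for n using L by (simp add: powr_divide powr_minus_divide)
    then have "(\<Sum>n\<in>{- int m..int m}. ?h n) = L powr \<beta> * (\<Sum>n\<in>{- int m..int m}. (max 1 \<bar>real_of_int n\<bar>) powr (-\<beta>))"
      by (simp only: sum_distrib_left)
    also have "\<dots> \<le> L powr \<beta> * (1 + 2 / (1 - \<beta>) * real m powr (1 - \<beta>))" by (intro mult_left_mono sum_powr_symmetric_le \<beta>) simp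
    also have "\<dots> \<le> L powr \<beta> * (1 + 2 / (1 - \<beta>) * (L * \<delta>) powr (1 - \<beta>))"
    proof -
      have "real m \<le> L * \<delta>" using L \<delta> by (simp add: m_def)
      then show ?thesis using \<beta> by (intro mult_left_mono add_left_mono powr_mono2) auto
    qed
    also have "\<dots> = L powr \<beta> + 2 / (1 - \<beta>) * (L powr \<beta> * L powr (1 - \<beta>)) * \<delta> powr (1 - \<beta>)" using L \<delta> by (simp add: powr_mult algebra_simps)
    also have "L powr \<beta> * L powr (1 - \<beta>) = L" using L by (simp add: powr_add[symmetric])
    also have "L powr \<beta> = L * L powr (\<beta> - 1)" using L by (simp add: powr_mult_base)
    finally show "(\<Sum>n\<in>{- int m..int m}. ?h n) \<le> L * (L powr (\<beta> - 1) + 2 / (1 - \<beta>) * \<delta> powr (1 - \<beta>))" by (simp add: algebra_simps)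
  qed (simp add: sum_nonneg)
  finally show ?thesis .
qed

lemma lattice_singular_sum:
  assumes \<eta>: "0 < \<eta>" "\<eta> < real CARD('d)" and e: "0 < e" and D: "0 < D"
  shows "\<exists>\<delta>>0. \<delta> \<le> D \<and> (\<forall>\<^sub>F L in at_top. \<forall>A :: (real^'d) set. finite A \<longrightarrow>
    A \<subseteq> {k \<in> dual_lattice L. k \<noteq> 0 \<and> norm k \<le> \<delta>} \<longrightarrow> (\<Sum>k\<in>A. norm k powr (-\<eta>)) \<le> e * L ^ CARD('d))"
proof -
  define \<beta> where "\<beta> = \<eta> / real CARD('d)"
  have \<beta>: "0 < \<beta>" "\<beta> < 1" using \<eta> by (simp_all add: \<beta>_def)
  \<comment> \<open>The cap at 1 makes the d-th power of e' at most e'.\<close>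
  define e' where "e' = min 1 e"
  have e': "0 < e'" "e' \<le> 1" "e' \<le> e" using e by (auto simp: e'_def)
  \<comment> \<open>Chosen so that 2 / (1 - \<beta>) times \<delta>^(1 - \<beta>) is at most e' / 2;
    the other half of e' is left for L^(\<beta> - 1), which tends to 0.\<close>
  define \<delta> where "\<delta> = min D (((1 - \<beta>) * e' / 4) powr (1 / (1 - \<beta>)))"
  have \<delta>: "0 < \<delta>" "\<delta> \<le> D" using D e' \<beta> by (auto simp: \<delta>_def)
  have "\<delta> powr (1 - \<beta>) \<le> (((1 - \<beta>) * e' / 4) powr (1 / (1 - \<beta>))) powr (1 - \<beta>)" using \<delta> \<beta> by (intro powr_mono2) (auto simp: \<delta>_def)
  also have "\<dots> = (1 - \<beta>) * e' / 4" using \<beta> e' by (simp add: powr_powr)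
  finally have \<delta>2: "2 / (1 - \<beta>) * \<delta> powr (1 - \<beta>) \<le> e' / 2" using \<beta> by (simp add: field_simps)
  have "((\<lambda>L::real. L powr (\<beta> - 1)) \<longlongrightarrow> 0) at_top" using \<beta> by (intro tendsto_neg_powr filterlim_ident) auto
  then have "\<forall>\<^sub>F L in at_top. L powr (\<beta> - 1) < e' / 2" by (rule order_tendstoD) (use e' in simp)
  then have "\<forall>\<^sub>F L in at_top. \<forall>A :: (real^'d) set. finite A \<longrightarrow>
    A \<subseteq> {k \<in> dual_lattice L. k \<noteq> 0 \<and> norm k \<le> \<delta>} \<longrightarrow> (\<Sum>k\<in>A. norm k powr (-\<eta>)) \<le> e * L ^ CARD('d)" using eventually_gt_at_top[of 0]
  proof eventually_elim
    case (elim L)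
    show ?case
    proof (intro allI impI)
      fix A :: "(real^'d) set"
      assume A: "finite A" "A \<subseteq> {k \<in> dual_lattice L. k \<noteq> 0 \<and> norm k \<le> \<delta>}"
      have "(\<Sum>k\<in>A. norm k powr (-\<eta>)) \<le> (L * (L powr (\<beta> - 1) + 2 / (1 - \<beta>) * \<delta> powr (1 - \<beta>))) ^ CARD('d)"
        using lattice_sum_le_product[OF elim(2) \<eta> \<delta>(1) A] by (simp only: \<beta>_def)
      also have "\<dots> \<le> (L * e') ^ CARD('d)" using elim \<delta>2 \<beta> by (intro power_mono mult_left_mono mult_nonneg_nonneg add_nonneg_nonneg) auto
      also have "\<dots> = e' ^ CARD('d) * L ^ CARD('d)" by (simp add: power_mult_distrib)
      also have "\<dots> \<le> e * L ^ CARD('d)"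
      proof -
        have "e' ^ CARD('d) \<le> e' ^ 1" using e' by (intro power_decreasing) (auto simp: Suc_le_eq)
        then show ?thesis using e' elim(2) by (intro mult_right_mono) auto
      qed
      finally show "(\<Sum>k\<in>A. norm k powr (-\<eta>)) \<le> e * L ^ CARD('d)" .
    qed
  qed
  then show ?thesis using \<delta> by blast
qed

definition lattice_cell :: "real \<Rightarrow> real^'d \<Rightarrow> real^'d" where
  "lattice_cell L x = (\<chi> i. real_of_int \<lfloor>L * x $ i\<rfloor> / L)"

lemma lattice_cell_mem: "0 < L \<Longrightarrow> lattice_cell L x \<in> dual_lattice L" unfolding dual_lattice_def
proof (rule image_eqI)
  show "lattice_cell L x = (1 / L) *\<^sub>R (\<chi> i. real_of_int \<lfloor>L * x $ i\<rfloor>)" unfolding lattice_cell_def vec_eq_iff by simp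
qed (simp add: int_lattice_def)

lemma lattice_cell_near:
  fixes x :: "real^'d"
  assumes "0 < L"
  shows "norm (lattice_cell L x - x) \<le> real CARD('d) / L"
proof -
  have "\<bar>(lattice_cell L x - x) $ i\<bar> \<le> 1 / L" for i
  proof -
    have "\<bar>real_of_int \<lfloor>L * x $ i\<rfloor> - L * x $ i\<bar> \<le> 1" by linarith
    then have "\<bar>real_of_int \<lfloor>L * x $ i\<rfloor> - L * x $ i\<bar> / L \<le> 1 / L" using assms by (intro divide_right_mono) auto
    moreover have "(lattice_cell L x - x) $ i = (real_of_int \<lfloor>L * x $ i\<rfloor> - L * x $ i) / L"
      using assms by (simp add: lattice_cell_def field_simps)
    ultimately show ?thesis using assms by simp
  qed
  then have "(\<Sum>i\<in>UNIV. \<bar>(lattice_cell L x - x) $ i\<bar>) \<le> (\<Sum>i\<in>(UNIV::'d set). 1 / L)" by (intro sum_mono)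
  then show ?thesis using norm_le_l1_cart[of "lattice_cell L x - x"] by simp
qed

lemma half_open_box_cell:
  assumes "0 < L" "k \<in> dual_lattice L"
  shows "x \<in> half_open_box k (1 / L) \<longleftrightarrow> lattice_cell L x = k"
proof -
  have "(k $ i \<le> x $ i \<and> x $ i < k $ i + 1 / L) \<longleftrightarrow> real_of_int \<lfloor>L * x $ i\<rfloor> / L = k $ i" for i
  proof -
    obtain n where k: "L * k $ i = real_of_int n" using dual_lattice_coordinate[OF assms, of i, symmetric] by blast
    have "(k $ i \<le> x $ i \<and> x $ i < k $ i + 1 / L) \<longleftrightarrow> (L * k $ i \<le> L * x $ i \<and> L * x $ i < L * k $ i + 1)"
      using assms(1) by (simp add: field_simps)
    also have "\<dots> \<longleftrightarrow> \<lfloor>L * x $ i\<rfloor> = n" unfolding k floor_eq_iff by simp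
    also have "\<dots> \<longleftrightarrow> real_of_int \<lfloor>L * x $ i\<rfloor> = L * k $ i" unfolding k by simp
    also have "\<dots> \<longleftrightarrow> real_of_int \<lfloor>L * x $ i\<rfloor> / L = k $ i" using assms(1) by (simp add: field_simps)
    finally show ?thesis .
  qed
  then show ?thesis unfolding half_open_box_def lattice_cell_def vec_eq_iff mem_Collect_eq vec_lambda_beta by blast
qed

text \<open>A lattice sum becomes the integral of a function constant on cells of side 1 / L, so
  that convergence theorems for integrals apply to Riemann sums over unbounded space.\<close>

lemma step_integral:
  fixes g :: "real^'d \<Rightarrow> real"
  assumes L: "0 < L" and g: "\<And>k. 0 \<le> g k" and s: "g summable_on dual_lattice L"
  shows "integrable lborel (\<lambda>x. g (lattice_cell L x))"
    and "(LINT x|lborel. g (lattice_cell L x)) = (\<Sum>\<^sub>\<infinity>k\<in>dual_lattice L. g k) / L ^ CARD('d)"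
proof -
  let ?m = "from_nat_into (dual_lattice L :: (real^'d) set)"
  have bij: "bij_betw ?m UNIV (dual_lattice L)" by (rule bij_betw_from_nat_into[OF dual_lattice_props(2,3)[OF L]])
  have mem: "?m n \<in> dual_lattice L" for n using bij by (metis bij_betw_imp_surj_on rangeI)
  let ?f = "\<lambda>n x. g (?m n) * indicator (half_open_box (?m n) (1 / L)) x"
  have "(g has_sum (\<Sum>\<^sub>\<infinity>k\<in>dual_lattice L. g k)) (dual_lattice L)" using s by (rule has_sum_infsum)
  then have "((\<lambda>n. g (?m n)) has_sum (\<Sum>\<^sub>\<infinity>k\<in>dual_lattice L. g k)) UNIV" using has_sum_reindex_bij_betw[OF bij, of g] by simp
  then have gs: "(\<lambda>n. g (?m n)) sums (\<Sum>\<^sub>\<infinity>k\<in>dual_lattice L. g k)" by (rule has_sum_imp_sums)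
  have fs: "(\<lambda>n. ?f n x) sums g (lattice_cell L x)" for x
  proof -
    obtain n0 where n0: "?m n0 = lattice_cell L x" using bij lattice_cell_mem[OF L, of x] by (metis bij_betw_imp_surj_on image_iff)
    have idx: "x \<in> half_open_box (?m n) (1 / L) \<longleftrightarrow> n0 = n" for n
      using half_open_box_cell[OF L mem, of x n] inj_eq[OF bij_betw_imp_inj_on[OF bij], of n0 n] unfolding n0 by (simp only:)
    have "?f n x = (if n = n0 then g (lattice_cell L x) else 0)" for n unfolding indicator_def idx using n0 by (cases "n = n0") simp_all
    then show ?thesis using sums_single[of n0 "\<lambda>_. g (lattice_cell L x)"] by (simp only:)
  qed
  have fn: "norm (?f n x) = ?f n x" for n x using g by simp
  have me: "measure lborel (half_open_box (?m n) (1 / L)) = (1 / L) ^ CARD('d)" for n using L by (intro measure_half_open_box) simp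
  have fin: "emeasure lborel (half_open_box (?m n) (1 / L)) < \<infinity>" for n
  proof -
    have "emeasure lborel (half_open_box (?m n) (1 / L)) \<le> emeasure lborel (cubic_box (?m n) (1 / L))"
      by (intro emeasure_mono half_open_box_subset) (simp add: cubic_box_def)
    also have "\<dots> < \<infinity>" unfolding cubic_box_def by (rule emeasure_lborel_cbox_finite)
    finally show ?thesis .
  qed
  have fi: "integrable lborel (?f n)" for n using fin[of n] by (intro integrable_mult_right integrable_real_indicator) auto
  have fI: "(LINT x|lborel. ?f n x) = g (?m n) * (1 / L) ^ CARD('d)" for n using me[of n] by simp
  have ns: "summable (\<lambda>n. norm (?f n x))" for x unfolding fn by (rule sums_summable[OF fs])
  have nI: "summable (\<lambda>n. LINT x|lborel. norm (?f n x))" unfolding fn fI by (intro summable_mult2 sums_summable[OF gs])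
  have eq: "(\<lambda>x. \<Sum>n. ?f n x) = (\<lambda>x. g (lattice_cell L x))" by (rule ext) (rule sums_unique[OF fs, symmetric])
  show "integrable lborel (\<lambda>x. g (lattice_cell L x))" unfolding eq[symmetric] by (rule integrable_suminf[OF fi AE_I2[OF ns] nI])
  have "(\<lambda>n. LINT x|lborel. ?f n x) sums (LINT x|lborel. g (lattice_cell L x))"
    unfolding eq[symmetric] by (rule sums_integral[OF fi AE_I2[OF ns] nI])
  moreover have "(\<lambda>n. LINT x|lborel. ?f n x) sums ((\<Sum>\<^sub>\<infinity>k\<in>dual_lattice L. g k) * (1 / L) ^ CARD('d))"
    unfolding fI by (rule sums_mult2[OF gs])
  ultimately have "(LINT x|lborel. g (lattice_cell L x)) = (\<Sum>\<^sub>\<infinity>k\<in>dual_lattice L. g k) * (1 / L) ^ CARD('d)" by (rule sums_unique2)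
  then show "(LINT x|lborel. g (lattice_cell L x)) = (\<Sum>\<^sub>\<infinity>k\<in>dual_lattice L. g k) / L ^ CARD('d)" by (simp add: power_one_over)
qed

lemma sum_infsum:
  fixes f :: "'a \<Rightarrow> 'b \<Rightarrow> real"
  assumes "finite J" "\<And>j. j \<in> J \<Longrightarrow> f j summable_on A"
  shows "(\<Sum>j\<in>J. infsum (f j) A) = (\<Sum>\<^sub>\<infinity>k\<in>A. \<Sum>j\<in>J. f j k)" "(\<lambda>k. \<Sum>j\<in>J. f j k) summable_on A"
proof -
  have "(\<Sum>j\<in>J. infsum (f j) A) = (\<Sum>\<^sub>\<infinity>k\<in>A. \<Sum>j\<in>J. f j k) \<and> (\<lambda>k. \<Sum>j\<in>J. f j k) summable_on A" using assms
  proof (induction J rule: finite_induct)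
    case (insert x F)
    then have i: "(\<Sum>j\<in>F. infsum (f j) A) = (\<Sum>\<^sub>\<infinity>k\<in>A. \<Sum>j\<in>F. f j k)" "(\<lambda>k. \<Sum>j\<in>F. f j k) summable_on A"
      "f x summable_on A" by auto
    then show ?case using insert.hyps infsum_add[OF i(3,2)] summable_on_add[OF i(3,2)] by simp
  qed simp
  then show "(\<Sum>j\<in>J. infsum (f j) A) = (\<Sum>\<^sub>\<infinity>k\<in>A. \<Sum>j\<in>J. f j k)" "(\<lambda>k. \<Sum>j\<in>J. f j k) summable_on A" by auto
qed

lemma geometric_tail_le:
  fixes x :: real
  assumes "0 \<le> x" "x < 1"
  shows "(\<Sum>j\<in>{J<..N}. x ^ j) \<le> x ^ J * x / (1 - x)"
proof -
  have "(\<Sum>j\<in>{J<..N}. x ^ j) = (\<Sum>j\<in>{J + 1..<N + 1}. x ^ j)" by (rule sum.cong) auto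
  also have "\<dots> = (\<Sum>j<N - J. x ^ (J + 1) * x ^ j)"
  proof (cases "J \<le> N")
    case True
    then have N: "N + 1 = (N - J) + (J + 1)" by simp
    show ?thesis unfolding N using sum.shift_bounds_nat_ivl[of "\<lambda>j. x ^ j" 0 "J + 1" "N - J"]
      by (simp add: power_add mult_ac atLeast0LessThan)
  qed simp
  also have "\<dots> = x ^ (J + 1) * (\<Sum>j<N - J. x ^ j)" by (simp only: sum_distrib_left)
  also have "\<dots> \<le> x ^ (J + 1) * (1 / (1 - x))" using assms by (intro mult_left_mono) (simp_all add: sum_gp_strict divide_right_mono)
  finally show ?thesis by (simp add: mult.commute)
qed

section \<open>The Fourier transform near and away from the origin\<close>

context jump_ensemble begin

lemma q_uniform: "uniformly_continuous_on UNIV q" using jump by (simp add: jump_function_def q_def[abs_def])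

lemma q_continuous: "continuous_on UNIV q" by (rule uniformly_continuous_imp_continuous[OF q_uniform])

lemma q_integrable: "integrable lborel q" using jump by (simp add: jump_function_def q_def[abs_def])

text \<open>Equality with 1 would force the character to be 1 wherever \<open>p\<close> is positive.
  By continuity \<open>p\<close> stays positive on a short segment in direction \<open>k\<close>,
  along which the phase moves by a nonzero fraction of a turn.\<close>

lemma q_lt_1:
  assumes k: "k \<noteq> 0"
  shows "q k < 1"
proof (rule ccontr)
  assume "\<not> q k < 1"
  then have q1: "q k = 1" using q_le_1[of k] by simp
  let ?g = "\<lambda>x. p x * (1 - Re (character (- k) x))"
  have Re: "integrable lborel (\<lambda>x. Re (complex_of_real (p x) * character (- k) x))" by (rule integrable_Re[OF p_character_integrable])
  have geq: "?g = (\<lambda>x. p x - Re (complex_of_real (p x) * character (- k) x))" by (auto simp: algebra_simps)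
  have gi: "integrable lborel ?g" unfolding geq using p_integral(1) Re by (rule Bochner_Integration.integrable_diff)
  have "(LINT x|lborel. Re (complex_of_real (p x) * character (- k) x)) = Re (fourier_weight \<xi> k)"
    unfolding fourier_weight_eq by (rule integral_Re[OF p_character_integrable])
  then have "(LINT x|lborel. ?g x) = 0"
    unfolding geq Bochner_Integration.integral_diff[OF p_integral(1) Re] p_integral(2) q_eq[symmetric] q1 by simp
  moreover have g0: "0 \<le> ?g x" for x using p_nonneg[of x] complex_Re_le_cmod[of "character (- k) x"] by simp
  ultimately have ae: "AE x in lborel. ?g x = 0" using integral_nonneg_eq_0_iff_AE[OF gi] by simp
  have gc: "continuous_on UNIV ?g" by (intro continuous_intros p_continuous)
  have zero: "?g x = 0" for x by (rule continuous_AE_zero[OF gc open_UNIV _ UNIV_I]) (use ae in simp)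
  have "\<exists>x0. p x0 \<noteq> 0"
  proof (rule ccontr)
    assume "\<nexists>x0. p x0 \<noteq> 0"
    then have "p = (\<lambda>_. 0)" by auto
    then show False using p_integral(2) by simp
  qed
  then obtain x0 where x0: "p x0 \<noteq> 0" by blast
  have chi: "character (- k) x = 1" if "p x \<noteq> 0" for x
  proof -
    have r: "Re (character (- k) x) = 1" using zero[of x] that by simp
    moreover have "(Re (character (- k) x))\<^sup>2 + (Im (character (- k) x))\<^sup>2 = 1" using norm_character[of "- k" x] by (simp add: cmod_def)
    ultimately show ?thesis by (simp add: complex_eq_iff)
  qed
  have "continuous_on UNIV (\<lambda>t::real. p (x0 + t *\<^sub>R k))" by (intro continuous_on_compose2[OF p_continuous] continuous_intros) auto
  then have "((\<lambda>t::real. p (x0 + t *\<^sub>R k)) \<longlongrightarrow> p (x0 + 0 *\<^sub>R k)) (at 0)" unfolding continuous_on_def by blast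
  then have "((\<lambda>t::real. p (x0 + t *\<^sub>R k)) \<longlongrightarrow> p x0) (at_right 0)" by (simp add: filterlim_at_split)
  then have "\<forall>\<^sub>F t::real in at_right 0. p (x0 + t *\<^sub>R k) \<noteq> 0" by (rule tendsto_imp_eventually_ne) (rule x0)
  moreover have "\<forall>\<^sub>F t::real in at_right 0. t < 1 / (k \<bullet> k)" by (rule eventually_at_rightI[of _ "1 / (k \<bullet> k)"]) (use k in auto)
  moreover have "\<forall>\<^sub>F t::real in at_right 0. 0 < t" by (rule eventually_at_right_less)
  ultimately have "\<forall>\<^sub>F t::real in at_right 0. False"
  proof eventually_elim
    case (elim t)
    have "1 = character (- k) (x0 + t *\<^sub>R k)" using chi[OF elim(1)] by simp
    also have "\<dots> = character (- k) x0 * character (- k) (t *\<^sub>R k)" by (rule character_add)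
    also have "character (- k) x0 = 1" by (rule chi[OF x0])
    finally have "cos (2 * pi * (t * (k \<bullet> k))) = 1" by (auto simp: character_def complex_eq_iff)
    then obtain n :: int where n: "2 * pi * (t * (k \<bullet> k)) = of_int n * 2 * pi" by (auto simp: cos_one_2pi_int)
    then have "t * (k \<bullet> k) = of_int n" by simp
    moreover have "0 < t * (k \<bullet> k)" "t * (k \<bullet> k) < 1" using elim k by (simp_all add: pos_less_divide_eq)
    ultimately show False by simp
  qed
  then show False by simp
qed

text \<open>On a sufficiently fine dual lattice, summability leaves only finitely many points with q
  \<ge> 1/4; uniform continuity carries this over to q \<le> 1/2 at all points far from 0. The
  remaining shell is compact, and there \<open>q_lt_1\<close> applies to a maximum.\<close>

lemma q_separated:
  assumes \<delta>: "0 < \<delta>"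
  shows "\<exists>s. 0 \<le> s \<and> s < 1 \<and> (\<forall>k. \<delta> \<le> norm k \<longrightarrow> q k \<le> s)"
proof -
  obtain r where r: "0 < r" "\<And>x y. dist x y < r \<Longrightarrow> dist (q x) (q y) < 1/4"
    using q_uniform unfolding uniformly_continuous_on_def by (metis UNIV_I zero_less_divide_1_iff zero_less_numeral)
  have "\<forall>\<^sub>F L in at_top. real CARD('d) / L < r"
    by (rule order_tendstoD(2)[OF tendsto_divide_0[OF tendsto_const filterlim_at_top_imp_at_infinity[OF filterlim_ident]] r(1)])
  then have "\<forall>\<^sub>F L in at_top. real CARD('d) / L < r \<and> good_side L" using eventually_good_side by eventually_elim simp
  then obtain L where L: "real CARD('d) / L < r" "good_side L" using eventually_happens[of _ "at_top :: real filter"] by auto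
  have L0: "0 < L" and qs: "q summable_on dual_lattice L" using L(2) by (auto simp: good_side_def)
  let ?A = "{k \<in> dual_lattice L. 1/4 \<le> q k}"
  have "finite ?A \<and> card ?A \<le> nat \<lceil>4 * infsum q (dual_lattice L)\<rceil>"
  proof (rule finite_if_finite_subsets_card_bdd)
    fix G assume G: "G \<subseteq> ?A" "finite G"
    have "real (card G) * (1/4) = (\<Sum>k\<in>G. 1/4)" by simp
    also have "\<dots> \<le> sum q G" using G by (intro sum_mono) auto
    also have "\<dots> \<le> infsum q (dual_lattice L)" using G by (intro finite_sum_le_infsum[OF qs]) (auto intro: less_imp_le[OF q_pos])
    finally have "real (card G) \<le> 4 * infsum q (dual_lattice L)" by simp
    then show "card G \<le> nat \<lceil>4 * infsum q (dual_lattice L)\<rceil>" by linarith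
  qed
  then have finA: "finite ?A" by simp
  define R where "R = Max (insert 0 (norm ` ?A)) + r"
  have far: "q k \<le> 1/2" if "R \<le> norm k" for k
  proof -
    let ?y = "lattice_cell L k"
    have near: "norm (?y - k) < r" using lattice_cell_near[OF L0, of k] L(1) by simp
    have "norm k \<le> norm ?y + norm (?y - k)" using norm_triangle_ineq4[of ?y "?y - k"] by simp
    then have "Max (insert 0 (norm ` ?A)) < norm ?y" using that near by (simp add: R_def)
    then have "norm ?y \<notin> norm ` ?A" using Max_ge[of "insert 0 (norm ` ?A)" "norm ?y"] finA by force
    then have "q ?y < 1/4" using lattice_cell_mem[OF L0, of k] by force
    moreover have "dist (q ?y) (q k) < 1/4" by (rule r(2)) (use near in \<open>simp add: dist_norm\<close>)
    ultimately show ?thesis unfolding dist_real_def by linarith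
  qed
  let ?K = "cball 0 R - ball (0 :: real^'d) \<delta>"
  have cK: "compact ?K" by (intro compact_diff) auto
  show ?thesis
  proof (cases "?K = {}")
    case True
    have "q k \<le> 1/2" if "\<delta> \<le> norm k" for k
    proof (rule far, rule ccontr)
      assume "\<not> R \<le> norm k"
      then have "k \<in> ?K" using that by (simp add: dist_norm)
      then show False using True by blast
    qed
    then show ?thesis by (intro exI[of _ "1/2"]) auto
  next
    case False
    obtain k0 where k0: "k0 \<in> ?K" "\<And>k. k \<in> ?K \<Longrightarrow> q k \<le> q k0"
      using continuous_attains_sup[OF cK False continuous_on_subset[OF q_continuous subset_UNIV]] by blast
    have "q k0 < 1" using k0(1) \<delta> by (intro q_lt_1) auto
    moreover have "q k \<le> max (1/2) (q k0)" if "\<delta> \<le> norm k" for k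
    proof (cases "R \<le> norm k")
      case True
      then show ?thesis using far by (simp add: le_max_iff_disj)
    next
      case False
      then have "k \<in> ?K" using that by (simp add: dist_norm)
      then show ?thesis using k0(2) by (simp add: le_max_iff_disj)
    qed
    ultimately show ?thesis by (intro exI[of _ "max (1/2) (q k0)"]) auto
  qed
qed

text \<open>With x = a |k|^\<eta> \<le> a, the bound on the dispersion gives 1 - q \<ge> 1 - exp (-
  x) \<ge> x exp (- x) \<ge> x exp (- a).\<close>

lemma q_near_0:
  obtains a \<eta> \<delta> where "0 < a" "0 < \<eta>" "\<eta> < real CARD('d)" "0 < \<delta>"
    and "\<And>k. norm k \<le> \<delta> \<Longrightarrow> a * norm k powr \<eta> \<le> 1 - q k"
proof -
  obtain a \<eta> where a: "0 < a" "\<eta> < real CARD('d)" "\<forall>\<^sub>F k in nhds 0. a * norm k powr \<eta> \<le> dispersion \<xi> k"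
    using jump by (auto simp: jump_function_def)
  obtain r where r: "0 < r" "\<And>k. norm k < r \<Longrightarrow> a * norm k powr \<eta> \<le> dispersion \<xi> k" using a(3) by (auto simp: eventually_nhds_metric)
  \<comment> \<open>A larger exponent weakens the bound for norm k \<le> 1. The value 1/2 makes it
    positive and stays below the dimension.\<close>
  define \<eta>' where "\<eta>' = max \<eta> (1/2)"
  have "1 \<le> real CARD('d)" by (simp add: Suc_le_eq)
  then have card: "1 / 2 < real CARD('d)" by linarith
  have \<eta>': "0 < \<eta>'" "\<eta>' < real CARD('d)" "\<eta> \<le> \<eta>'" using a(2) card unfolding \<eta>'_def by linarith+
  have main: "a * exp (- a) * norm k powr \<eta>' \<le> 1 - q k" if k: "norm k \<le> min (r / 2) 1" for k
  proof -
    define x where "x = a * norm k powr \<eta>'"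
    have x0: "0 \<le> x" using a(1) by (simp add: x_def)
    have "norm k powr \<eta>' \<le> 1 powr \<eta>'" using k \<eta>' by (intro powr_mono2) auto
    then have xa: "x \<le> a" using a(1) mult_left_mono[of "norm k powr \<eta>'" 1 a] by (simp add: x_def)
    have "norm k powr \<eta>' \<le> norm k powr \<eta>" using k \<eta>'(3) by (cases "k = 0") (auto intro: powr_mono')
    then have "x \<le> a * norm k powr \<eta>" using a(1) by (simp add: x_def)
    also have "\<dots> \<le> dispersion \<xi> k" using k r(1) by (intro r(2)) auto
    finally have "q k \<le> exp (- x)" by (simp add: q_def)
    moreover have "x * exp (- x) \<le> 1 - exp (- x)"
    proof -
      have "(1 + x) * exp (- x) \<le> exp x * exp (- x)" by (rule mult_right_mono[OF exp_ge_add_one_self]) simp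
      then show ?thesis by (simp add: mult_exp_exp algebra_simps)
    qed
    moreover have "x * exp (- a) \<le> x * exp (- x)" using x0 xa by (intro mult_left_mono) auto
    ultimately show ?thesis by (simp add: x_def mult_ac)
  qed
  show ?thesis by (rule that[of "a * exp (- a)" \<eta>' "min (r / 2) 1"]) (use a(1) \<eta>' r(1) main in auto)
qed

lemma q_power_integrable:
  assumes "1 \<le> j"
  shows "integrable lborel (\<lambda>k. q k ^ j)"
proof (rule Bochner_Integration.integrable_bound[OF q_integrable])
  have "q \<in> borel_measurable borel" using q_continuous by (rule borel_measurable_continuous_onI)
  then show "(\<lambda>k. q k ^ j) \<in> borel_measurable lborel" by measurable
  have "q k ^ j \<le> q k" for k using power_decreasing[OF assms less_imp_le[OF q_pos] q_le_1, of k] by simp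
  then show "AE k in lborel. norm (q k ^ j) \<le> norm (q k)" by (simp add: less_imp_le[OF q_pos])
qed

lemma q_power_summable:
  assumes "good_side L" "1 \<le> j"
  shows "(\<lambda>k. q k ^ j) summable_on dual_lattice L" using torus_weight.q_power_sums(2)[OF torus_weight[OF assms(1)] assms(2)] .

text \<open>For j = 1 convergence is part of \<open>jump_function\<close>. With pointwise
  convergence of the step functions, Scheffe's lemma upgrades it to convergence in mean, and |x^j -
  y^j| \<le> j |x - y| on [0, 1] passes this on to all powers.\<close>

lemma riemann_sum_tendsto:
  fixes L :: "nat \<Rightarrow> real"
  assumes L: "filterlim L at_top sequentially" and good: "\<And>n. good_side (L n)" and j: "1 \<le> j"
  shows "(\<lambda>n. (\<Sum>\<^sub>\<infinity>k\<in>dual_lattice (L n). q k ^ j) / L n ^ CARD('d)) \<longlonglongrightarrow> (LINT k|lborel. q k ^ j)"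
proof -
  have L0: "0 < L n" for n using good[of n] by (simp add: good_side_def)
  let ?f = "\<lambda>n x. q (lattice_cell (L n) x)"
  have q0: "0 \<le> q k" for k by (rule less_imp_le[OF q_pos])
  have step: "integrable lborel (\<lambda>x. ?f n x ^ i)"
    "(LINT x|lborel. ?f n x ^ i) = (\<Sum>\<^sub>\<infinity>k\<in>dual_lattice (L n). q k ^ i) / L n ^ CARD('d)" if "1 \<le> i" for n i
    using step_integral[OF L0 _ q_power_summable[OF good that], of n] q0 by auto
  have fi: "integrable lborel (?f n)" for n using step(1)[of 1 n] by simp
  have pt: "(\<lambda>n. ?f n x) \<longlonglongrightarrow> q x" for x
  proof -
    have "(\<lambda>n. real CARD('d) / L n) \<longlonglongrightarrow> 0" by (rule tendsto_divide_0[OF tendsto_const filterlim_at_top_imp_at_infinity[OF L]])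
    then have "(\<lambda>n. lattice_cell (L n) x - x) \<longlonglongrightarrow> 0" by (rule Lim_null_comparison[rotated]) (simp add: lattice_cell_near[OF L0])
    then have "(\<lambda>n. lattice_cell (L n) x) \<longlonglongrightarrow> x" by (simp only: LIM_zero_iff)
    moreover have "isCont q x" using q_continuous by (simp add: continuous_on_eq_continuous_at)
    ultimately show ?thesis by (rule isCont_tendsto_compose[rotated])
  qed
  have "((\<lambda>L. (1 / L ^ CARD('d)) * (\<Sum>\<^sub>\<infinity>k\<in>dual_lattice L. q k)) \<longlongrightarrow> (LINT k|lborel. q k)) at_top"
    using jump by (simp add: jump_function_def q_def[abs_def])
  from filterlim_compose[OF this L]
  have "(\<lambda>n. LINT x|lborel. ?f n x) \<longlonglongrightarrow> (LINT k|lborel. q k)" using step(2)[of 1] by simp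
  then have "(\<lambda>n. ennreal (LINT x|lborel. ?f n x)) \<longlonglongrightarrow> ennreal (LINT k|lborel. q k)" by (rule tendsto_ennrealI)
  moreover have "(\<integral>\<^sup>+x. norm (?f n x) \<partial>lborel) = ennreal (LINT x|lborel. ?f n x)" for n
    using nn_integral_eq_integral[OF fi AE_I2, of n] q0 by simp
  moreover have qn: "(\<integral>\<^sup>+x. norm (q x) \<partial>lborel) = ennreal (LINT x|lborel. q x)"
    using nn_integral_eq_integral[OF q_integrable AE_I2] q0 by simp
  ultimately have "(\<lambda>n. \<integral>\<^sup>+x. norm (?f n x) \<partial>lborel) \<longlonglongrightarrow> (\<integral>\<^sup>+x. norm (q x) \<partial>lborel)" by (simp only:)
  then have "limsup (\<lambda>n. \<integral>\<^sup>+x. norm (?f n x) \<partial>lborel) = (\<integral>\<^sup>+x. norm (q x) \<partial>lborel)" by (rule lim_imp_Limsup[rotated]) simp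
  then have "(\<lambda>n. \<integral>\<^sup>+x. norm (?f n x - q x) \<partial>lborel) \<longlonglongrightarrow> 0"
    by (intro Scheffe_lemma1[OF fi q_integrable AE_I2[OF pt]]) (simp only: order_refl)
  moreover have di: "integrable lborel (\<lambda>x. norm (?f n x - q x))" for n
    by (intro integrable_norm Bochner_Integration.integrable_diff fi q_integrable)
  then have "(\<integral>\<^sup>+x. norm (?f n x - q x) \<partial>lborel) = ennreal (LINT x|lborel. norm (?f n x - q x))" for n
    by (rule nn_integral_eq_integral) simp
  ultimately have "(\<lambda>n. ennreal (LINT x|lborel. norm (?f n x - q x))) \<longlonglongrightarrow> 0" by (simp only:)
  then have d0: "(\<lambda>n. LINT x|lborel. norm (?f n x - q x)) \<longlonglongrightarrow> 0" by (subst (asm) ennreal_tendsto_0_iff) auto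
  have "(\<lambda>n. (LINT x|lborel. ?f n x ^ j) - (LINT k|lborel. q k ^ j)) \<longlonglongrightarrow> 0"
  proof (rule Lim_null_comparison[OF always_eventually])
    show "\<forall>n. norm ((LINT x|lborel. ?f n x ^ j) - (LINT k|lborel. q k ^ j)) \<le> real j * (LINT x|lborel. norm (?f n x - q x))"
    proof
      fix n
      have "norm ((LINT x|lborel. ?f n x ^ j) - (LINT k|lborel. q k ^ j)) = norm (LINT x|lborel. ?f n x ^ j - q x ^ j)"
        by (simp only: Bochner_Integration.integral_diff[OF step(1)[OF j] q_power_integrable[OF j]])
      also have "\<dots> \<le> (LINT x|lborel. norm (?f n x ^ j - q x ^ j))" by (rule integral_norm_bound)
      also have "\<dots> \<le> (LINT x|lborel. real j * norm (?f n x - q x))"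
      proof (rule integral_mono)
        show "integrable lborel (\<lambda>x. norm (?f n x ^ j - q x ^ j))"
          by (intro integrable_norm Bochner_Integration.integrable_diff step(1) q_power_integrable j)
        show "integrable lborel (\<lambda>x. real j * norm (?f n x - q x))" by (intro integrable_mult_right di)
        show "norm (?f n x ^ j - q x ^ j) \<le> real j * norm (?f n x - q x)" for x by (rule norm_power_diff) (use q0 q_le_1 in auto)
      qed
      also have "\<dots> = real j * (LINT x|lborel. norm (?f n x - q x))" by (rule integral_mult_right_zero)
      finally show "norm ((LINT x|lborel. ?f n x ^ j) - (LINT k|lborel. q k ^ j)) \<le> real j * (LINT x|lborel. norm (?f n x - q x))" .
    qed
    show "(\<lambda>n. real j * (LINT x|lborel. norm (?f n x - q x))) \<longlonglongrightarrow> 0" using tendsto_mult_right_zero[OF d0] by simp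
  qed
  then show ?thesis unfolding step(2)[OF j] by (simp only: LIM_zero_iff)
qed

end

section \<open>Sums over the nonzero modes\<close>

context jump_ensemble begin

definition modes :: "real \<Rightarrow> nat \<Rightarrow> real" where
  "modes L j = (\<Sum>\<^sub>\<infinity>k\<in>dual_lattice L - {0}. q k ^ j)"

lemma modes_nonneg: "0 \<le> modes L j" unfolding modes_def by (rule infsum_nonneg) (simp add: less_imp_le[OF q_pos])

lemma q_power_summable_nonzero:
  assumes "good_side L" "1 \<le> j"
  shows "(\<lambda>k. q k ^ j) summable_on dual_lattice L - {0}" by (rule summable_on_subset[OF q_power_summable[OF assms]]) blast

lemma mode_sum_eq:
  assumes "good_side L" "1 \<le> j"
  shows "(\<Sum>\<^sub>\<infinity>k\<in>dual_lattice L. q k ^ j) = 1 + modes L j"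
proof -
  have "0 < L" using assms(1) by (simp add: good_side_def)
  then have "dual_lattice L = insert 0 (dual_lattice L - {0 :: real^'d})" using dual_lattice_props(4)[of L, where 'd='d] by blast
  then show ?thesis using infsum_insert[OF q_power_summable_nonzero[OF assms], of 0] by (simp add: modes_def q_0)
qed

text \<open>The sum over j > J is at most q^J q / (1 - q) in each mode. Near the origin this is at
  most |k|^(- \<eta>) / a, whose lattice sum over a small ball is a small multiple of the volume
  since \<eta> < d; away from it q \<le> s < 1, and s^J times the total number density is small for
  large \<open>J\<close>.\<close>

lemma modes_tail:
  assumes e: "0 < e"
  shows "\<exists>J. \<forall>\<^sub>F L in at_top. \<forall>N. (\<Sum>j\<in>{J<..N}. modes L j) \<le> e * L ^ CARD('d)"
proof -
  obtain a \<eta> D where a: "0 < a" "0 < \<eta>" "\<eta> < real CARD('d)" "0 < D"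
    and near: "\<And>k. norm k \<le> D \<Longrightarrow> a * norm k powr \<eta> \<le> 1 - q k" by (rule q_near_0) blast
  have ae: "0 < a * e / 2" using a(1) e by simp
  obtain \<delta> where \<delta>: "0 < \<delta>" "\<delta> \<le> D" and sing: "\<forall>\<^sub>F L in at_top. \<forall>A :: (real^'d) set. finite A \<longrightarrow>
    A \<subseteq> {k \<in> dual_lattice L. k \<noteq> 0 \<and> norm k \<le> \<delta>} \<longrightarrow> (\<Sum>k\<in>A. norm k powr (-\<eta>)) \<le> a * e / 2 * L ^ CARD('d)"
    using lattice_singular_sum[OF a(2,3) ae a(4)] by blast
  obtain s where s: "0 \<le> s" "s < 1" "\<And>k. \<delta> \<le> norm k \<Longrightarrow> q k \<le> s" using q_separated[OF \<delta>(1)] by blast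
  define I where "I = (LINT k|lborel. q k)"
  have I0: "0 \<le> I" unfolding I_def by (rule integral_nonneg_AE) (simp add: less_imp_le[OF q_pos])
  have "((\<lambda>L. (1 / L ^ CARD('d)) * (\<Sum>\<^sub>\<infinity>k\<in>dual_lattice L. q k)) \<longlongrightarrow> I) at_top"
    using jump by (simp add: jump_function_def q_def[abs_def] I_def)
  then have ev: "\<forall>\<^sub>F L in at_top. (1 / L ^ CARD('d)) * (\<Sum>\<^sub>\<infinity>k\<in>dual_lattice L. q k) < I + 1" by (rule order_tendstoD) simp
  have "(\<lambda>J. s ^ J * ((I + 1) / (1 - s))) \<longlonglongrightarrow> 0 * ((I + 1) / (1 - s))" using s(1,2) by (intro tendsto_mult_right LIMSEQ_realpow_zero)
  then have "\<forall>\<^sub>F J in sequentially. s ^ J * ((I + 1) / (1 - s)) < e / 2" by (rule order_tendstoD) (use e in simp)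
  then obtain J where J: "s ^ J * ((I + 1) / (1 - s)) < e / 2" using eventually_happens[of _ "sequentially"] by auto
  have q0: "0 \<le> q k" for k by (rule less_imp_le[OF q_pos])
  have "\<forall>\<^sub>F L in at_top. \<forall>N. (\<Sum>j\<in>{J<..N}. modes L j) \<le> e * L ^ CARD('d)" using sing ev eventually_good_side
  proof eventually_elim
    case (elim L)
    have L: "0 < L" using elim(3) by (simp add: good_side_def)
    let ?V = "L ^ CARD('d)"
    have V: "0 < ?V" using L by simp
    have tot: "(\<Sum>\<^sub>\<infinity>k\<in>dual_lattice L. q k) \<le> (I + 1) * ?V" using elim(2) V by (simp add: field_simps)
    have qs: "q summable_on dual_lattice L" using elim(3) by (simp add: good_side_def)
    show ?case
    proof
      fix N
      let ?G = "\<lambda>k. \<Sum>j\<in>{J<..N}. q k ^ j"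
      have sm: "(\<lambda>k. q k ^ j) summable_on dual_lattice L - {0}" if "j \<in> {J<..N}" for j
        by (rule q_power_summable_nonzero[OF elim(3)]) (use that in auto)
      have eq: "(\<Sum>j\<in>{J<..N}. modes L j) = (\<Sum>\<^sub>\<infinity>k\<in>dual_lattice L - {0}. \<Sum>j\<in>{J<..N}. q k ^ j)"
        unfolding modes_def by (rule sum_infsum(1)) (use sm in auto)
      have ssm: "(\<lambda>k. \<Sum>j\<in>{J<..N}. q k ^ j) summable_on dual_lattice L - {0}" by (rule sum_infsum(2)) (use sm in auto)
      show "(\<Sum>j\<in>{J<..N}. modes L j) \<le> e * ?V" unfolding eq
      proof (rule infsum_le_finite_sums[OF ssm])
        fix A :: "(real^'d) set" assume A: "finite A" "A \<subseteq> dual_lattice L - {0}"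
        let ?A1 = "{k \<in> A. norm k \<le> \<delta>}" and ?A2 = "{k \<in> A. \<not> norm k \<le> \<delta>}"
        have g: "?G k \<le> q k ^ J * q k / (1 - q k)" if "k \<in> A" for k by (rule geometric_tail_le[OF q0 q_lt_1]) (use A that in auto)
        have "(\<Sum>k\<in>?A1. ?G k) \<le> (\<Sum>k\<in>?A1. norm k powr (-\<eta>) / a)"
        proof (rule sum_mono)
          fix k assume k: "k \<in> ?A1"
          then have k0: "k \<noteq> 0" using A by auto
          have "0 < a * norm k powr \<eta>" using a(1) k0 by simp
          moreover have "a * norm k powr \<eta> \<le> 1 - q k" using k \<delta>(2) by (intro near) auto
          moreover have "q k ^ J * q k \<le> 1" using q0[of k] q_le_1[of k] by (intro mult_le_one power_le_one) auto
          ultimately have "q k ^ J * q k / (1 - q k) \<le> 1 / (a * norm k powr \<eta>)" by (intro frac_le) auto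
          also have "\<dots> = norm k powr (-\<eta>) / a" by (simp add: powr_minus divide_inverse)
          finally show "?G k \<le> norm k powr (-\<eta>) / a" using g[of k] k by auto
        qed
        also have "\<dots> = (\<Sum>k\<in>?A1. norm k powr (-\<eta>)) / a" by (rule sum_divide_distrib[symmetric])
        also have "\<dots> \<le> (a * e / 2 * ?V) / a" using elim(1)[rule_format, of ?A1] A a(1) by (intro divide_right_mono) auto
        also have "\<dots> = e / 2 * ?V" using a(1) by simp
        finally have 1: "(\<Sum>k\<in>?A1. ?G k) \<le> e / 2 * ?V" .
        have "(\<Sum>k\<in>?A2. ?G k) \<le> (\<Sum>k\<in>?A2. s ^ J / (1 - s) * q k)"
        proof (rule sum_mono)
          fix k assume k: "k \<in> ?A2"
          then have qs: "q k \<le> s" by (intro s(3)) auto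
          have "q k ^ J * q k / (1 - q k) \<le> s ^ J * q k / (1 - s)" using q0 qs s(1,2) by (intro frac_le mult_right_mono power_mono) auto
          then show "?G k \<le> s ^ J / (1 - s) * q k" using g[of k] k by auto
        qed
        also have "\<dots> = s ^ J / (1 - s) * (\<Sum>k\<in>?A2. q k)" by (rule sum_distrib_left[symmetric])
        also have "\<dots> \<le> s ^ J / (1 - s) * ((I + 1) * ?V)"
        proof (rule mult_left_mono)
          have "sum q ?A2 \<le> infsum q (dual_lattice L)" using A q0 by (intro finite_sum_le_infsum[OF qs]) auto
          then show "sum q ?A2 \<le> (I + 1) * ?V" using tot by linarith
        qed (use s in simp)
        also have "\<dots> = s ^ J * ((I + 1) / (1 - s)) * ?V" by simp
        also have "\<dots> \<le> e / 2 * ?V" using J V by (intro mult_right_mono) auto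
        finally have 2: "(\<Sum>k\<in>?A2. ?G k) \<le> e / 2 * ?V" .
        have "A = ?A1 \<union> ?A2" by blast
        then have "(\<Sum>k\<in>A. ?G k) = (\<Sum>k\<in>?A1. ?G k) + (\<Sum>k\<in>?A2. ?G k)" using A(1) sum.union_disjoint[of ?A1 ?A2 ?G] by auto
        then show "(\<Sum>k\<in>A. ?G k) \<le> e * ?V" using 1 2 by linarith
      qed
    qed
  qed
  then show ?thesis by blast
qed

text \<open>Every nonzero dual lattice point has norm at least 1 / L, so each nonzero mode satisfies
  q \<le> exp (- a L^(- \<eta>)), and each further power gains this factor.\<close>

lemma modes_decay:
  obtains a \<eta> where "0 < a" "0 < \<eta>" "\<eta> < real CARD('d)"
    and "\<forall>\<^sub>F L in at_top. \<forall>j\<ge>1. \<forall>i. modes L (j + i) \<le> exp (- (a * L powr (-\<eta>)) * real i) * modes L j"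
proof -
  obtain a \<eta> D where a: "0 < a" "0 < \<eta>" "\<eta> < real CARD('d)" "0 < D"
    and near: "\<And>k. norm k \<le> D \<Longrightarrow> a * norm k powr \<eta> \<le> 1 - q k" by (rule q_near_0) blast
  obtain s where s: "0 \<le> s" "s < 1" "\<And>k. D \<le> norm k \<Longrightarrow> q k \<le> s" using q_separated[OF a(4)] by blast
  have "((\<lambda>L::real. a * L powr (-\<eta>)) \<longlongrightarrow> a * 0) at_top" using a(2) by (intro tendsto_mult_left tendsto_neg_powr filterlim_ident) auto
  then have "\<forall>\<^sub>F L in at_top. a * L powr (-\<eta>) < 1 - s" by (rule order_tendstoD) (use s in simp)
  then have "\<forall>\<^sub>F L in at_top. \<forall>j\<ge>1. \<forall>i. modes L (j + i) \<le> exp (- (a * L powr (-\<eta>)) * real i) * modes L j" using eventually_good_side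
  proof eventually_elim
    case (elim L)
    have L: "0 < L" using elim(2) by (simp add: good_side_def)
    let ?x = "a * L powr (-\<eta>)"
    have qx: "q k \<le> exp (- ?x)" if k: "k \<in> dual_lattice L - {0}" for k
    proof -
      have "?x \<le> 1 - q k"
      proof (cases "norm k \<le> D")
        case True
        have "1 / L \<le> norm k" using k by (intro dual_lattice_norm_ge[OF L]) auto
        then have "(1 / L) powr \<eta> \<le> norm k powr \<eta>" using L a(2) by (intro powr_mono2) auto
        moreover have "(1 / L) powr \<eta> = L powr (-\<eta>)" using L by (simp add: powr_divide powr_minus_divide)
        ultimately have "?x \<le> a * norm k powr \<eta>" using a(1) by simp
        then show ?thesis using near[OF True] by linarith
      next
        case False
        then have "q k \<le> s" by (intro s(3)) auto
        then show ?thesis using elim(1) by linarith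
      qed
      then have "q k \<le> 1 + (- ?x)" by simp
      also have "\<dots> \<le> exp (- ?x)" by (rule exp_ge_add_one_self)
      finally show ?thesis .
    qed
    show ?case
    proof (intro allI impI)
      fix j i :: nat assume j: "1 \<le> j"
      have sj: "(\<lambda>k. q k ^ j) summable_on dual_lattice L - {0}" by (rule q_power_summable_nonzero[OF elim(2) j])
      have "modes L (j + i) \<le> (\<Sum>\<^sub>\<infinity>k\<in>dual_lattice L - {0}. exp (- ?x * real i) * q k ^ j)" unfolding modes_def
      proof (rule infsum_mono)
        show "(\<lambda>k. q k ^ (j + i)) summable_on dual_lattice L - {0}" by (rule q_power_summable_nonzero[OF elim(2)]) (use j in simp)
        show "(\<lambda>k. exp (- ?x * real i) * q k ^ j) summable_on dual_lattice L - {0}" by (rule summable_on_cmult_right[OF sj])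
        fix k :: "real^'d" assume k: "k \<in> dual_lattice L - {0}"
        have "q k ^ i \<le> exp (- ?x) ^ i" using qx[OF k] by (intro power_mono less_imp_le[OF q_pos])
        also have "\<dots> = exp (- ?x * real i)" by (simp add: exp_of_nat_mult[symmetric] mult.commute)
        finally have "q k ^ i * q k ^ j \<le> exp (- ?x * real i) * q k ^ j" by (rule mult_right_mono) (simp add: less_imp_le[OF q_pos])
        then show "q k ^ (j + i) \<le> exp (- ?x * real i) * q k ^ j" by (simp only: power_add mult.commute[of "q k ^ j"])
      qed
      also have "\<dots> = exp (- ?x * real i) * modes L j" unfolding modes_def by (rule infsum_cmult_right[OF sj])
      finally show "modes L (j + i) \<le> exp (- ?x * real i) * modes L j" .
    qed
  qed
  then show ?thesis by (rule that[OF a(1-3)])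
qed

end

section \<open>Boxes at fixed density\<close>

locale thermodynamic_ensemble = jump_ensemble \<xi> for \<xi> :: "real^'d \<Rightarrow> ereal" +
  fixes \<rho> :: real
  assumes \<rho>: "0 < \<rho>"
begin

definition side :: "nat \<Rightarrow> real" where "side N = root CARD('d) (real N / \<rho>)"

lemma side_power: "side N ^ CARD('d) = real N / \<rho>" using \<rho> by (simp add: side_def)

lemma side_at_top: "filterlim side at_top sequentially" unfolding filterlim_at_top_gt[where c = 0]
proof (intro allI impI)
  fix Z :: real assume Z: "0 < Z"
  have "\<forall>\<^sub>F N in sequentially. Z ^ CARD('d) * \<rho> \<le> real N" using filterlim_real_sequentially by (simp add: filterlim_at_top)
  then show "\<forall>\<^sub>F N in sequentially. Z \<le> side N"
  proof eventually_elim
    case (elim N)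
    then have "Z ^ CARD('d) \<le> real N / \<rho>" using \<rho> by (simp add: pos_le_divide_eq)
    then have "root CARD('d) (Z ^ CARD('d)) \<le> side N" unfolding side_def by simp
    then show ?case using Z by (simp add: real_root_power_cancel)
  qed
qed

lemma eventually_good: "\<forall>\<^sub>F N in sequentially. good_side (side N)"
  by (rule eventually_compose_filterlim[OF eventually_good_side side_at_top])

lemma modes_lim:
  assumes j: "1 \<le> j"
  shows "(\<lambda>N. modes (side N) j / real N) \<longlonglongrightarrow> (LINT k|lborel. q k ^ j) / \<rho>"
proof -
  obtain N0 where N0: "\<And>N. N0 \<le> N \<Longrightarrow> good_side (side N)" using eventually_good by (auto simp: eventually_sequentially)
  \<comment> \<open>The index is shifted so that every box is good, as
    \<open>riemann_sum_tendsto\<close> requires, and no box is empty, which allows the division by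
    the number of points.\<close>
  have f: "filterlim (\<lambda>N. side (N + Suc N0)) at_top sequentially"
    by (rule filterlim_compose[OF side_at_top filterlim_add_const_nat_at_top])
  have g: "good_side (side (N + Suc N0))" for N by (rule N0) simp
  have "(\<lambda>N. (\<Sum>\<^sub>\<infinity>k\<in>dual_lattice (side (N + Suc N0)). q k ^ j) / side (N + Suc N0) ^ CARD('d) / \<rho> - 1 / real (N + Suc N0))
      \<longlonglongrightarrow> (LINT k|lborel. q k ^ j) / \<rho> - 0"
    by (intro tendsto_diff tendsto_divide[OF riemann_sum_tendsto[OF f g j] tendsto_const] LIMSEQ_ignore_initial_segment[OF lim_1_over_n]) (use \<rho> in simp)
  moreover have "(\<Sum>\<^sub>\<infinity>k\<in>dual_lattice (side (N + Suc N0)). q k ^ j) / side (N + Suc N0) ^ CARD('d) / \<rho> - 1 / real (N + Suc N0)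
      = modes (side (N + Suc N0)) j / real (N + Suc N0)" for N
  proof -
    have "x / (real (N + Suc N0) / \<rho>) / \<rho> = x / real (N + Suc N0)" for x using \<rho> by (simp del: of_nat_add of_nat_Suc)
    then show ?thesis unfolding mode_sum_eq[OF g j] side_power by (simp add: add_divide_distrib del: of_nat_add of_nat_Suc)
  qed
  ultimately have "(\<lambda>N. modes (side (N + Suc N0)) j / real (N + Suc N0)) \<longlonglongrightarrow> (LINT k|lborel. q k ^ j) / \<rho>" by (simp only: diff_0_right)
  then show ?thesis by (rule LIMSEQ_offset)
qed

lemma side_tail:
  assumes e: "0 < e"
  shows "\<exists>J. \<forall>\<^sub>F N in sequentially. (\<Sum>j\<in>{J<..N}. modes (side N) j) \<le> e * real N"
proof -
  have "0 < e * \<rho>" using e \<rho> by simp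
  from modes_tail[OF this] obtain J where
    "\<forall>\<^sub>F L in at_top. \<forall>M. (\<Sum>j\<in>{J<..M}. modes L j) \<le> e * \<rho> * L ^ CARD('d)" by blast
  from eventually_compose_filterlim[OF this side_at_top]
  have "\<forall>\<^sub>F N in sequentially. (\<Sum>j\<in>{J<..N}. modes (side N) j) \<le> e * real N"
  proof eventually_elim
    case (elim N)
    then have "(\<Sum>j\<in>{J<..N}. modes (side N) j) \<le> e * \<rho> * (real N / \<rho>)" unfolding side_power by blast
    then show ?case using \<rho> by simp
  qed
  then show ?thesis by blast
qed

lemma side_decay:
  obtains s c where "0 \<le> s" "s < 1" "0 < (c::real)"
    and "\<forall>\<^sub>F N in sequentially. \<forall>j\<ge>1. \<forall>i. modes (side N) (j + i) \<le> exp (- (c * real N powr (- s)) * real i) * modes (side N) j"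
proof -
  obtain a \<eta> where a: "0 < a" "0 < \<eta>" "\<eta> < real CARD('d)"
    and dec: "\<forall>\<^sub>F L in at_top. \<forall>j\<ge>1. \<forall>i. modes L (j + i) \<le> exp (- (a * L powr (-\<eta>)) * real i) * modes L j" by (rule modes_decay)
  \<comment> \<open>Since L is the d-th root of N / \<rho>, the gap L^(- \<eta>) is a constant times
    N^(- \<eta> / d); the exponent is below 1 because \<eta> < d.\<close>
  let ?s = "\<eta> / real CARD('d)"
  have eq: "a * side N powr (-\<eta>) = a * \<rho> powr ?s * real N powr (- ?s)" if "0 < N" for N
  proof -
    have "side N = (real N / \<rho>) powr (1 / real CARD('d))" unfolding side_def using that \<rho> by (intro root_powr_inverse) auto
    then have "side N powr (-\<eta>) = (real N / \<rho>) powr (- ?s)" by (simp add: powr_powr)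
    also have "\<dots> = \<rho> powr ?s * real N powr (- ?s)" using that \<rho> by (simp add: powr_divide powr_minus field_simps)
    finally show ?thesis by simp
  qed
  have "\<forall>\<^sub>F N in sequentially. \<forall>j\<ge>1. \<forall>i. modes (side N) (j + i)
      \<le> exp (- (a * \<rho> powr ?s * real N powr (- ?s)) * real i) * modes (side N) j"
    using eventually_compose_filterlim[OF dec side_at_top] eventually_gt_at_top[of 0] by eventually_elim (simp only: eq)
  then show ?thesis by (rule that[rotated 3]) (use a \<rho> in auto)
qed

end

section \<open>Spatial permutations\<close>

lemma integral_pair_finite:
  fixes f :: "'a \<times> 'b \<Rightarrow> real"
  assumes "sigma_finite_measure M" and P: "finite P"
    and f: "\<And>\<pi>. \<pi> \<in> P \<Longrightarrow> integrable M (\<lambda>x. f (x, \<pi>))"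
  shows "f \<in> borel_measurable (M \<Otimes>\<^sub>M count_space P)"
    and "integrable (M \<Otimes>\<^sub>M count_space P) f"
    and "(LINT z|(M \<Otimes>\<^sub>M count_space P). f z) = (\<Sum>\<pi>\<in>P. LINT x|M. f (x, \<pi>))"
proof -
  interpret M: sigma_finite_measure M by fact
  interpret S: sigma_finite_measure "count_space P" by (rule sigma_finite_measure_count_space_finite[OF P])
  interpret PS: pair_sigma_finite "count_space P" M ..
  let ?g = "\<lambda>(\<pi>, x). f (x, \<pi>)"
  have g: "?g \<in> borel_measurable (count_space P \<Otimes>\<^sub>M M)"
    by (rule measurable_pair_measure_countable1[OF countable_finite[OF P]]) (use f in auto)
  show "f \<in> borel_measurable (M \<Otimes>\<^sub>M count_space P)" using measurable_pair_swap[OF g] by (simp add: case_prod_eta)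
  have gi: "integrable (count_space P \<Otimes>\<^sub>M M) ?g"
  proof (rule PS.Fubini_integrable[OF g])
    show "integrable (count_space P) (\<lambda>\<pi>. LINT x|M. norm (?g (\<pi>, x)))" by (rule integrable_count_space[OF P])
    show "AE \<pi> in count_space P. integrable M (\<lambda>x. ?g (\<pi>, x))" using f by (simp add: AE_count_space)
  qed
  show "integrable (M \<Otimes>\<^sub>M count_space P) f" using PS.integrable_product_swap[OF gi] by (simp add: case_prod_eta)
  have "(LINT z|(M \<Otimes>\<^sub>M count_space P). f z) = integral\<^sup>L (count_space P \<Otimes>\<^sub>M M) ?g"
    using PS.integral_product_swap[OF g] by (simp add: case_prod_eta)
  also have "\<dots> = (LINT \<pi>|count_space P. (LINT x|M. f (x, \<pi>)))" using PS.integral_fst'[OF gi] by simp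
  also have "\<dots> = (\<Sum>\<pi>\<in>P. LINT x|M. f (x, \<pi>))" by (rule lebesgue_integral_count_space_finite[OF P])
  finally show "(LINT z|(M \<Otimes>\<^sub>M count_space P). f z) = (\<Sum>\<pi>\<in>P. LINT x|M. f (x, \<pi>))" .
qed

locale spatial_ensemble = thermodynamic_ensemble \<xi> \<rho> for \<xi> :: "real^'d \<Rightarrow> ereal" and \<rho> +
  fixes \<alpha> :: "nat \<Rightarrow> real" and \<theta> c0 C0 C s c' :: real and c :: "nat \<Rightarrow> real^'d"
  assumes canonical: "canonical_ensemble (\<lambda>j. exp (- \<alpha> j)) \<theta> c0 C0 C (\<lambda>N. modes (side N))
    (\<lambda>j. (LINT k|lborel. q k ^ j) / \<rho>) s c'"
begin

sublocale CE: canonical_ensemble "\<lambda>j. exp (- \<alpha> j)" \<theta> c0 C0 C "\<lambda>N. modes (side N)" "\<lambda>j. (LINT k|lborel. q k ^ j) / \<rho>" s c'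
  by (rule canonical)

lemma critical_density_eq: "critical_density \<xi> \<alpha> = \<rho> * CE.\<kappa>"
proof -
  have e: "exp (- real j * dispersion \<xi> k) = q k ^ j" for j k by (simp add: q_def exp_of_nat_mult[symmetric])
  have "exp (- \<alpha> (Suc n)) * (LINT k|lborel. exp (- real (Suc n) * dispersion \<xi> k))
      = \<rho> * (exp (- \<alpha> (Suc n)) * ((LINT k|lborel. q k ^ Suc n) / \<rho>))" for n unfolding e using \<rho> by simp
  then show ?thesis unfolding critical_density_def CE.\<kappa>_def using suminf_mult[OF CE.lam_lim(1), of \<rho>] by (simp only:)
qed

abbreviation "weight N \<pi> \<equiv> cycle_weight (CE.w N) (cycle_sets N \<pi>)"

lemma box_weight_eq:
  assumes g: "good_side (side N)" and \<pi>: "\<pi> \<in> perms N"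
  shows "(LINT x|lebesgue_box_power (c N) (side N) N. exp_neg (hamiltonian \<xi> \<alpha> (side N) N x \<pi>)) = weight N \<pi>"
  unfolding box_weight(1)[OF g \<pi>] cycle_weight_def
proof (rule prod.cong[OF refl])
  fix C assume "C \<in> cycle_sets N \<pi>"
  then have "1 \<le> card C" using orbit_partition(5)[OF \<pi>] by (simp add: Suc_le_eq card_gt_0_iff)
  then show "exp (- \<alpha> (card C)) * (\<Sum>\<^sub>\<infinity>k\<in>dual_lattice (side N). q k ^ card C) = CE.w N (card C)"
    by (simp add: mode_sum_eq[OF g] CE.w_def distrib_left)
qed

lemma partition_function_eq:
  assumes g: "good_side (side N)"
  shows "partition_function \<xi> \<alpha> (c N) (side N) N = CE.Y N N"
  using sum_cycle_weight[of "CE.w N" N] by (simp add: partition_function_def box_weight_eq[OF g] CE.Y_def)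

abbreviation "\<mu> N \<equiv> thermo_measure \<xi> \<alpha> \<rho> c N"

lemma sets_thermo [measurable_cong]:
  "sets (\<mu> N) = sets (lebesgue_box_power (c N) (side N) N \<Otimes>\<^sub>M count_space (perms N))"
  unfolding thermo_measure_def spatial_perm_measure_def side_def by (rule sets_density)

text \<open>Fubini over the finite set of permutations: with the positions integrated out, the
  density becomes the cycle weight. The constant function 1 gives the total mass.\<close>

lemma thermo_integral:
  assumes g: "good_side (side N)"
  shows "(LINT z|\<mu> N. h (snd z)) = (\<Sum>\<pi>\<in>perms N. weight N \<pi> * h \<pi>) / (fact N * CE.Y N N)"
    and "prob_space (\<mu> N)"
proof -
  let ?M = "lebesgue_box_power (c N) (side N) N" and ?D = "fact N * CE.Y N N"
  let ?d = "\<lambda>z. exp_neg (hamiltonian \<xi> \<alpha> (side N) N (fst z) (snd z)) / ?D"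
  have D: "0 < ?D" using CE.Y_pos[of N N] by simp
  interpret T: torus_weight p q "side N" by (rule torus_weight[OF g])
  interpret fm: finite_measure ?M unfolding lebesgue_box_power_def by (rule T.finite_box_power)
  have sf: "sigma_finite_measure ?M" ..
  have \<mu>: "\<mu> N = density (?M \<Otimes>\<^sub>M count_space (perms N)) (\<lambda>z. ennreal (?d z))"
    by (simp add: thermo_measure_def spatial_perm_measure_def partition_function_eq[OF g, unfolded side_def] side_def case_prod_beta')
  have di: "integrable ?M (\<lambda>x. exp_neg (hamiltonian \<xi> \<alpha> (side N) N x \<pi>) / ?D)" if "\<pi> \<in> perms N" for \<pi>
    by (intro integrable_divide box_weight(2)[OF g that])
  note d = integral_pair_finite[OF sf finite_perms, of N ?d]
  have dm: "?d \<in> borel_measurable (?M \<Otimes>\<^sub>M count_space (perms N))" using di by (intro d(1)) simp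
  have dI: "integrable (?M \<Otimes>\<^sub>M count_space (perms N)) ?d" using di by (intro d(2)) simp
  have d0: "0 \<le> ?d z" for z using D exp_neg_nonneg by (intro divide_nonneg_pos) auto
  have int: "(LINT z|(?M \<Otimes>\<^sub>M count_space (perms N)). ?d z * h (snd z)) = (\<Sum>\<pi>\<in>perms N. weight N \<pi> * h \<pi>) / ?D" for h
  proof -
    have "integrable ?M (\<lambda>x. exp_neg (hamiltonian \<xi> \<alpha> (side N) N x \<pi>) / ?D * h \<pi>)" if "\<pi> \<in> perms N" for \<pi>
      by (intro integrable_mult_left di that)
    then have "(LINT z|(?M \<Otimes>\<^sub>M count_space (perms N)). ?d z * h (snd z))
        = (\<Sum>\<pi>\<in>perms N. LINT x|?M. exp_neg (hamiltonian \<xi> \<alpha> (side N) N x \<pi>) / ?D * h \<pi>)"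
      using integral_pair_finite(3)[OF sf finite_perms, of N "\<lambda>z. ?d z * h (snd z)"] by simp
    also have "\<dots> = (\<Sum>\<pi>\<in>perms N. weight N \<pi> / ?D * h \<pi>)"
      by (intro sum.cong refl) (simp only: integral_mult_left_zero integral_divide_zero box_weight_eq[OF g])
    finally show ?thesis by (simp add: sum_divide_distrib)
  qed
  have hm: "(\<lambda>z. h (snd z)) \<in> borel_measurable (?M \<Otimes>\<^sub>M count_space (perms N))" for h :: "(nat \<Rightarrow> nat) \<Rightarrow> real"
    by (rule measurable_compose[OF measurable_snd]) simp
  show "(LINT z|\<mu> N. h (snd z)) = (\<Sum>\<pi>\<in>perms N. weight N \<pi> * h \<pi>) / ?D"
    unfolding \<mu> using integral_density[OF hm dm AE_I2[OF d0]] int[of h] by simp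
  show "prob_space (\<mu> N)"
  proof
    have "emeasure (\<mu> N) (space (\<mu> N)) = (\<integral>\<^sup>+z. ennreal (?d z) \<partial>(?M \<Otimes>\<^sub>M count_space (perms N)))"
      unfolding \<mu> using dm by (subst emeasure_density) (auto intro!: nn_integral_cong simp: indicator_def)
    also have "\<dots> = ennreal (LINT z|(?M \<Otimes>\<^sub>M count_space (perms N)). ?d z)" by (rule nn_integral_eq_integral[OF dI AE_I2[OF d0]])
    also have "(LINT z|(?M \<Otimes>\<^sub>M count_space (perms N)). ?d z) = (\<Sum>\<pi>\<in>perms N. weight N \<pi>) / ?D" using int[of "\<lambda>_. 1"] by simp
    also have "\<dots> = 1" using sum_cycle_weight[of "CE.w N" N] CE.Y_pos[of N N] by (simp add: CE.Y_def)
    finally show "emeasure (\<mu> N) (space (\<mu> N)) = 1" by simp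
  qed
qed

abbreviation "long_total N K \<pi> \<equiv> \<Sum>i | K < cycle_length N \<pi> i. real (cycle_length N \<pi> i)"

text \<open>Size biasing expresses the fraction as a sum over lengths above \<open>K\<close>. The
  recursion for \<open>Y N N\<close> replaces it by the complement, a sum whose number of terms does
  not grow with \<open>N\<close>.\<close>

lemma expected_long_fraction:
  assumes g: "good_side (side N)" and N: "0 < N" "K \<le> N"
  shows "(LINT (x, \<pi>)|\<mu> N. (1 / real N) * long_total N K \<pi>)
    = 1 - CE.short_fraction K N"
proof -
  let ?f = "\<lambda>j. if K < j then 1 else 0 :: real"
  let ?c = "\<lambda>\<pi>. \<Sum>C\<in>cycle_sets N \<pi>. real (card C) * ?f (card C)" and ?w = "\<Sum>j=1..N. ?f j * CE.w N j * CE.Y N (N - j)"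
  let ?h = "\<lambda>\<pi>. (1 / real N) * long_total N K \<pi>"
  have h: "?h \<pi> = (1 / real N) * (?c \<pi>)" if \<pi>: "\<pi> \<in> perms N" for \<pi>
  proof -
    note L = cycle_length_mset[OF \<pi>]
    let ?n = "length (sorted_cycle_lengths N \<pi>)"
    have "{i. K < cycle_length N \<pi> i} = {i \<in> {..<?n}. K < cycle_length N \<pi> i}"
      using L(2) by (auto simp: not_less[symmetric] intro: ccontr)
    then have "long_total N K \<pi>
        = (\<Sum>i<?n. if K < cycle_length N \<pi> i then real (cycle_length N \<pi> i) else 0)" by (simp only: sum.inter_filter[OF finite_lessThan])
    also have "\<dots> = (\<Sum>i<?n. real (cycle_length N \<pi> i) * ?f (cycle_length N \<pi> i))" by (intro sum.cong) auto
    also have "\<dots> = ?c \<pi>" by (rule L(5))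
    finally show ?thesis by simp
  qed
  have "(LINT (x, \<pi>)|\<mu> N. ?h \<pi>) = (LINT z|\<mu> N. ?h (snd z))" by (simp add: case_prod_beta')
  also have "\<dots> = (\<Sum>\<pi>\<in>perms N. weight N \<pi> * ?h \<pi>) / (fact N * CE.Y N N)" by (rule thermo_integral(1)[OF g])
  also have "(\<Sum>\<pi>\<in>perms N. weight N \<pi> * ?h \<pi>)
      = (\<Sum>\<pi>\<in>perms N. (1 / real N) * (weight N \<pi> * (?c \<pi>)))"
  proof (rule sum.cong[OF refl])
    fix \<pi> assume "\<pi> \<in> perms N"
    from h[OF this] show "weight N \<pi> * ?h \<pi> = 1 / real N * (weight N \<pi> * (?c \<pi>))" by (simp only: mult.left_commute)
  qed
  also have "\<dots> = (1 / real N) * (\<Sum>\<pi>\<in>perms N. weight N \<pi> * (?c \<pi>))" by (rule sum_distrib_left[symmetric])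
  also have "\<dots> = (1 / real N) * (fact N * ?w)" using sum_cycle_weight_length[OF N(1), of "CE.w N" ?f] by (simp only: CE.Y_def)
  finally have 1: "(LINT (x, \<pi>)|\<mu> N. ?h \<pi>) = ?w / (real N * CE.Y N N)" by simp
  have "(\<Sum>j=1..N. CE.w N j * CE.Y N (N - j))
      = (\<Sum>j=1..K. CE.w N j * CE.Y N (N - j)) + (\<Sum>j\<in>{K<..N}. CE.w N j * CE.Y N (N - j))"
    using N(2) by (subst sum.union_disjoint[symmetric]) (auto intro!: sum.cong)
  also have "(\<Sum>j\<in>{K<..N}. CE.w N j * CE.Y N (N - j)) = ?w" by (rule sum.mono_neutral_cong_left) auto
  finally have "?w = real N * CE.Y N N - (\<Sum>j=1..K. CE.w N j * CE.Y N (N - j))" using hcoef_rec[of N "CE.w N"] by (simp add: CE.Y_def)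
  then show ?thesis unfolding 1 using N(1) CE.Y_pos[of N N] by (simp add: diff_divide_distrib)
qed

lemma expected_cycle_product:
  assumes g: "good_side (side N)"
  shows "(LINT z|\<mu> N. (\<Prod>C\<in>cycle_sets N (snd z). h (card C))) = hcoef (\<lambda>j. CE.w N j * h j) N / CE.Y N N"
proof -
  have "(LINT z|\<mu> N. (\<Prod>C\<in>cycle_sets N (snd z). h (card C)))
     = (\<Sum>\<pi>\<in>perms N. weight N \<pi> * (\<Prod>C\<in>cycle_sets N \<pi>. h (card C))) / (fact N * CE.Y N N)"
    by (rule thermo_integral(1)[OF g, of "\<lambda>\<pi>. \<Prod>C\<in>cycle_sets N \<pi>. h (card C)"])
  also have "(\<Sum>\<pi>\<in>perms N. weight N \<pi> * (\<Prod>C\<in>cycle_sets N \<pi>. h (card C))) = fact N * hcoef (\<lambda>j. CE.w N j * h j) N"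
    using sum_cycle_weight[of "\<lambda>j. CE.w N j * h j" N] by (simp add: cycle_weight_def prod.distrib)
  finally show ?thesis by simp
qed

lemma fraction_longer_limit:
  assumes "(\<lambda>N. 1 - CE.short_fraction K N) \<longlonglongrightarrow> l"
  shows "fraction_longer \<xi> \<alpha> \<rho> c K = l"
proof -
  have "\<forall>\<^sub>F N in sequentially. 1 - CE.short_fraction K N
     = (LINT (x, \<pi>)|\<mu> N. (1 / real N) * long_total N K \<pi>)" using eventually_good eventually_gt_at_top[of 0] eventually_ge_at_top[of K]
    by eventually_elim (simp only: expected_long_fraction)
  from Lim_transform_eventually[OF assms this]
  have "(\<lambda>N. ereal (LINT (x, \<pi>)|\<mu> N. (1 / real N) * long_total N K \<pi>)) \<longlonglongrightarrow> ereal l" by (simp only: lim_ereal)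
  then show ?thesis unfolding fraction_longer_def by (subst lim_imp_Liminf) auto
qed

text \<open>For \<kappa> \<ge> 1 only eventual bounds on the fraction are at hand, not its limit, so
  the lower limit is enclosed; the bound at \<open>K0\<close> passes to larger \<open>K\<close>
  because the short fraction grows with \<open>K\<close>.\<close>

lemma fraction_longer_bounds:
  assumes "K0 \<le> K" and "\<forall>\<^sub>F N in sequentially. 1 - CE.short_fraction K0 N \<le> u"
  shows "0 \<le> fraction_longer \<xi> \<alpha> \<rho> c K" "fraction_longer \<xi> \<alpha> \<rho> c K \<le> u"
proof -
  let ?e = "\<lambda>N. LINT (x, \<pi>)|\<mu> N. (1 / real N) * long_total N K \<pi>"
  have wY: "0 \<le> CE.w N j * CE.Y N (N - j)" if "1 \<le> j" for N j
    using CE.w_ge[OF that, of N] CE.c0 CE.Y_pos[of N "N - j"] by (intro mult_nonneg_nonneg) linarith+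
  have "\<forall>\<^sub>F N in sequentially. ?e N \<le> u" using assms(2) eventually_good eventually_gt_at_top[of 0] eventually_ge_at_top[of K]
  proof eventually_elim
    case (elim N)
    have "(\<Sum>j=1..K0. CE.w N j * CE.Y N (N - j)) \<le> (\<Sum>j=1..K. CE.w N j * CE.Y N (N - j))" using assms(1) wY by (intro sum_mono2) auto
    then have "CE.short_fraction K0 N \<le> CE.short_fraction K N" using elim(3) CE.Y_pos[of N N] by (intro divide_right_mono) auto
    then show ?case using elim(1) expected_long_fraction[OF elim(2-4)] by linarith
  qed
  then have "Limsup sequentially (\<lambda>N. ereal (?e N)) \<le> ereal u" by (intro Limsup_bounded) (simp add: ereal_less_eq)
  then have up: "liminf (\<lambda>N. ereal (?e N)) \<le> ereal u"
    using Liminf_le_Limsup[of sequentially "\<lambda>N. ereal (?e N)"] by (meson order_trans trivial_limit_sequentially)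
  have "0 \<le> ?e N" for N by (rule integral_nonneg_AE) (auto intro!: AE_I2 divide_nonneg_nonneg sum_nonneg)
  then have low: "ereal 0 \<le> liminf (\<lambda>N. ereal (?e N))" by (intro Liminf_bounded always_eventually allI) (simp only: ereal_less_eq)
  \<comment> \<open>With finite bounds on both sides the lower limit is a real number, which
    \<open>real_of_ereal\<close> preserves.\<close>
  obtain r where "liminf (\<lambda>N. ereal (?e N)) = ereal r" using up low by (cases "liminf (\<lambda>N. ereal (?e N))") auto
  then show "0 \<le> fraction_longer \<xi> \<alpha> \<rho> c K" "fraction_longer \<xi> \<alpha> \<rho> c K \<le> u" unfolding fraction_longer_def using up low by auto
qed

lemma fraction_infinite_eq: "fraction_infinite \<xi> \<alpha> \<rho> c = max 0 (1 - CE.\<kappa>)"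
proof (cases "CE.\<kappa> < 1")
  case True
  let ?tg = "\<lambda>j. exp (- \<alpha> j) * ((LINT k|lborel. q k ^ j) / \<rho>)"
  have "fraction_longer \<xi> \<alpha> \<rho> c K = 1 - (\<Sum>j=1..K. ?tg j)" for K
    by (rule fraction_longer_limit) (intro tendsto_diff tendsto_const CE.short_cycle_fraction[OF True])
  moreover have "(\<Sum>j=1..K. ?tg j) = (\<Sum>n<K. ?tg (Suc n))" for K by (rule sum.reindex_bij_witness[of _ Suc "\<lambda>j. j - 1"]) auto
  moreover have "(\<lambda>K. \<Sum>n<K. ?tg (Suc n)) \<longlonglongrightarrow> CE.\<kappa>" unfolding CE.\<kappa>_def by (rule summable_LIMSEQ[OF CE.lam_lim(1)])
  ultimately have "(\<lambda>K. fraction_longer \<xi> \<alpha> \<rho> c K) \<longlonglongrightarrow> 1 - CE.\<kappa>" by (simp only:) (intro tendsto_diff tendsto_const)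
  then show ?thesis unfolding fraction_infinite_def using True by (simp add: limI)
next
  case False
  have "(\<lambda>K. fraction_longer \<xi> \<alpha> \<rho> c K) \<longlonglongrightarrow> 0"
  proof (rule LIMSEQ_I)
    fix e :: real assume e: "0 < e"
    define \<delta> where "\<delta> = min (1/2) (e / 4)"
    have \<delta>: "0 < \<delta>" "\<delta> < 1" "2 * \<delta> < e" using e by (auto simp: \<delta>_def)
    obtain K0 where K0: "\<forall>\<^sub>F N in sequentially. 1 - CE.short_fraction K0 N \<le> 2 * \<delta>"
      using CE.subcritical_short_cycles[OF _ \<delta>(1,2)] False by auto
    have "norm (fraction_longer \<xi> \<alpha> \<rho> c K - 0) < e" if "K0 \<le> K" for K using fraction_longer_bounds[OF that K0] \<delta>(3) by simp
    then show "\<exists>K0. \<forall>K\<ge>K0. norm (fraction_longer \<xi> \<alpha> \<rho> c K - 0) < e" by blast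
  qed
  then show ?thesis unfolding fraction_infinite_def using False by (simp add: limI)
qed

end

section \<open>Joint convergence of the rescaled cycle lengths\<close>

context spatial_ensemble begin

text \<open>The cycle lengths add up to \<open>N\<close>, so after division by \<nu> N their mass is
  b = 1 / \<nu>. As functions of the sorted lengths the test products extend to all cycles, the
  missing factors being 1, and thus no longer depend on the order.\<close>

lemma rescaled_cycle_lengths:
  fixes b :: real
  assumes \<pi>: "\<pi> \<in> perms N" and N: "0 < N" and b: "0 < b"
  shows "(\<lambda>i. b * real (cycle_length N \<pi> i) / real N) \<in> mass_simplex b"
    and "test_fun \<delta> g \<Longrightarrow> b < real n * \<delta> \<Longrightarrow>
      (\<Prod>i<n. g (b * real (cycle_length N \<pi> i) / real N)) = (\<Prod>C\<in>cycle_sets N \<pi>. g (b * real (card C) / real N))"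
proof -
  note L = cycle_length_mset[OF \<pi>]
  note P = orbit_partition[OF \<pi>]
  let ?l = "length (sorted_cycle_lengths N \<pi>)" and ?y = "\<lambda>i. b * real (cycle_length N \<pi> i) / real N"
  have tot: "(\<Sum>i<?l. real (cycle_length N \<pi> i)) = real N"
  proof -
    have "(\<Sum>i<?l. real (cycle_length N \<pi> i)) = (\<Sum>C\<in>cycle_sets N \<pi>. real (card C))" by (rule L(5))
    also have "\<dots> = real (card (\<Union>(cycle_sets N \<pi>)))"
      using P(1,3,5) by (subst card_Union_disjoint) (auto simp: pairwise_def disjnt_def disjoint_def)
    finally show ?thesis unfolding P(2) by simp
  qed
  have le: "(\<Sum>i<n. real (cycle_length N \<pi> i)) \<le> real N" for n
  proof -
    have "(\<Sum>i<n. real (cycle_length N \<pi> i)) \<le> (\<Sum>i<max n ?l. real (cycle_length N \<pi> i))" by (intro sum_mono2) auto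
    also have "\<dots> = (\<Sum>i<?l. real (cycle_length N \<pi> i))" using L(2) by (intro sum.mono_neutral_right) auto
    finally show ?thesis unfolding tot .
  qed
  show simplex: "?y \<in> mass_simplex b" unfolding mass_simplex_def
  proof (intro CollectI conjI allI)
    show "0 \<le> ?y i" for i using b by simp
    show "decseq ?y" using L(3) b N by (auto simp: decseq_def intro!: divide_right_mono mult_left_mono)
    fix n
    have "(\<Sum>i<n. ?y i) = b * (\<Sum>i<n. real (cycle_length N \<pi> i)) / real N" by (simp only: sum_distrib_left sum_divide_distrib)
    also have "\<dots> \<le> b * real N / real N" using le[of n] b by (intro divide_right_mono mult_left_mono) auto
    finally show "(\<Sum>i<n. ?y i) \<le> b" using N by simp
  qed
  assume g: "test_fun \<delta> g" "b < real n * \<delta>"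
  have g0: "g 0 = 1" using g(1) by (auto simp: test_fun_def)
  have "(\<Prod>i<n. g (?y i)) = (\<Prod>i<max n ?l. g (?y i))" by (rule test_fun_prod[OF g(1) simplex g(2), symmetric]) simp
  also have "\<dots> = (\<Prod>i<?l. g (?y i))" using L(2) g0 by (intro prod.mono_neutral_right) auto
  also have "\<dots> = (\<Prod>C\<in>cycle_sets N \<pi>. g (b * real (card C) / real N))" by (rule L(4)[of "\<lambda>l. g (b * real l / real N)"])
  finally show "(\<Prod>i<n. g (?y i)) = (\<Prod>C\<in>cycle_sets N \<pi>. g (b * real (card C) / real N))" .
qed

end

lemma mass_simplex_mono: "a \<le> b \<Longrightarrow> mass_simplex a \<subseteq> mass_simplex b" by (auto simp: mass_simplex_def intro: order_trans)

text \<open>A function of \<open>m\<close> coordinates is viewed as a function of sequences by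
  restriction, which makes it continuous on the simplex. For measurability, tuples are extended by 0
  to sequences and restricted again.\<close>

lemma powertop_extension:
  assumes "continuous_map (powertop_real {..<m}) euclideanreal f"
  shows "continuous_on UNIV (\<lambda>y::nat \<Rightarrow> real. f (restrict y {..<m}))"
    and "f \<in> borel_measurable (PiM {..<m} (\<lambda>_. borel))"
proof -
  have "continuous_map (powertop_real UNIV) (powertop_real {..<m}) (\<lambda>y. restrict y {..<m})"
    by (subst continuous_map_componentwise) (auto intro: continuous_intros)
  from continuous_map_compose[OF this assms]
  show c: "continuous_on UNIV (\<lambda>y::nat \<Rightarrow> real. f (restrict y {..<m}))" by (simp add: euclidean_product_topology comp_def)
  let ?e = "\<lambda>y::nat \<Rightarrow> real. \<lambda>i. if i < m then y i else 0"
  have "?e \<in> measurable (PiM {..<m} (\<lambda>_. borel)) (PiM UNIV (\<lambda>_. borel))"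
  proof (rule measurable_PiM_single')
    show "(\<lambda>y. ?e y i) \<in> borel_measurable (PiM {..<m} (\<lambda>_. borel))" for i by (cases "i < m") simp_all
  qed (auto simp: space_PiM)
  then have "?e \<in> measurable (PiM {..<m} (\<lambda>_. borel)) borel" by (simp add: sets_PiM_equal_borel cong: measurable_cong_sets)
  from measurable_compose[OF this borel_measurable_continuous_onI[OF c]]
  have m: "(\<lambda>y. f (restrict (?e y) {..<m})) \<in> borel_measurable (PiM {..<m} (\<lambda>_. borel))" .
  have eq: "(\<lambda>y. f (restrict (?e y) {..<m})) \<in> borel_measurable (PiM {..<m} (\<lambda>_. borel)) \<longleftrightarrow>
      f \<in> borel_measurable (PiM {..<m} (\<lambda>_. borel))"
  proof (rule measurable_cong)
    fix y :: "nat \<Rightarrow> real" assume "y \<in> space (PiM {..<m} (\<lambda>_. borel))"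
    then have "restrict (?e y) {..<m} = y" by (auto simp: space_PiM PiE_def extensional_def fun_eq_iff)
    then show "f (restrict (?e y) {..<m}) = f y" by simp
  qed
  show "f \<in> borel_measurable (PiM {..<m} (\<lambda>_. borel))" using m unfolding eq .
qed

lemma joint_law_integral:
  assumes "continuous_map (powertop_real {..<m}) euclideanreal f"
    and "\<And>i. i < m \<Longrightarrow> Y i \<in> borel_measurable M"
  shows "(LINT y|joint_law m M Y. f y) = (LINT \<omega>|M. f (restrict (\<lambda>i. Y i \<omega>) {..<m}))" unfolding joint_law_def
  by (rule integral_distr[OF measurable_restrict powertop_extension(2)]) (use assms in auto)

context spatial_ensemble begin

lemma converges_to_PD_ensemble:
  assumes \<kappa>: "CE.\<kappa> < 1" and \<nu>: "\<nu> = 1 - CE.\<kappa>"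
  shows "converges_to_PD (thermo_measure \<xi> \<alpha> \<rho> c) (\<lambda>N i (x, \<pi>). real (cycle_length N \<pi> i) / (\<nu> * real N)) \<theta>"
  unfolding converges_to_PD_def weak_conv_pow_def
proof (intro allI impI, elim conjE)
  fix m and f :: "(nat \<Rightarrow> real) \<Rightarrow> real"
  assume f: "continuous_map (powertop_real {..<m}) euclideanreal f"
  let ?Y = "\<lambda>N i (x :: nat \<Rightarrow> real^'d, \<pi>). real (cycle_length N \<pi> i) / (\<nu> * real N)"
  let ?Z = "\<lambda>N z i. (1 / \<nu>) * real (cycle_length N (snd z) i) / real N"
  have \<kappa>0: "0 \<le> CE.\<kappa>" unfolding CE.\<kappa>_def using \<rho> by (intro suminf_nonneg CE.lam_lim(1)) (simp add: less_imp_le[OF q_pos])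
  have \<nu>01: "0 < \<nu>" "\<nu> \<le> 1" using \<kappa> \<kappa>0 by (auto simp: \<nu>)
  \<comment> \<open>The rescaled lengths have mass 1 / \<nu> and the limit has mass at most 1; since
    \<nu> \<le> 1, the simplex of mass 1 / \<nu> contains both.\<close>
  have b: "0 < 1 / \<nu>" "1 \<le> 1 / \<nu>" using \<nu>01 by auto
  have YZ: "?Y N i z = ?Z N z i" for N i z by (simp add: case_prod_beta')
  obtain N0 where N0: "\<And>N. N0 \<le> N \<Longrightarrow> good_side (side N) \<and> 0 < N"
    using eventually_conj[OF eventually_good eventually_gt_at_top[of 0]] by (auto simp: eventually_sequentially)
  have \<theta>0: "0 < \<theta>" by (rule CE.theta_pos)
  note PD = PD_properties[OF \<theta>0]
  have Zm: "?Z N \<in> measurable (\<mu> N) (PiM UNIV (\<lambda>_. borel))" for N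
    by (rule measurable_PiM_single') (auto intro!: measurable_compose[OF measurable_snd] cong: measurable_cong_sets simp: sets_thermo)
  have Yi: "?Y N i \<in> borel_measurable (\<mu> N)" for N i
    using measurable_compose[OF Zm measurable_component_singleton[of i UNIV]] unfolding YZ by simp
  have Zb: "?Z N \<in> measurable (\<mu> N) borel" for N using Zm[of N] by (simp add: sets_PiM_equal_borel cong: measurable_cong_sets)
  have sp: "snd z \<in> perms N" if "z \<in> space (\<mu> N)" for z N
    using that unfolding sets_eq_imp_space_eq[OF sets_thermo[of N]] space_pair_measure by auto
  have lim: "(\<lambda>N. LINT z|\<mu> N. f (restrict (?Z N z) {..<m})) \<longlonglongrightarrow> (LINT p|PD \<theta>. f (restrict p {..<m}))"
  proof (rule mass_simplex_weak_convergence[where Z = "\<lambda>p. p" and Y = ?Z and b = "1 / \<nu>" and ?N0.0 = N0, OF _ Zb])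
    show "prob_space (\<mu> N)" if "N0 \<le> N" for N using thermo_integral(2) N0[OF that] by blast
    show "AE z in \<mu> N. ?Z N z \<in> mass_simplex (1 / \<nu>)" if "N0 \<le> N" for N
      using N0[OF that] b by (intro AE_I2 rescaled_cycle_lengths(1) sp) auto
    show "prob_space (PD \<theta>)" by (rule PD(1))
    show "(\<lambda>p. p) \<in> measurable (PD \<theta>) borel" using PD(2) by (intro measurable_ident_sets) (simp add: sets_PiM_equal_borel)
    show "AE p in PD \<theta>. p \<in> mass_simplex (1 / \<nu>)" using PD(3) mass_simplex_mono[OF b(2)] by (auto elim: eventually_mono)
    show "continuous_on UNIV (\<lambda>y. f (restrict y {..<m}))" by (rule powertop_extension(1)[OF f])
    fix \<delta> g and n :: nat
    assume g: "test_fun \<delta> g" "1 / \<nu> < real n * \<delta>"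
    have "(\<lambda>k. stick_iter \<theta> g (\<lambda>_. 1) k 1) \<longlonglongrightarrow> (LINT p|PD \<theta>. (\<Prod>i<n. g (p i)))" using g b(2) by (intro PD(4)) auto
    from CE.cycle_functional_limit[OF \<kappa> g(1) this]
    have l: "(\<lambda>N. hcoef (\<lambda>j. CE.w N j * g (real j / (\<nu> * real N))) N / CE.Y N N) \<longlonglongrightarrow> (LINT p|PD \<theta>. (\<Prod>i<n. g (p i)))"
      unfolding \<nu>[symmetric] .
    have "\<forall>\<^sub>F N in sequentially. hcoef (\<lambda>j. CE.w N j * g (real j / (\<nu> * real N))) N / CE.Y N N = (LINT z|\<mu> N. (\<Prod>i<n. g (?Z N z i)))"
      using eventually_ge_at_top[of N0]
    proof eventually_elim
      case (elim N)
      note N = N0[OF elim]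
      have "(LINT z|\<mu> N. (\<Prod>i<n. g (?Z N z i))) = (LINT z|\<mu> N. (\<Prod>C\<in>cycle_sets N (snd z). g ((1 / \<nu>) * real (card C) / real N)))"
        using N b by (intro Bochner_Integration.integral_cong refl rescaled_cycle_lengths(2)[OF _ _ _ g] sp) auto
      also have "\<dots> = hcoef (\<lambda>j. CE.w N j * g ((1 / \<nu>) * real j / real N)) N / CE.Y N N"
        using N by (intro expected_cycle_product[of N "\<lambda>j. g ((1 / \<nu>) * real j / real N)"]) auto
      finally show ?case by simp
    qed
    from Lim_transform_eventually[OF l this]
    show "(\<lambda>N. LINT z|\<mu> N. (\<Prod>i<n. g (?Z N z i))) \<longlonglongrightarrow> (LINT p|PD \<theta>. (\<Prod>i<n. g (p i)))" .
  qed (use b in auto)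
  have 1: "(LINT y|joint_law m (\<mu> N) (?Y N). f y) = (LINT z|\<mu> N. f (restrict (?Z N z) {..<m}))" for N
    using joint_law_integral[OF f Yi, of N] unfolding YZ .
  have "(\<lambda>p. p i) \<in> borel_measurable (PD \<theta>)" for i
    using PD(2) measurable_component_singleton[of i UNIV "\<lambda>_. borel"] by (simp cong: measurable_cong_sets)
  then have 2: "(LINT y|joint_law m (PD \<theta>) (\<lambda>i p. p i). f y) = (LINT p|PD \<theta>. f (restrict p {..<m}))"
    using joint_law_integral[OF f, of "\<lambda>i p. p i" "PD \<theta>"] by simp
  show "(\<lambda>N. LINT y|joint_law m (\<mu> N) (?Y N). f y) \<longlonglongrightarrow> (LINT y|joint_law m (PD \<theta>) (\<lambda>i p. p i). f y)" unfolding 1 2 by (rule lim)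
qed

end

section \<open>From the energies of the cycles to their weights\<close>

lemma exp_diff_le:
  fixes x y K :: real
  assumes "x \<le> K" "y \<le> K"
  shows "\<bar>exp x - exp y\<bar> \<le> exp K * \<bar>x - y\<bar>"
proof -
  have *: "exp u - exp v \<le> exp K * \<bar>u - v\<bar>" if "u \<le> K" for u v :: real
  proof -
    have "1 + (v - u) \<le> exp (v - u)" by (rule exp_ge_add_one_self)
    then have "exp u * (1 + (v - u)) \<le> exp u * exp (v - u)" by (intro mult_left_mono) auto
    then have "exp u - exp v \<le> exp u * (u - v)" by (simp add: mult_exp_exp algebra_simps)
    also have "\<dots> \<le> exp u * \<bar>u - v\<bar>" by (intro mult_left_mono) auto
    also have "\<dots> \<le> exp K * \<bar>u - v\<bar>" using that by (intro mult_right_mono) auto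
    finally show ?thesis .
  qed
  show ?thesis using *[OF assms(1), of y] *[OF assms(2), of x] by (auto simp: abs_if)
qed

text \<open>A convergent \<alpha> is bounded, so exp is Lipschitz along it and either summability
  condition passes from \<alpha> to the weights exp (- \<alpha>). The sign of the limit decides
  between \<theta> \<le> 1 and \<theta> \<ge> 1.\<close>

lemma cycle_weights_exp:
  assumes lim: "\<alpha> \<longlonglongrightarrow> \<alpha>_lim"
    and cases: "(0 < \<alpha>_lim \<and> summable (\<lambda>n. \<bar>\<alpha> (Suc n) - \<alpha>_lim\<bar>)) \<or>
         (\<alpha>_lim \<le> 0 \<and> summable (\<lambda>n. (1 / real (Suc n)) * \<bar>\<alpha> (Suc n) - \<alpha>_lim\<bar>))"
  obtains c0 C0 C where "cycle_weights (\<lambda>j. exp (- \<alpha> j)) (exp (- \<alpha>_lim)) c0 C0 C"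
proof -
  let ?t = "\<lambda>j. exp (- \<alpha> j)" and ?\<theta> = "exp (- \<alpha>_lim)"
  obtain K0 where K0: "\<And>j. norm (\<alpha> j) \<le> K0" using lim by (metis BseqE Bseq_def convergentI convergent_imp_Bseq)
  define K where "K = max K0 \<bar>\<alpha>_lim\<bar>"
  have K: "\<bar>\<alpha> j\<bar> \<le> K" "\<bar>\<alpha>_lim\<bar> \<le> K" for j using K0[of j] by (auto simp: K_def)
  have d: "\<bar>?t j - ?\<theta>\<bar> \<le> exp K * \<bar>\<alpha> j - \<alpha>_lim\<bar>" for j
    using exp_diff_le[of "- \<alpha> j" K "- \<alpha>_lim"] K(1)[of j] K(2) by (simp add: abs_minus_commute)
  have "(1 \<le> ?\<theta> \<and> summable (\<lambda>j. \<bar>?t (Suc j) - ?\<theta>\<bar> / real (Suc j))) \<or> (?\<theta> \<le> 1 \<and> summable (\<lambda>j. \<bar>?t (Suc j) - ?\<theta>\<bar>))" using cases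
  proof
    assume a: "0 < \<alpha>_lim \<and> summable (\<lambda>n. \<bar>\<alpha> (Suc n) - \<alpha>_lim\<bar>)"
    then have s: "summable (\<lambda>n. exp K * \<bar>\<alpha> (Suc n) - \<alpha>_lim\<bar>)" by (intro summable_mult) blast
    have "summable (\<lambda>j. \<bar>?t (Suc j) - ?\<theta>\<bar>)" by (rule summable_comparison_test'[OF s, of 0]) (use d in simp)
    then show ?thesis using a by simp
  next
    assume a: "\<alpha>_lim \<le> 0 \<and> summable (\<lambda>n. (1 / real (Suc n)) * \<bar>\<alpha> (Suc n) - \<alpha>_lim\<bar>)"
    then have s: "summable (\<lambda>n. exp K * ((1 / real (Suc n)) * \<bar>\<alpha> (Suc n) - \<alpha>_lim\<bar>))" by (intro summable_mult) blast
    have "summable (\<lambda>j. \<bar>?t (Suc j) - ?\<theta>\<bar> / real (Suc j))"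
    proof (rule summable_comparison_test'[OF s, of 0])
      fix j
      have "\<bar>?t (Suc j) - ?\<theta>\<bar> / real (Suc j) \<le> exp K * \<bar>\<alpha> (Suc j) - \<alpha>_lim\<bar> / real (Suc j)" by (rule divide_right_mono[OF d]) simp
      then show "norm (\<bar>?t (Suc j) - ?\<theta>\<bar> / real (Suc j)) \<le> exp K * ((1 / real (Suc j)) * \<bar>\<alpha> (Suc j) - \<alpha>_lim\<bar>)" by simp
    qed
    then show ?thesis using a by simp
  qed
  from hcoef_asymp[OF _ this] obtain C where C: "0 < C" "(\<lambda>n. hcoef ?t n / real n powr (?\<theta> - 1)) \<longlonglongrightarrow> C" by auto
  have "cycle_weights ?t ?\<theta> (exp (- K)) (exp K) C"
  proof
    show "?t \<longlonglongrightarrow> ?\<theta>" by (intro tendsto_exp tendsto_minus lim)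
    show "exp (- K) \<le> ?t j" "?t j \<le> exp K" for j using K(1)[of j] by (auto simp: abs_le_iff)
  qed (use C in auto)
  then show ?thesis by (rule that)
qed

theorem theorem2p1:
  fixes \<xi> :: "real^'d \<Rightarrow> ereal"
    and \<alpha> :: "nat \<Rightarrow> real" and \<alpha>_lim \<rho> :: real
    and c :: "nat \<Rightarrow> real^'d"
  assumes "jump_function \<xi>"
    and "0 < \<rho>"
    and "\<alpha> \<longlonglongrightarrow> \<alpha>_lim"
    and "(0 < \<alpha>_lim \<and> summable (\<lambda>n. \<bar>\<alpha> (Suc n) - \<alpha>_lim\<bar>)) \<or>
         (\<alpha>_lim \<le> 0 \<and> summable (\<lambda>n. (1 / real (Suc n)) * \<bar>\<alpha> (Suc n) - \<alpha>_lim\<bar>))"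
  defines "\<nu> \<equiv> fraction_infinite \<xi> \<alpha> \<rho> c"
  shows "\<nu> = max 0 (1 - critical_density \<xi> \<alpha> / \<rho>) \<and>
         (0 < \<nu> \<longrightarrow>
            converges_to_PD (thermo_measure \<xi> \<alpha> \<rho> c)
              (\<lambda>N i (x, \<pi>). real (cycle_length N \<pi> i) / (\<nu> * real N))
              (exp (- \<alpha>_lim)))"
proof -
  interpret T: thermodynamic_ensemble \<xi> \<rho> by unfold_locales (use assms in auto)
  obtain c0 C0 C where cw: "cycle_weights (\<lambda>j. exp (- \<alpha> j)) (exp (- \<alpha>_lim)) c0 C0 C" using cycle_weights_exp[OF assms(3,4)] .
  obtain s c' where sc: "0 \<le> s" "s < 1" "0 < c'" and dec:
    "\<forall>\<^sub>F N in sequentially. \<forall>j\<ge>1. \<forall>i. T.modes (T.side N) (j + i) \<le> exp (- (c' * real N powr (- s)) * real i) * T.modes (T.side N) j"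
    by (rule T.side_decay)
  interpret S: spatial_ensemble \<xi> \<rho> \<alpha> "exp (- \<alpha>_lim)" c0 C0 C s c' c
  proof (intro spatial_ensemble.intro spatial_ensemble_axioms.intro T.thermodynamic_ensemble_axioms)
    interpret cycle_weights "\<lambda>j. exp (- \<alpha> j)" "exp (- \<alpha>_lim)" c0 C0 C by (rule cw)
    show "canonical_ensemble (\<lambda>j. exp (- \<alpha> j)) (exp (- \<alpha>_lim)) c0 C0 C (\<lambda>N. T.modes (T.side N))
      (\<lambda>j. (LINT k|lborel. T.q k ^ j) / \<rho>) s c'"
      by (intro canonical_ensemble.intro canonical_ensemble_axioms.intro cycle_weights_axioms cw) (rule T.modes_nonneg T.modes_lim T.side_tail dec sc; assumption?)+
  qed
  have \<nu>: "\<nu> = max 0 (1 - S.CE.\<kappa>)" unfolding \<nu>_def by (rule S.fraction_infinite_eq)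
  have "critical_density \<xi> \<alpha> / \<rho> = S.CE.\<kappa>" unfolding S.critical_density_eq using assms(2) by simp
  moreover have "converges_to_PD (thermo_measure \<xi> \<alpha> \<rho> c)
      (\<lambda>N i (x, \<pi>). real (cycle_length N \<pi> i) / (\<nu> * real N)) (exp (- \<alpha>_lim))" if "0 < \<nu>"
    \<comment> \<open>Positivity of \<nu> means that the maximum is attained by its second argument,
      that is, \<kappa> < 1 and \<nu> = 1 - \<kappa>.\<close>
    by (rule S.converges_to_PD_ensemble) (use that \<nu> in \<open>auto simp: max_def split: if_splits\<close>)
  ultimately show ?thesis using \<nu> by simp
qed

end
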